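(* Suppose that Assumptions (L), (SC), (M), (S) and (A) listed in the context hold. Then there are $\alpha\in(0,\alpha_*]$, a sampling time $\tau>0$, $r_0,\beta>0$, $0<\lambda\le\lambda_0$, and $\varrho\in(0,1)$ such that, with $\mathsf D_\chi(\mathsf x,\mathsf y)=e^{\chi[\mathcal V(\mathsf x)+\mathcal V(\mathsf y)]}\|\mathsf x-\mathsf y\|_{\mathbb H}$ (with $\chi$ from (S)) and $$d_0(\mathsf x,\mathsf y)=1\wedge\left[\frac{\mathsf D_\chi(\mathsf x,\mathsf y)}{r_0}\right]^\alpha,\qquad d(\mathsf x,\mathsf y)=\sqrt{d_0(\mathsf x,\mathsf y)\bigl(1+\beta e^{\lambda\mathcal V(\mathsf x)}+\beta e^{\lambda\mathcal V(\mathsf y)}\bigr)},$$ one has $$\mathsf W_d(\mu_1P_{n\tau},\mu_2P_{n\tau})\le\varrho^n\,\mathsf W_d(\mu_1,\mu_2),\qquad n\ge0,$$ for all probability measures $\mu_1,\mu_2$ on $H$ with finite $e^{\lambda\mathcal V}$ moment.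
   Context: Setting. $H$ and $\mathbb H$ are separable Hilbert spaces with a continuous dense embedding $H\hookrightarrow\mathbb H$, and $(P_t)_{t\ge0}$ is a Feller Markov semigroup on $H$. For every $T>0$, $(E_T,H_{W,T},\gamma_T)$ is an abstract Wiener space with Cameron–Martin embedding $\iota_T:H_{W,T}\hookrightarrow E_T$, and $\Phi_T:H\times E_T\to H$ is a Borel endpoint representation of $P_T$, i.e. $\Phi_T(\mathsf x,\cdot)_\#\gamma_T=P_T(\mathsf x,\cdot)$. For nonnegative lower semicontinuous $\delta$, $\mathsf W_\delta(\mu_1,\mu_2)=\inf_\Gamma\int\delta\,d\Gamma$ over couplings $\Gamma$. $\mathcal L$ denotes bounded operators, $\mathcal K(\mathbb H)$ the compact operators on $\mathbb H$. For $R<\infty$, $\mathbb V_R=\{\mathsf x\in H:\mathcal V(\mathsf x)\le R\}$. (L) There are $\lambda_0>0$, $C<\infty$, and a nonnegative function $\vartheta(t)=o(t^{-1})$ as $t\to\infty$, such that $\mathcal V:H\to[1,\infty)$ is continuous with sublevels compact in $\mathbb H$ and $P_te^{\sigma\mathcal V}(\mathsf x)\le C\exp\{\sigma\vartheta(t)\mathcal V(\mathsf x)\}$ for $0<\sigma\le\lambda_0$, $t\ge0$. (SC) For every sufficiently large $T$ (block subscripts $T$ suppressed on $E,H_W,\gamma,\iota,\Phi$ and related objects), writing $\mathsf z=(\mathsf x,\mathsf y)\in H^2$: (i) There are strongly measurable $S_{\mathsf z,\omega},\mathcal K_{\mathsf z,\omega}\in\mathcal L(\mathbb H)$ such that, with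 $\mathcal J_{\mathsf z,\omega}=S_{\mathsf z,\omega}+\mathcal K_{\mathsf z,\omega}$, $$\Phi(\mathsf y,\omega)-\Phi(\mathsf x,\omega)=\mathcal J_{\mathsf z,\omega}(\mathsf y-\mathsf x),\qquad\|S_{\mathsf z,\omega}\|_{\mathcal L(\mathbb H)}\le\rho,\qquad\mathcal K_{\mathsf z,\omega}\in\mathcal K(\mathbb H),$$ where the deterministic $\rho=\rho(T)$ satisfies $\rho(T)\to0$ as $T\to\infty$. (ii) The Malliavin (Cameron–Martin) derivative $\mathcal D\Phi(\mathsf x,\omega)\in\mathcal L(H_W,\mathbb H)$ is defined on $H\times E$ and strongly measurable, and for every $R<\infty$ and compact $G\subset E$ the maps $(\mathsf z,\omega)\mapsto\mathcal K_{\mathsf z,\omega}\in\mathcal L(\mathbb H)$ and $(\mathsf x,\omega)\mapsto\mathcal D\Phi(\mathsf x,\omega)\in\mathcal L(H_W,\mathbb H)$ are continuous (in operator norm) on $\mathbb V_R^2\times G$ and $\mathbb V_R\times G$ respectively, where $\mathbb V_R$ carries the $\mathbb H$-topology. (iii) There is $p_0>0$ independent of $T$ such that, for every $R<\infty$, there are measurable $C_R:H\times E\to[1,\infty)$ and $r_R:H\times E\to(0,1]$ satisfying $$\|\Phi(\mathsf x,\omega+\iota h)-\Phi(\mathsf x,\omega)-\mathcal D\Phi(\mathsf x,\omega)h\|_{\mathbb H}\le C_R(\mathsf x,\omega)\|h\|_{H_W}^2\qquad(\ast)$$ whenever $\mathsf x\in\mathbb V_R$ and $\|h\|_{H_W}\le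 r_R(\mathsf x,\omega)$, and $$\sup_{\mathsf z\in\mathbb V_R^2}\int_E\bigl[C_R(\mathsf x,\omega)^{p_0}+r_R(\mathsf x,\omega)^{-p_0}+\|\mathcal D\Phi(\mathsf x,\omega)\|^{p_0}+\|\mathcal J_{\mathsf z,\omega}\|^{p_0}\bigr]\gamma(d\omega)<\infty .$$ For every finite dimensional $F\subset\iota^*(E^* )$ and compact $G\subset E$, $(\ast)$ holds for $(\mathsf x,\omega)\in\mathbb V_R\times G$ and $h\in F$ with a deterministic constant and radius depending on $T,R,G,F$. (M) For every sufficiently large $T$ there is a Borel set $\Omega_*\subset E$ of full $\gamma$-measure such that $\operatorname{Ran}\mathcal D\Phi(\mathsf x,\omega)$ is dense in $\mathbb H$ for every $\mathsf x\in H$ and $\omega\in\Omega_*$. (S) There are $\alpha_*\in(0,1]$ and $\chi,c_*,C_*>0$ such that, for every sufficiently large $T$, there is $C_T\ge1$ with $\log C_T\le C_*(1+T)$ and, for every $\mathsf x\ne\mathsf y$ in $H$, $$\int_{E_T}\mathsf D_\chi\bigl(\Phi_T(\mathsf x,\omega),\Phi_T(\mathsf y,\omega)\bigr)^{\alpha_*}\gamma_T(d\omega)\le C_Te^{-c_*[\mathcal V(\mathsf x)+\mathcal V(\mathsf y)]}\mathsf D_\chi(\mathsf x,\mathsf y)^{\alpha_*},$$ where $\mathsf D_\chi(\mathsf x,\mathsf y)=e^{\chi[\mathcal V(\mathsf x)+\mathcal V(\mathsf y)]}\|\mathsf x-\mathsf y\|_{\mathbb H}$. (A) There is $\mathsf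 x_*\in H$ such that, for every $R<\infty$ and $\varepsilon>0$, there is $t_{R,\varepsilon}<\infty$ with $\inf_{\mathsf x\in\mathbb V_R}P_t(\mathsf x,B_H(\mathsf x_*,\varepsilon))>0$ for all $t\ge t_{R,\varepsilon}$, where $B_H$ denotes balls in $H$. *)

theory Defs
  imports "HOL-Probability.Probability" "HOL-Library.Landau_Symbols"
begin

text \<open>
  Separable Hilbert spaces are types of sort \<open>{real_inner, banach, second_countable_topology}\<close>.

  The Wiener spaces depend on the real parameter \<open>T\<close>, and a type cannot. So the families \<open>E\<^sub>T\<close>
  and \<open>H\<^sub>W\<^sub>,\<^sub>T\<close> are given as families of closed subspaces \<open>E T\<close>, \<open>HW T\<close> of an arbitrary Banach
  type \<open>'e\<close> and an arbitrary Hilbert type \<open>'w\<close>, neither of them assumed separable. This is no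
  restriction: any family of Banach (Hilbert) spaces embeds isometrically into its \<open>l\<^sup>1\<close>
  (\<open>l\<^sup>2\<close>) direct sum.
\<close>

definition bounded_linear_on :: "'a::real_normed_vector set \<Rightarrow> ('a \<Rightarrow> 'b::real_normed_vector) \<Rightarrow> bool"
  where "bounded_linear_on X f \<longleftrightarrow>
    (\<forall>x\<in>X. \<forall>y\<in>X. f (x + y) = f x + f y) \<and>
    (\<forall>c. \<forall>x\<in>X. f (c *\<^sub>R x) = c *\<^sub>R f x) \<and>
    (\<exists>B. \<forall>x\<in>X. norm (f x) \<le> B * norm x)"

definition dual_on :: "'e::real_normed_vector set \<Rightarrow> ('e \<Rightarrow> real) set"
  where "dual_on E = {l. bounded_linear_on E l}"

text \<open>\<open>h = \<iota>\<^sup>* l\<close>, with the dual of the Cameron--Martin space identified with the space itself.\<close>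

definition is_adjoint_image :: "'w::real_inner set \<Rightarrow> ('w \<Rightarrow> 'e) \<Rightarrow> ('e \<Rightarrow> real) \<Rightarrow> 'w \<Rightarrow> bool"
  where "is_adjoint_image HW \<iota> l h \<longleftrightarrow> h \<in> HW \<and> (\<forall>k\<in>HW. inner h k = l (\<iota> k))"

definition adjoint_range ::
    "'e::real_normed_vector set \<Rightarrow> 'w::real_inner set \<Rightarrow> ('w \<Rightarrow> 'e) \<Rightarrow> 'w set"
  where "adjoint_range E HW \<iota> = {h. \<exists>l\<in>dual_on E. is_adjoint_image HW \<iota> l h}"

text \<open>
  \<open>\<gamma>\<close> is the centred Gaussian measure on the Borel sets of \<open>E\<close> with characteristic functional
  \<open>exp (- \<parallel>\<iota>\<^sup>* l\<parallel>\<^sup>2 / 2)\<close>. The element \<open>h = \<iota>\<^sup>* l\<close> exists uniquely by the Riesz representation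
  theorem.
\<close>

definition abstract_wiener_space ::
    "'e::banach set \<Rightarrow> 'w::{real_inner, banach} set \<Rightarrow> ('w \<Rightarrow> 'e) \<Rightarrow> 'e measure \<Rightarrow> bool"
  where "abstract_wiener_space E HW \<iota> \<gamma> \<longleftrightarrow>
    subspace E \<and> closed E \<and> separable_space (top_of_set E) \<and>
    subspace HW \<and> closed HW \<and> separable_space (top_of_set HW) \<and>
    bounded_linear_on HW \<iota> \<and> inj_on \<iota> HW \<and> \<iota> ` HW \<subseteq> E \<and> E \<subseteq> closure (\<iota> ` HW) \<and>
    prob_space \<gamma> \<and> space \<gamma> = E \<and> sets \<gamma> = sets (restrict_space borel E) \<and>
    (\<forall>l\<in>dual_on E. \<exists>h. is_adjoint_image HW \<iota> l h \<and>
      (CLINT \<omega>|\<gamma>. iexp (l \<omega>)) = complex_of_real (exp (- (norm h)\<^sup>2 / 2)))"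

text \<open>
  A bounded operator on \<open>HW\<close> is represented by its extension to \<open>'w\<close> vanishing on the orthogonal
  complement of \<open>HW\<close>. This extension is linear and isometric in the operator, so the norm of
  \<open>A :: 'w \<Rightarrow>\<^sub>L 'k\<close> is the operator norm on \<open>HW\<close>, and \<open>A\<close> is uniquely determined below.
\<close>

definition has_cm_derivative ::
    "'w::{real_inner, banach} set \<Rightarrow> ('w \<Rightarrow> 'e::banach) \<Rightarrow> ('e \<Rightarrow> 'k::real_normed_vector) \<Rightarrow>
     ('w \<Rightarrow>\<^sub>L 'k) \<Rightarrow> 'e \<Rightarrow> bool"
  where "has_cm_derivative HW \<iota> F A \<omega> \<longleftrightarrow>
    ((\<lambda>h. F (\<omega> + \<iota> h)) has_derivative blinfun_apply A) (at 0 within HW) \<and>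
    (\<forall>h\<in>orthogonal_comp HW. blinfun_apply A h = 0)"

definition feller_markov_semigroup :: "(real \<Rightarrow> 'h::topological_space \<Rightarrow> 'h measure) \<Rightarrow> bool"
  where "feller_markov_semigroup P \<longleftrightarrow>
    (\<forall>t\<ge>0. P t \<in> borel \<rightarrow>\<^sub>M prob_algebra borel) \<and>
    (\<forall>x. P 0 x = return borel x) \<and>
    (\<forall>s\<ge>0. \<forall>t\<ge>0. \<forall>x. P (s + t) x = P s x \<bind> P t) \<and>
    (\<forall>t\<ge>0. \<forall>f :: 'h \<Rightarrow> real. continuous_on UNIV f \<longrightarrow> bounded (range f) \<longrightarrow>
      continuous_on UNIV (\<lambda>x. \<integral>y. f y \<partial>P t x))"

definition couplings :: "'a measure \<Rightarrow> 'a measure \<Rightarrow> ('a \<times> 'a) measure set"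
  where "couplings \<mu> \<nu> = {\<Gamma>. prob_space \<Gamma> \<and> sets \<Gamma> = sets (\<mu> \<Otimes>\<^sub>M \<nu>) \<and>
    distr \<Gamma> \<mu> fst = \<mu> \<and> distr \<Gamma> \<nu> snd = \<nu>}"

definition wasserstein :: "('a \<Rightarrow> 'a \<Rightarrow> real) \<Rightarrow> 'a measure \<Rightarrow> 'a measure \<Rightarrow> ennreal"
  where "wasserstein \<delta> \<mu> \<nu> = (INF \<Gamma>\<in>couplings \<mu> \<nu>. \<integral>\<^sup>+(x, y). ennreal (\<delta> x y) \<partial>\<Gamma>)"

definition dense_embedding ::
    "('h::{real_inner, banach, second_countable_topology} \<Rightarrow>\<^sub>L
      'k::{real_inner, banach, second_countable_topology}) \<Rightarrow> bool"
  where "dense_embedding emb \<longleftrightarrow>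
    inj (blinfun_apply emb) \<and> closure (range (blinfun_apply emb)) = UNIV"

definition endpoint_representation ::
    "('h::topological_space \<Rightarrow> 'h measure) \<Rightarrow> 'e measure \<Rightarrow> ('h \<Rightarrow> 'e \<Rightarrow> 'h) \<Rightarrow> bool"
  where "endpoint_representation Q \<gamma> \<Phi> \<longleftrightarrow>
    (\<lambda>(x, \<omega>). \<Phi> x \<omega>) \<in> borel \<Otimes>\<^sub>M \<gamma> \<rightarrow>\<^sub>M borel \<and>
    (\<forall>x. distr \<gamma> borel (\<Phi> x) = Q x)"

definition compact_operator :: "('a::real_normed_vector \<Rightarrow>\<^sub>L 'b::real_normed_vector) \<Rightarrow> bool"
  where "compact_operator A \<longleftrightarrow> compact (closure (blinfun_apply A ` cball 0 1))"

definition sublevel :: "('h \<Rightarrow> real) \<Rightarrow> real \<Rightarrow> 'h set"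
  where "sublevel V R = {x. V x \<le> R}"

text \<open>The sublevel set carries the topology of the larger space, the codomain of \<open>emb\<close>.\<close>

definition sublevel_top :: "('h::real_normed_vector \<Rightarrow>\<^sub>L 'k::real_normed_vector) \<Rightarrow> ('h \<Rightarrow> real) \<Rightarrow>
    real \<Rightarrow> 'h topology"
  where "sublevel_top emb V R = pullback_topology (sublevel V R) (blinfun_apply emb) euclidean"

definition D_chi :: "('h::real_normed_vector \<Rightarrow>\<^sub>L 'k::real_normed_vector) \<Rightarrow> ('h \<Rightarrow> real) \<Rightarrow>
    real \<Rightarrow> 'h \<Rightarrow> 'h \<Rightarrow> real"
  where "D_chi emb V chi x y = exp (chi * (V x + V y)) * norm (blinfun_apply emb (x - y))"

definition assumption_L ::
    "('h::real_normed_vector \<Rightarrow>\<^sub>L 'k::real_normed_vector) \<Rightarrow> (real \<Rightarrow> 'h \<Rightarrow> 'h measure) \<Rightarrow>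
     ('h \<Rightarrow> real) \<Rightarrow> real \<Rightarrow> bool"
  where "assumption_L emb P V lam0 \<longleftrightarrow>
    lam0 > 0 \<and>
    (\<forall>x. V x \<ge> 1) \<and> continuous_on UNIV V \<and>
    (\<forall>R. compact (blinfun_apply emb ` sublevel V R)) \<and>
    (\<exists>(C::real) \<theta>. (\<forall>t\<ge>0. \<theta> t \<ge> 0) \<and> \<theta> \<in> o[at_top](\<lambda>t. 1 / t) \<and>
      (\<forall>\<sigma> t x. 0 < \<sigma> \<longrightarrow> \<sigma> \<le> lam0 \<longrightarrow> 0 \<le> t \<longrightarrow>
        (\<integral>\<^sup>+y. ennreal (exp (\<sigma> * V y)) \<partial>P t x) \<le> ennreal (C * exp (\<sigma> * \<theta> t * V x))))"

text \<open>The quadratic remainder estimate at \<open>(x, \<omega>)\<close> for all \<open>h \<in> X\<close> with \<open>\<parallel>h\<parallel> \<le> r\<close>.\<close>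

definition quadratic_remainder ::
    "('h::real_normed_vector \<Rightarrow>\<^sub>L 'k::real_normed_vector) \<Rightarrow> ('w::real_normed_vector \<Rightarrow> 'e::plus) \<Rightarrow>
     ('h \<Rightarrow> 'e \<Rightarrow> 'h) \<Rightarrow> ('h \<Rightarrow> 'e \<Rightarrow> 'w \<Rightarrow>\<^sub>L 'k) \<Rightarrow> 'w set \<Rightarrow> 'h \<Rightarrow> 'e \<Rightarrow> real \<Rightarrow> real \<Rightarrow> bool"
  where "quadratic_remainder emb \<iota> \<Phi> D X x \<omega> c r \<longleftrightarrow>
    (\<forall>h\<in>X. norm h \<le> r \<longrightarrow>
      norm (blinfun_apply emb (\<Phi> x (\<omega> + \<iota> h)) - blinfun_apply emb (\<Phi> x \<omega>) - blinfun_apply (D x \<omega>) h)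
        \<le> c * (norm h)\<^sup>2)"

text \<open>
  The three parts of (SC) at a fixed time, with \<open>D\<close> the Malliavin derivative of \<open>\<Phi>\<close>.
  Strong measurability of an operator-valued map is measurability of its evaluation at each vector.
\<close>

definition SC_splitting ::
    "('h::real_normed_vector \<Rightarrow>\<^sub>L 'k::real_normed_vector) \<Rightarrow> 'e set \<Rightarrow> 'e measure \<Rightarrow> ('h \<Rightarrow> 'e \<Rightarrow> 'h) \<Rightarrow>
     ('h \<times> 'h \<Rightarrow> 'e \<Rightarrow> 'k \<Rightarrow>\<^sub>L 'k) \<Rightarrow> ('h \<times> 'h \<Rightarrow> 'e \<Rightarrow> 'k \<Rightarrow>\<^sub>L 'k) \<Rightarrow> real \<Rightarrow> bool"
  where "SC_splitting emb E \<gamma> \<Phi> S K \<rho> \<longleftrightarrow>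
    (\<forall>v. (\<lambda>(z, \<omega>). blinfun_apply (S z \<omega>) v) \<in> (borel \<Otimes>\<^sub>M borel) \<Otimes>\<^sub>M \<gamma> \<rightarrow>\<^sub>M borel) \<and>
    (\<forall>v. (\<lambda>(z, \<omega>). blinfun_apply (K z \<omega>) v) \<in> (borel \<Otimes>\<^sub>M borel) \<Otimes>\<^sub>M \<gamma> \<rightarrow>\<^sub>M borel) \<and>
    (\<forall>x y. \<forall>\<omega>\<in>E.
      blinfun_apply emb (\<Phi> y \<omega> - \<Phi> x \<omega>)
        = blinfun_apply (S (x, y) \<omega> + K (x, y) \<omega>) (blinfun_apply emb (y - x)) \<and>
      norm (S (x, y) \<omega>) \<le> \<rho> \<and>
      compact_operator (K (x, y) \<omega>))"

definition SC_continuity ::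
    "('h::real_normed_vector \<Rightarrow>\<^sub>L 'k::real_normed_vector) \<Rightarrow> ('h \<Rightarrow> real) \<Rightarrow> 'e::banach set \<Rightarrow>
     'w::{real_inner, banach} set \<Rightarrow> ('w \<Rightarrow> 'e) \<Rightarrow> 'e measure \<Rightarrow> ('h \<Rightarrow> 'e \<Rightarrow> 'h) \<Rightarrow>
     ('h \<Rightarrow> 'e \<Rightarrow> 'w \<Rightarrow>\<^sub>L 'k) \<Rightarrow> ('h \<times> 'h \<Rightarrow> 'e \<Rightarrow> 'k \<Rightarrow>\<^sub>L 'k) \<Rightarrow> bool"
  where "SC_continuity emb V E HW \<iota> \<gamma> \<Phi> D K \<longleftrightarrow>
    (\<forall>x. \<forall>\<omega>\<in>E. has_cm_derivative HW \<iota> (\<lambda>\<omega>'. blinfun_apply emb (\<Phi> x \<omega>')) (D x \<omega>) \<omega>) \<and>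
    (\<forall>h\<in>HW. (\<lambda>(x, \<omega>). blinfun_apply (D x \<omega>) h) \<in> borel \<Otimes>\<^sub>M \<gamma> \<rightarrow>\<^sub>M borel) \<and>
    (\<forall>R. \<forall>G\<subseteq>E. compact G \<longrightarrow>
      continuous_map
        (prod_topology (prod_topology (sublevel_top emb V R) (sublevel_top emb V R)) (top_of_set G))
        euclidean (\<lambda>(z, \<omega>). K z \<omega>) \<and>
      continuous_map
        (prod_topology (sublevel_top emb V R) (top_of_set G))
        euclidean (\<lambda>(x, \<omega>). D x \<omega>))"

definition SC_remainder ::
    "('h::real_normed_vector \<Rightarrow>\<^sub>L 'k::real_normed_vector) \<Rightarrow> ('h \<Rightarrow> real) \<Rightarrow> 'e::banach set \<Rightarrow>
     'w::{real_inner, banach} set \<Rightarrow> ('w \<Rightarrow> 'e) \<Rightarrow> 'e measure \<Rightarrow> ('h \<Rightarrow> 'e \<Rightarrow> 'h) \<Rightarrow>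
     ('h \<Rightarrow> 'e \<Rightarrow> 'w \<Rightarrow>\<^sub>L 'k) \<Rightarrow> ('h \<times> 'h \<Rightarrow> 'e \<Rightarrow> 'k \<Rightarrow>\<^sub>L 'k) \<Rightarrow> real \<Rightarrow> bool"
  where "SC_remainder emb V E HW \<iota> \<gamma> \<Phi> D J p\<^sub>0 \<longleftrightarrow>
    (\<forall>R.
      (\<exists>C r :: 'h \<Rightarrow> 'e \<Rightarrow> real.
        (\<lambda>(x, \<omega>). C x \<omega>) \<in> borel \<Otimes>\<^sub>M \<gamma> \<rightarrow>\<^sub>M borel \<and>
        (\<lambda>(x, \<omega>). r x \<omega>) \<in> borel \<Otimes>\<^sub>M \<gamma> \<rightarrow>\<^sub>M borel \<and>
        (\<forall>x. \<forall>\<omega>\<in>E. C x \<omega> \<ge> 1 \<and> 0 < r x \<omega> \<and> r x \<omega> \<le> 1) \<and>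
        (\<forall>x\<in>sublevel V R. \<forall>\<omega>\<in>E. quadratic_remainder emb \<iota> \<Phi> D HW x \<omega> (C x \<omega>) (r x \<omega>)) \<and>
        (SUP (x, y) \<in> sublevel V R \<times> sublevel V R.
          \<integral>\<^sup>+\<omega>. ennreal (C x \<omega> powr p\<^sub>0 + r x \<omega> powr (- p\<^sub>0) + norm (D x \<omega>) powr p\<^sub>0
            + norm (J (x, y) \<omega>) powr p\<^sub>0) \<partial>\<gamma>) < \<infinity>) \<and>
      (\<forall>F G. subspace F \<longrightarrow> (\<exists>B. finite B \<and> F = span B) \<longrightarrow> F \<subseteq> adjoint_range E HW \<iota> \<longrightarrow>
        G \<subseteq> E \<longrightarrow> compact G \<longrightarrow>
        (\<exists>c r. r > 0 \<and>
          (\<forall>x\<in>sublevel V R. \<forall>\<omega>\<in>G. quadratic_remainder emb \<iota> \<Phi> D F x \<omega> c r))))"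

definition assumption_SC ::
    "('h::real_normed_vector \<Rightarrow>\<^sub>L 'k::real_normed_vector) \<Rightarrow> ('h \<Rightarrow> real) \<Rightarrow> (real \<Rightarrow> 'e::banach set) \<Rightarrow>
     (real \<Rightarrow> 'w::{real_inner, banach} set) \<Rightarrow> (real \<Rightarrow> 'w \<Rightarrow> 'e) \<Rightarrow> (real \<Rightarrow> 'e measure) \<Rightarrow>
     (real \<Rightarrow> 'h \<Rightarrow> 'e \<Rightarrow> 'h) \<Rightarrow> (real \<Rightarrow> 'h \<Rightarrow> 'e \<Rightarrow> 'w \<Rightarrow>\<^sub>L 'k) \<Rightarrow> bool"
  where "assumption_SC emb V E HW \<iota> \<gamma> \<Phi> D \<longleftrightarrow>
    (\<exists>\<rho> :: real \<Rightarrow> real. \<exists>p\<^sub>0 :: real. (\<rho> \<longlongrightarrow> 0) at_top \<and> p\<^sub>0 > 0 \<and>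
      (\<forall>\<^sub>F T in at_top. \<exists>S K.
        SC_splitting emb (E T) (\<gamma> T) (\<Phi> T) S K (\<rho> T) \<and>
        SC_continuity emb V (E T) (HW T) (\<iota> T) (\<gamma> T) (\<Phi> T) (D T) K \<and>
        SC_remainder emb V (E T) (HW T) (\<iota> T) (\<gamma> T) (\<Phi> T) (D T)
          (\<lambda>z \<omega>. S z \<omega> + K z \<omega>) p\<^sub>0))"

definition assumption_M ::
    "(real \<Rightarrow> 'w::{real_inner, banach} set) \<Rightarrow> (real \<Rightarrow> 'e measure) \<Rightarrow>
     (real \<Rightarrow> 'h \<Rightarrow> 'e \<Rightarrow> 'w \<Rightarrow>\<^sub>L 'k::real_normed_vector) \<Rightarrow> bool"
  where "assumption_M HW \<gamma> D \<longleftrightarrow>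
    (\<forall>\<^sub>F T in at_top. \<exists>\<Omega>\<in>sets (\<gamma> T). measure (\<gamma> T) \<Omega> = 1 \<and>
      (\<forall>x. \<forall>\<omega>\<in>\<Omega>. closure (blinfun_apply (D T x \<omega>) ` HW T) = UNIV))"

definition assumption_S ::
    "('h::real_normed_vector \<Rightarrow>\<^sub>L 'k::real_normed_vector) \<Rightarrow> ('h \<Rightarrow> real) \<Rightarrow> (real \<Rightarrow> 'e measure) \<Rightarrow>
     (real \<Rightarrow> 'h \<Rightarrow> 'e \<Rightarrow> 'h) \<Rightarrow> real \<Rightarrow> real \<Rightarrow> bool"
  where "assumption_S emb V \<gamma> \<Phi> \<alpha>_star chi \<longleftrightarrow>
    0 < \<alpha>_star \<and> \<alpha>_star \<le> 1 \<and> chi > 0 \<and>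
    (\<exists>c C. c > 0 \<and> C > 0 \<and>
      (\<forall>\<^sub>F T in at_top. \<exists>C\<^sub>T\<ge>1. ln C\<^sub>T \<le> C * (1 + T) \<and>
        (\<forall>x y. x \<noteq> y \<longrightarrow>
          (\<integral>\<^sup>+\<omega>. ennreal (D_chi emb V chi (\<Phi> T x \<omega>) (\<Phi> T y \<omega>) powr \<alpha>_star) \<partial>\<gamma> T)
            \<le> ennreal (C\<^sub>T * exp (- c * (V x + V y)) * D_chi emb V chi x y powr \<alpha>_star))))"

text \<open>The infimum is taken in \<open>ennreal\<close>, so that it is positive (infinite) over an empty sublevel set.\<close>

definition assumption_A :: "(real \<Rightarrow> 'h::metric_space \<Rightarrow> 'h measure) \<Rightarrow> ('h \<Rightarrow> real) \<Rightarrow> bool"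
  where "assumption_A P V \<longleftrightarrow>
    (\<exists>x_star. \<forall>R. \<forall>\<epsilon>>0. \<exists>t\<^sub>0\<ge>0. \<forall>t\<ge>t\<^sub>0.
      (INF x\<in>sublevel V R. emeasure (P t x) (ball x_star \<epsilon>)) > 0)"

definition d\<^sub>0 :: "('h::real_normed_vector \<Rightarrow>\<^sub>L 'k::real_normed_vector) \<Rightarrow> ('h \<Rightarrow> real) \<Rightarrow>
    real \<Rightarrow> real \<Rightarrow> real \<Rightarrow> 'h \<Rightarrow> 'h \<Rightarrow> real"
  where "d\<^sub>0 emb V chi r\<^sub>0 \<alpha> x y = min 1 ((D_chi emb V chi x y / r\<^sub>0) powr \<alpha>)"

definition dist_d :: "('h::real_normed_vector \<Rightarrow>\<^sub>L 'k::real_normed_vector) \<Rightarrow> ('h \<Rightarrow> real) \<Rightarrow>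
    real \<Rightarrow> real \<Rightarrow> real \<Rightarrow> real \<Rightarrow> real \<Rightarrow> 'h \<Rightarrow> 'h \<Rightarrow> real"
  where "dist_d emb V chi r\<^sub>0 \<alpha> \<beta> lam x y =
    sqrt (d\<^sub>0 emb V chi r\<^sub>0 \<alpha> x y * (1 + \<beta> * exp (lam * V x) + \<beta> * exp (lam * V y)))"

end

theory Submission
  imports Defs
begin

text \<open>The distance \<open>d\<close> is contracted by a weak form of Harris' theorem. Suppose that the transition
  probabilities over a time step admit couplings under which \<open>d\<^sub>0\<close> halves on average as long as
  \<open>d\<^sub>0 < 1\<close>, that \<open>d\<^sub>0\<close> decreases by a fixed amount on pairs with \<open>d\<^sub>0 = 1\<close> in a sublevel set of the
  Lyapunov function, and that \<open>exp (lam V)\<close> decreases on average outside of it. Then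
  \<open>sqrt (d\<^sub>0 (1 + \<beta> W x + \<beta> W y))\<close> with \<open>W = exp (lam V)\<close> contracts for small \<open>\<beta>\<close>
  (\<open>weak_Harris_contraction\<close>), and so does the transport cost it defines (\<open>wasserstein_bind_le\<close>).
  The Lyapunov bound is \<open>assumption_L\<close> at large times. For \<open>d\<^sub>0 = 1\<close> the independent coupling gains,
  because by \<open>assumption_A\<close> both copies enter a small ball around \<open>x_star\<close> with positive probability.

  The substance is the halving of \<open>d\<^sub>0\<close> at small distance (\<open>one_step_contraction\<close>). If
  \<open>V x + V y\<close> is large, the copies are driven by the same noise, and \<open>assumption_S\<close> gives the
  contraction directly. Otherwise the difference of the endpoints is \<open>(S + K) (y - x)\<close>, where \<open>S\<close> is
  small and the compact part \<open>K\<close> has to be removed. Moving the noise of the second copy by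
  \<open>h = A (y - x)\<close> adds \<open>D\<Phi> h\<close> to first order, and since \<open>D\<Phi>\<close> has dense range, a finite rank \<open>A\<close>
  makes \<open>K + D\<Phi> A\<close> small (\<open>admissible_control_exists\<close>). This \<open>A\<close> depends on the pair and on the
  noise, but by compactness and continuity finitely many serve all pairs of the sublevel set and
  all noises in a compact set of nearly full measure (\<open>control_cover\<close>).

  Letting the shift depend on the noise would require a comparison of the Gaussian measure with its
  image under a nonlinear map. Instead one of the finitely many constant shifts \<open>A\<^sub>j (y - x)\<close> is
  drawn at random, with probabilities \<open>\<psi>\<^sub>j\<close> that are Lipschitz functions of the noise. By the
  Cameron--Martin theorem the laws involved then change in total variation by at most a multiple of
  \<open>\<parallel>y - x\<parallel>\<close>, and a coupling with exact marginals is obtained at a cost of this order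
  (\<open>control_coupling\<close>). As \<open>d\<^sub>0 x y < 1\<close> is at least \<open>(\<parallel>y - x\<parallel> / r\<^sub>0) powr \<alpha>\<close> and \<open>\<alpha> \<le> 1\<close>, the cost is
  negligible for small \<open>r\<^sub>0\<close>. Where no control is effective, the moment bounds of \<open>SC_remainder\<close>
  together with the small measure of this set suffice (\<open>controlled_displacement_on_small_set\<close>).

  The order of the constants matters in one place. The admissible size of \<open>S\<close>, that is of \<open>\<rho> T\<close>,
  depends on a bound \<open>U\<close> for exponential moments of \<open>V\<close> at time \<open>T\<close>, started below the level \<open>R T\<close>
  above which \<open>assumption_S\<close> contracts. This level grows linearly in \<open>T\<close>, while \<open>assumption_L\<close>
  multiplies \<open>V\<close> by \<open>\<theta> T = o(1/T)\<close>, so \<open>U\<close> does not depend on \<open>T\<close>, and \<open>T\<close> can be chosen last.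

  The Cameron--Martin theorem rests on the fact that a Gaussian measure is not changed if the
  component along \<open>\<iota> h\<close> is replaced by an independent normal one (\<open>resample_distr\<close>), which reduces it
  to a translation on the real line. That fact is read off from characteristic functionals, which
  determine a measure (\<open>char_functional_unique\<close>): the measure is concentrated on compact sets up to small mass, and there
  trigonometric polynomials are dense because bounded functionals separate points.\<close>

section \<open>Linear functionals and finite rank operators\<close>

definition sublinear :: "('a::real_vector \<Rightarrow> real) \<Rightarrow> bool" where
  "sublinear p \<longleftrightarrow> (\<forall>x y. p (x + y) \<le> p x + p y) \<and> (\<forall>c>0. \<forall>x. p (c *\<^sub>R x) \<le> c * p x)"

lemma sublinear_zero:
  assumes "sublinear p" shows "p 0 = 0"
proof -
  have "p 0 \<le> p 0 + p 0" using assms unfolding sublinear_def by (metis add_0)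
  moreover have "p ((1/2) *\<^sub>R 0) \<le> (1/2) * p 0"
    using assms unfolding sublinear_def by (meson half_gt_zero_iff zero_less_one)
  ultimately show ?thesis by simp
qed

lemma sublinear_scale:
  assumes "sublinear p" "0 \<le> c" shows "p (c *\<^sub>R x) = c * p x"
proof (cases "c = 0")
  case True then show ?thesis using sublinear_zero[OF assms(1)] by simp
next
  case False
  then have c: "c > 0" using assms(2) by simp
  have "p (inverse c *\<^sub>R (c *\<^sub>R x)) \<le> inverse c * p (c *\<^sub>R x)"
    using assms(1) c unfolding sublinear_def by (meson positive_imp_inverse_positive)
  then have "c * p x \<le> p (c *\<^sub>R x)" using c by (simp add: field_simps)
  moreover have "p (c *\<^sub>R x) \<le> c * p x" using assms(1) c unfolding sublinear_def by blast
  ultimately show ?thesis by simp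
qed

text \<open>The largest sublinear minorant of \<open>p\<close> that is linear in the direction \<open>a\<close> with slope \<open>p a\<close>: a minimal
  sublinear functional must coincide with it, and is therefore additive.\<close>

definition slope_minorant :: "('a::real_vector \<Rightarrow> real) \<Rightarrow> 'a \<Rightarrow> 'a \<Rightarrow> real" where
  "slope_minorant p a x = (INF t\<in>{0..}. p (x + t *\<^sub>R a) - t * p a)"

lemma slope_minorant_bdd:
  assumes "sublinear p"
  shows "bdd_below ((\<lambda>t. p (x + t *\<^sub>R a) - t * p a) ` {0..})"
proof (rule bdd_belowI2[where m = "- p (- x)"])
  fix t :: real assume t: "t \<in> {0..}"
  have "t * p a = p ((x + t *\<^sub>R a) + - x)" using sublinear_scale[OF assms, of t a] t by simp
  also have "\<dots> \<le> p (x + t *\<^sub>R a) + p (- x)" using assms unfolding sublinear_def by blast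
  finally show "- p (- x) \<le> p (x + t *\<^sub>R a) - t * p a" by simp
qed

lemma slope_minorant_le:
  assumes "sublinear p" "0 \<le> t"
  shows "slope_minorant p a x \<le> p (x + t *\<^sub>R a) - t * p a"
  unfolding slope_minorant_def
  by (rule cINF_lower[OF slope_minorant_bdd[OF assms(1)]]) (use assms in auto)

lemma sublinear_slope_minorant:
  assumes "sublinear p"
  shows "sublinear (slope_minorant p a)"
  unfolding sublinear_def
proof (intro conjI allI impI)
  fix x y
  have "slope_minorant p a (x + y) - (p (x + s *\<^sub>R a) - s * p a) \<le> p (y + t *\<^sub>R a) - t * p a"
    if "0 \<le> s" "0 \<le> t" for s t
  proof -
    have "slope_minorant p a (x + y) \<le> p ((x + y) + (s + t) *\<^sub>R a) - (s + t) * p a"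
      using slope_minorant_le[OF assms, of "s + t"] that by simp
    also have "(x + y) + (s + t) *\<^sub>R a = (x + s *\<^sub>R a) + (y + t *\<^sub>R a)" by (simp add: algebra_simps)
    also have "p \<dots> \<le> p (x + s *\<^sub>R a) + p (y + t *\<^sub>R a)" using assms unfolding sublinear_def by blast
    finally show ?thesis by (simp add: algebra_simps)
  qed
  then have "slope_minorant p a (x + y) - (p (x + s *\<^sub>R a) - s * p a) \<le> slope_minorant p a y"
    if "0 \<le> s" for s
    unfolding slope_minorant_def[of p a y] by (intro cINF_greatest) (use that in auto)
  then have "slope_minorant p a (x + y) - slope_minorant p a y \<le> p (x + s *\<^sub>R a) - s * p a"
    if "0 \<le> s" for s using that by (smt (verit))
  then have "slope_minorant p a (x + y) - slope_minorant p a y \<le> slope_minorant p a x"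
    unfolding slope_minorant_def[of p a x] by (intro cINF_greatest) auto
  then show "slope_minorant p a (x + y) \<le> slope_minorant p a x + slope_minorant p a y" by simp
next
  fix c :: real and x assume c: "c > 0"
  have "slope_minorant p a (c *\<^sub>R x) / c \<le> p (x + t *\<^sub>R a) - t * p a" if "0 \<le> t" for t
  proof -
    have "slope_minorant p a (c *\<^sub>R x) \<le> p (c *\<^sub>R x + (c * t) *\<^sub>R a) - (c * t) * p a"
      using slope_minorant_le[OF assms, of "c * t"] c that by simp
    also have "c *\<^sub>R x + (c * t) *\<^sub>R a = c *\<^sub>R (x + t *\<^sub>R a)" by (simp add: algebra_simps)
    also have "p \<dots> = c * p (x + t *\<^sub>R a)" using sublinear_scale[OF assms] c by simp
    finally show ?thesis using c by (simp add: field_simps)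
  qed
  then have "slope_minorant p a (c *\<^sub>R x) / c \<le> slope_minorant p a x"
    unfolding slope_minorant_def[of p a x] by (intro cINF_greatest) auto
  then show "slope_minorant p a (c *\<^sub>R x) \<le> c * slope_minorant p a x" using c by (simp add: field_simps)
qed

text \<open>Zorn's lemma on sublinear functionals ordered pointwise; chains have their pointwise infimum
  as lower bound.\<close>

theorem dominated_linear_functional_exists:
  fixes p :: "'a::real_vector \<Rightarrow> real"
  assumes p: "sublinear p"
  obtains f where "linear f" "\<And>x. f x \<le> p x"
proof -
  define A where "A = {q. sublinear q \<and> q \<le> p}"
  have "\<exists>m\<in>A. \<forall>q\<in>A. q \<le> m \<longrightarrow> q = m"
  proof (rule predicate_Zorn)
    show "partial_order_on A (relation_of (\<lambda>f g. g \<le> f) A)"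
      by (rule partial_order_on_relation_ofI) auto
  next
    fix C assume C: "C \<in> Chains (relation_of (\<lambda>f g. g \<le> f) A)"
    have CA: "C \<subseteq> A" and ch: "\<And>q q'. q \<in> C \<Longrightarrow> q' \<in> C \<Longrightarrow> q \<le> q' \<or> q' \<le> q"
      using C unfolding Chains_def relation_of_def by blast+
    show "\<exists>u\<in>A. \<forall>q\<in>C. u \<le> q"
    proof (cases "C = {}")
      case True then show ?thesis using p unfolding A_def by auto
    next
      case False
      define u where "u x = (INF q\<in>C. q x)" for x
      have bdd: "bdd_below ((\<lambda>q. q x) ` C)" for x
      proof (rule bdd_belowI2[where m = "- p (- x)"])
        fix q assume "q \<in> C"
        then have q: "sublinear q" "q \<le> p" using CA unfolding A_def by auto
        have "0 = q (x + - x)" using sublinear_zero[OF q(1)] by simp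
        also have "\<dots> \<le> q x + q (- x)" using q(1) unfolding sublinear_def by blast
        also have "q (- x) \<le> p (- x)" using q(2) by (simp add: le_fun_def)
        finally show "- p (- x) \<le> q x" by simp
      qed
      have ule: "u x \<le> q x" if "q \<in> C" for q x
        unfolding u_def by (rule cINF_lower[OF bdd that])
      have glb: "c \<le> u x" if "\<And>q. q \<in> C \<Longrightarrow> c \<le> q x" for c x
        unfolding u_def by (rule cINF_greatest[OF False]) (use that in auto)
      have "sublinear u" unfolding sublinear_def
      proof (intro conjI allI impI)
        fix x y
        have "u (x + y) \<le> q x + q' y" if qq: "q \<in> C" "q' \<in> C" for q q'
        proof -
          obtain r where r: "r \<in> C" "r \<le> q" "r \<le> q'" using ch[OF qq] qq by blast
          have "u (x + y) \<le> r (x + y)" using ule r by blast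
          also have "\<dots> \<le> r x + r y" using r(1) CA unfolding A_def sublinear_def by blast
          also have "\<dots> \<le> q x + q' y" using r by (simp add: le_fun_def add_mono)
          finally show ?thesis .
        qed
        then have "u (x + y) - q x \<le> u y" if "q \<in> C" for q using that glb by (smt (verit))
        then have "u (x + y) - u y \<le> u x" by (intro glb) (smt (verit))
        then show "u (x + y) \<le> u x + u y" by simp
      next
        fix c :: real and x assume c: "c > 0"
        have "u (c *\<^sub>R x) / c \<le> q x" if "q \<in> C" for q
        proof -
          have "u (c *\<^sub>R x) \<le> q (c *\<^sub>R x)" using ule that by blast
          also have "\<dots> \<le> c * q x" using that CA c unfolding A_def sublinear_def by blast
          finally show ?thesis using c by (simp add: field_simps)
        qed
        then have "u (c *\<^sub>R x) / c \<le> u x" by (rule glb)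
        then show "u (c *\<^sub>R x) \<le> c * u x" using c by (simp add: field_simps)
      qed
      moreover have "u \<le> p"
      proof -
        obtain q where "q \<in> C" using False by blast
        then show ?thesis using ule CA unfolding A_def le_fun_def by (blast intro: order_trans)
      qed
      ultimately show ?thesis using ule unfolding A_def le_fun_def by blast
    qed
  qed
  then obtain m where m: "sublinear m" "m \<le> p" and min: "\<And>q. sublinear q \<Longrightarrow> q \<le> m \<Longrightarrow> q = m"
    unfolding A_def by (auto intro: order_trans)
  have super: "m x + m a \<le> m (x + a)" for x a
  proof -
    have "slope_minorant m a y \<le> m y" for y
      using slope_minorant_le[OF m(1), of 0] by simp
    then have "slope_minorant m a = m"
      using min[OF sublinear_slope_minorant[OF m(1)]] by (simp add: le_fun_def)
    then show ?thesis using slope_minorant_le[OF m(1), of 1 a x] by simp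
  qed
  then have add: "m (x + y) = m x + m y" for x y
    using m(1) unfolding sublinear_def by (simp add: antisym)
  have neg: "m (- x) = - m x" for x using add[of x "- x"] sublinear_zero[OF m(1)] by simp
  have "linear m"
  proof (rule linearI[OF add])
    fix c :: real and x
    show "m (c *\<^sub>R x) = c *\<^sub>R m x"
    proof (cases "c \<ge> 0")
      case True then show ?thesis using sublinear_scale[OF m(1)] by simp
    next
      case False
      then have "m ((- c) *\<^sub>R x) = (- c) * m x" using sublinear_scale[OF m(1), of "- c" x] by linarith
      then show ?thesis using neg[of "c *\<^sub>R x"] by simp
    qed
  qed
  then show ?thesis using that m(2) by (auto simp: le_fun_def)
qed

text \<open>A functional dominated by the norm may vanish at \<open>a\<close>, but one dominated by the slope minorant of the
  norm along \<open>a\<close> is at most \<open>- norm a\<close> at \<open>- a\<close>.\<close>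

corollary separating_functional_exists:
  fixes a :: "'a::real_normed_vector"
  assumes "a \<noteq> 0"
  obtains f :: "'a \<Rightarrow> real" where "bounded_linear f" "f a \<noteq> 0"
proof -
  have nrm: "sublinear (norm :: 'a \<Rightarrow> real)"
    unfolding sublinear_def by (auto simp: norm_triangle_ineq)
  obtain f where f: "linear f" "\<And>x. f x \<le> slope_minorant norm a x"
    using dominated_linear_functional_exists[OF sublinear_slope_minorant[OF nrm]] by blast
  have le: "f x \<le> norm x" for x
    using f(2)[of x] slope_minorant_le[OF nrm, of 0 a x] by simp
  have "\<bar>f x\<bar> \<le> norm x" for x
    using le[of x] le[of "- x"] linear_neg[OF f(1), of x] by simp
  then have "bounded_linear f"
    using f(1) by (intro bounded_linear_intro[where K = 1]) (auto simp: linear_add linear_cmul)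
  moreover have "f (- a) \<le> - norm a"
    using f(2)[of "- a"] slope_minorant_le[OF nrm, of 1 a "- a"] by simp
  then have "f a \<noteq> 0" using linear_neg[OF f(1), of a] assms by auto
  ultimately show ?thesis using that by blast
qed

text \<open>A minimising sequence is Cauchy by the parallelogram law.\<close>

lemma orthogonal_projection_exists:
  fixes M :: "'a::{real_inner, banach} set"
  assumes M: "subspace M" "closed M"
  obtains y where "y \<in> M" "\<And>z. z \<in> M \<Longrightarrow> inner (x - y) z = 0"
proof -
  define d where "d = infdist x M"
  have ne: "M \<noteq> {}" using M(1) subspace_0 by blast
  have dle: "d \<le> norm (x - w)" if "w \<in> M" for w
    using infdist_le[OF that, of x] unfolding d_def dist_norm .
  have d0: "d \<ge> 0" unfolding d_def by (rule infdist_nonneg)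
  have "\<exists>w\<in>M. norm (x - w) < d + 1 / (real n + 1)" for n
  proof -
    have "infdist x M < d + 1 / (real n + 1)" unfolding d_def by simp
    moreover have "bdd_below ((\<lambda>w. dist x w) ` M)" by (intro bdd_belowI2[where m = 0]) auto
    ultimately show ?thesis
      by (simp add: infdist_notempty[OF ne] cINF_less_iff[OF ne] dist_norm)
  qed
  then obtain y where y: "\<And>n. y n \<in> M" "\<And>n. norm (x - y n) < d + 1 / (real n + 1)" by metis
  have par: "(norm (a - b))\<^sup>2 \<le> 2 * (norm (x - a))\<^sup>2 + 2 * (norm (x - b))\<^sup>2 - 4 * d\<^sup>2"
    if "a \<in> M" "b \<in> M" for a b
  proof -
    have "(1/2) *\<^sub>R (a + b) \<in> M" using that M(1) by (simp add: subspace_add subspace_scale)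
    from dle[OF this] have "d\<^sup>2 \<le> (norm (x - (1/2) *\<^sub>R (a + b)))\<^sup>2" using d0 by (simp add: power_mono)
    moreover have "(norm (a - b))\<^sup>2 = 2 * (norm (x - a))\<^sup>2 + 2 * (norm (x - b))\<^sup>2
        - 4 * (norm (x - (1/2) *\<^sub>R (a + b)))\<^sup>2"
      unfolding power2_norm_eq_inner by (simp add: algebra_simps inner_commute)
    ultimately show ?thesis by simp
  qed
  have lim0: "(\<lambda>n. 4 * ((d + 1 / (real n + 1))\<^sup>2 - d\<^sup>2)) \<longlonglongrightarrow> 0"
  proof -
    have "(\<lambda>n. 4 * ((d + 1 / real (Suc n))\<^sup>2 - d\<^sup>2)) \<longlonglongrightarrow> 4 * ((d + 0)\<^sup>2 - d\<^sup>2)"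
      by (intro tendsto_intros LIMSEQ_Suc[OF lim_1_over_n])
    then show ?thesis by (simp add: add.commute)
  qed
  have "Cauchy y"
  proof (rule CauchyI)
    fix e :: real assume e: "e > 0"
    then have "e\<^sup>2 > 0" by simp
    from order_tendstoD(2)[OF lim0 this] obtain N
      where N: "\<And>n. n \<ge> N \<Longrightarrow> 4 * ((d + 1 / (real n + 1))\<^sup>2 - d\<^sup>2) < e\<^sup>2"
      unfolding eventually_sequentially by blast
    have "norm (y m - y n) < e" if "m \<ge> N" "n \<ge> N" for m n
    proof -
      have b: "(norm (x - y k))\<^sup>2 \<le> (d + 1 / (real N + 1))\<^sup>2" if "k \<ge> N" for k
      proof (rule power_mono)
        have "1 / (real k + 1) \<le> 1 / (real N + 1)" using that by (simp add: field_simps)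
        then show "norm (x - y k) \<le> d + 1 / (real N + 1)" using y(2)[of k] by linarith
      qed simp
      have "(norm (y m - y n))\<^sup>2 < e\<^sup>2"
        using par[OF y(1) y(1), of m n] b[OF that(1)] b[OF that(2)] N[of N] by simp
      then show ?thesis using e by (simp add: power2_less_imp_less)
    qed
    then show "\<exists>M. \<forall>m\<ge>M. \<forall>n\<ge>M. norm (y m - y n) < e" by blast
  qed
  then obtain l where l: "y \<longlonglongrightarrow> l" using Cauchy_convergent_iff convergent_def by blast
  have lM: "l \<in> M" using closed_sequentially[OF M(2)] y(1) l by blast
  have "norm (x - l) \<le> d"
  proof (rule LIMSEQ_le)
    show "(\<lambda>n. norm (x - y n)) \<longlonglongrightarrow> norm (x - l)" by (intro tendsto_intros l)
    have "(\<lambda>n. d + 1 / real (Suc n)) \<longlonglongrightarrow> d + 0"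
      by (intro tendsto_intros LIMSEQ_Suc[OF lim_1_over_n])
    then show "(\<lambda>n. d + 1 / (real n + 1)) \<longlonglongrightarrow> d" by (simp add: add.commute)
    show "\<exists>N. \<forall>n\<ge>N. norm (x - y n) \<le> d + 1 / (real n + 1)" using y(2) less_imp_le by blast
  qed
  have "inner (x - l) z = 0" if z: "z \<in> M" for z
  proof (cases "z = 0")
    case False
    define t where "t = inner (x - l) z / inner z z"
    have zz: "inner z z > 0" using False by simp
    have "l + t *\<^sub>R z \<in> M" using lM z M(1) by (simp add: subspace_add subspace_scale)
    then have "(norm (x - l))\<^sup>2 \<le> (norm (x - (l + t *\<^sub>R z)))\<^sup>2"
      using dle \<open>norm (x - l) \<le> d\<close> by (intro power_mono) force+
    also have "\<dots> = (norm (x - l))\<^sup>2 - 2 * t * inner (x - l) z + t\<^sup>2 * inner z z"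
      unfolding power2_norm_eq_inner
      by (simp add: inner_commute inner_diff_left inner_diff_right inner_add_left inner_add_right
          power2_eq_square algebra_simps)
    finally have "2 * t * inner (x - l) z \<le> t\<^sup>2 * inner z z" by simp
    moreover have "t\<^sup>2 * inner z z = (inner (x - l) z)\<^sup>2 / inner z z"
      "2 * t * inner (x - l) z = 2 * ((inner (x - l) z)\<^sup>2 / inner z z)"
      using zz by (simp_all add: t_def power2_eq_square)
    ultimately have "(inner (x - l) z)\<^sup>2 / inner z z \<le> 0" by linarith
    then show ?thesis using zz by (simp add: divide_le_0_iff)
  qed simp
  then show ?thesis using that lM by blast
qed

lemma orthonormal_spanning_exists:
  fixes S :: "'a::real_inner set"
  assumes "finite S"
  shows "\<exists>B. finite B \<and> S \<subseteq> span B \<and> (\<forall>b\<in>B. \<forall>c\<in>B. inner b c = (if b = c then 1 else 0))"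
  using assms
proof (induction rule: finite_induct)
  case empty show ?case by (rule exI[of _ "{}"]) simp
next
  case (insert s S)
  then obtain B where B: "finite B" "S \<subseteq> span B"
    "\<forall>b\<in>B. \<forall>c\<in>B. inner b c = (if b = c then 1 else 0)" by blast
  define w where "w = (\<Sum>b\<in>B. inner s b *\<^sub>R b)"
  define u where "u = s - w"
  have wB: "w \<in> span B" unfolding w_def by (intro span_sum span_scale span_base)
  have orth: "inner u c = 0" if c: "c \<in> B" for c
  proof -
    have "inner w c = (\<Sum>b\<in>B. inner s b * inner b c)" unfolding w_def by (simp add: inner_sum_left)
    also have "\<dots> = (\<Sum>b\<in>B. if b = c then inner s c else 0)"
      by (rule sum.cong) (use B(3) c in auto)
    also have "\<dots> = inner s c" using c B(1) by simp
    finally show ?thesis unfolding u_def by (simp add: inner_diff_left)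
  qed
  show ?case
  proof (cases "u = 0")
    case True
    then have "s \<in> span B" using wB unfolding u_def by simp
    then show ?thesis using B by blast
  next
    case False
    define e where "e = u /\<^sub>R norm u"
    have ee: "inner e e = 1" using False unfolding e_def
      by (simp add: dot_square_norm power2_eq_square)
    have eo: "inner e c = 0" "inner c e = 0" if "c \<in> B" for c
      using orth[OF that] unfolding e_def by (simp_all add: inner_commute)
    have "u = norm u *\<^sub>R e" using False unfolding e_def by simp
    then have "s = w + norm u *\<^sub>R e" unfolding u_def by (metis add.commute diff_add_cancel)
    moreover have "w \<in> span (insert e B)" using wB span_mono[of B "insert e B"] by blast
    ultimately have "s \<in> span (insert e B)"
      by (metis insertI1 span_add span_base span_scale)
    moreover have "S \<subseteq> span (insert e B)" using B(2) span_mono[of B "insert e B"] by blast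
    moreover have "\<forall>b\<in>insert e B. \<forall>c\<in>insert e B. inner b c = (if b = c then 1 else 0)"
      using B(3) ee eo by (auto simp: )
    ultimately show ?thesis using B(1) by (intro exI[of _ "insert e B"]) simp
  qed
qed

text \<open>Project onto the span of a finite \<open>\<epsilon>\<close>-net of the image of the unit ball.\<close>

lemma compact_operator_finite_rank_approx:
  fixes K :: "'a::real_normed_vector \<Rightarrow>\<^sub>L 'b::real_inner"
  assumes K: "compact_operator K" and e: "e > 0"
  shows "\<exists>B. finite B \<and> (\<forall>v. norm (K v - (\<Sum>b\<in>B. inner (K v) b *\<^sub>R b)) \<le> e * norm v)"
proof -
  have "compact (closure (blinfun_apply K ` cball 0 1))" using K unfolding compact_operator_def .
  then obtain S where S: "finite S" "closure (blinfun_apply K ` cball 0 1) \<subseteq> (\<Union>c\<in>S. ball c e)"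
    using compact_eq_totally_bounded e by (metis)
  obtain B where B: "finite B" "S \<subseteq> span B"
    "\<forall>b\<in>B. \<forall>c\<in>B. inner b c = (if b = c then 1 else 0)"
    using orthonormal_spanning_exists[OF S(1)] by blast
  define Q where "Q v = (\<Sum>b\<in>B. inner v b *\<^sub>R b)" for v
  have Qorth: "inner (v - Q v) c = 0" if c: "c \<in> B" for v c
  proof -
    have "inner (Q v) c = (\<Sum>b\<in>B. inner v b * inner b c)" unfolding Q_def by (simp add: inner_sum_left)
    also have "\<dots> = (\<Sum>b\<in>B. if b = c then inner v c else 0)"
      by (rule sum.cong) (use B(3) c in auto)
    also have "\<dots> = inner v c" using c B(1) by simp
    finally show ?thesis by (simp add: inner_diff_left)
  qed
  have Qorth': "inner (v - Q v) w = 0" if "w \<in> span B" for v w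
    using that by (induction rule: span_induct_alt) (auto simp: inner_add_right Qorth)
  have Qs: "Q v \<in> span B" for v unfolding Q_def by (intro span_sum span_scale span_base)
  have Qle: "norm (v - Q v) \<le> norm (v - w)" if "w \<in> span B" for v w
  proof -
    have "v - w = (v - Q v) + (Q v - w)" by simp
    moreover have "inner (v - Q v) (Q v - w) = 0" using Qorth' Qs that by (simp add: span_diff)
    ultimately have "(norm (v - w))\<^sup>2 = (norm (v - Q v))\<^sup>2 + (norm (Q v - w))\<^sup>2"
      using norm_add_Pythagorean orthogonal_def by metis
    then have "(norm (v - Q v))\<^sup>2 \<le> (norm (v - w))\<^sup>2" by simp
    then show ?thesis by simp
  qed
  have "norm (K v - Q (K v)) \<le> e * norm v" for v
  proof (cases "v = 0")
    case True then show ?thesis unfolding Q_def by simp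
  next
    case False
    define u where "u = v /\<^sub>R norm v"
    have "u \<in> cball 0 1" using False unfolding u_def by simp
    then have "K u \<in> closure (blinfun_apply K ` cball 0 1)" by (intro subsetD[OF closure_subset] imageI)
    then obtain c where c: "c \<in> S" "dist c (K u) < e" using S(2) by auto
    have "norm (K u - Q (K u)) \<le> norm (K u - c)" using Qle c(1) B(2) by blast
    also have "\<dots> < e" using c(2) by (simp add: dist_norm norm_minus_commute)
    finally have le: "norm (K u - Q (K u)) < e" .
    have "K v = norm v *\<^sub>R K u" using False unfolding u_def by (simp add: blinfun.scaleR_right)
    moreover have "Q (norm v *\<^sub>R w) = norm v *\<^sub>R Q w" for w unfolding Q_def by (simp add: scaleR_sum_right)
    ultimately have "norm (K v - Q (K v)) = norm v * norm (K u - Q (K u))"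
      by (simp flip: scaleR_diff_right)
    also have "\<dots> \<le> norm v * e" using le by (intro mult_left_mono) auto
    finally show ?thesis by (simp add: mult.commute)
  qed
  then show ?thesis using B(1) unfolding Q_def by blast
qed

text \<open>The control of the linearised flow: a compact perturbation is cancelled, up to \<open>\<epsilon>\<close>, by
  finitely many directions whose images under \<open>D\<close> are nearly prescribed.\<close>

lemma finite_rank_control_exists:
  fixes K :: "'a::real_normed_vector \<Rightarrow>\<^sub>L 'b::real_inner" and D :: "'w::real_normed_vector \<Rightarrow>\<^sub>L 'b"
  assumes K: "compact_operator K" and dense: "closure (blinfun_apply D ` S) = UNIV" and e: "e > 0"
  shows "\<exists>B h (A::'a \<Rightarrow>\<^sub>L 'w). finite B \<and> (\<forall>b\<in>B. h b \<in> S) \<and>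
    (\<forall>v. blinfun_apply A v = (\<Sum>b\<in>B. inner (K v) (- b) *\<^sub>R h b)) \<and> norm (K + (D o\<^sub>L A)) \<le> e"
proof -
  obtain B where B: "finite B" "\<And>v. norm (K v - (\<Sum>b\<in>B. inner (K v) b *\<^sub>R b)) \<le> (e/2) * norm v"
    using compact_operator_finite_rank_approx[OF K, of "e/2"] e by auto
  have d: "\<exists>h\<in>S. norm (b - D h) \<le> d" if "d > 0" for d b
  proof -
    have "b \<in> closure (blinfun_apply D ` S)" using dense by simp
    then show ?thesis using that unfolding closure_approachable
      by (metis dist_norm image_iff less_imp_le norm_minus_commute)
  qed
  \<comment> \<open>The coefficients of \<open>K v\<close> are at most \<open>norm K * norm v * norm b\<close>, so errors \<open>\<delta>\<close> in prescribing
    the \<open>b\<close> amount to at most \<open>e / 2\<close> in operator norm.\<close>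
  define \<delta> where "\<delta> = e / (2 * (norm K + 1) * ((\<Sum>b\<in>B. norm b) + 1))"
  have s0: "(\<Sum>b\<in>B. norm b) \<ge> 0" by (simp add: sum_nonneg)
  have den: "2 * (norm K + 1) * ((\<Sum>b\<in>B. norm b) + 1) > 0"
    using s0 by (intro mult_pos_pos) (auto intro: add_nonneg_pos)
  have \<delta>: "\<delta> > 0" unfolding \<delta>_def using e den by simp
  obtain h where h: "\<And>b. h b \<in> S" "\<And>b. norm (b - D (h b)) \<le> \<delta>" using d[OF \<delta>] by metis
  define A0 where "A0 v = (\<Sum>b\<in>B. inner (K v) (- b) *\<^sub>R h b)" for v
  have bl: "bounded_linear A0" unfolding A0_def
    by (intro bounded_linear_sum bounded_linear_scaleR_const
        bounded_linear_inner_left_comp blinfun.bounded_linear_right)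
  define A where "A = Blinfun A0"
  have A: "A v = (\<Sum>b\<in>B. inner (K v) (- b) *\<^sub>R h b)" for v
    unfolding A_def using bounded_linear_Blinfun_apply[OF bl] unfolding A0_def by simp
  have "norm ((K + (D o\<^sub>L A)) v) \<le> e * norm v" for v
  proof -
    have "(K + (D o\<^sub>L A)) v = (K v - (\<Sum>b\<in>B. inner (K v) b *\<^sub>R b))
        + (\<Sum>b\<in>B. inner (K v) b *\<^sub>R (b - D (h b)))"
      by (simp add: blinfun.add_left A blinfun.sum_right blinfun.scaleR_right blinfun.minus_right
          scaleR_diff_right sum_subtractf sum_negf)
    also have "norm \<dots> \<le> (e/2) * norm v + (\<Sum>b\<in>B. norm (inner (K v) b *\<^sub>R (b - D (h b))))"
      by (rule order_trans[OF norm_triangle_ineq add_mono[OF B(2) norm_sum]])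
    also have "(\<Sum>b\<in>B. norm (inner (K v) b *\<^sub>R (b - D (h b)))) \<le> (\<Sum>b\<in>B. (norm K * norm v * norm b) * \<delta>)"
    proof (rule sum_mono)
      fix b
      have "\<bar>inner (K v) b\<bar> \<le> norm (K v) * norm b" by (rule Cauchy_Schwarz_ineq2)
      also have "\<dots> \<le> norm K * norm v * norm b" by (intro mult_right_mono norm_blinfun) simp
      finally show "norm (inner (K v) b *\<^sub>R (b - D (h b))) \<le> (norm K * norm v * norm b) * \<delta>"
        using h(2)[of b] by (auto intro: mult_mono)
    qed
    also have "\<dots> = norm v * (norm K * (\<Sum>b\<in>B. norm b) * \<delta>)"
      by (simp add: sum_distrib_left sum_distrib_right mult_ac)
    also have "norm K * (\<Sum>b\<in>B. norm b) * \<delta> \<le> (norm K + 1) * ((\<Sum>b\<in>B. norm b) + 1) * \<delta>"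
      using s0 \<delta> by (intro mult_right_mono mult_mono) auto
    also have "\<dots> = e / 2" unfolding \<delta>_def using den by (simp add: field_simps)
    finally have "norm ((K + (D o\<^sub>L A)) v) \<le> (e/2) * norm v + norm v * (e/2)"
      by (simp add: mult_left_mono)
    then show ?thesis by (simp add: field_simps)
  qed
  then have "norm (K + (D o\<^sub>L A)) \<le> e" using e by (intro norm_blinfun_bound) auto
  then show ?thesis using B(1) h(1) A by blast
qed

section \<open>Measures determined by their characteristic functional\<close>

text \<open>The Banach type is not assumed to be separable. A Borel measure therefore lives on a separable closed
  subset with the trace \<open>\<sigma>\<close>-algebra, where tightness and the measurability of sums are available.\<close>

locale borel_prob_on = prob_space \<mu> for \<mu> :: "'e::banach measure" +
  fixes E :: "'e set"
  assumes closed_E: "closed E" and separable_E: "separable_space (top_of_set E)"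
    and sets_eq: "sets \<mu> = sets (restrict_space borel E)"
begin

lemma space_eq: "space \<mu> = E"
  using sets_eq_imp_space_eq[OF sets_eq] by (simp add: space_restrict_space)

lemma E_nonempty: "E \<noteq> {}"
  using not_empty space_eq by simp

lemma sets_iff: "A \<in> sets \<mu> \<longleftrightarrow> A \<subseteq> E \<and> A \<in> sets borel"
  unfolding sets_eq using closed_E by (subst sets_restrict_space_iff) auto

lemma closed_in_sets: "closed C \<Longrightarrow> C \<inter> E \<in> sets \<mu>"
  using closed_E by (simp add: sets_iff)

lemma open_in_sets: "open U \<Longrightarrow> U \<inter> E \<in> sets \<mu>"
  using closed_E by (simp add: sets_iff)

lemma measurable_from_borel:
  assumes "f \<in> borel \<rightarrow>\<^sub>M M" shows "f \<in> \<mu> \<rightarrow>\<^sub>M M"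
  using measurable_restrict_space1[OF assms, of E] measurable_cong_sets[OF sets_eq refl] by blast

lemma continuous_measurable:
  fixes f :: "'e \<Rightarrow> 'b::topological_space"
  assumes "continuous_on E f" shows "f \<in> \<mu> \<rightarrow>\<^sub>M borel"
  using borel_measurable_continuous_on_restrict[OF assms] measurable_cong_sets[OF sets_eq refl] by blast

lemma dense_sequence:
  obtains d :: "nat \<Rightarrow> 'e" where "range d \<subseteq> E" "\<And>x e. x \<in> E \<Longrightarrow> e > 0 \<Longrightarrow> \<exists>n. dist (d n) x < e"
proof -
  obtain C where C: "countable C" "C \<subseteq> E" "top_of_set E closure_of C = E"
    using separable_E unfolding separable_space_def by auto
  have cl: "E \<subseteq> closure C"
    using C(2,3) by (metis closure_of_subtopology_subset euclidean_closure_of)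
  then have "C \<noteq> {}" using E_nonempty by auto
  then have "range (from_nat_into C) = C" using C(1) by (rule range_from_nat_into)
  moreover have "\<exists>n. dist (from_nat_into C n) x < e" if x: "x \<in> E" "e > 0" for x e
  proof -
    obtain y where "y \<in> C" "dist y x < e" using cl x unfolding closure_approachable by (meson closure_approachable subsetD)
    then show ?thesis using \<open>range (from_nat_into C) = C\<close> by (metis imageE)
  qed
  ultimately show ?thesis using that C(2) by metis
qed

text \<open>For each \<open>k\<close>, finitely many balls of radius \<open>1 / (k + 1)\<close> around a dense sequence carry all but
  \<open>e / 2 ^ (k + 1)\<close> of the mass. The intersection over \<open>k\<close> is closed and totally bounded.\<close>

lemma tight:
  assumes e: "e > 0"
  obtains G where "compact G" "G \<subseteq> E" "measure \<mu> (E - G) \<le> e"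
proof -
  obtain d :: "nat \<Rightarrow> 'e" where d: "range d \<subseteq> E" "\<And>x e. x \<in> E \<Longrightarrow> e > 0 \<Longrightarrow> \<exists>n. dist (d n) x < e"
    using dense_sequence by blast
  define A where "A k n = (\<Union>i\<le>n. cball (d i) (1 / real (Suc k)))" for k n :: nat
  have clA: "closed (A k n)" for k n unfolding A_def by (intro closed_UN) auto
  have Am: "E - A k n \<in> sets \<mu>" for k n
    using closed_E clA by (auto simp: sets_iff)
  have "\<exists>n. measure \<mu> (E - A k n) < e * (1/2) ^ Suc k" for k
  proof -
    have "(\<lambda>n. measure \<mu> (E - A k n)) \<longlonglongrightarrow> measure \<mu> (\<Inter>n. E - A k n)"
    proof (rule finite_Lim_measure_decseq)
      show "range (\<lambda>n. E - A k n) \<subseteq> sets \<mu>" using Am by auto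
      show "decseq (\<lambda>n. E - A k n)" unfolding decseq_def A_def by fastforce
    qed
    moreover have "(\<Inter>n. E - A k n) = {}"
    proof -
      have "\<exists>n. x \<in> A k n" if x: "x \<in> E" for x
      proof -
        obtain n where "dist (d n) x < 1 / real (Suc k)" using d(2)[OF x, of "1 / real (Suc k)"] by auto
        then show ?thesis unfolding A_def by (intro exI[of _ n]) (auto intro!: bexI[of _ n])
      qed
      then show ?thesis by auto
    qed
    ultimately have "(\<lambda>n. measure \<mu> (E - A k n)) \<longlonglongrightarrow> 0" by (simp only: measure_empty)
    from order_tendstoD(2)[OF this, of "e * (1/2) ^ Suc k"] show ?thesis
      using e by (auto simp: eventually_sequentially)
  qed
  then obtain n where n: "\<And>k. measure \<mu> (E - A k (n k)) < e * (1/2) ^ Suc k" by metis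
  define G where "G = E \<inter> (\<Inter>k. A k (n k))"
  have "compact G" unfolding compact_eq_totally_bounded
  proof (intro conjI allI impI)
    show "Topological_Spaces.complete G" unfolding G_def complete_eq_closed
      using closed_E clA by (intro closed_Int closed_INT) auto
    fix r :: real assume "r > 0"
    then obtain k where k: "1 / real (Suc k) < r" using nat_approx_posE by blast
    have "G \<subseteq> (\<Union>x\<in>d ` {..n k}. ball x r)"
    proof
      fix x assume "x \<in> G"
      then have "x \<in> A k (n k)" unfolding G_def by auto
      then obtain i where "i \<le> n k" "dist (d i) x \<le> 1 / real (Suc k)" unfolding A_def by auto
      then show "x \<in> (\<Union>x\<in>d ` {..n k}. ball x r)" using k by (auto intro!: bexI[of _ i])
    qed
    then show "\<exists>K. finite K \<and> G \<subseteq> (\<Union>x\<in>K. ball x r)" by blast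
  qed
  moreover have "measure \<mu> (E - G) \<le> e"
  proof -
    have gs: "(\<lambda>k. e * (1/2) ^ Suc k) sums e"
      using sums_mult[OF power_half_series, of e] by simp
    have sm: "summable (\<lambda>k. measure \<mu> (E - A k (n k)))"
      by (rule summable_comparison_test'[OF sums_summable[OF gs], of 0]) (use n less_imp_le in auto)
    have "E - G = (\<Union>k. E - A k (n k))" unfolding G_def by auto
    then have "measure \<mu> (E - G) \<le> (\<Sum>k. measure \<mu> (E - A k (n k)))"
      using finite_measure_subadditive_countably[of "\<lambda>k. E - A k (n k)"] Am sm by auto
    also have "\<dots> \<le> (\<Sum>k. e * (1/2) ^ Suc k)"
      by (rule suminf_le[OF _ sm sums_summable[OF gs]]) (use n less_imp_le in blast)
    also have "\<dots> = e" using sums_unique[OF gs] by simp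
    finally show ?thesis .
  qed
  ultimately show ?thesis using that unfolding G_def by blast
qed

text \<open>These sets decrease to the empty set as \<open>\<kappa>\<close> vanishes. They are where a cut-off function of the
  distance to \<open>C\<close> differs from the indicator of \<open>C\<close>.\<close>

lemma punctured_neighbourhood_small:
  assumes C: "closed C" "C \<noteq> {}" and e: "e > 0"
  obtains \<kappa>\<^sub>0 where "\<kappa>\<^sub>0 > 0" "\<And>\<kappa>. 0 < \<kappa> \<Longrightarrow> \<kappa> \<le> \<kappa>\<^sub>0 \<Longrightarrow> measure \<mu> {w\<in>E. 0 < infdist w C \<and> infdist w C < \<kappa>} < e"
proof -
  define A where "A \<kappa> = {w\<in>E. 0 < infdist w C \<and> infdist w C < \<kappa>}" for \<kappa>
  have Am: "A \<kappa> \<in> sets \<mu>" for \<kappa>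
  proof -
    have "(\<lambda>w. infdist w C) \<in> borel_measurable \<mu>"
      by (intro continuous_measurable continuous_intros)
    then have "{w\<in>space \<mu>. 0 < infdist w C \<and> infdist w C < \<kappa>} \<in> sets \<mu>" by measurable
    then show ?thesis unfolding A_def space_eq .
  qed
  have "(\<lambda>n. measure \<mu> (A (1 / real (Suc n)))) \<longlonglongrightarrow> measure \<mu> (\<Inter>n. A (1 / real (Suc n)))"
  proof (rule finite_Lim_measure_decseq)
    show "range (\<lambda>n. A (1 / real (Suc n))) \<subseteq> sets \<mu>" using Am by auto
    show "decseq (\<lambda>n. A (1 / real (Suc n)))"
    proof (rule decseq_SucI, rule subsetI)
      fix n w assume "w \<in> A (1 / real (Suc (Suc n)))"
      moreover have "1 / real (Suc (Suc n)) \<le> 1 / real (Suc n)" by (simp add: field_simps)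
      ultimately show "w \<in> A (1 / real (Suc n))" unfolding A_def by simp
    qed
  qed
  moreover have "(\<Inter>n. A (1 / real (Suc n))) = {}"
  proof -
    have False if "\<And>n. w \<in> A (1 / real (Suc n))" for w
    proof -
      have "0 < infdist w C" using that[of 0] unfolding A_def by simp
      then obtain n where "1 / real (Suc n) < infdist w C" using nat_approx_posE by blast
      then show False using that[of n] unfolding A_def by simp
    qed
    then show ?thesis by auto
  qed
  ultimately have "(\<lambda>n. measure \<mu> (A (1 / real (Suc n)))) \<longlonglongrightarrow> 0" by simp
  from order_tendstoD(2)[OF this e] obtain n where n: "measure \<mu> (A (1 / real (Suc n))) < e"
    by (auto simp: eventually_sequentially)
  have "measure \<mu> (A \<kappa>) < e" if "\<kappa> \<le> 1 / real (Suc n)" for \<kappa>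
    by (rule order_le_less_trans[OF finite_measure_mono n]) (use that Am in \<open>auto simp: A_def\<close>)
  then show ?thesis using that[of "1 / real (Suc n)"] unfolding A_def by simp
qed

text \<open>The sets approximable by closed sets from inside and by open sets from outside form a
  \<open>\<sigma>\<close>-algebra containing the open sets.\<close>

lemma closed_open_regular:
  assumes "B \<in> sets borel" "e > 0"
  shows "\<exists>C U. closed C \<and> open U \<and> C \<subseteq> B \<inter> E \<and> B \<inter> E \<subseteq> U \<and> measure \<mu> (U \<inter> E - C) < e"
proof -
  have "B \<in> sigma_sets UNIV {S. open S}" using assms(1) unfolding sets_borel .
  then show ?thesis using assms(2)
  proof (induction arbitrary: e)
    case (Basic U)
    then have U: "open U" by simp
    show ?case
    proof (cases "U = UNIV")
      case True
      then show ?thesis using Basic closed_E by (intro exI[of _ E] exI[of _ UNIV]) auto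
    next
      case False
      then have ne: "- U \<noteq> {}" and cl: "closed (- U)" using U by auto
      obtain \<kappa>\<^sub>0 where \<kappa>: "\<kappa>\<^sub>0 > 0"
        "\<And>\<kappa>. 0 < \<kappa> \<Longrightarrow> \<kappa> \<le> \<kappa>\<^sub>0 \<Longrightarrow> measure \<mu> {w\<in>E. 0 < infdist w (- U) \<and> infdist w (- U) < \<kappa>} < e"
        using punctured_neighbourhood_small[OF cl ne Basic(2)] by blast
      define C where "C = E \<inter> {w. infdist w (- U) \<ge> \<kappa>\<^sub>0}"
      have "closed C" unfolding C_def
        by (intro closed_Int closed_E closed_Collect_le continuous_intros)
      moreover have pos: "w \<in> U \<longleftrightarrow> infdist w (- U) > 0" for w
        using in_closed_iff_infdist_zero[OF cl ne, of w] infdist_nonneg[of w "- U"] by auto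
      then have "C \<subseteq> U \<inter> E" "U \<inter> E - C = {w\<in>E. 0 < infdist w (- U) \<and> infdist w (- U) < \<kappa>\<^sub>0}"
        unfolding C_def using \<kappa>(1) by (auto intro: order_less_le_trans)
      ultimately show ?thesis using U \<kappa>(2)[of \<kappa>\<^sub>0] \<kappa>(1) by (intro exI[of _ C] exI[of _ U]) auto
    qed
  next
    case Empty
    then show ?case by (intro exI[of _ "{}"]) auto
  next
    case (Compl B)
    obtain C U where CU: "closed C" "open U" "C \<subseteq> B \<inter> E" "B \<inter> E \<subseteq> U" "measure \<mu> (U \<inter> E - C) < e"
      using Compl.IH[OF Compl.prems] by blast
    have "- C \<inter> E - (E - U) = U \<inter> E - C" by auto
    then show ?case using CU closed_E
      by (intro exI[of _ "E - U"] exI[of _ "- C"]) (auto simp: closed_Diff)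
  next
    case (Union B)
    have "\<exists>C U. closed C \<and> open U \<and> C \<subseteq> B i \<inter> E \<and> B i \<inter> E \<subseteq> U \<and>
        measure \<mu> (U \<inter> E - C) < e/2 * (1/2) ^ Suc i" for i
      by (rule Union.IH) (use Union.prems in simp)
    then obtain C U where CU: "\<And>i. closed (C i)" "\<And>i. open (U i)" "\<And>i. C i \<subseteq> B i \<inter> E"
      "\<And>i. B i \<inter> E \<subseteq> U i" "\<And>i. measure \<mu> (U i \<inter> E - C i) < e/2 * (1/2) ^ Suc i" by metis
    define V where "V = (\<Union>i. U i)"
    define F where "F n = (\<Union>i\<le>n. C i)" for n
    have clF: "closed (F n)" for n unfolding F_def using CU(1) by (intro closed_UN) auto
    have opV: "open V" unfolding V_def using CU(2) by blast
    have m: "U i \<inter> E - C i \<in> sets \<mu>" "V \<inter> E - F n \<in> sets \<mu>" for i n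
      using open_in_sets[OF CU(2)] closed_in_sets[OF CU(1)] open_in_sets[OF opV] closed_in_sets[OF clF]
        closed_E CU(1) CU(2) clF opV by (auto simp: sets_iff)
    have "(\<lambda>n. measure \<mu> (V \<inter> E - F n)) \<longlonglongrightarrow> measure \<mu> (\<Inter>n. V \<inter> E - F n)"
      by (rule finite_Lim_measure_decseq) (use m in \<open>auto simp: decseq_def F_def\<close>)
    moreover have "measure \<mu> (\<Inter>n. V \<inter> E - F n) < e"
    proof -
      have gs: "(\<lambda>k. e/2 * (1/2) ^ Suc k) sums (e/2)"
        using sums_mult[OF power_half_series, of "e/2"] by simp
      have sm: "summable (\<lambda>k. measure \<mu> (U k \<inter> E - C k))"
        by (rule summable_comparison_test'[OF sums_summable[OF gs], of 0]) (use CU(5) less_imp_le in auto)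
      have "(\<Inter>n. V \<inter> E - F n) \<subseteq> (\<Union>k. U k \<inter> E - C k)" unfolding V_def F_def by auto
      then have "measure \<mu> (\<Inter>n. V \<inter> E - F n) \<le> measure \<mu> (\<Union>k. U k \<inter> E - C k)"
        using m by (intro finite_measure_mono) auto
      also have "\<dots> \<le> (\<Sum>k. measure \<mu> (U k \<inter> E - C k))"
        using finite_measure_subadditive_countably[of "\<lambda>k. U k \<inter> E - C k"] m sm by auto
      also have "\<dots> \<le> (\<Sum>k. e/2 * (1/2) ^ Suc k)"
        by (rule suminf_le[OF _ sm sums_summable[OF gs]]) (use CU(5) less_imp_le in blast)
      also have "\<dots> < e" using sums_unique[OF gs] Union.prems by simp
      finally show ?thesis .
    qed
    ultimately have "\<forall>\<^sub>F n in sequentially. measure \<mu> (V \<inter> E - F n) < e" by (rule order_tendstoD(2))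
    then obtain n where "measure \<mu> (V \<inter> E - F n) < e" unfolding eventually_sequentially by blast
    moreover have "F n \<subseteq> \<Union> (range B) \<inter> E" unfolding F_def using CU(3) by blast
    moreover have "\<Union> (range B) \<inter> E \<subseteq> V" unfolding V_def using CU(4) by blast
    ultimately show ?case using clF[of n] opV by (intro exI[of _ "F n"] exI[of _ V] conjI) assumption+
  qed
qed

lemma inner_regular_closed:
  assumes "A \<in> sets \<mu>" "e > 0"
  obtains C where "closed C" "C \<subseteq> A" "measure \<mu> (A - C) < e"
proof -
  have A: "A \<subseteq> E" "A \<in> sets borel" using assms(1) sets_iff by auto
  obtain C U where CU: "closed C" "open U" "C \<subseteq> A \<inter> E" "A \<inter> E \<subseteq> U" "measure \<mu> (U \<inter> E - C) < e"
    using closed_open_regular[OF A(2) assms(2)] by blast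
  have "measure \<mu> (A - C) \<le> measure \<mu> (U \<inter> E - C)"
  proof (rule finite_measure_mono)
    show "A - C \<subseteq> U \<inter> E - C" using CU A by auto
    show "U \<inter> E - C \<in> sets \<mu>" using CU(1,2) closed_E by (auto simp: sets_iff)
  qed
  then show ?thesis using that[of C] CU by auto
qed

lemma inner_regular_compact:
  assumes "A \<in> sets \<mu>" "e > 0"
  obtains G where "compact G" "G \<subseteq> A" "measure \<mu> (A - G) < e"
proof -
  obtain C where C: "closed C" "C \<subseteq> A" "measure \<mu> (A - C) < e/2"
    by (rule inner_regular_closed[OF assms(1) half_gt_zero[OF assms(2)]])
  obtain K where K: "compact K" "K \<subseteq> E" "measure \<mu> (E - K) \<le> e/2"
    by (rule tight[OF half_gt_zero[OF assms(2)]])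
  have A: "A \<subseteq> E" "A \<in> sets borel" using assms(1) sets_iff by auto
  have m: "A - C \<in> sets \<mu>" "E - K \<in> sets \<mu>"
    using A C(1) closed_E compact_imp_closed[OF K(1)] by (auto simp: sets_iff)
  have "measure \<mu> (A - K \<inter> C) \<le> measure \<mu> ((A - C) \<union> (E - K))"
    using m A by (intro finite_measure_mono) auto
  also have "\<dots> \<le> measure \<mu> (A - C) + measure \<mu> (E - K)"
    using m by (rule measure_Un_le)
  finally show ?thesis using that[of "K \<inter> C"] C K by (auto simp: compact_Int_closed)
qed

end

text \<open>Real trigonometric polynomials in continuous linear functionals; the phase covers the sine.\<close>

inductive_set trig_polynomials :: "('e::real_normed_vector \<Rightarrow> real) set" where
  monomial: "bounded_linear l \<Longrightarrow> (\<lambda>x. c * cos (l x + \<phi>)) \<in> trig_polynomials"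
| add: "f \<in> trig_polynomials \<Longrightarrow> g \<in> trig_polynomials \<Longrightarrow> (\<lambda>x. f x + g x) \<in> trig_polynomials"

lemma trig_polynomials_const: "(\<lambda>_. c) \<in> trig_polynomials"
  using trig_polynomials.monomial[OF bounded_linear_zero, of c 0] by simp

lemma trig_polynomials_mult:
  assumes "f \<in> trig_polynomials" "g \<in> trig_polynomials"
  shows "(\<lambda>x. f x * g x) \<in> trig_polynomials"
  using assms
proof (induction arbitrary: g)
  case (monomial l c \<phi>)
  from monomial(2) show ?case
  proof induction
    case (monomial m d \<psi>)
    have "(\<lambda>x. c * cos (l x + \<phi>) * (d * cos (m x + \<psi>)))
        = (\<lambda>x. c * d / 2 * cos ((l x - m x) + (\<phi> - \<psi>)) + c * d / 2 * cos ((l x + m x) + (\<phi> + \<psi>)))"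
    proof
      fix x
      have "c * cos (l x + \<phi>) * (d * cos (m x + \<psi>)) = c * d * (cos (l x + \<phi>) * cos (m x + \<psi>))" by simp
      also have "cos (l x + \<phi>) * cos (m x + \<psi>)
          = (cos ((l x - m x) + (\<phi> - \<psi>)) + cos ((l x + m x) + (\<phi> + \<psi>))) / 2"
        unfolding cos_times_cos by (simp add: algebra_simps)
      finally show "c * cos (l x + \<phi>) * (d * cos (m x + \<psi>))
        = c * d / 2 * cos ((l x - m x) + (\<phi> - \<psi>)) + c * d / 2 * cos ((l x + m x) + (\<phi> + \<psi>))"
        by (simp add: field_simps)
    qed
    then show ?case using \<open>bounded_linear l\<close> monomial
      by (simp only:) (intro trig_polynomials.intros bounded_linear_sub bounded_linear_add)
  next
    case (add f g)
    then show ?case by (simp add: distrib_left trig_polynomials.add)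
  qed
next
  case (add f g h)
  then show ?case by (simp add: distrib_right trig_polynomials.add)
qed

lemma trig_polynomials_continuous: "f \<in> trig_polynomials \<Longrightarrow> continuous_on S f"
proof (induction rule: trig_polynomials.induct)
  case (monomial l c \<phi>)
  then show ?case by (intro continuous_intros linear_continuous_on)
qed (intro continuous_intros)

lemma trig_polynomials_bounded: "f \<in> trig_polynomials \<Longrightarrow> \<exists>B. \<forall>x. \<bar>f x\<bar> \<le> B"
proof (induction rule: trig_polynomials.induct)
  case (monomial l c \<phi>)
  have "\<bar>c * cos (l x + \<phi>)\<bar> \<le> \<bar>c\<bar> * 1" for x unfolding abs_mult by (intro mult_left_mono) auto
  then show ?case by blast
next
  case (add f g)
  then obtain A B where "\<And>x. \<bar>f x\<bar> \<le> A" "\<And>x. \<bar>g x\<bar> \<le> B" by blast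
  then have "\<bar>f x + g x\<bar> \<le> A + B" for x by (meson abs_triangle_ineq add_mono order_trans)
  then show ?case by blast
qed

lemma trig_polynomials_compose_polynomial:
  assumes "real_polynomial_function q" "g \<in> trig_polynomials"
  shows "(\<lambda>x. q (g x)) \<in> trig_polynomials"
  using assms(1)
proof induction
  case (linear f)
  have "f t = t * f 1" for t :: real
    using linear_cmul[OF bounded_linear.linear[OF linear], of t 1] by simp
  then have "(\<lambda>x. f (g x)) = (\<lambda>x. g x * f 1)" by metis
  then show ?case using trig_polynomials_mult[OF assms(2) trig_polynomials_const] by simp
next
  case (const c) show ?case by (rule trig_polynomials_const)
next
  case (add f g) then show ?case by (intro trig_polynomials.add)
next
  case (mult f g) then show ?case by (intro trig_polynomials_mult)
qed

lemma trig_polynomials_function_ring: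
  fixes G :: "'e::real_normed_vector set"
  assumes "compact G"
  shows "function_ring_on trig_polynomials G"
proof
  fix x y :: 'e assume "x \<noteq> y"
  then obtain l :: "'e \<Rightarrow> real" where l: "bounded_linear l" "l (x - y) \<noteq> 0"
    using separating_functional_exists[of "x - y"] by auto
  \<comment> \<open>Rescaling makes the phases at \<open>x\<close> and \<open>y\<close> differ by \<open>pi / 2\<close>.\<close>
  define t where "t = pi / (2 * l (x - y))"
  define l' where "l' w = t * l w" for w
  have l': "bounded_linear l'" unfolding l'_def using l(1) by (rule bounded_linear_const_mult)
  have "l' x - l' y = t * l (x - y)"
    unfolding l'_def linear_diff[OF bounded_linear.linear[OF l(1)]] by (rule right_diff_distrib[symmetric])
  then have "l' x - l' y = pi / 2" using l(2) unfolding t_def by simp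
  then have "l' x + (pi/2 - l' y) = pi" "l' y + (pi/2 - l' y) = pi/2" by simp_all
  then have "cos (l' x + (pi/2 - l' y)) \<noteq> cos (l' y + (pi/2 - l' y))" by (simp only: cos_pi cos_pi_half)
  then show "\<exists>f\<in>trig_polynomials. f x \<noteq> f y"
    using trig_polynomials.monomial[OF l', of 1 "pi/2 - l' y"] by (intro bexI) auto
qed (use assms in \<open>auto intro: trig_polynomials_continuous trig_polynomials.add trig_polynomials_mult
      trig_polynomials_const\<close>)

lemma (in borel_prob_on) trig_polynomials_integrable:
  assumes "f \<in> trig_polynomials" shows "integrable \<mu> f"
proof -
  obtain B where "\<And>x. \<bar>f x\<bar> \<le> B" using trig_polynomials_bounded[OF assms] by blast
  then show ?thesis
    using continuous_measurable[OF trig_polynomials_continuous[OF assms]]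
    by (intro integrable_const_bound[where B = B]) auto
qed

lemma trig_polynomials_integral_eq:
  assumes \<mu>: "borel_prob_on \<mu> E" and \<nu>: "borel_prob_on \<nu> E"
    and eq: "\<And>l. bounded_linear l \<Longrightarrow> (CLINT w|\<mu>. iexp (l w)) = (CLINT w|\<nu>. iexp (l w))"
    and f: "f \<in> trig_polynomials"
  shows "(\<integral>w. f w \<partial>\<mu>) = (\<integral>w. f w \<partial>\<nu>)"
  using f
proof induction
  case (monomial l c \<phi>)
  have *: "(\<integral>w. c * cos (l w + \<phi>) \<partial>\<nu>) = c * Re (exp (\<i> * \<phi>) * (CLINT w|\<nu>. iexp (l w)))"
    if "borel_prob_on \<nu> E" for \<nu>
  proof -
    interpret N: borel_prob_on \<nu> E by fact
    have "l \<in> \<nu> \<rightarrow>\<^sub>M borel"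
      using monomial by (intro N.continuous_measurable linear_continuous_on)
    then have int: "complex_integrable \<nu> (\<lambda>w. iexp (l w))"
      by (intro N.integrable_const_bound[where B = 1]) auto
    have "Re (exp (\<i> * \<phi>) * (CLINT w|\<nu>. iexp (l w))) = Re (CLINT w|\<nu>. exp (\<i> * \<phi>) * iexp (l w))"
      by simp
    also have "\<dots> = (\<integral>w. Re (exp (\<i> * \<phi>) * iexp (l w)) \<partial>\<nu>)"
      using int by (intro integral_Re[symmetric]) simp
    also have "(\<lambda>w. Re (exp (\<i> * \<phi>) * iexp (l w))) = (\<lambda>w. cos (l w + \<phi>))"
      by (auto simp flip: exp_add distrib_left of_real_add cis_conv_exp simp: add.commute cos_add)
    finally show ?thesis by simp
  qed
  show ?case unfolding *[OF \<mu>] *[OF \<nu>] eq[OF monomial] ..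
next
  case (add f g)
  then show ?case
    using borel_prob_on.trig_polynomials_integrable[OF \<mu>] borel_prob_on.trig_polynomials_integrable[OF \<nu>]
    by simp
qed

text \<open>The trigonometric polynomial that is close to \<open>f\<close> on a compact set may be large elsewhere.
  Composing it with a polynomial approximation of the truncation at height \<open>M\<close> cures this.\<close>

lemma bounded_trig_approx:
  fixes f :: "'e::real_normed_vector \<Rightarrow> real"
  assumes G: "compact G" and f: "continuous_on G f" "\<And>x. \<bar>f x\<bar> \<le> M" and e: "e > 0"
  obtains h where "h \<in> trig_polynomials" "\<And>x. x \<in> G \<Longrightarrow> \<bar>f x - h x\<bar> \<le> e" "\<And>x. \<bar>h x\<bar> \<le> M + e"
proof -
  interpret function_ring_on trig_polynomials G by (rule trig_polynomials_function_ring[OF G])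
  obtain g where g: "g \<in> trig_polynomials" "\<And>x. x \<in> G \<Longrightarrow> \<bar>f x - g x\<bar> < e/2"
    using Stone_Weierstrass_basic[OF f(1), of "e/2"] e by auto
  obtain B where B: "\<And>x. \<bar>g x\<bar> \<le> B" using trig_polynomials_bounded[OF g(1)] by blast
  define c where "c t = max (- M) (min M t)" for t :: real
  have M: "M \<ge> 0" using f(2)[of undefined] by linarith
  have "continuous_on {-B..B} c" unfolding c_def by (intro continuous_intros)
  then obtain q where q: "real_polynomial_function q" "\<And>t. t \<in> {-B..B} \<Longrightarrow> \<bar>c t - q t\<bar> < e/2"
    using Stone_Weierstrass_real_polynomial_function[of "{-B..B}" c "e/2"] e by auto
  have qg: "\<bar>c (g x) - q (g x)\<bar> < e/2" for x using q(2)[of "g x"] B[of x] by (simp add: abs_le_iff)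
  show ?thesis
  proof (rule that)
    show "(\<lambda>x. q (g x)) \<in> trig_polynomials" by (rule trig_polynomials_compose_polynomial[OF q(1) g(1)])
    show "\<bar>f x - q (g x)\<bar> \<le> e" if "x \<in> G" for x
    proof -
      have "\<bar>f x - c (g x)\<bar> \<le> \<bar>f x - g x\<bar>" using f(2)[of x] M unfolding c_def by (auto simp: abs_le_iff max_def min_def)
      then show ?thesis using g(2)[OF that] qg[of x] by linarith
    qed
    show "\<bar>q (g x)\<bar> \<le> M + e" for x
    proof -
      have "\<bar>c (g x)\<bar> \<le> M" unfolding c_def using M by auto
      then show ?thesis using qg[of x] e by linarith
    qed
  qed
qed

lemma (in borel_prob_on) integral_approx_on_large_set:
  fixes f h :: "'e \<Rightarrow> real"
  assumes f: "f \<in> borel_measurable \<mu>" "\<And>x. \<bar>f x\<bar> \<le> M" and h: "h \<in> borel_measurable \<mu>" "\<And>x. \<bar>h x\<bar> \<le> M + e"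
    and fh: "\<And>x. x \<in> G \<Longrightarrow> \<bar>f x - h x\<bar> \<le> e" and G: "closed G" "measure \<mu> (E - G) \<le> e" and e: "e \<ge> 0"
  shows "\<bar>(\<integral>x. f x \<partial>\<mu>) - (\<integral>x. h x \<partial>\<mu>)\<bar> \<le> e + (2 * M + e) * e"
proof -
  have M: "0 \<le> M" using f(2)[of undefined] by linarith
  have i: "integrable \<mu> f" "integrable \<mu> h"
    using f h by (auto intro: integrable_const_bound[where B = M] integrable_const_bound[where B = "M + e"])
  have m: "E - G \<in> sets \<mu>" using G(1) closed_E by (auto simp: sets_iff)
  have "\<bar>(\<integral>x. f x \<partial>\<mu>) - (\<integral>x. h x \<partial>\<mu>)\<bar> = \<bar>\<integral>x. f x - h x \<partial>\<mu>\<bar>" using i by simp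
  also have "\<dots> \<le> (\<integral>x. \<bar>f x - h x\<bar> \<partial>\<mu>)" by (rule integral_abs_bound)
  also have "\<dots> \<le> (\<integral>x. e + (2 * M + e) * indicator (E - G) x \<partial>\<mu>)"
  proof (rule integral_mono)
    show "integrable \<mu> (\<lambda>x. e + (2 * M + e) * indicator (E - G) x)"
      using m by (intro Bochner_Integration.integrable_add integrable_const integrable_mult_right
          integrable_real_indicator) (auto simp: emeasure_eq_measure)
    fix x assume "x \<in> space \<mu>"
    then show "\<bar>f x - h x\<bar> \<le> e + (2 * M + e) * indicator (E - G) x"
      using fh[of x] f(2)[of x] h(2)[of x] e by (cases "x \<in> G") (auto simp: space_eq)
  qed (use i in auto)
  also have "\<dots> = e + (2 * M + e) * measure \<mu> (E - G)"
    using m by (simp add: prob_space emeasure_eq_measure Bochner_Integration.integral_add)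
  also have "\<dots> \<le> e + (2 * M + e) * e" using G(2) M e by (intro add_left_mono mult_left_mono) auto
  finally show ?thesis .
qed

lemma bounded_continuous_integral_eq:
  fixes f :: "'e::banach \<Rightarrow> real"
  assumes \<mu>: "borel_prob_on \<mu> E" and \<nu>: "borel_prob_on \<nu> E"
    and eq: "\<And>l. bounded_linear l \<Longrightarrow> (CLINT w|\<mu>. iexp (l w)) = (CLINT w|\<nu>. iexp (l w))"
    and f: "continuous_on UNIV f" "\<And>x. \<bar>f x\<bar> \<le> M"
  shows "(\<integral>w. f w \<partial>\<mu>) = (\<integral>w. f w \<partial>\<nu>)"
proof -
  interpret M: borel_prob_on \<mu> E by fact
  interpret N: borel_prob_on \<nu> E by fact
  have b: "\<bar>(\<integral>w. f w \<partial>\<mu>) - (\<integral>w. f w \<partial>\<nu>)\<bar> \<le> 2 * (e + (2 * M + e) * e)" if e: "e > 0" for e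
  proof -
    obtain G1 where G1: "compact G1" "G1 \<subseteq> E" "measure \<mu> (E - G1) \<le> e" using M.tight[OF e] by blast
    obtain G2 where G2: "compact G2" "G2 \<subseteq> E" "measure \<nu> (E - G2) \<le> e" using N.tight[OF e] by blast
    define G where "G = G1 \<union> G2"
    have G: "compact G" "closed G" unfolding G_def using G1 G2 by (auto intro: compact_imp_closed)
    have "measure \<mu> (E - G) \<le> measure \<mu> (E - G1)"
      by (rule M.finite_measure_mono) (use compact_imp_closed[OF G1(1)] M.closed_E in \<open>auto simp: G_def M.sets_iff\<close>)
    then have mG: "measure \<mu> (E - G) \<le> e" using G1 by simp
    have "measure \<nu> (E - G) \<le> measure \<nu> (E - G2)"
      by (rule N.finite_measure_mono) (use compact_imp_closed[OF G2(1)] M.closed_E in \<open>auto simp: G_def N.sets_iff\<close>)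
    then have nG: "measure \<nu> (E - G) \<le> e" using G2 by simp
    obtain h where h: "h \<in> trig_polynomials" "\<And>x. x \<in> G \<Longrightarrow> \<bar>f x - h x\<bar> \<le> e" "\<And>x. \<bar>h x\<bar> \<le> M + e"
      using bounded_trig_approx[OF G(1) continuous_on_subset[OF f(1)] f(2) e] by auto
    have fm: "f \<in> borel_measurable borel" "h \<in> borel_measurable borel"
      using f(1) trig_polynomials_continuous[OF h(1)] borel_measurable_continuous_onI by blast+
    have "\<bar>(\<integral>w. f w \<partial>\<mu>) - (\<integral>w. h w \<partial>\<mu>)\<bar> \<le> e + (2 * M + e) * e"
      by (rule M.integral_approx_on_large_set[where G = G])
        (use f fm h G mG e in \<open>auto intro: M.measurable_from_borel\<close>)
    moreover have "\<bar>(\<integral>w. f w \<partial>\<nu>) - (\<integral>w. h w \<partial>\<nu>)\<bar> \<le> e + (2 * M + e) * e"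
      by (rule N.integral_approx_on_large_set[where G = G])
        (use f fm h G nG e in \<open>auto intro: N.measurable_from_borel\<close>)
    moreover have "(\<integral>w. h w \<partial>\<mu>) = (\<integral>w. h w \<partial>\<nu>)" by (rule trig_polynomials_integral_eq[OF \<mu> \<nu> eq h(1)])
    moreover have "\<bar>a - b\<bar> \<le> 2 * k" if "\<bar>a - c\<bar> \<le> k" "\<bar>b - d\<bar> \<le> k" "c = d" for a b c d k :: real
      using that by linarith
    ultimately show ?thesis by blast
  qed
  have "(\<lambda>n. 2 * (1 / real (Suc n) + (2 * M + 1 / real (Suc n)) * (1 / real (Suc n))))
      \<longlonglongrightarrow> 2 * (0 + (2 * M + 0) * 0)"
    by (intro tendsto_intros LIMSEQ_Suc[OF lim_1_over_n])
  then have "\<bar>(\<integral>w. f w \<partial>\<mu>) - (\<integral>w. f w \<partial>\<nu>)\<bar> \<le> 2 * (0 + (2 * M + 0) * 0)"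
    by (rule LIMSEQ_le_const) (intro exI[of _ 0] allI impI b, simp)
  then show ?thesis by simp
qed

lemma closed_measure_le_from_continuous:
  assumes \<mu>: "borel_prob_on \<mu> E" and \<nu>: "borel_prob_on \<nu> E"
    and eq: "\<And>f :: _ \<Rightarrow> real. continuous_on UNIV f \<Longrightarrow> (\<And>x. \<bar>f x\<bar> \<le> 1) \<Longrightarrow> (\<integral>w. f w \<partial>\<mu>) = (\<integral>w. f w \<partial>\<nu>)"
    and C: "closed C" "C \<subseteq> E"
  shows "measure \<mu> C \<le> measure \<nu> C"
proof (cases "C = {}")
  case False
  interpret M: borel_prob_on \<mu> E by fact
  interpret N: borel_prob_on \<nu> E by fact
  have Cs: "C \<in> sets \<mu>" "C \<in> sets \<nu>" using C by (auto simp: M.sets_iff N.sets_iff)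
  show ?thesis
  proof (rule field_le_epsilon)
    fix e :: real assume e: "e > 0"
    obtain \<kappa> where \<kappa>: "\<kappa> > 0"
      "\<And>k. 0 < k \<Longrightarrow> k \<le> \<kappa> \<Longrightarrow> measure \<nu> {w\<in>E. 0 < infdist w C \<and> infdist w C < k} < e"
      using N.punctured_neighbourhood_small[OF C(1) False e] by blast
    define A where "A = {w\<in>E. 0 < infdist w C \<and> infdist w C < \<kappa>}"
    \<comment> \<open>Squeezed between the indicators of \<open>C\<close> and of \<open>A \<union> C\<close>.\<close>
    define f where "f w = max 0 (1 - infdist w C / \<kappa>)" for w
    have fc: "continuous_on UNIV f" unfolding f_def using \<kappa>(1) by (intro continuous_intros) auto
    have fb: "\<bar>f w\<bar> \<le> 1" "0 \<le> f w" for w unfolding f_def using \<kappa>(1) infdist_nonneg[of w C] by auto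
    have fm: "f \<in> borel_measurable borel" using fc borel_measurable_continuous_onI by blast
    have fi: "integrable \<mu> f" "integrable \<nu> f"
      using fb M.measurable_from_borel[OF fm] N.measurable_from_borel[OF fm]
      by (auto intro!: M.integrable_const_bound[where B = 1] N.integrable_const_bound[where B = 1])
    have Am: "A \<in> sets \<nu>"
    proof -
      have "(\<lambda>w. infdist w C) \<in> borel_measurable \<nu>"
        by (intro N.continuous_measurable continuous_intros)
      then have "{w\<in>space \<nu>. 0 < infdist w C \<and> infdist w C < \<kappa>} \<in> sets \<nu>" by measurable
      then show ?thesis unfolding A_def N.space_eq .
    qed
    have "measure \<mu> C = (\<integral>w. indicator C w \<partial>\<mu>)" using Cs C by (simp add: M.space_eq inf.absorb1)
    also have "\<dots> \<le> (\<integral>w. f w \<partial>\<mu>)"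
    proof (rule integral_mono[OF _ fi(1)])
      show "integrable \<mu> (indicat_real C)"
        using Cs by (intro integrable_real_indicator) (auto simp: M.emeasure_eq_measure)
      show "indicat_real C w \<le> f w" for w using fb(2)[of w] by (auto simp: f_def indicator_def)
    qed
    also have "\<dots> = (\<integral>w. f w \<partial>\<nu>)" by (rule eq[OF fc fb(1)])
    also have "\<dots> \<le> (\<integral>w. indicator (C \<union> A) w \<partial>\<nu>)"
    proof (rule integral_mono[OF fi(2)])
      show "integrable \<nu> (indicat_real (C \<union> A))"
        using Cs Am by (intro integrable_real_indicator) (auto simp: N.emeasure_eq_measure)
      fix w assume "w \<in> space \<nu>"
      then have "w \<in> E" by (simp add: N.space_eq)
      then show "f w \<le> indicator (C \<union> A) w"
        using fb[of w] in_closed_iff_infdist_zero[OF C(1) False, of w] infdist_nonneg[of w C] \<kappa>(1)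
        by (auto simp: A_def f_def indicator_def field_simps)
    qed
    also have "\<dots> = measure \<nu> (C \<union> A)" using C by (simp add: N.space_eq A_def inf.absorb1)
    also have "\<dots> \<le> measure \<nu> C + measure \<nu> A" using Cs(2) Am by (rule measure_Un_le)
    finally show "measure \<mu> C \<le> measure \<nu> C + e" using \<kappa>(2)[OF \<kappa>(1) order_refl] unfolding A_def by simp
  qed
qed simp

lemma measure_le_from_closed:
  assumes \<mu>: "borel_prob_on \<mu> E" and \<nu>: "borel_prob_on \<nu> E"
    and ceq: "\<And>C. closed C \<Longrightarrow> C \<subseteq> E \<Longrightarrow> measure \<mu> C = measure \<nu> C"
    and A: "A \<in> sets \<mu>"
  shows "measure \<mu> A \<le> measure \<nu> A"
proof (rule field_le_epsilon)
  interpret M: borel_prob_on \<mu> E by fact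
  interpret N: borel_prob_on \<nu> E by fact
  fix e :: real assume "e > 0"
  then obtain C where C: "closed C" "C \<subseteq> A" "measure \<mu> (A - C) < e"
    using M.inner_regular_closed[OF A] by blast
  have AE: "A \<subseteq> E" "A \<in> sets \<nu>" using A by (auto simp: M.sets_iff N.sets_iff)
  have CE: "C \<subseteq> E" using C(2) AE by auto
  then have Cs: "C \<in> sets \<mu>" "C \<in> sets \<nu>" using C by (auto simp: M.sets_iff N.sets_iff)
  have "measure \<mu> A = measure \<mu> C + measure \<mu> (A - C)"
    using M.finite_measure_Diff[OF A Cs(1) C(2)] by simp
  also have "\<dots> \<le> measure \<nu> C + e" using ceq[OF C(1) CE] C(3) by simp
  also have "measure \<nu> C \<le> measure \<nu> A" using C AE by (intro N.finite_measure_mono) auto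
  finally show "measure \<mu> A \<le> measure \<nu> A + e" by simp
qed

text \<open>The integrals of trigonometric polynomials are linear combinations of values of the characteristic
  functional; they determine the integrals of bounded continuous functions, these the measures of
  closed sets, and inner regularity the rest.\<close>

theorem char_functional_unique:
  assumes \<mu>: "borel_prob_on \<mu> E" and \<nu>: "borel_prob_on \<nu> E"
    and eq: "\<And>l. bounded_linear l \<Longrightarrow> (CLINT w|\<mu>. iexp (l w)) = (CLINT w|\<nu>. iexp (l w))"
  shows "\<mu> = \<nu>"
proof -
  interpret M: borel_prob_on \<mu> E by fact
  interpret N: borel_prob_on \<nu> E by fact
  have ss: "sets \<mu> = sets \<nu>" using M.sets_eq N.sets_eq by simp
  have ceq: "measure \<mu> C = measure \<nu> C" if "closed C" "C \<subseteq> E" for C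
    using closed_measure_le_from_continuous[OF \<mu> \<nu> _ that]
      closed_measure_le_from_continuous[OF \<nu> \<mu> _ that]
      bounded_continuous_integral_eq[OF \<mu> \<nu> eq] by (intro antisym) metis+
  show ?thesis
  proof (rule measure_eqI[OF ss])
    fix A assume A: "A \<in> sets \<mu>"
    have "measure \<mu> A = measure \<nu> A"
      using measure_le_from_closed[OF \<mu> \<nu> ceq A] measure_le_from_closed[OF \<nu> \<mu> ceq[symmetric], of A] A ss by (intro antisym) auto
    then show "emeasure \<mu> A = emeasure \<nu> A" by (simp add: M.emeasure_eq_measure N.emeasure_eq_measure)
  qed
qed

section \<open>Translations of a Gaussian measure\<close>

lemma subspace_closure:
  fixes S :: "'a::real_normed_vector set"
  assumes "subspace S" shows "subspace (closure S)"
proof (rule subspaceI)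
  show "0 \<in> closure S" using subspace_0[OF assms] closure_subset by blast
next
  fix x y assume "x \<in> closure S" "y \<in> closure S"
  then obtain f g where fg: "\<And>n::nat. f n \<in> S" "f \<longlonglongrightarrow> x" "\<And>n::nat. g n \<in> S" "g \<longlonglongrightarrow> y"
    unfolding closure_sequential by blast
  then have "\<And>n. f n + g n \<in> S" "(\<lambda>n. f n + g n) \<longlonglongrightarrow> x + y"
    using subspace_add[OF assms] tendsto_add by blast+
  then show "x + y \<in> closure S" unfolding closure_sequential by (intro exI[of _ "\<lambda>n. f n + g n"]) simp
next
  fix c x assume "x \<in> closure S"
  then obtain f where f: "\<And>n::nat. f n \<in> S" "f \<longlonglongrightarrow> x" unfolding closure_sequential by blast
  then have "\<And>n. c *\<^sub>R f n \<in> S" "(\<lambda>n. c *\<^sub>R f n) \<longlonglongrightarrow> c *\<^sub>R x"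
    using subspace_scale[OF assms] tendsto_scaleR[OF tendsto_const] by blast+
  then show "c *\<^sub>R x \<in> closure S" unfolding closure_sequential by (intro exI[of _ "\<lambda>n. c *\<^sub>R f n"]) simp
qed

lemma (in borel_prob_on) measurable_into:
  assumes "f \<in> N \<rightarrow>\<^sub>M borel" "\<And>x. x \<in> space N \<Longrightarrow> f x \<in> E"
  shows "f \<in> N \<rightarrow>\<^sub>M \<mu>"
  using measurable_restrict_space2[of f N E borel] assms measurable_cong_sets[OF refl sets_eq] by blast

text \<open>Addition is measurable although the ambient space need not be second countable: the first
  summand is a limit of countably valued maps with values in a dense sequence of \<open>E\<close>.\<close>

lemma (in borel_prob_on) measurable_add:
  fixes f g :: "'b \<Rightarrow> 'e"
  assumes f: "f \<in> N \<rightarrow>\<^sub>M \<mu>" and g: "g \<in> N \<rightarrow>\<^sub>M \<mu>" and E: "subspace E"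
  shows "(\<lambda>x. f x + g x) \<in> N \<rightarrow>\<^sub>M \<mu>"
proof (rule measurable_into)
  obtain d :: "nat \<Rightarrow> 'e" where d: "range d \<subseteq> E" "\<And>x e. x \<in> E \<Longrightarrow> e > 0 \<Longrightarrow> \<exists>n. dist (d n) x < e"
    using dense_sequence by blast
  define i where "i n x = (LEAST k. dist (d k) (f x) < 1 / real (Suc n))" for n x
  have fE: "f x \<in> E" "g x \<in> E" if "x \<in> space N" for x
    using measurable_space[OF f that] measurable_space[OF g that] by (auto simp: space_eq)
  have i: "dist (d (i n x)) (f x) < 1 / real (Suc n)" if "x \<in> space N" for n x
    unfolding i_def by (rule LeastI_ex) (use d(2)[OF fE(1)[OF that]] in auto)
  have di: "(\<lambda>x. dist (d k) (f x)) \<in> borel_measurable N" for k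
    by (rule measurable_compose[OF f]) (intro continuous_measurable continuous_intros)
  have im: "i n \<in> N \<rightarrow>\<^sub>M count_space UNIV" for n
    unfolding i_def using di by measurable
  show "(\<lambda>x. f x + g x) \<in> borel_measurable N"
  proof (rule borel_measurable_LIMSEQ_metric)
    fix n
    have "(\<lambda>x. d k + g x) \<in> borel_measurable N" for k
      by (rule measurable_compose[OF g]) (intro continuous_measurable continuous_intros)
    then show "(\<lambda>x. d (i n x) + g x) \<in> borel_measurable N"
      by (rule measurable_compose_countable[of "\<lambda>k x. d k + g x", OF _ im])
  next
    fix x assume x: "x \<in> space N"
    have "(\<lambda>n. d (i n x)) \<longlonglongrightarrow> f x"
      unfolding tendsto_iff
    proof (intro allI impI)
      fix e :: real assume "e > 0"
      then have "\<forall>\<^sub>F n in sequentially. 1 / real (Suc n) < e"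
        using order_tendstoD(2)[OF LIMSEQ_Suc[OF lim_1_over_n]] by auto
      then show "\<forall>\<^sub>F n in sequentially. dist (d (i n x)) (f x) < e"
        by eventually_elim (use i[OF x] in \<open>auto intro: order_less_trans\<close>)
    qed
    then show "(\<lambda>n. d (i n x) + g x) \<longlonglongrightarrow> f x + g x" by (intro tendsto_intros)
  qed
  show "f x + g x \<in> E" if "x \<in> space N" for x using fE[OF that] E by (simp add: subspace_add)
qed

lemma bounded_linear_onI:
  assumes "bounded_linear l" shows "bounded_linear_on X l"
proof -
  obtain K where "\<And>x. norm (l x) \<le> norm x * K" using bounded_linear.bounded[OF assms] by blast
  then show ?thesis
    using linear_add[OF bounded_linear.linear[OF assms]] linear_cmul[OF bounded_linear.linear[OF assms]]
    unfolding bounded_linear_on_def by (metis mult.commute)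
qed

lemma bounded_linear_on_diff:
  assumes "bounded_linear_on X f" "x \<in> X" "y \<in> X" "subspace X"
  shows "f (x - y) = f x - f y"
proof -
  have "f (x + (-1) *\<^sub>R y) = f x + f ((-1) *\<^sub>R y)" "f ((-1) *\<^sub>R y) = (-1) *\<^sub>R f y"
    using assms subspace_scale[OF assms(4,3), of "-1"] unfolding bounded_linear_on_def by blast+
  then show ?thesis by simp
qed

lemma bounded_linear_on_continuous:
  assumes f: "bounded_linear_on X f" "subspace X" shows "continuous_on X f"
proof -
  obtain B where B: "\<And>x. x \<in> X \<Longrightarrow> norm (f x) \<le> B * norm x" using f(1) unfolding bounded_linear_on_def by blast
  have "\<bar>B\<bar>-lipschitz_on X f"
  proof (rule lipschitz_onI)
    fix x y assume xy: "x \<in> X" "y \<in> X"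
    have "norm (f x - f y) = norm (f (x - y))" using bounded_linear_on_diff[OF f(1) xy f(2)] by simp
    also have "\<dots> \<le> B * norm (x - y)" using B subspace_diff[OF f(2) xy] by blast
    also have "\<dots> \<le> \<bar>B\<bar> * norm (x - y)" by (intro mult_right_mono) auto
    finally show "dist (f x) (f y) \<le> \<bar>B\<bar> * dist x y" by (simp add: dist_norm)
  qed simp
  then show ?thesis by (rule lipschitz_on_continuous_on)
qed

lemma dual_on_lincomb:
  assumes "l \<in> dual_on E" "m \<in> dual_on E" shows "(\<lambda>x. l x + c * m x) \<in> dual_on E"
proof -
  obtain A B where AB: "\<And>x. x \<in> E \<Longrightarrow> norm (l x) \<le> A * norm x" "\<And>x. x \<in> E \<Longrightarrow> norm (m x) \<le> B * norm x"
    using assms unfolding dual_on_def bounded_linear_on_def by blast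
  have "norm (l x + c * m x) \<le> (A + \<bar>c\<bar> * B) * norm x" if "x \<in> E" for x
  proof -
    have "norm (l x + c * m x) \<le> norm (l x) + \<bar>c\<bar> * norm (m x)"
      using norm_triangle_ineq[of "l x" "c * m x"] by (simp add: abs_mult)
    also have "\<dots> \<le> A * norm x + \<bar>c\<bar> * (B * norm x)"
      by (intro add_mono mult_left_mono AB that) simp
    finally show ?thesis by (simp add: algebra_simps)
  qed
  then have "\<exists>B. \<forall>x\<in>E. norm (l x + c * m x) \<le> B * norm x" by blast
  moreover have "\<forall>x\<in>E. \<forall>y\<in>E. l (x + y) + c * m (x + y) = (l x + c * m x) + (l y + c * m y)"
    "\<forall>a. \<forall>x\<in>E. l (a *\<^sub>R x) + c * m (a *\<^sub>R x) = a *\<^sub>R (l x + c * m x)"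
    using assms unfolding dual_on_def bounded_linear_on_def by (auto simp: algebra_simps)
  ultimately show ?thesis unfolding dual_on_def bounded_linear_on_def by blast
qed

lemma dual_on_zero: "(\<lambda>_. 0) \<in> dual_on E"
  unfolding dual_on_def bounded_linear_on_def by (auto intro: exI[of _ 0])

lemma is_adjoint_image_lincomb:
  assumes "is_adjoint_image HW \<iota> l h" "is_adjoint_image HW \<iota> m k" "subspace HW"
  shows "is_adjoint_image HW \<iota> (\<lambda>x. l x + c * m x) (h + c *\<^sub>R k)"
  using assms unfolding is_adjoint_image_def
  by (auto simp: inner_add_left subspace_add subspace_scale)

lemma is_adjoint_image_unique:
  assumes h: "is_adjoint_image HW \<iota> l h" "is_adjoint_image HW \<iota> l k" and HW: "subspace HW"
  shows "h = k"
proof -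
  have "h - k \<in> HW" using h HW by (simp add: is_adjoint_image_def subspace_diff)
  then have "inner h (h - k) = inner k (h - k)" using h unfolding is_adjoint_image_def by simp
  then have "inner (h - k) (h - k) = 0" by (simp add: inner_diff_left)
  then show ?thesis by simp
qed

locale wiener_space =
  fixes E :: "'e::banach set" and HW :: "'w::{real_inner, banach} set" and \<iota> :: "'w \<Rightarrow> 'e"
    and \<gamma> :: "'e measure"
  assumes wiener: "abstract_wiener_space E HW \<iota> \<gamma>"
begin

lemma subspaces: "subspace E" "subspace HW" "closed HW"
  and \<iota>_bounded_linear: "bounded_linear_on HW \<iota>" and \<iota>_inj: "inj_on \<iota> HW"
  and \<iota>_range: "k \<in> HW \<Longrightarrow> \<iota> k \<in> E" and \<iota>_dense: "E \<subseteq> closure (\<iota> ` HW)"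
  using wiener unfolding abstract_wiener_space_def by auto

sublocale borel_prob_on \<gamma> E
proof -
  interpret prob_space \<gamma> using wiener unfolding abstract_wiener_space_def by blast
  show "borel_prob_on \<gamma> E" by unfold_locales (use wiener in \<open>auto simp: abstract_wiener_space_def\<close>)
qed

lemma \<iota>_scale: "k \<in> HW \<Longrightarrow> \<iota> (c *\<^sub>R k) = c *\<^sub>R \<iota> k"
  using \<iota>_bounded_linear unfolding bounded_linear_on_def by blast

lemma \<iota>_zero: "\<iota> 0 = 0"
  using \<iota>_scale[OF subspace_0[OF subspaces(2)], of 0] by simp

lemma char_functional:
  assumes "l \<in> dual_on E" "is_adjoint_image HW \<iota> l h"
  shows "(CLINT w|\<gamma>. iexp (l w)) = complex_of_real (exp (- (norm h)\<^sup>2 / 2))"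
proof -
  obtain k where "is_adjoint_image HW \<iota> l k" "(CLINT w|\<gamma>. iexp (l w)) = complex_of_real (exp (- (norm k)\<^sup>2 / 2))"
    using wiener assms(1) unfolding abstract_wiener_space_def by blast
  then show ?thesis using is_adjoint_image_unique[OF assms(2) _ subspaces(2)] by blast
qed

lemma adjoint_exists:
  assumes "l \<in> dual_on E" obtains h where "is_adjoint_image HW \<iota> l h"
  using wiener assms unfolding abstract_wiener_space_def by blast

lemma dual_on_measurable: "l \<in> dual_on E \<Longrightarrow> l \<in> borel_measurable \<gamma>"
  unfolding dual_on_def by (auto intro!: continuous_measurable bounded_linear_on_continuous subspaces)

lemma bounded_linear_in_dual_on: "bounded_linear l \<Longrightarrow> l \<in> dual_on E"
  unfolding dual_on_def by (simp add: bounded_linear_onI)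

lemma dual_on_affine:
  assumes "l \<in> dual_on E" "w \<in> E" "e \<in> E" shows "l (w + c *\<^sub>R e) = l w + c * l e"
  using assms subspace_scale[OF subspaces(1)] unfolding dual_on_def bounded_linear_on_def by auto

lemma subspace_adjoint_range: "subspace (adjoint_range E HW \<iota>)"
proof (rule subspaceI)
  show "0 \<in> adjoint_range E HW \<iota>" unfolding adjoint_range_def is_adjoint_image_def
    using dual_on_zero subspace_0[OF subspaces(2)] by force
next
  fix h k assume "h \<in> adjoint_range E HW \<iota>" "k \<in> adjoint_range E HW \<iota>"
  then obtain l m where "l \<in> dual_on E" "is_adjoint_image HW \<iota> l h" "m \<in> dual_on E" "is_adjoint_image HW \<iota> m k"
    unfolding adjoint_range_def by blast
  then show "h + k \<in> adjoint_range E HW \<iota>"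
    using dual_on_lincomb[of l E m 1] is_adjoint_image_lincomb[of HW \<iota> l h m k 1, OF _ _ subspaces(2)]
    unfolding adjoint_range_def by auto
next
  fix c h assume "h \<in> adjoint_range E HW \<iota>"
  then obtain l where l: "l \<in> dual_on E" "is_adjoint_image HW \<iota> l h" unfolding adjoint_range_def by blast
  have "is_adjoint_image HW \<iota> (\<lambda>_. 0) 0" unfolding is_adjoint_image_def using subspace_0[OF subspaces(2)] by simp
  from is_adjoint_image_lincomb[OF this l(2) subspaces(2), of c] dual_on_lincomb[OF dual_on_zero l(1), of c]
  show "c *\<^sub>R h \<in> adjoint_range E HW \<iota>" unfolding adjoint_range_def by auto
qed

text \<open>If a vector is orthogonal to the range of \<open>\<iota>\<^sup>*\<close>, all bounded functionals annihilate its image under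
  \<open>\<iota>\<close>, which is therefore zero.\<close>

lemma adjoint_range_dense: "HW \<subseteq> closure (adjoint_range E HW \<iota>)"
proof
  fix k assume k: "k \<in> HW"
  have sub: "closure (adjoint_range E HW \<iota>) \<subseteq> HW"
    by (rule closure_minimal[OF _ subspaces(3)]) (auto simp: adjoint_range_def is_adjoint_image_def)
  obtain y where y: "y \<in> closure (adjoint_range E HW \<iota>)"
    "\<And>z. z \<in> closure (adjoint_range E HW \<iota>) \<Longrightarrow> inner (k - y) z = 0"
    using orthogonal_projection_exists[OF subspace_closure[OF subspace_adjoint_range] closed_closure] by blast
  define u where "u = k - y"
  have u: "u \<in> HW" unfolding u_def using k y(1) sub subspaces(2) by (blast intro: subspace_diff)
  have "l (\<iota> u) = 0" if l: "bounded_linear l" for l :: "'e \<Rightarrow> real"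
  proof -
    obtain h where h: "is_adjoint_image HW \<iota> l h" using adjoint_exists[OF bounded_linear_in_dual_on[OF l]] by blast
    then have "h \<in> adjoint_range E HW \<iota>" using bounded_linear_in_dual_on[OF l] unfolding adjoint_range_def by blast
    then have "inner u h = 0" using y(2) closure_subset unfolding u_def by blast
    then show ?thesis using h u unfolding is_adjoint_image_def by (simp add: inner_commute)
  qed
  then have "\<iota> u = 0" using separating_functional_exists[of "\<iota> u"] by metis
  then have "u = 0" using \<iota>_inj u subspace_0[OF subspaces(2)] \<iota>_zero by (metis inj_onD)
  then show "k \<in> closure (adjoint_range E HW \<iota>)" using y(1) unfolding u_def by simp
qed

end

text \<open>A functional \<open>l = \<langle>h, \<cdot>\<rangle>\<close> on the Wiener space together with its representer \<open>h\<close>.\<close>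

locale wiener_functional = wiener_space E HW \<iota> \<gamma>
  for E :: "'e::banach set" and HW :: "'w::{real_inner, banach} set" and \<iota> and \<gamma> +
  fixes l :: "'e \<Rightarrow> real" and h :: 'w
  assumes l_dual: "l \<in> dual_on E" and l_adj: "is_adjoint_image HW \<iota> l h"
begin

lemma h_in: "h \<in> HW" and \<iota>h_in: "\<iota> h \<in> E" and l_\<iota>h: "l (\<iota> h) = (norm h)\<^sup>2"
  using l_adj \<iota>_range unfolding is_adjoint_image_def by (auto simp: power2_norm_eq_inner)

lemma l_measurable[measurable]: "l \<in> borel_measurable \<gamma>" by (rule dual_on_measurable[OF l_dual])

lemma l_shift: "w \<in> E \<Longrightarrow> l (w + c *\<^sub>R \<iota> h) = l w + c * (norm h)\<^sup>2"
  using dual_on_affine[OF l_dual _ \<iota>h_in] l_\<iota>h by simp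

lemma shift_measurable:
  assumes "f \<in> N \<rightarrow>\<^sub>M \<gamma>" "a \<in> borel_measurable N"
  shows "(\<lambda>x. f x + a x *\<^sub>R \<iota> h) \<in> N \<rightarrow>\<^sub>M \<gamma>"
proof (rule measurable_add[OF assms(1) _ subspaces(1)])
  have "(\<lambda>c. c *\<^sub>R \<iota> h) \<in> borel \<rightarrow>\<^sub>M borel" by (intro borel_measurable_continuous_onI continuous_intros)
  then show "(\<lambda>x. a x *\<^sub>R \<iota> h) \<in> N \<rightarrow>\<^sub>M \<gamma>"
    using assms(2) \<iota>h_in subspaces(1) by (intro measurable_into) (auto intro: subspace_scale measurable_compose)
qed

text \<open>Replacing the component of \<open>w\<close> along \<open>\<iota> h\<close> by an independent standard normal amount.\<close>

definition resample :: "'e \<times> real \<Rightarrow> 'e" where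
  "resample = (\<lambda>(w, s). w + (s / norm h - l w / (norm h)\<^sup>2) *\<^sub>R \<iota> h)"

lemma resample_measurable: "resample \<in> \<gamma> \<Otimes>\<^sub>M borel \<rightarrow>\<^sub>M \<gamma>"
proof -
  have "(\<lambda>x. fst x + (snd x / norm h - l (fst x) / (norm h)\<^sup>2) *\<^sub>R \<iota> h) \<in> \<gamma> \<Otimes>\<^sub>M borel \<rightarrow>\<^sub>M \<gamma>"
    by (rule shift_measurable) measurable
  then show ?thesis unfolding resample_def by (simp add: case_prod_beta')
qed

lemma resample_shift:
  assumes "h \<noteq> 0" shows "resample (w, s) + \<iota> h = resample (w, s + norm h)"
  using assms unfolding resample_def by (simp add: add_divide_distrib algebra_simps)

lemma l_resample:
  assumes "h \<noteq> 0" "w \<in> E" shows "l (resample (w, s)) = s * norm h"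
  using assms by (simp add: resample_def l_shift field_simps power2_eq_square)

text \<open>Both sides have the same characteristic functional: resampling removes from \<open>\<iota>\<^sup>* m\<close> its
  component along \<open>h\<close> and the normal variable puts it back.\<close>

lemma resample_distr:
  assumes h0: "h \<noteq> 0"
  shows "distr (\<gamma> \<Otimes>\<^sub>M std_normal_distribution) \<gamma> resample = \<gamma>"
proof (rule char_functional_unique)
  interpret N: prob_space std_normal_distribution using prob_space_normal_density by simp
  interpret P: pair_prob_space \<gamma> std_normal_distribution ..
  have rm: "resample \<in> \<gamma> \<Otimes>\<^sub>M std_normal_distribution \<rightarrow>\<^sub>M \<gamma>"
    using resample_measurable measurable_cong_sets[OF sets_pair_measure_cong[OF refl] refl] by fastforce
  show "borel_prob_on (distr (\<gamma> \<Otimes>\<^sub>M std_normal_distribution) \<gamma> resample) E"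
  proof -
    interpret R: prob_space "distr (\<gamma> \<Otimes>\<^sub>M std_normal_distribution) \<gamma> resample"
      by (rule P.prob_space_distr[OF rm])
    show ?thesis by unfold_locales (simp_all add: closed_E separable_E sets_eq)
  qed
  show "borel_prob_on \<gamma> E" by unfold_locales
  fix m :: "'e \<Rightarrow> real" assume m: "bounded_linear m"
  then have md: "m \<in> dual_on E" by (rule bounded_linear_in_dual_on)
  then obtain k where k: "is_adjoint_image HW \<iota> m k" using adjoint_exists by blast
  define a where "a = inner k h"
  have m\<iota>h: "m (\<iota> h) = a" using k h_in unfolding is_adjoint_image_def a_def by simp
  define m' where "m' = (\<lambda>w. m w + (- (a / (norm h)\<^sup>2)) * l w)"
  define k' where "k' = k + (- (a / (norm h)\<^sup>2)) *\<^sub>R h"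
  have m'd: "m' \<in> dual_on E" unfolding m'_def by (rule dual_on_lincomb[OF md l_dual])
  have k': "is_adjoint_image HW \<iota> m' k'" unfolding m'_def k'_def
    by (rule is_adjoint_image_lincomb[OF k l_adj subspaces(2)])
  have nk': "(norm k')\<^sup>2 = (norm k)\<^sup>2 - (a / norm h)\<^sup>2"
  proof -
    have "(norm k')\<^sup>2 = (norm k)\<^sup>2 - 2 * (a / (norm h)\<^sup>2) * a + (a / (norm h)\<^sup>2)\<^sup>2 * (norm h)\<^sup>2"
      unfolding k'_def power2_norm_eq_inner a_def
      by (simp add: inner_add_left inner_add_right inner_commute power2_eq_square algebra_simps)
    also have "\<dots> = (norm k)\<^sup>2 - (a / norm h)\<^sup>2" using h0 by (simp add: field_simps power2_eq_square)
    finally show ?thesis .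
  qed
  have mres: "m (resample (w, s)) = m' w + s * (a / norm h)" if "w \<in> E" for w s
    unfolding resample_def prod.case dual_on_affine[OF md that \<iota>h_in] m'_def m\<iota>h
    by (simp add: algebra_simps)
  have mm: "(\<lambda>w. m w) \<in> borel_measurable \<gamma>" by (rule dual_on_measurable[OF md])
  have m'm[measurable]: "m' \<in> borel_measurable \<gamma>" by (rule dual_on_measurable[OF m'd])
  have "(CLINT w|distr (\<gamma> \<Otimes>\<^sub>M std_normal_distribution) \<gamma> resample. iexp (m w))
      = (CLINT p|\<gamma> \<Otimes>\<^sub>M std_normal_distribution. iexp (m (resample p)))"
    using mm by (subst integral_distr[OF rm]) auto
  also have "\<dots> = (CLINT p|\<gamma> \<Otimes>\<^sub>M std_normal_distribution. iexp (m' (fst p)) * iexp (snd p * (a / norm h)))"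
    by (rule Bochner_Integration.integral_cong[OF refl])
      (auto simp: space_pair_measure space_eq mres exp_add[symmetric] distrib_left)
  also have "\<dots> = (CLINT w|\<gamma>. CLINT s|std_normal_distribution. iexp (m' w) * iexp (s * (a / norm h)))"
  proof -
    have int: "complex_integrable (\<gamma> \<Otimes>\<^sub>M std_normal_distribution)
        (\<lambda>p. iexp (m' (fst p)) * iexp (snd p * (a / norm h)))"
    proof (rule P.integrable_const_bound[where B = 1])
      show "(\<lambda>p. iexp (m' (fst p)) * iexp (snd p * (a / norm h)))
          \<in> borel_measurable (\<gamma> \<Otimes>\<^sub>M std_normal_distribution)" by measurable
    qed (simp add: norm_mult)
    show ?thesis using P.integral_fst'[OF int] by simp
  qed
  also have "\<dots> = (CLINT w|\<gamma>. iexp (m' w) * char std_normal_distribution (a / norm h))"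
    unfolding char_def by (simp add: mult.commute)
  also have "\<dots> = (CLINT w|\<gamma>. iexp (m' w)) * char std_normal_distribution (a / norm h)" by simp
  also have "\<dots> = complex_of_real (exp (- (norm k')\<^sup>2 / 2)) * complex_of_real (exp (- (a / norm h)\<^sup>2 / 2))"
    unfolding char_functional[OF m'd k'] char_std_normal_distribution ..
  also have "\<dots> = complex_of_real (exp (- (norm k)\<^sup>2 / 2))"
    unfolding of_real_mult[symmetric] exp_add[symmetric] nk' by (simp add: diff_divide_distrib)
  also have "\<dots> = (CLINT w|\<gamma>. iexp (m w))" unfolding char_functional[OF md k] ..
  finally show "(CLINT w|distr (\<gamma> \<Otimes>\<^sub>M std_normal_distribution) \<gamma> resample. iexp (m w)) = (CLINT w|\<gamma>. iexp (m w))" .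
qed

definition cm_density :: "'e \<Rightarrow> real" where
  "cm_density w = exp (l w - (norm h)\<^sup>2 / 2)"

lemma cm_density_measurable[measurable]: "cm_density \<in> borel_measurable \<gamma>"
  unfolding cm_density_def by measurable

lemma cm_density_nonneg: "0 \<le> cm_density w" unfolding cm_density_def by simp

text \<open>The functional vanishes on the range of \<open>\<iota>\<close>, which is dense in \<open>E\<close>.\<close>

lemma l_zero_if_h_zero:
  assumes "h = 0" "w \<in> E" shows "l w = 0"
proof -
  have z: "\<And>k. k \<in> HW \<Longrightarrow> l (\<iota> k) = 0" using l_adj assms(1) unfolding is_adjoint_image_def by simp
  have "w \<in> closure (\<iota> ` HW)" using assms(2) \<iota>_dense by blast
  then obtain f where f: "\<And>n::nat. f n \<in> \<iota> ` HW" "f \<longlonglongrightarrow> w" unfolding closure_sequential by blast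
  have "continuous_on E l" using l_dual subspaces(1) unfolding dual_on_def by (auto intro: bounded_linear_on_continuous)
  moreover have "f n \<in> E" for n
  proof -
    obtain k where "k \<in> HW" "f n = \<iota> k" using f(1)[of n] by blast
    then show ?thesis using \<iota>_range by simp
  qed
  ultimately have "(\<lambda>n. l (f n)) \<longlonglongrightarrow> l w"
    using f(2) assms(2) unfolding continuous_on_sequentially comp_def by blast
  moreover have "l (f n) = 0" for n
  proof -
    obtain k where "k \<in> HW" "f n = \<iota> k" using f(1)[of n] by blast
    then show ?thesis using z by simp
  qed
  then have "(\<lambda>n. l (f n)) = (\<lambda>_. 0)" by simp
  ultimately show ?thesis using LIMSEQ_unique tendsto_const by metis
qed

lemma cm_density_eq_1_if_h_zero:
  assumes "h = 0" "w \<in> E" shows "cm_density w = 1"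
  unfolding cm_density_def l_zero_if_h_zero[OF assms] using assms(1) by simp

text \<open>After resampling, the shift by \<open>\<iota> h\<close> is a translation of the standard normal variable by \<open>norm h\<close>,
  and \<open>cm_density\<close> is the ratio of the two normal densities.\<close>

theorem Cameron_Martin:
  assumes F: "F \<in> borel_measurable \<gamma>"
  shows "(\<integral>\<^sup>+w. F (w + \<iota> h) \<partial>\<gamma>) = (\<integral>\<^sup>+w. F w * ennreal (cm_density w) \<partial>\<gamma>)"
proof (cases "h = 0")
  case True
  show ?thesis
  proof (rule nn_integral_cong)
    fix w assume "w \<in> space \<gamma>"
    then have 1: "cm_density w = 1" by (intro cm_density_eq_1_if_h_zero True) (simp add: space_eq)
    have 2: "w + \<iota> h = w" using True \<iota>_zero by simp
    show "F (w + \<iota> h) = F w * ennreal (cm_density w)" unfolding 1 2 by simp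
  qed
next
  case False
  interpret N: prob_space std_normal_distribution using prob_space_normal_density by simp
  interpret P: pair_prob_space \<gamma> std_normal_distribution ..
  have rm: "resample \<in> \<gamma> \<Otimes>\<^sub>M std_normal_distribution \<rightarrow>\<^sub>M \<gamma>"
    using resample_measurable measurable_cong_sets[OF sets_pair_measure_cong[OF refl] refl] by fastforce
  have shift: "(\<lambda>w. w + \<iota> h) \<in> \<gamma> \<rightarrow>\<^sub>M \<gamma>" using shift_measurable[of "\<lambda>w. w" \<gamma> "\<lambda>_. 1"] by simp
  have via: "(\<integral>\<^sup>+w. G w \<partial>\<gamma>) = (\<integral>\<^sup>+w. \<integral>\<^sup>+s. G (resample (w, s)) * ennreal (std_normal_density s) \<partial>lborel \<partial>\<gamma>)"
    if G: "G \<in> borel_measurable \<gamma>" for G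
  proof -
    have "(\<integral>\<^sup>+w. G w \<partial>\<gamma>) = (\<integral>\<^sup>+w. G w \<partial>distr (\<gamma> \<Otimes>\<^sub>M std_normal_distribution) \<gamma> resample)"
      by (simp only: resample_distr[OF False])
    also have "\<dots> = (\<integral>\<^sup>+p. G (resample p) \<partial>(\<gamma> \<Otimes>\<^sub>M std_normal_distribution))"
      by (rule nn_integral_distr[OF rm]) (use G in simp)
    also have "\<dots> = (\<integral>\<^sup>+w. \<integral>\<^sup>+s. G (resample (w, s)) \<partial>std_normal_distribution \<partial>\<gamma>)"
      by (rule N.nn_integral_fst[symmetric]) (rule measurable_compose[OF rm G])
    also have "\<dots> = (\<integral>\<^sup>+w. \<integral>\<^sup>+s. G (resample (w, s)) * ennreal (std_normal_density s) \<partial>lborel \<partial>\<gamma>)"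
    proof (rule nn_integral_cong)
      fix w assume "w \<in> space \<gamma>"
      then have "(\<lambda>s. G (resample (w, s))) \<in> borel_measurable borel"
        using measurable_compose[OF measurable_compose[OF measurable_Pair1' resample_measurable] G] by simp
      then show "(\<integral>\<^sup>+s. G (resample (w, s)) \<partial>std_normal_distribution)
          = (\<integral>\<^sup>+s. G (resample (w, s)) * ennreal (std_normal_density s) \<partial>lborel)"
        by (subst nn_integral_density) (auto simp: mult.commute)
    qed
    finally show ?thesis .
  qed
  have "(\<integral>\<^sup>+w. F (w + \<iota> h) \<partial>\<gamma>)
      = (\<integral>\<^sup>+w. \<integral>\<^sup>+s. F (resample (w, s + norm h)) * ennreal (std_normal_density s) \<partial>lborel \<partial>\<gamma>)"
    by (subst via) (auto intro: measurable_compose[OF shift F] simp: resample_shift[OF False])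
  also have "\<dots> = (\<integral>\<^sup>+w. \<integral>\<^sup>+s. F (resample (w, s)) * ennreal (std_normal_density (s - norm h)) \<partial>lborel \<partial>\<gamma>)"
  proof (rule nn_integral_cong)
    fix w assume "w \<in> space \<gamma>"
    then have [measurable]: "(\<lambda>s. F (resample (w, s))) \<in> borel_measurable borel"
      using measurable_compose[OF measurable_compose[OF measurable_Pair1' resample_measurable] F] by simp
    show "(\<integral>\<^sup>+s. F (resample (w, s + norm h)) * ennreal (std_normal_density s) \<partial>lborel)
        = (\<integral>\<^sup>+s. F (resample (w, s)) * ennreal (std_normal_density (s - norm h)) \<partial>lborel)"
      by (subst (2) nn_integral_real_affine[where c = 1 and t = "norm h"]) (simp_all add: add.commute)
  qed
  also have "\<dots> = (\<integral>\<^sup>+w. \<integral>\<^sup>+s. (F (resample (w, s)) * ennreal (cm_density (resample (w, s))))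
      * ennreal (std_normal_density s) \<partial>lborel \<partial>\<gamma>)"
  proof (intro nn_integral_cong)
    fix w s assume "w \<in> space \<gamma>"
    then have w: "w \<in> E" by (simp add: space_eq)
    have "std_normal_density (s - norm h) = cm_density (resample (w, s)) * std_normal_density s"
    proof -
      have "exp (- (s - norm h)\<^sup>2 / 2) = exp (s * norm h - (norm h)\<^sup>2 / 2) * exp (- s\<^sup>2 / 2)"
        unfolding exp_add[symmetric] by (simp add: power2_eq_square field_simps)
      then show ?thesis unfolding cm_density_def l_resample[OF False w] normal_density_def by simp
    qed
    then show "F (resample (w, s)) * ennreal (std_normal_density (s - norm h))
        = F (resample (w, s)) * ennreal (cm_density (resample (w, s))) * ennreal (std_normal_density s)"
      by (simp add: ennreal_mult cm_density_nonneg mult.assoc)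
  qed
  also have "\<dots> = (\<integral>\<^sup>+w. F w * ennreal (cm_density w) \<partial>\<gamma>)"
    by (rule via[symmetric]) (use F in measurable)
  finally show ?thesis .
qed

lemma cm_density_integral: "(\<integral>\<^sup>+w. ennreal (cm_density w) \<partial>\<gamma>) = 1"
  using Cameron_Martin[of "\<lambda>_. 1"] by (simp add: emeasure_space_1)

lemma cm_density_sq_integral: "(\<integral>\<^sup>+w. ennreal ((cm_density w)\<^sup>2) \<partial>\<gamma>) = ennreal (exp ((norm h)\<^sup>2))"
proof -
  have "(\<integral>\<^sup>+w. ennreal ((cm_density w)\<^sup>2) \<partial>\<gamma>) = (\<integral>\<^sup>+w. ennreal (cm_density w) * ennreal (cm_density w) \<partial>\<gamma>)"
    by (simp add: power2_eq_square ennreal_mult cm_density_nonneg)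
  also have "\<dots> = (\<integral>\<^sup>+w. ennreal (cm_density (w + \<iota> h)) \<partial>\<gamma>)"
    using Cameron_Martin[of "\<lambda>w. ennreal (cm_density w)"] by simp
  also have "\<dots> = (\<integral>\<^sup>+w. ennreal (exp ((norm h)\<^sup>2)) * ennreal (cm_density w) \<partial>\<gamma>)"
  proof (rule nn_integral_cong)
    fix w assume "w \<in> space \<gamma>"
    then have "l (w + \<iota> h) = l w + (norm h)\<^sup>2" using l_shift[of w 1] by (simp add: space_eq)
    then have "cm_density (w + \<iota> h) = exp ((norm h)\<^sup>2) * cm_density w"
      unfolding cm_density_def exp_add[symmetric] by simp
    then show "ennreal (cm_density (w + \<iota> h)) = ennreal (exp ((norm h)\<^sup>2)) * ennreal (cm_density w)"
      by (simp add: ennreal_mult cm_density_nonneg)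
  qed
  also have "\<dots> = ennreal (exp ((norm h)\<^sup>2))" by (subst nn_integral_cmult) (auto simp: cm_density_integral)
  finally show ?thesis .
qed

text \<open>Total variation distance between \<open>\<gamma>\<close> and its translate, from the second moment of the density.\<close>

lemma cm_density_L1:
  assumes h1: "norm h \<le> 1"
  shows "(\<integral>\<^sup>+w. ennreal \<bar>cm_density w - 1\<bar> \<partial>\<gamma>) \<le> ennreal (2 * norm h)"
proof (cases "h = 0")
  case True
  have "(\<integral>\<^sup>+w. ennreal \<bar>cm_density w - 1\<bar> \<partial>\<gamma>) = (\<integral>\<^sup>+w. 0 \<partial>\<gamma>)"
  proof (rule nn_integral_cong)
    fix w assume "w \<in> space \<gamma>"
    then have 1: "cm_density w = 1" by (intro cm_density_eq_1_if_h_zero True) (simp add: space_eq)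
    show "ennreal \<bar>cm_density w - 1\<bar> = 0" unfolding 1 by simp
  qed
  then show ?thesis by simp
next
  case False
  then have n: "norm h > 0" by simp
  have i1: "integrable \<gamma> cm_density" "(\<integral>w. cm_density w \<partial>\<gamma>) = 1"
    using nn_integral_eq_integrable[of cm_density \<gamma> 1] cm_density_integral cm_density_nonneg by auto
  have i2: "integrable \<gamma> (\<lambda>w. (cm_density w)\<^sup>2)" "(\<integral>w. (cm_density w)\<^sup>2 \<partial>\<gamma>) = exp ((norm h)\<^sup>2)"
    using nn_integral_eq_integrable[of "\<lambda>w. (cm_density w)\<^sup>2" \<gamma> "exp ((norm h)\<^sup>2)"] cm_density_sq_integral by auto
  have ib: "integrable \<gamma> (\<lambda>w. ((cm_density w)\<^sup>2 - 2 * cm_density w + 1) / norm h + norm h)"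
    using i1 i2 by simp
  have "(\<integral>w. \<bar>cm_density w - 1\<bar> \<partial>\<gamma>) \<le> (\<integral>w. (((cm_density w)\<^sup>2 - 2 * cm_density w + 1) / norm h + norm h) / 2 \<partial>\<gamma>)"
  proof (rule integral_mono)
    fix w
    \<comment> \<open>Balancing the square against \<open>norm h\<close>, the order of the standard deviation of the density,
      keeps the bound linear in \<open>norm h\<close>.\<close>
    have "0 \<le> (\<bar>cm_density w - 1\<bar> - norm h)\<^sup>2" by simp
    then have "2 * \<bar>cm_density w - 1\<bar> * norm h \<le> (cm_density w - 1)\<^sup>2 + (norm h)\<^sup>2"
      by (simp add: power2_eq_square algebra_simps)
    then show "\<bar>cm_density w - 1\<bar> \<le> (((cm_density w)\<^sup>2 - 2 * cm_density w + 1) / norm h + norm h) / 2"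
      using n by (simp add: field_simps power2_eq_square)
  qed (use i1 ib in auto)
  also have "\<dots> = ((exp ((norm h)\<^sup>2) - 1) / norm h + norm h) / 2"
    using i1 i2 by (simp add: prob_space)
  finally have L1: "(\<integral>w. \<bar>cm_density w - 1\<bar> \<partial>\<gamma>) \<le> ((exp ((norm h)\<^sup>2) - 1) / norm h + norm h) / 2" .
  have half_sum_le: "(a + b) / 2 \<le> 2 * b" if "a \<le> 2 * b" "0 < b" for a b :: real
    using that by (simp add: field_simps)
  have "exp ((norm h)\<^sup>2) - 1 \<le> 2 * (norm h)\<^sup>2"
  proof -
    have "(norm h)\<^sup>2 \<le> 1" using h1 by (simp add: power_le_one)
    then have "exp ((norm h)\<^sup>2) \<le> 1 + (norm h)\<^sup>2 + ((norm h)\<^sup>2)\<^sup>2" by (intro exp_bound) auto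
    also have "((norm h)\<^sup>2)\<^sup>2 \<le> (norm h)\<^sup>2" using \<open>(norm h)\<^sup>2 \<le> 1\<close> by (simp add: power2_eq_square mult_left_le)
    finally show ?thesis by simp
  qed
  then have "(exp ((norm h)\<^sup>2) - 1) / norm h \<le> 2 * norm h"
    using n by (simp add: pos_divide_le_eq power2_eq_square mult.assoc)
  then have "((exp ((norm h)\<^sup>2) - 1) / norm h + norm h) / 2 \<le> 2 * norm h"
    using half_sum_le n by blast
  with L1 have le: "(\<integral>w. \<bar>cm_density w - 1\<bar> \<partial>\<gamma>) \<le> 2 * norm h" by (rule order_trans)
  have "(\<integral>\<^sup>+w. ennreal \<bar>cm_density w - 1\<bar> \<partial>\<gamma>) = ennreal (\<integral>w. \<bar>cm_density w - 1\<bar> \<partial>\<gamma>)"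
    using i1 by (intro nn_integral_eq_integral) auto
  then show ?thesis using le by (simp add: ennreal_leI)
qed

end

section \<open>Couplings of Markov kernels\<close>

text \<open>Measurability in the starting pair allows couplings to be selected case by case, composed along the
  chain, and averaged over a coupling of initial distributions.\<close>

definition couples :: "('a \<times> 'a \<Rightarrow> ('a \<times> 'a) measure) \<Rightarrow> ('a \<Rightarrow> 'a measure) \<Rightarrow> 'a measure \<Rightarrow> bool" where
  "couples \<kappa> Q N \<longleftrightarrow> \<kappa> \<in> N \<Otimes>\<^sub>M N \<rightarrow>\<^sub>M prob_algebra (N \<Otimes>\<^sub>M N) \<and>
    (\<forall>x\<in>space N. \<forall>y\<in>space N. distr (\<kappa> (x, y)) N fst = Q x \<and> distr (\<kappa> (x, y)) N snd = Q y)"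

lemma couplesD:
  assumes "couples \<kappa> Q N"
  shows "\<kappa> \<in> N \<Otimes>\<^sub>M N \<rightarrow>\<^sub>M prob_algebra (N \<Otimes>\<^sub>M N)"
    and "x \<in> space N \<Longrightarrow> y \<in> space N \<Longrightarrow> distr (\<kappa> (x, y)) N fst = Q x"
    and "x \<in> space N \<Longrightarrow> y \<in> space N \<Longrightarrow> distr (\<kappa> (x, y)) N snd = Q y"
    and "x \<in> space N \<Longrightarrow> y \<in> space N \<Longrightarrow> prob_space (\<kappa> (x, y))"
    and "x \<in> space N \<Longrightarrow> y \<in> space N \<Longrightarrow> sets (\<kappa> (x, y)) = sets (N \<Otimes>\<^sub>M N)"
proof -
  show \<kappa>: "\<kappa> \<in> N \<Otimes>\<^sub>M N \<rightarrow>\<^sub>M prob_algebra (N \<Otimes>\<^sub>M N)" using assms unfolding couples_def by blast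
  assume xy: "x \<in> space N" "y \<in> space N"
  show "distr (\<kappa> (x, y)) N fst = Q x" "distr (\<kappa> (x, y)) N snd = Q y"
    using assms xy unfolding couples_def by blast+
  have "(x, y) \<in> space (N \<Otimes>\<^sub>M N)" using xy by (simp add: space_pair_measure)
  from measurable_space[OF \<kappa> this]
  show "prob_space (\<kappa> (x, y))" "sets (\<kappa> (x, y)) = sets (N \<Otimes>\<^sub>M N)" by (auto simp: space_prob_algebra)
qed

lemma couples_marginal_integral:
  assumes c: "couples \<kappa> Q N" and xy: "x \<in> space N" "y \<in> space N" and g: "g \<in> borel_measurable N"
  shows "(\<integral>\<^sup>+p. g (fst p) \<partial>\<kappa> (x, y)) = (\<integral>\<^sup>+u. g u \<partial>Q x)"
    and "(\<integral>\<^sup>+p. g (snd p) \<partial>\<kappa> (x, y)) = (\<integral>\<^sup>+u. g u \<partial>Q y)"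
proof -
  have m: "fst \<in> \<kappa> (x, y) \<rightarrow>\<^sub>M N" "snd \<in> \<kappa> (x, y) \<rightarrow>\<^sub>M N"
    using measurable_fst measurable_snd measurable_cong_sets[OF couplesD(5)[OF c xy] refl] by blast+
  show "(\<integral>\<^sup>+p. g (fst p) \<partial>\<kappa> (x, y)) = (\<integral>\<^sup>+u. g u \<partial>Q x)"
    using g by (subst couplesD(2)[OF c xy, symmetric]) (simp add: nn_integral_distr[OF m(1)])
  show "(\<integral>\<^sup>+p. g (snd p) \<partial>\<kappa> (x, y)) = (\<integral>\<^sup>+u. g u \<partial>Q y)"
    using g by (subst couplesD(3)[OF c xy, symmetric]) (simp add: nn_integral_distr[OF m(2)])
qed

lemma couples_independent:
  assumes Q: "Q \<in> N \<rightarrow>\<^sub>M prob_algebra N"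
  shows "couples (\<lambda>z. Q (fst z) \<Otimes>\<^sub>M Q (snd z)) Q N"
  unfolding couples_def
proof (intro conjI ballI)
  show "(\<lambda>z. Q (fst z) \<Otimes>\<^sub>M Q (snd z)) \<in> N \<Otimes>\<^sub>M N \<rightarrow>\<^sub>M prob_algebra (N \<Otimes>\<^sub>M N)" using Q by measurable
  fix x y assume "x \<in> space N" "y \<in> space N"
  then have p: "prob_space (Q x)" "sets (Q x) = sets N" "prob_space (Q y)" "sets (Q y) = sets N"
    using measurable_space[OF Q] by (auto simp: space_prob_algebra)
  interpret X: prob_space "Q x" by fact
  interpret Y: prob_space "Q y" by fact
  interpret XY: pair_prob_space "Q x" "Q y" ..
  have "distr (Q x \<Otimes>\<^sub>M Q y) N fst = distr (Q x \<Otimes>\<^sub>M Q y) (Q x) fst" using p by (intro distr_cong) auto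
  then show "distr (Q (fst (x, y)) \<Otimes>\<^sub>M Q (snd (x, y))) N fst = Q x" using Y.distr_pair_fst[of "Q x"] by simp
  have "distr (Q x \<Otimes>\<^sub>M Q y) N snd = Q y"
  proof (rule measure_eqI)
    show "sets (distr (Q x \<Otimes>\<^sub>M Q y) N snd) = sets (Q y)" using p by simp
    fix A assume "A \<in> sets (distr (Q x \<Otimes>\<^sub>M Q y) N snd)"
    then have A: "A \<in> sets N" "A \<in> sets (Q y)" using p by auto
    have m: "snd \<in> Q x \<Otimes>\<^sub>M Q y \<rightarrow>\<^sub>M N" using p measurable_snd measurable_cong_sets by blast
    have "snd -` A \<inter> space (Q x \<Otimes>\<^sub>M Q y) = space (Q x) \<times> A"
      using sets.sets_into_space[OF A(2)] by (auto simp: space_pair_measure)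
    then have "emeasure (distr (Q x \<Otimes>\<^sub>M Q y) N snd) A = emeasure (Q x \<Otimes>\<^sub>M Q y) (space (Q x) \<times> A)"
      using emeasure_distr[OF m A(1)] by simp
    also have "\<dots> = emeasure (Q y) A"
      using A by (simp add: Y.emeasure_pair_measure_Times X.emeasure_space_1)
    finally show "emeasure (distr (Q x \<Otimes>\<^sub>M Q y) N snd) A = emeasure (Q y) A" .
  qed
  then show "distr (Q (fst (x, y)) \<Otimes>\<^sub>M Q (snd (x, y))) N snd = Q y" by simp
qed

lemma couples_if:
  assumes "couples \<kappa>\<^sub>1 Q N" "couples \<kappa>\<^sub>2 Q N" and S: "{z \<in> space (N \<Otimes>\<^sub>M N). S z} \<in> sets (N \<Otimes>\<^sub>M N)"
  shows "couples (\<lambda>z. if S z then \<kappa>\<^sub>1 z else \<kappa>\<^sub>2 z) Q N"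
  using assms(1,2) unfolding couples_def by (auto intro!: measurable_If S)

lemma couples_bind:
  assumes c1: "couples \<kappa>\<^sub>1 Q\<^sub>1 N" and c2: "couples \<kappa>\<^sub>2 Q\<^sub>2 N" and Q2: "Q\<^sub>2 \<in> N \<rightarrow>\<^sub>M prob_algebra N"
  shows "couples (\<lambda>z. \<kappa>\<^sub>1 z \<bind> \<kappa>\<^sub>2) (\<lambda>x. Q\<^sub>1 x \<bind> Q\<^sub>2) N"
  unfolding couples_def
proof (intro conjI ballI)
  show "(\<lambda>z. \<kappa>\<^sub>1 z \<bind> \<kappa>\<^sub>2) \<in> N \<Otimes>\<^sub>M N \<rightarrow>\<^sub>M prob_algebra (N \<Otimes>\<^sub>M N)"
    by (rule measurable_bind_prob_space[OF couplesD(1)[OF c1] couplesD(1)[OF c2]])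
  fix x y assume xy: "x \<in> space N" "y \<in> space N"
  have s: "sets (\<kappa>\<^sub>1 (x, y)) = sets (N \<Otimes>\<^sub>M N)" by (rule couplesD(5)[OF c1 xy])
  have sp: "space (\<kappa>\<^sub>1 (x, y)) = space (N \<Otimes>\<^sub>M N)" by (rule sets_eq_imp_space_eq[OF s])
  have ne: "space (\<kappa>\<^sub>1 (x, y)) \<noteq> {}" using xy unfolding sp by (auto simp: space_pair_measure)
  have k2: "\<kappa>\<^sub>2 \<in> \<kappa>\<^sub>1 (x, y) \<rightarrow>\<^sub>M subprob_algebra (N \<Otimes>\<^sub>M N)"
    using measurable_prob_algebraD[OF couplesD(1)[OF c2]] measurable_cong_sets[OF s refl] by blast
  have Q2': "Q\<^sub>2 \<in> N \<rightarrow>\<^sub>M subprob_algebra N" by (rule measurable_prob_algebraD[OF Q2])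
  have m: "fst \<in> \<kappa>\<^sub>1 (x, y) \<rightarrow>\<^sub>M N" "snd \<in> \<kappa>\<^sub>1 (x, y) \<rightarrow>\<^sub>M N"
    using measurable_fst measurable_snd measurable_cong_sets[OF s refl] by blast+
  have "distr (\<kappa>\<^sub>1 (x, y) \<bind> \<kappa>\<^sub>2) N fst = \<kappa>\<^sub>1 (x, y) \<bind> (\<lambda>p. distr (\<kappa>\<^sub>2 p) N fst)"
    by (rule distr_bind[OF k2 ne]) simp
  also have "\<dots> = \<kappa>\<^sub>1 (x, y) \<bind> (\<lambda>p. Q\<^sub>2 (fst p))"
    using couplesD(2)[OF c2] by (intro bind_cong_All) (auto simp: sp space_pair_measure)
  also have "\<dots> = distr (\<kappa>\<^sub>1 (x, y)) N fst \<bind> Q\<^sub>2" by (rule bind_distr[OF m(1) Q2' ne, symmetric])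
  finally show "distr (\<kappa>\<^sub>1 (x, y) \<bind> \<kappa>\<^sub>2) N fst = Q\<^sub>1 x \<bind> Q\<^sub>2" using couplesD(2)[OF c1 xy] by simp
  have "distr (\<kappa>\<^sub>1 (x, y) \<bind> \<kappa>\<^sub>2) N snd = \<kappa>\<^sub>1 (x, y) \<bind> (\<lambda>p. distr (\<kappa>\<^sub>2 p) N snd)"
    by (rule distr_bind[OF k2 ne]) simp
  also have "\<dots> = \<kappa>\<^sub>1 (x, y) \<bind> (\<lambda>p. Q\<^sub>2 (snd p))"
    using couplesD(3)[OF c2] by (intro bind_cong_All) (auto simp: sp space_pair_measure)
  also have "\<dots> = distr (\<kappa>\<^sub>1 (x, y)) N snd \<bind> Q\<^sub>2" by (rule bind_distr[OF m(2) Q2' ne, symmetric])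
  finally show "distr (\<kappa>\<^sub>1 (x, y) \<bind> \<kappa>\<^sub>2) N snd = Q\<^sub>1 y \<bind> Q\<^sub>2" using couplesD(3)[OF c1 xy] by simp
qed

lemma couples_cong: "couples \<kappa> Q N \<Longrightarrow> (\<And>x. x \<in> space N \<Longrightarrow> Q x = Q' x) \<Longrightarrow> couples \<kappa> Q' N"
  unfolding couples_def by simp

lemma couples_bind_nn_integral:
  assumes c1: "couples \<kappa>\<^sub>1 Q\<^sub>1 N" and c2: "couples \<kappa>\<^sub>2 Q\<^sub>2 N" and f: "f \<in> borel_measurable (N \<Otimes>\<^sub>M N)"
    and xy: "x \<in> space N" "y \<in> space N"
  shows "(\<integral>\<^sup>+p. f p \<partial>(\<kappa>\<^sub>1 (x, y) \<bind> \<kappa>\<^sub>2)) = (\<integral>\<^sup>+q. \<integral>\<^sup>+p. f p \<partial>\<kappa>\<^sub>2 q \<partial>\<kappa>\<^sub>1 (x, y))"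
proof (rule nn_integral_bind[OF f])
  show "\<kappa>\<^sub>2 \<in> \<kappa>\<^sub>1 (x, y) \<rightarrow>\<^sub>M subprob_algebra (N \<Otimes>\<^sub>M N)"
    using measurable_prob_algebraD[OF couplesD(1)[OF c2]] measurable_cong_sets[OF couplesD(5)[OF c1 xy] refl] by blast
qed

text \<open>If distances contract in expectation under a measurable choice of couplings of the transition
  probabilities, then so does the transport cost: push an arbitrary coupling through the kernel.\<close>

lemma wasserstein_bind_le:
  fixes \<delta> :: "'a \<Rightarrow> 'a \<Rightarrow> real"
  assumes c: "couples \<kappa> Q N" and Q: "Q \<in> N \<rightarrow>\<^sub>M prob_algebra N"
    and \<delta>: "(\<lambda>(x, y). \<delta> x y) \<in> borel_measurable (N \<Otimes>\<^sub>M N)"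
    and contr: "\<And>x y. x \<in> space N \<Longrightarrow> y \<in> space N \<Longrightarrow>
      (\<integral>\<^sup>+(u, v). ennreal (\<delta> u v) \<partial>\<kappa> (x, y)) \<le> ennreal q * ennreal (\<delta> x y)"
    and q: "q > 0"
    and \<mu>: "prob_space \<mu>\<^sub>1" "sets \<mu>\<^sub>1 = sets N" "prob_space \<mu>\<^sub>2" "sets \<mu>\<^sub>2 = sets N"
  shows "wasserstein \<delta> (\<mu>\<^sub>1 \<bind> Q) (\<mu>\<^sub>2 \<bind> Q) \<le> ennreal q * wasserstein \<delta> \<mu>\<^sub>1 \<mu>\<^sub>2"
proof -
  have \<mu>a: "\<mu>\<^sub>1 \<in> space (prob_algebra N)" "\<mu>\<^sub>2 \<in> space (prob_algebra N)" using \<mu> by (auto simp: space_prob_algebra)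
  have sb: "sets (\<mu>\<^sub>1 \<bind> Q) = sets N" "sets (\<mu>\<^sub>2 \<bind> Q) = sets N" using sets_bind'[OF \<mu>a(1) Q] sets_bind'[OF \<mu>a(2) Q] by auto
  have d[measurable]: "(\<lambda>(x, y). ennreal (\<delta> x y)) \<in> borel_measurable (N \<Otimes>\<^sub>M N)"
    using measurable_compose[OF \<delta> measurable_ennreal] by (simp add: case_prod_beta')
  have step: "wasserstein \<delta> (\<mu>\<^sub>1 \<bind> Q) (\<mu>\<^sub>2 \<bind> Q) \<le> ennreal q * (\<integral>\<^sup>+(x, y). ennreal (\<delta> x y) \<partial>\<Gamma>)"
    if \<Gamma>: "\<Gamma> \<in> couplings \<mu>\<^sub>1 \<mu>\<^sub>2" for \<Gamma>
  proof -
    have g: "prob_space \<Gamma>" "sets \<Gamma> = sets (N \<Otimes>\<^sub>M N)" "distr \<Gamma> \<mu>\<^sub>1 fst = \<mu>\<^sub>1" "distr \<Gamma> \<mu>\<^sub>2 snd = \<mu>\<^sub>2"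
      using \<Gamma> \<mu> unfolding couplings_def by (auto cong: sets_pair_measure_cong)
    have sp: "space \<Gamma> = space (N \<Otimes>\<^sub>M N)" by (rule sets_eq_imp_space_eq[OF g(2)])
    have ne: "space \<Gamma> \<noteq> {}" using g(1) by (rule prob_space.not_empty)
    have \<Gamma>a: "\<Gamma> \<in> space (prob_algebra (N \<Otimes>\<^sub>M N))" using g by (simp add: space_prob_algebra)
    have k: "\<kappa> \<in> \<Gamma> \<rightarrow>\<^sub>M subprob_algebra (N \<Otimes>\<^sub>M N)"
      using measurable_prob_algebraD[OF couplesD(1)[OF c]] measurable_cong_sets[OF g(2) refl] by blast
    have Q': "Q \<in> N \<rightarrow>\<^sub>M subprob_algebra N" by (rule measurable_prob_algebraD[OF Q])
    have m: "fst \<in> \<Gamma> \<rightarrow>\<^sub>M N" "snd \<in> \<Gamma> \<rightarrow>\<^sub>M N"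
      using measurable_fst measurable_snd measurable_cong_sets[OF g(2) refl] by blast+
    define \<Gamma>' where "\<Gamma>' = \<Gamma> \<bind> \<kappa>"
    have s\<Gamma>': "sets \<Gamma>' = sets (N \<Otimes>\<^sub>M N)" unfolding \<Gamma>'_def by (rule sets_bind'[OF \<Gamma>a couplesD(1)[OF c]])
    have "distr \<Gamma>' N fst = \<Gamma> \<bind> (\<lambda>p. distr (\<kappa> p) N fst)" unfolding \<Gamma>'_def by (rule distr_bind[OF k ne]) simp
    also have "\<dots> = \<Gamma> \<bind> (\<lambda>p. Q (fst p))"
      using couplesD(2)[OF c] by (intro bind_cong_All) (auto simp: sp space_pair_measure)
    also have "\<dots> = distr \<Gamma> N fst \<bind> Q" by (rule bind_distr[OF m(1) Q' ne, symmetric])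
    also have "distr \<Gamma> N fst = \<mu>\<^sub>1" using g(3) \<mu> by (metis distr_cong)
    finally have f1: "distr \<Gamma>' (\<mu>\<^sub>1 \<bind> Q) fst = \<mu>\<^sub>1 \<bind> Q" using sb by (metis distr_cong)
    have "distr \<Gamma>' N snd = \<Gamma> \<bind> (\<lambda>p. distr (\<kappa> p) N snd)" unfolding \<Gamma>'_def by (rule distr_bind[OF k ne]) simp
    also have "\<dots> = \<Gamma> \<bind> (\<lambda>p. Q (snd p))"
      using couplesD(3)[OF c] by (intro bind_cong_All) (auto simp: sp space_pair_measure)
    also have "\<dots> = distr \<Gamma> N snd \<bind> Q" by (rule bind_distr[OF m(2) Q' ne, symmetric])
    also have "distr \<Gamma> N snd = \<mu>\<^sub>2" using g(4) \<mu> by (metis distr_cong)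
    finally have f2: "distr \<Gamma>' (\<mu>\<^sub>2 \<bind> Q) snd = \<mu>\<^sub>2 \<bind> Q" using sb by (metis distr_cong)
    have "prob_space \<Gamma>'" unfolding \<Gamma>'_def by (rule prob_space_bind'[OF \<Gamma>a couplesD(1)[OF c]])
    then have "\<Gamma>' \<in> couplings (\<mu>\<^sub>1 \<bind> Q) (\<mu>\<^sub>2 \<bind> Q)"
      unfolding couplings_def using s\<Gamma>' f1 f2 sets_pair_measure_cong[OF sb] by simp
    then have "wasserstein \<delta> (\<mu>\<^sub>1 \<bind> Q) (\<mu>\<^sub>2 \<bind> Q) \<le> (\<integral>\<^sup>+(x, y). ennreal (\<delta> x y) \<partial>\<Gamma>')"
      unfolding wasserstein_def by (rule INF_lower)
    also have "\<dots> = (\<integral>\<^sup>+z. \<integral>\<^sup>+(x, y). ennreal (\<delta> x y) \<partial>\<kappa> z \<partial>\<Gamma>)"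
      unfolding \<Gamma>'_def by (rule nn_integral_bind[OF d k])
    also have "\<dots> \<le> (\<integral>\<^sup>+z. ennreal q * (case z of (x, y) \<Rightarrow> ennreal (\<delta> x y)) \<partial>\<Gamma>)"
      by (rule nn_integral_mono) (auto simp: sp space_pair_measure intro: contr)
    also have "\<dots> = ennreal q * (\<integral>\<^sup>+(x, y). ennreal (\<delta> x y) \<partial>\<Gamma>)"
      using d measurable_cong_sets[OF g(2) refl] by (intro nn_integral_cmult) blast
    finally show ?thesis .
  qed
  have q': "ennreal q \<noteq> 0" "ennreal q \<noteq> top" using q by auto
  have cancel: "ennreal q * x / ennreal q = x" for x
    by (subst mult.commute) (rule mult_divide_eq_ennreal[OF q'])
  have "wasserstein \<delta> (\<mu>\<^sub>1 \<bind> Q) (\<mu>\<^sub>2 \<bind> Q) / ennreal q \<le> wasserstein \<delta> \<mu>\<^sub>1 \<mu>\<^sub>2"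
    unfolding wasserstein_def[of \<delta> \<mu>\<^sub>1 \<mu>\<^sub>2]
  proof (rule INF_greatest)
    fix \<Gamma> assume \<Gamma>: "\<Gamma> \<in> couplings \<mu>\<^sub>1 \<mu>\<^sub>2"
    from divide_right_mono_ennreal[OF step[OF \<Gamma>], of "ennreal q"] cancel
    show "wasserstein \<delta> (\<mu>\<^sub>1 \<bind> Q) (\<mu>\<^sub>2 \<bind> Q) / ennreal q \<le> (\<integral>\<^sup>+(x, y). ennreal (\<delta> x y) \<partial>\<Gamma>)"
      by simp
  qed
  from mult_left_mono[OF this, of "ennreal q"] show ?thesis
    by (simp add: ennreal_times_divide cancel)
qed

text \<open>A sub-coupling with marginals below the prescribed ones is completed by the normalised product
  of the two remainders.\<close>

lemma coupling_completion:
  fixes Q1 Q2 :: "'z \<Rightarrow> 'a measure"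
  assumes Q1: "Q1 \<in> M \<rightarrow>\<^sub>M prob_algebra N" and Q2: "Q2 \<in> M \<rightarrow>\<^sub>M prob_algebra N"
    and L: "L \<in> M \<rightarrow>\<^sub>M subprob_algebra (N \<Otimes>\<^sub>M N)"
    and le1: "\<And>z A. z \<in> space M \<Longrightarrow> A \<in> sets N \<Longrightarrow> emeasure (L z) (A \<times> space N) \<le> emeasure (Q1 z) A"
    and le2: "\<And>z A. z \<in> space M \<Longrightarrow> A \<in> sets N \<Longrightarrow> emeasure (L z) (space N \<times> A) \<le> emeasure (Q2 z) A"
  obtains \<kappa> where "\<kappa> \<in> M \<rightarrow>\<^sub>M prob_algebra (N \<Otimes>\<^sub>M N)"
    "\<And>z. z \<in> space M \<Longrightarrow> distr (\<kappa> z) N fst = Q1 z" "\<And>z. z \<in> space M \<Longrightarrow> distr (\<kappa> z) N snd = Q2 z"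
    "\<And>z f. z \<in> space M \<Longrightarrow> f \<in> borel_measurable (N \<Otimes>\<^sub>M N) \<Longrightarrow> (\<And>p. f p \<le> 1) \<Longrightarrow>
      (\<integral>\<^sup>+p. f p \<partial>\<kappa> z) \<le> (\<integral>\<^sup>+p. f p \<partial>L z) + (1 - emeasure (L z) (space N \<times> space N))"
proof -
  have Q1': "Q1 \<in> M \<rightarrow>\<^sub>M subprob_algebra N" and Q2': "Q2 \<in> M \<rightarrow>\<^sub>M subprob_algebra N"
    using Q1 Q2 by (auto intro: measurable_prob_algebraD)
  have Lp: "sets (L z) = sets (N \<Otimes>\<^sub>M N)" "subprob_space (L z)" if "z \<in> space M" for z
    using subprob_measurableD(2)[OF L that] measurable_space[OF L that] by (auto simp: space_subprob_algebra)
  have Qp: "prob_space (Q1 z)" "sets (Q1 z) = sets N" "prob_space (Q2 z)" "sets (Q2 z) = sets N" if "z \<in> space M" for z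
    using measurable_space[OF Q1 that] measurable_space[OF Q2 that] by (auto simp: space_prob_algebra)
  define c where "c z = 1 - emeasure (L z) (space N \<times> space N)" for z
  define R1 where "R1 z = diff_measure (Q1 z) (distr (L z) N fst)" for z
  define R2 where "R2 z = diff_measure (Q2 z) (distr (L z) N snd)" for z
  \<comment> \<open>Both remainders have mass \<open>c z\<close>, hence so does \<open>R z\<close>; if \<open>c z = 0\<close> then \<open>inverse (c z) = \<infinity>\<close>, but
    \<open>R z\<close> is null since \<open>\<infinity> * 0 = 0\<close>.\<close>
  define R where "R z = scale_measure (inverse (c z)) (R1 z \<Otimes>\<^sub>M R2 z)" for z
  \<comment> \<open>The sum of the measures \<open>L z\<close> and \<open>R z\<close>.\<close>
  define \<kappa> where "\<kappa> z = count_space UNIV \<bind> (\<lambda>b::bool. if b then L z else R z)" for z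
  have Lm[measurable]: "(\<lambda>z. emeasure (L z) X) \<in> borel_measurable M" if "X \<in> sets (N \<Otimes>\<^sub>M N)" for X
    by (rule measurable_emeasure_kernel[OF L that])
  have cm[measurable]: "c \<in> borel_measurable M" unfolding c_def by (intro borel_measurable_minus_ennreal measurable_const Lm) auto
  have c1: "c z \<le> 1" for z unfolding c_def by (simp add: diff_le_self_ennreal)
  have facts: "sets (R1 z) = sets N" "sets (R2 z) = sets N"
    "\<And>A. A \<in> sets N \<Longrightarrow> emeasure (R1 z) A = emeasure (Q1 z) A - emeasure (L z) (A \<times> space N)"
    "\<And>A. A \<in> sets N \<Longrightarrow> emeasure (R2 z) A = emeasure (Q2 z) A - emeasure (L z) (space N \<times> A)"
    "emeasure (R1 z) (space N) = c z" "emeasure (R2 z) (space N) = c z"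
    if z: "z \<in> space M" for z
  proof -
    have f: "fst \<in> L z \<rightarrow>\<^sub>M N" "snd \<in> L z \<rightarrow>\<^sub>M N"
      using measurable_fst measurable_snd measurable_cong_sets[OF Lp(1)[OF z] refl] by blast+
    have sp: "space (L z) = space N \<times> space N"
      using sets_eq_imp_space_eq[OF Lp(1)[OF z]] by (simp add: space_pair_measure)
    interpret Lz: subprob_space "L z" by (rule Lp(2)[OF z])
    interpret Q1z: prob_space "Q1 z" by (rule Qp(1)[OF z])
    interpret Q2z: prob_space "Q2 z" by (rule Qp(3)[OF z])
    have d: "emeasure (distr (L z) N fst) A = emeasure (L z) (A \<times> space N)"
      "emeasure (distr (L z) N snd) A = emeasure (L z) (space N \<times> A)" if A: "A \<in> sets N" for A
    proof -
      have "fst -` A \<inter> space (L z) = A \<times> space N" "snd -` A \<inter> space (L z) = space N \<times> A"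
        using sets.sets_into_space[OF A] unfolding sp by auto
      then show "emeasure (distr (L z) N fst) A = emeasure (L z) (A \<times> space N)"
        "emeasure (distr (L z) N snd) A = emeasure (L z) (space N \<times> A)"
        using emeasure_distr[OF f(1) A] emeasure_distr[OF f(2) A] by auto
    qed
    have fin: "finite_measure (distr (L z) N fst)" "finite_measure (distr (L z) N snd)"
      by (auto intro!: Lz.finite_measure_distr f)
    show s: "sets (R1 z) = sets N" "sets (R2 z) = sets N" unfolding R1_def R2_def using Qp z by auto
    show e1: "emeasure (R1 z) A = emeasure (Q1 z) A - emeasure (L z) (A \<times> space N)" if A: "A \<in> sets N" for A
      unfolding R1_def
      by (subst emeasure_diff_measure[OF Q1z.finite_measure_axioms fin(1)])
        (use Qp[OF z] le1[OF z] d A in auto)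
    show e2: "emeasure (R2 z) A = emeasure (Q2 z) A - emeasure (L z) (space N \<times> A)" if A: "A \<in> sets N" for A
      unfolding R2_def
      by (subst emeasure_diff_measure[OF Q2z.finite_measure_axioms fin(2)])
        (use Qp[OF z] le2[OF z] d A in auto)
    show "emeasure (R1 z) (space N) = c z" "emeasure (R2 z) (space N) = c z"
      unfolding c_def e1[OF sets.top] e2[OF sets.top]
      using Q1z.emeasure_space_1 Q2z.emeasure_space_1 sets_eq_imp_space_eq[OF Qp(2)[OF z]]
        sets_eq_imp_space_eq[OF Qp(4)[OF z]] by auto
  qed
  have spR: "space (R1 z) = space N" "space (R2 z) = space N" if "z \<in> space M" for z
    using sets_eq_imp_space_eq[OF facts(1)[OF that]] sets_eq_imp_space_eq[OF facts(2)[OF that]] by auto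
  have ne: "space N \<noteq> {}" if "z \<in> space M" for z
    using prob_space.not_empty[OF Qp(1)[OF that]] sets_eq_imp_space_eq[OF Qp(2)[OF that]] by simp
  have subR: "subprob_space (R1 z)" "subprob_space (R2 z)" if "z \<in> space M" for z
    using facts(5,6)[OF that] c1[of z] spR[OF that] ne[OF that] by (auto intro!: subprob_spaceI)
  have R1m: "R1 \<in> M \<rightarrow>\<^sub>M subprob_algebra N"
  proof (rule measurable_subprob_algebra)
    fix A assume A: "A \<in> sets N"
    have "(\<lambda>z. emeasure (Q1 z) A - emeasure (L z) (A \<times> space N)) \<in> borel_measurable M"
      by (intro borel_measurable_minus_ennreal measurable_emeasure_kernel[OF Q1' A] Lm pair_measureI A sets.top)
    then show "(\<lambda>z. emeasure (R1 z) A) \<in> borel_measurable M"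
      by (subst measurable_cong[OF facts(3)[OF _ A]])
  qed (use subR facts in auto)
  have R2m: "R2 \<in> M \<rightarrow>\<^sub>M subprob_algebra N"
  proof (rule measurable_subprob_algebra)
    fix A assume A: "A \<in> sets N"
    have "(\<lambda>z. emeasure (Q2 z) A - emeasure (L z) (space N \<times> A)) \<in> borel_measurable M"
      by (intro borel_measurable_minus_ennreal measurable_emeasure_kernel[OF Q2' A] Lm pair_measureI A sets.top)
    then show "(\<lambda>z. emeasure (R2 z) A) \<in> borel_measurable M"
      by (subst measurable_cong[OF facts(4)[OF _ A]])
  qed (use subR facts in auto)
  have RRm: "(\<lambda>z. R1 z \<Otimes>\<^sub>M R2 z) \<in> M \<rightarrow>\<^sub>M subprob_algebra (N \<Otimes>\<^sub>M N)" by (rule measurable_pair_measure[OF R1m R2m])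
  have RR: "emeasure (R1 z \<Otimes>\<^sub>M R2 z) (A \<times> B) = emeasure (R1 z) A * emeasure (R2 z) B"
    if "z \<in> space M" "A \<in> sets N" "B \<in> sets N" for z A B
  proof -
    interpret S: subprob_space "R2 z" by (rule subR(2)[OF that(1)])
    show ?thesis using that facts(1,2) by (intro S.emeasure_pair_measure_Times) auto
  qed
  have inv: "inverse (c z) * (x * c z) = x" if "x \<le> c z" for z x
  proof (cases "c z = 0")
    case False
    moreover have "c z < top" using c1[of z] by (rule order_le_less_trans) simp
    ultimately have "c z * inverse (c z) = 1" using ennreal_divide_self[of "c z"] by (simp add: divide_ennreal_def)
    moreover have "inverse (c z) * (x * c z) = x * (c z * inverse (c z))" by (simp only: mult_ac)
    ultimately show ?thesis by simp
  qed (use that in simp)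
  have Rs: "sets (R z) = sets (N \<Otimes>\<^sub>M N)" if "z \<in> space M" for z
    unfolding R_def using facts(1,2)[OF that] by (simp cong: sets_pair_measure_cong)
  have Rtot: "emeasure (R z) (space N \<times> space N) = c z" if z: "z \<in> space M" for z
    using RR[OF z sets.top sets.top] facts(5,6)[OF z] inv[of "c z" z] unfolding R_def by simp
  have subRz: "subprob_space (R z)" if z: "z \<in> space M" for z
  proof (rule subprob_spaceI)
    have "space (R z) = space N \<times> space N" using sets_eq_imp_space_eq[OF Rs[OF z]] by (simp add: space_pair_measure)
    then show "emeasure (R z) (space (R z)) \<le> 1" "space (R z) \<noteq> {}" using Rtot[OF z] c1[of z] ne[OF z] by auto
  qed
  have ker: "(\<lambda>b. if b then L z else R z) \<in> count_space UNIV \<rightarrow>\<^sub>M subprob_algebra (N \<Otimes>\<^sub>M N)" if z: "z \<in> space M" for z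
    using Lp[OF z] Rs[OF z] subRz[OF z] by (auto simp: space_subprob_algebra)
  have int\<kappa>: "(\<integral>\<^sup>+p. f p \<partial>\<kappa> z) = (\<integral>\<^sup>+p. f p \<partial>L z) + (\<integral>\<^sup>+p. f p \<partial>R z)"
    if z: "z \<in> space M" and f: "f \<in> borel_measurable (N \<Otimes>\<^sub>M N)" for z f
    unfolding \<kappa>_def nn_integral_bind[OF f ker[OF z]]
    by (simp add: nn_integral_count_space_finite UNIV_bool add.commute)
  have em\<kappa>: "emeasure (\<kappa> z) A = emeasure (L z) A + emeasure (R z) A"
    if z: "z \<in> space M" and A: "A \<in> sets (N \<Otimes>\<^sub>M N)" for z A
    unfolding \<kappa>_def using emeasure_bind[OF _ ker[OF z] A]
    by (simp add: nn_integral_count_space_finite UNIV_bool add.commute)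
  have s\<kappa>: "sets (\<kappa> z) = sets (N \<Otimes>\<^sub>M N)" if z: "z \<in> space M" for z
    unfolding \<kappa>_def by (rule sets_bind) (use Lp[OF z] Rs[OF z] in auto)
  have sp\<kappa>: "space (\<kappa> z) = space N \<times> space N" if z: "z \<in> space M" for z
    using sets_eq_imp_space_eq[OF s\<kappa>[OF z]] by (simp add: space_pair_measure)
  have le1': "emeasure (L z) (space N \<times> space N) \<le> 1" if z: "z \<in> space M" for z
    using subprob_space.subprob_emeasure_le_1[OF Lp(2)[OF z]] by blast
  have p\<kappa>: "prob_space (\<kappa> z)" if z: "z \<in> space M" for z
    using em\<kappa>[OF z, of "space N \<times> space N"] Rtot[OF z] le1'[OF z] sp\<kappa>[OF z]
    by (intro prob_spaceI) (simp add: c_def add_diff_inverse_ennreal)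
  show ?thesis
  proof (rule that[of \<kappa>])
    show "\<kappa> \<in> M \<rightarrow>\<^sub>M prob_algebra (N \<Otimes>\<^sub>M N)"
    proof (rule measurable_prob_algebraI[OF p\<kappa>], assumption, rule measurable_subprob_algebra)
      fix A assume A: "A \<in> sets (N \<Otimes>\<^sub>M N)"
      have "(\<lambda>z. emeasure (L z) A + inverse (c z) * emeasure (R1 z \<Otimes>\<^sub>M R2 z) A) \<in> borel_measurable M"
        using Lm[OF A] measurable_emeasure_kernel[OF RRm A] cm by measurable
      then show "(\<lambda>z. emeasure (\<kappa> z) A) \<in> borel_measurable M"
        by (subst measurable_cong[OF em\<kappa>[OF _ A]]) (simp_all add: R_def)
    qed (use p\<kappa> s\<kappa> in \<open>auto intro: prob_space_imp_subprob_space\<close>)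
    fix z assume z: "z \<in> space M"
    have f: "fst \<in> \<kappa> z \<rightarrow>\<^sub>M N" "snd \<in> \<kappa> z \<rightarrow>\<^sub>M N"
      using measurable_fst measurable_snd measurable_cong_sets[OF s\<kappa>[OF z] refl] by blast+
    show "distr (\<kappa> z) N fst = Q1 z"
    proof (rule measure_eqI)
      show "sets (distr (\<kappa> z) N fst) = sets (Q1 z)" using Qp[OF z] by simp
      fix A assume "A \<in> sets (distr (\<kappa> z) N fst)"
      then have A: "A \<in> sets N" by simp
      have "fst -` A \<inter> space (\<kappa> z) = A \<times> space N" using sets.sets_into_space[OF A] sp\<kappa>[OF z] by auto
      then have "emeasure (distr (\<kappa> z) N fst) A = emeasure (\<kappa> z) (A \<times> space N)" using emeasure_distr[OF f(1) A] by simp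
      also have "\<dots> = emeasure (L z) (A \<times> space N) + inverse (c z) * (emeasure (R1 z) A * c z)"
        using em\<kappa>[OF z, of "A \<times> space N"] A RR[OF z A sets.top] facts(6)[OF z] by (simp add: R_def)
      also have "inverse (c z) * (emeasure (R1 z) A * c z) = emeasure (R1 z) A"
        using emeasure_mono[of A "space N" "R1 z"] sets.sets_into_space[OF A] facts(1,5)[OF z] by (intro inv) simp
      also have "emeasure (L z) (A \<times> space N) + emeasure (R1 z) A = emeasure (Q1 z) A"
        unfolding facts(3)[OF z A] by (rule add_diff_inverse_ennreal[OF le1[OF z A]])
      finally show "emeasure (distr (\<kappa> z) N fst) A = emeasure (Q1 z) A" .
    qed
    show "distr (\<kappa> z) N snd = Q2 z"
    proof (rule measure_eqI)
      show "sets (distr (\<kappa> z) N snd) = sets (Q2 z)" using Qp[OF z] by simp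
      fix A assume "A \<in> sets (distr (\<kappa> z) N snd)"
      then have A: "A \<in> sets N" by simp
      have "snd -` A \<inter> space (\<kappa> z) = space N \<times> A" using sets.sets_into_space[OF A] sp\<kappa>[OF z] by auto
      then have "emeasure (distr (\<kappa> z) N snd) A = emeasure (\<kappa> z) (space N \<times> A)" using emeasure_distr[OF f(2) A] by simp
      also have "\<dots> = emeasure (L z) (space N \<times> A) + inverse (c z) * (emeasure (R2 z) A * c z)"
        using em\<kappa>[OF z, of "space N \<times> A"] A RR[OF z sets.top A] facts(5)[OF z] by (simp add: R_def mult.commute)
      also have "inverse (c z) * (emeasure (R2 z) A * c z) = emeasure (R2 z) A"
        using emeasure_mono[of A "space N" "R2 z"] sets.sets_into_space[OF A] facts(2,6)[OF z] by (intro inv) simp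
      also have "emeasure (L z) (space N \<times> A) + emeasure (R2 z) A = emeasure (Q2 z) A"
        unfolding facts(4)[OF z A] by (rule add_diff_inverse_ennreal[OF le2[OF z A]])
      finally show "emeasure (distr (\<kappa> z) N snd) A = emeasure (Q2 z) A" .
    qed
    fix f :: "'a \<times> 'a \<Rightarrow> ennreal" assume fm: "f \<in> borel_measurable (N \<Otimes>\<^sub>M N)" and f1: "\<And>p. f p \<le> 1"
    have "(\<integral>\<^sup>+p. f p \<partial>R z) \<le> (\<integral>\<^sup>+p. 1 \<partial>R z)" by (intro nn_integral_mono f1)
    also have "\<dots> = c z"
      using Rtot[OF z] sets_eq_imp_space_eq[OF Rs[OF z]] by (simp add: space_pair_measure)
    finally show "(\<integral>\<^sup>+p. f p \<partial>\<kappa> z) \<le> (\<integral>\<^sup>+p. f p \<partial>L z) + (1 - emeasure (L z) (space N \<times> space N))"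
      unfolding int\<kappa>[OF z fm] c_def[symmetric] by (rule add_left_mono)
  qed
qed

section \<open>The weak Harris argument\<close>

lemma nn_integral_sqrt_mult_le:
  assumes f: "f \<in> borel_measurable M" "\<And>x. 0 \<le> f x" and g: "g \<in> borel_measurable M" "\<And>x. 0 \<le> g x"
    and A: "(\<integral>\<^sup>+x. ennreal (f x) \<partial>M) \<le> ennreal a" "0 \<le> a"
    and B: "(\<integral>\<^sup>+x. ennreal (g x) \<partial>M) \<le> ennreal b" "0 \<le> b"
  shows "(\<integral>\<^sup>+x. ennreal (sqrt (f x * g x)) \<partial>M) \<le> ennreal (sqrt (a * b))"
proof -
  define I where "I = (\<integral>\<^sup>+x. ennreal (sqrt (f x * g x)) \<partial>M)"
  have sq: "(ennreal (sqrt (h x)))\<^sup>2 = ennreal (h x)" if "\<And>x. 0 \<le> h x" for h :: "_ \<Rightarrow> real" and x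
    using that by (simp add: ennreal_power)
  have "I\<^sup>2 = (\<integral>\<^sup>+x. ennreal (sqrt (f x)) * ennreal (sqrt (g x)) \<partial>M)\<^sup>2"
    unfolding I_def using f g by (simp add: real_sqrt_mult ennreal_mult)
  also have "\<dots> \<le> (\<integral>\<^sup>+x. (ennreal (sqrt (f x)))\<^sup>2 \<partial>M) * (\<integral>\<^sup>+x. (ennreal (sqrt (g x)))\<^sup>2 \<partial>M)"
    using f g by (intro Cauchy_Schwarz_nn_integral) auto
  also have "\<dots> = (\<integral>\<^sup>+x. ennreal (f x) \<partial>M) * (\<integral>\<^sup>+x. ennreal (g x) \<partial>M)"
    by (simp add: sq f g)
  also have "\<dots> \<le> ennreal a * ennreal b" by (intro mult_mono A B) auto
  also have "\<dots> = (ennreal (sqrt (a * b)))\<^sup>2" using A(2) B(2) by (simp add: ennreal_power ennreal_mult)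
  finally have le: "I\<^sup>2 \<le> (ennreal (sqrt (a * b)))\<^sup>2" .
  have ab: "0 \<le> sqrt (a * b)" using A(2) B(2) by simp
  have "I \<le> ennreal (sqrt (a * b))"
  proof (cases I)
    case (real i)
    then have "i\<^sup>2 \<le> (sqrt (a * b))\<^sup>2" using le ab by (simp add: ennreal_power)
    then have "i \<le> sqrt (a * b)" using ab by (rule power2_le_imp_le)
    then show ?thesis using real by (simp add: ennreal_leI)
  next
    case top
    then show ?thesis using le ab by (simp add: ennreal_power power2_eq_square top_unique ennreal_mult_eq_top_iff)
  qed
  then show ?thesis unfolding I_def .
qed

text \<open>The three regimes of the weak Harris argument. By Cauchy--Schwarz the expected distance is at most
  the square root of the expectation of \<open>\<delta>\<^sub>0\<close> times that of the Lyapunov weight. For \<open>\<delta>\<^sub>0 < 1\<close> the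
  first factor contracts; for \<open>\<delta>\<^sub>0 = 1\<close> it drops to \<open>1 - e\<close> where the Lyapunov function is moderate, and
  elsewhere the second factor contracts. Taking \<open>\<beta>\<close> small makes the weight harmless in the first two
  regimes.\<close>

lemma weak_Harris_contraction:
  fixes \<kappa> :: "'a \<times> 'a \<Rightarrow> ('a \<times> 'a) measure" and W :: "'a \<Rightarrow> real" and \<delta>\<^sub>0 :: "'a \<Rightarrow> 'a \<Rightarrow> real" and K e :: real
  assumes c: "couples \<kappa> Q N"
    and W: "W \<in> borel_measurable N" "\<And>x. 0 \<le> W x"
    and d: "(\<lambda>(x, y). \<delta>\<^sub>0 x y) \<in> borel_measurable (N \<Otimes>\<^sub>M N)" "\<And>x y. 0 \<le> \<delta>\<^sub>0 x y" "\<And>x y. \<delta>\<^sub>0 x y \<le> 1"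
    and K: "0 \<le> K" and Lyapunov: "\<And>x. x \<in> space N \<Longrightarrow> (\<integral>\<^sup>+u. ennreal (W u) \<partial>Q x) \<le> ennreal (W x / 8 + K)"
    and near: "\<And>x y. x \<in> space N \<Longrightarrow> y \<in> space N \<Longrightarrow> \<delta>\<^sub>0 x y < 1 \<Longrightarrow>
      (\<integral>\<^sup>+(u, v). ennreal (\<delta>\<^sub>0 u v) \<partial>\<kappa> (x, y)) \<le> ennreal (\<delta>\<^sub>0 x y / 2)"
    and e: "0 < e" "e \<le> 1"
    and small: "\<And>x y. x \<in> space N \<Longrightarrow> y \<in> space N \<Longrightarrow> \<delta>\<^sub>0 x y = 1 \<Longrightarrow> W x + W y \<le> 8 * K + 8 \<Longrightarrow>
      (\<integral>\<^sup>+(u, v). ennreal (\<delta>\<^sub>0 u v) \<partial>\<kappa> (x, y)) \<le> ennreal (1 - e)"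
  obtains \<beta> \<rho> where "\<beta> > 0" "0 < \<rho>" "\<rho> < 1"
    "\<And>x y. x \<in> space N \<Longrightarrow> y \<in> space N \<Longrightarrow>
      (\<integral>\<^sup>+(u, v). ennreal (sqrt (\<delta>\<^sub>0 u v * (1 + \<beta> * W u + \<beta> * W v))) \<partial>\<kappa> (x, y))
        \<le> ennreal \<rho> * ennreal (sqrt (\<delta>\<^sub>0 x y * (1 + \<beta> * W x + \<beta> * W y)))"
proof -
  \<comment> \<open>\<open>\<beta>\<close> bounds the growth \<open>1 + 2 * \<beta> * K\<close> of the weight by \<open>1 + e\<close> and \<open>3 / 2\<close>. Far out, where
    \<open>s = \<beta> * (W x + W y)\<close> exceeds \<open>t\<^sub>0\<close>, the weight \<open>1 + s\<close> decreases at least by the factor \<open>r\<close>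
    that is attained at \<open>t\<^sub>0\<close>. The three terms of \<open>R\<close> belong to the three regimes.\<close>
  define \<beta> where "\<beta> = e / (4 * (K + 1))"
  define t\<^sub>0 where "t\<^sub>0 = \<beta> * (8 * K + 8)"
  define r where "r = (1 + 3 * t\<^sub>0 / 8) / (1 + t\<^sub>0)"
  define R where "R = max (3/4) (max (1 - e * e) r)"
  have \<beta>: "\<beta> > 0" unfolding \<beta>_def using K e by simp
  have \<beta>K: "2 * \<beta> * K \<le> e" "2 * \<beta> * K \<le> 1/2"
  proof -
    have "\<beta> * K \<le> \<beta> * (K + 1)" using \<beta> by (intro mult_left_mono) auto
    also have "\<dots> = e / 4" unfolding \<beta>_def using K by (simp add: field_simps)
    finally show "2 * \<beta> * K \<le> e" "2 * \<beta> * K \<le> 1/2" using e by auto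
  qed
  have t0: "t\<^sub>0 > 0" unfolding t\<^sub>0_def using \<beta> K by simp
  have r: "r < 1" "r \<ge> 3/8" "r * (1 + t\<^sub>0) = 1 + 3 * t\<^sub>0 / 8" unfolding r_def using t0 by (auto simp: field_simps)
  have R: "R < 1" "3/4 \<le> R" "1 - e * e \<le> R" "r \<le> R" unfolding R_def using r(1) e by auto
  show ?thesis
  proof (rule that[OF \<beta>, of "sqrt R"])
    show "0 < sqrt R" "sqrt R < 1" using R by auto
    fix x y assume xy: "x \<in> space N" "y \<in> space N"
    show "(\<integral>\<^sup>+(u, v). ennreal (sqrt (\<delta>\<^sub>0 u v * (1 + \<beta> * W u + \<beta> * W v))) \<partial>\<kappa> (x, y))
        \<le> ennreal (sqrt R) * ennreal (sqrt (\<delta>\<^sub>0 x y * (1 + \<beta> * W x + \<beta> * W y)))"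
    proof -
    define s where "s = \<beta> * (W x + W y)"
    have s0: "0 \<le> s" unfolding s_def using \<beta> W(2) by simp
    have sets: "sets (\<kappa> (x, y)) = sets (N \<Otimes>\<^sub>M N)" by (rule couplesD(5)[OF c xy])
    interpret k: prob_space "\<kappa> (x, y)" by (rule couplesD(4)[OF c xy])
    have mc: "measurable (\<kappa> (x, y)) borel = measurable (N \<Otimes>\<^sub>M N) borel" by (rule measurable_cong_sets[OF sets refl])
    have dm: "(\<lambda>p. \<delta>\<^sub>0 (fst p) (snd p)) \<in> borel_measurable (\<kappa> (x, y))"
      using d(1) unfolding mc by (simp add: case_prod_beta')
    have Wm: "(\<lambda>p. W (fst p)) \<in> borel_measurable (\<kappa> (x, y))" "(\<lambda>p. W (snd p)) \<in> borel_measurable (\<kappa> (x, y))"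
      unfolding mc using W(1) by measurable
    have weight: "(\<integral>\<^sup>+p. ennreal (1 + \<beta> * W (fst p) + \<beta> * W (snd p)) \<partial>\<kappa> (x, y)) \<le> ennreal (1 + 2 * \<beta> * K + s / 8)"
    proof -
      have "(\<integral>\<^sup>+p. ennreal (1 + \<beta> * W (fst p) + \<beta> * W (snd p)) \<partial>\<kappa> (x, y))
          = (\<integral>\<^sup>+p. 1 + (ennreal \<beta> * ennreal (W (fst p)) + ennreal \<beta> * ennreal (W (snd p))) \<partial>\<kappa> (x, y))"
        using \<beta> W(2) by (simp add: ennreal_plus ennreal_mult add.assoc)
      also have "\<dots> = 1 + (ennreal \<beta> * (\<integral>\<^sup>+u. ennreal (W u) \<partial>Q x) + ennreal \<beta> * (\<integral>\<^sup>+u. ennreal (W u) \<partial>Q y))"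
        using Wm W(1) couples_marginal_integral[OF c xy, of "\<lambda>u. ennreal (W u)"]
        by (simp add: nn_integral_add nn_integral_cmult k.emeasure_space_1)
      also have "\<dots> \<le> 1 + (ennreal \<beta> * ennreal (W x / 8 + K) + ennreal \<beta> * ennreal (W y / 8 + K))"
        by (intro add_mono mult_left_mono Lyapunov xy) auto
      also have "\<dots> = ennreal (1 + (\<beta> * (W x / 8 + K) + \<beta> * (W y / 8 + K)))"
        using \<beta> W(2) K by (simp add: ennreal_plus ennreal_mult)
      also have "1 + (\<beta> * (W x / 8 + K) + \<beta> * (W y / 8 + K)) = 1 + 2 * \<beta> * K + s / 8"
        unfolding s_def by (simp add: field_simps)
      finally show ?thesis .
    qed
    have CS: "(\<integral>\<^sup>+p. ennreal (sqrt (\<delta>\<^sub>0 (fst p) (snd p) * (1 + \<beta> * W (fst p) + \<beta> * W (snd p)))) \<partial>\<kappa> (x, y))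
        \<le> ennreal (sqrt (a * (1 + 2 * \<beta> * K + s / 8)))"
      if a: "(\<integral>\<^sup>+p. ennreal (\<delta>\<^sub>0 (fst p) (snd p)) \<partial>\<kappa> (x, y)) \<le> ennreal a" "0 \<le> a" for a
      by (rule nn_integral_sqrt_mult_le[OF dm d(2) _ _ a weight])
        (use \<beta> W(2) K s0 Wm in \<open>auto intro!: add_nonneg_nonneg mult_nonneg_nonneg\<close>)
    have fin: "(\<integral>\<^sup>+(u, v). ennreal (sqrt (\<delta>\<^sub>0 u v * (1 + \<beta> * W u + \<beta> * W v))) \<partial>\<kappa> (x, y))
        \<le> ennreal (sqrt R) * ennreal (sqrt (\<delta>\<^sub>0 x y * (1 + \<beta> * W x + \<beta> * W y)))"
      if a: "(\<integral>\<^sup>+p. ennreal (\<delta>\<^sub>0 (fst p) (snd p)) \<partial>\<kappa> (x, y)) \<le> ennreal a" "0 \<le> a"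
        and le: "a * (1 + 2 * \<beta> * K + s / 8) \<le> R * (\<delta>\<^sub>0 x y * (1 + s))" for a
    proof -
      have "sqrt (a * (1 + 2 * \<beta> * K + s / 8)) \<le> sqrt R * sqrt (\<delta>\<^sub>0 x y * (1 + s))"
        using le by (simp flip: real_sqrt_mult)
      then have "ennreal (sqrt (a * (1 + 2 * \<beta> * K + s / 8))) \<le> ennreal (sqrt R) * ennreal (sqrt (\<delta>\<^sub>0 x y * (1 + s)))"
        using R(2) d(2) s0 by (simp flip: ennreal_mult add: ennreal_leI)
      moreover have "1 + \<beta> * W x + \<beta> * W y = 1 + s" unfolding s_def by (simp add: distrib_left)
      ultimately show ?thesis using order_trans[OF CS[OF a]] by (simp only: case_prod_beta')
    qed
    have bal: "1 + 2 * \<beta> * K + s / 8 \<le> (1 + 2 * \<beta> * K) * (1 + s)"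
    proof -
      have "0 \<le> 2 * \<beta> * K * s" using \<beta> K s0 by simp
      then show ?thesis using s0 by (simp add: field_simps)
    qed
    show ?thesis
    proof (cases "\<delta>\<^sub>0 x y < 1")
      case True
      show ?thesis
      proof (rule fin)
        show "(\<integral>\<^sup>+p. ennreal (\<delta>\<^sub>0 (fst p) (snd p)) \<partial>\<kappa> (x, y)) \<le> ennreal (\<delta>\<^sub>0 x y / 2)"
          using near[OF xy True] by (simp add: case_prod_beta')
        show "0 \<le> \<delta>\<^sub>0 x y / 2" using d(2) by simp
        have "\<delta>\<^sub>0 x y / 2 * (1 + 2 * \<beta> * K + s / 8) \<le> \<delta>\<^sub>0 x y / 2 * ((3/2) * (1 + s))"
          using bal \<beta>K(2) s0 d(2) by (intro mult_left_mono) (auto intro: order_trans[OF bal] mult_right_mono)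
        also have "\<dots> = 3/4 * (\<delta>\<^sub>0 x y * (1 + s))" by simp
        also have "\<dots> \<le> R * (\<delta>\<^sub>0 x y * (1 + s))" using R(2) d(2) s0 by (intro mult_right_mono) auto
        finally show "\<delta>\<^sub>0 x y / 2 * (1 + 2 * \<beta> * K + s / 8) \<le> R * (\<delta>\<^sub>0 x y * (1 + s))" .
      qed
    next
      case False
      then have d1: "\<delta>\<^sub>0 x y = 1" using d(3)[of x y] by simp
      show ?thesis
      proof (cases "W x + W y \<le> 8 * K + 8")
        case True
        show ?thesis
        proof (rule fin)
          show "(\<integral>\<^sup>+p. ennreal (\<delta>\<^sub>0 (fst p) (snd p)) \<partial>\<kappa> (x, y)) \<le> ennreal (1 - e)"
            using small[OF xy d1 True] by (simp add: case_prod_beta')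
          show "0 \<le> 1 - e" using e by simp
          have "(1 - e) * (1 + 2 * \<beta> * K + s / 8) \<le> (1 - e) * ((1 + e) * (1 + s))"
            using \<beta>K(1) s0 e by (intro mult_left_mono) (auto intro: order_trans[OF bal] mult_right_mono)
          also have "\<dots> = (1 - e * e) * (1 + s)" by (simp add: field_simps)
          also have "\<dots> \<le> R * (1 + s)" using R(3) s0 by (intro mult_right_mono) auto
          finally show "(1 - e) * (1 + 2 * \<beta> * K + s / 8) \<le> R * (\<delta>\<^sub>0 x y * (1 + s))" using d1 by simp
        qed
      next
        case False
        show ?thesis
        proof (rule fin)
          have "(\<integral>\<^sup>+p. ennreal (\<delta>\<^sub>0 (fst p) (snd p)) \<partial>\<kappa> (x, y)) \<le> (\<integral>\<^sup>+p. 1 \<partial>\<kappa> (x, y))"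
            using d(3) by (intro nn_integral_mono) (metis ennreal_1 ennreal_leI)
          then show "(\<integral>\<^sup>+p. ennreal (\<delta>\<^sub>0 (fst p) (snd p)) \<partial>\<kappa> (x, y)) \<le> ennreal 1" by (simp add: k.emeasure_space_1)
          have st: "s \<ge> t\<^sub>0" unfolding s_def t\<^sub>0_def using False \<beta> by (intro mult_left_mono) auto
          have "2 * \<beta> * K \<le> t\<^sub>0 / 4" unfolding t\<^sub>0_def using \<beta> by (simp add: field_simps)
          then have "1 + 2 * \<beta> * K + s / 8 \<le> 1 + 3 * s / 8" using st by (simp add: field_simps)
          also have "\<dots> = (1 + 3 * t\<^sub>0 / 8) + 3/8 * (s - t\<^sub>0)" by (simp add: field_simps)
          also have "\<dots> \<le> r * (1 + t\<^sub>0) + r * (s - t\<^sub>0)"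
            unfolding r(3) using r(2) st by (intro add_left_mono mult_right_mono) auto
          also have "\<dots> = r * (1 + s)" by (simp add: field_simps)
          also have "\<dots> \<le> R * (1 + s)" using R(4) s0 by (intro mult_right_mono) auto
          finally show "1 * (1 + 2 * \<beta> * K + s / 8) \<le> R * (\<delta>\<^sub>0 x y * (1 + s))" using d1 by simp
        qed simp
      qed
    qed
    qed
  qed
qed

text \<open>Since \<open>\<delta>\<^sub>0\<close> does not increase on average in any step (where it equals 1 this is its upper bound),
  the gain of the first step survives.\<close>

lemma iterated_coupling:
  fixes P :: "real \<Rightarrow> 'a \<Rightarrow> 'a measure" and \<delta>\<^sub>0 :: "'a \<Rightarrow> 'a \<Rightarrow> real"
  assumes T: "T \<ge> 0" and P: "\<And>t. t \<ge> 0 \<Longrightarrow> P t \<in> N \<rightarrow>\<^sub>M prob_algebra N"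
    and CK: "\<And>s t x. s \<ge> 0 \<Longrightarrow> t \<ge> 0 \<Longrightarrow> P (s + t) x = P s x \<bind> P t"
    and c: "couples \<kappa> (P T) N"
    and d: "(\<lambda>(x, y). \<delta>\<^sub>0 x y) \<in> borel_measurable (N \<Otimes>\<^sub>M N)" "\<And>x y. 0 \<le> \<delta>\<^sub>0 x y" "\<And>x y. \<delta>\<^sub>0 x y \<le> 1"
    and near: "\<And>x y. x \<in> space N \<Longrightarrow> y \<in> space N \<Longrightarrow> \<delta>\<^sub>0 x y < 1 \<Longrightarrow>
      (\<integral>\<^sup>+(u, v). ennreal (\<delta>\<^sub>0 u v) \<partial>\<kappa> (x, y)) \<le> ennreal (\<delta>\<^sub>0 x y / 2)"
  shows "\<exists>\<kappa>'. couples \<kappa>' (P (real (Suc m) * T)) N \<and>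
    (\<forall>x\<in>space N. \<forall>y\<in>space N. \<delta>\<^sub>0 x y < 1 \<longrightarrow>
      (\<integral>\<^sup>+(u, v). ennreal (\<delta>\<^sub>0 u v) \<partial>\<kappa>' (x, y)) \<le> ennreal (\<delta>\<^sub>0 x y / 2))"
proof (induction m)
  case 0
  show ?case using c near by (intro exI[of _ \<kappa>]) simp
next
  case (Suc m)
  then obtain \<kappa>' where k': "couples \<kappa>' (P (real (Suc m) * T)) N"
    and near': "\<And>x y. x \<in> space N \<Longrightarrow> y \<in> space N \<Longrightarrow> \<delta>\<^sub>0 x y < 1 \<Longrightarrow>
      (\<integral>\<^sup>+(u, v). ennreal (\<delta>\<^sub>0 u v) \<partial>\<kappa>' (x, y)) \<le> ennreal (\<delta>\<^sub>0 x y / 2)" by blast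
  have T': "0 \<le> real (Suc m) * T" using T by simp
  have dm: "(\<lambda>(x, y). ennreal (\<delta>\<^sub>0 x y)) \<in> borel_measurable (N \<Otimes>\<^sub>M N)"
    using measurable_compose[OF d(1) measurable_ennreal] by (simp add: case_prod_beta')
  have nonexp: "(\<integral>\<^sup>+(u, v). ennreal (\<delta>\<^sub>0 u v) \<partial>\<kappa>' (x, y)) \<le> ennreal (\<delta>\<^sub>0 x y)"
    if xy: "x \<in> space N" "y \<in> space N" for x y
  proof (cases "\<delta>\<^sub>0 x y < 1")
    case True
    have "ennreal (\<delta>\<^sub>0 x y / 2) \<le> ennreal (\<delta>\<^sub>0 x y)" using d(2)[of x y] by (intro ennreal_leI) simp
    then show ?thesis using near'[OF xy True] by (rule order_trans[rotated])
  next
    case False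
    interpret k: prob_space "\<kappa>' (x, y)" by (rule couplesD(4)[OF k' xy])
    have "(\<integral>\<^sup>+(u, v). ennreal (\<delta>\<^sub>0 u v) \<partial>\<kappa>' (x, y)) \<le> (\<integral>\<^sup>+p. 1 \<partial>\<kappa>' (x, y))"
      using d(3) by (intro nn_integral_mono) (auto simp: ennreal_le_1)
    also have "\<dots> = ennreal (\<delta>\<^sub>0 x y)"
    proof -
      have "\<delta>\<^sub>0 x y = 1" using False d(3)[of x y] by simp
      then show ?thesis by (simp add: k.emeasure_space_1)
    qed
    finally show ?thesis .
  qed
  have "P (real (Suc (Suc m)) * T) x = P T x \<bind> P (real (Suc m) * T)" for x
    using CK[OF T T', of x] by (simp add: algebra_simps)
  then have "couples (\<lambda>z. \<kappa> z \<bind> \<kappa>') (P (real (Suc (Suc m)) * T)) N"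
    using couples_cong[OF couples_bind[OF c k' P[OF T']]] by simp
  moreover have "(\<integral>\<^sup>+(u, v). ennreal (\<delta>\<^sub>0 u v) \<partial>(\<kappa> (x, y) \<bind> \<kappa>')) \<le> ennreal (\<delta>\<^sub>0 x y / 2)"
    if xy: "x \<in> space N" "y \<in> space N" and lt: "\<delta>\<^sub>0 x y < 1" for x y
  proof -
    have sp: "space (\<kappa> (x, y)) = space (N \<Otimes>\<^sub>M N)" by (rule sets_eq_imp_space_eq[OF couplesD(5)[OF c xy]])
    have "(\<integral>\<^sup>+(u, v). ennreal (\<delta>\<^sub>0 u v) \<partial>(\<kappa> (x, y) \<bind> \<kappa>'))
        = (\<integral>\<^sup>+q. \<integral>\<^sup>+(u, v). ennreal (\<delta>\<^sub>0 u v) \<partial>\<kappa>' q \<partial>\<kappa> (x, y))"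
      by (rule couples_bind_nn_integral[OF c k' dm xy])
    also have "\<dots> \<le> (\<integral>\<^sup>+(u, v). ennreal (\<delta>\<^sub>0 u v) \<partial>\<kappa> (x, y))"
      by (rule nn_integral_mono) (auto simp: sp space_pair_measure intro: nonexp)
    also have "\<dots> \<le> ennreal (\<delta>\<^sub>0 x y / 2)" by (rule near[OF xy lt])
    finally show ?thesis .
  qed
  ultimately show ?case by (intro exI[of _ "\<lambda>z. \<kappa> z \<bind> \<kappa>'"]) blast
qed

text \<open>With probability at least \<open>p * p\<close> both components are in \<open>B\<close>, which gains \<open>1 / 2\<close>.\<close>

lemma independent_coupling_small:
  fixes \<delta>\<^sub>0 :: "'a \<Rightarrow> 'a \<Rightarrow> real"
  assumes \<mu>: "prob_space \<mu>" "prob_space \<nu>"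
    and B: "B \<in> sets \<mu>" "B \<in> sets \<nu>"
    and p: "ennreal p \<le> emeasure \<mu> B" "ennreal p \<le> emeasure \<nu> B" "0 \<le> p"
    and d: "\<And>x y. \<delta>\<^sub>0 x y \<le> 1" "\<And>x y. x \<in> B \<Longrightarrow> y \<in> B \<Longrightarrow> \<delta>\<^sub>0 x y \<le> 1/2"
  shows "(\<integral>\<^sup>+(u, v). ennreal (\<delta>\<^sub>0 u v) \<partial>(\<mu> \<Otimes>\<^sub>M \<nu>)) \<le> ennreal (1 - p * p / 2)"
proof -
  interpret X: prob_space \<mu> by fact
  interpret Y: prob_space \<nu> by fact
  interpret XY: pair_prob_space \<mu> \<nu> ..
  have m: "B \<times> B \<in> sets (\<mu> \<Otimes>\<^sub>M \<nu>)" using B by (rule pair_measureI)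
  have p': "p \<le> measure \<mu> B" "p \<le> measure \<nu> B"
    using p by (auto simp: X.emeasure_eq_measure Y.emeasure_eq_measure)
  have "emeasure (\<mu> \<Otimes>\<^sub>M \<nu>) (B \<times> B) = ennreal (measure \<mu> B * measure \<nu> B)"
    using Y.emeasure_pair_measure_Times[OF B] by (simp add: X.emeasure_eq_measure Y.emeasure_eq_measure ennreal_mult)
  then have "measure (\<mu> \<Otimes>\<^sub>M \<nu>) (B \<times> B) = measure \<mu> B * measure \<nu> B" by (simp add: measure_def)
  then have pp: "p * p \<le> measure (\<mu> \<Otimes>\<^sub>M \<nu>) (B \<times> B)" using p' p(3) by (simp add: mult_mono)
  have "(\<integral>\<^sup>+(u, v). ennreal (\<delta>\<^sub>0 u v) \<partial>(\<mu> \<Otimes>\<^sub>M \<nu>)) \<le> (\<integral>\<^sup>+q. ennreal (1 - indicator (B \<times> B) q / 2) \<partial>(\<mu> \<Otimes>\<^sub>M \<nu>))"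
  proof (rule nn_integral_mono)
    fix q
    have "\<delta>\<^sub>0 (fst q) (snd q) \<le> 1 - indicator (B \<times> B) q / 2" using d by (cases q) (simp add: indicator_def)
    then show "(case q of (u, v) \<Rightarrow> ennreal (\<delta>\<^sub>0 u v)) \<le> ennreal (1 - indicator (B \<times> B) q / 2)"
      by (simp add: case_prod_beta' ennreal_leI)
  qed
  also have "\<dots> = ennreal (\<integral>q. 1 - indicator (B \<times> B) q / 2 \<partial>(\<mu> \<Otimes>\<^sub>M \<nu>))"
  proof (rule nn_integral_eq_integral)
    show "integrable (\<mu> \<Otimes>\<^sub>M \<nu>) (\<lambda>q. 1 - indicat_real (B \<times> B) q / 2)"
      using m by (intro Bochner_Integration.integrable_diff integrable_divide_zero integrable_real_indicator)
        (auto simp: XY.emeasure_eq_measure)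
    show "AE q in \<mu> \<Otimes>\<^sub>M \<nu>. 0 \<le> 1 - indicat_real (B \<times> B) q / 2"
      by (intro AE_I2) (simp add: indicator_def)
  qed
  also have "(\<integral>q. 1 - indicator (B \<times> B) q / 2 \<partial>(\<mu> \<Otimes>\<^sub>M \<nu>)) = 1 - measure (\<mu> \<Otimes>\<^sub>M \<nu>) (B \<times> B) / 2"
    using m by (subst Bochner_Integration.integral_diff) (auto simp: XY.prob_space XY.emeasure_eq_measure)
  also have "ennreal \<dots> \<le> ennreal (1 - p * p / 2)" using pp by (intro ennreal_leI) simp
  finally show ?thesis .
qed

section \<open>Couplings by randomly chosen shifts\<close>

text \<open>A partition of unity as increments of a running maximum: unlike normalisation by the sum it
  keeps Lipschitz bounds without a lower bound on the sum.\<close>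

fun running_max :: "(nat \<Rightarrow> real) \<Rightarrow> nat \<Rightarrow> real" where
  "running_max b 0 = 0"
| "running_max b (Suc n) = max (running_max b n) (b n)"

definition max_increment :: "(nat \<Rightarrow> real) \<Rightarrow> nat \<Rightarrow> real" where
  "max_increment b n = running_max b (Suc n) - running_max b n"

lemma running_max_nonneg: "0 \<le> running_max b n" by (induction n) auto

lemma running_max_le_1: "(\<And>i. i < n \<Longrightarrow> b i \<le> 1) \<Longrightarrow> running_max b n \<le> 1" by (induction n) auto

lemma running_max_eq_1: "(\<And>i. i < n \<Longrightarrow> b i \<le> 1) \<Longrightarrow> i < n \<Longrightarrow> b i = 1 \<Longrightarrow> running_max b n = 1"
proof (induction n)
  case (Suc n)
  have "running_max b (Suc n) \<le> 1" using Suc.prems(1) by (intro running_max_le_1)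
  moreover have "1 \<le> running_max b (Suc n)" using Suc by (cases "i = n") auto
  ultimately show ?case by (rule antisym)
qed simp

lemma max_increment_nonneg: "0 \<le> max_increment b n" unfolding max_increment_def by simp

lemma max_increment_le: "0 \<le> b n \<Longrightarrow> max_increment b n \<le> b n"
  unfolding max_increment_def using running_max_nonneg[of b n] by auto

lemma max_increment_sum: "(\<Sum>i<n. max_increment b i) = running_max b n"
  unfolding max_increment_def using sum_lessThan_telescope[of "running_max b" n] by simp

lemma max_increment_eq_0:
  assumes "\<And>i. i \<le> n \<Longrightarrow> b i \<le> 1" "i < n" "b i = 1" shows "max_increment b n = 0"
  using running_max_eq_1[of n b i] assms unfolding max_increment_def by simp

lemma running_max_Lipschitz:
  "0 \<le> c \<Longrightarrow> (\<And>i. i < n \<Longrightarrow> \<bar>b i - b' i\<bar> \<le> c) \<Longrightarrow> \<bar>running_max b n - running_max b' n\<bar> \<le> c"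
proof (induction n)
  case (Suc n)
  have "\<bar>running_max b n - running_max b' n\<bar> \<le> c" "\<bar>b n - b' n\<bar> \<le> c" using Suc by auto
  then show ?case by (auto simp: max_def abs_le_iff)
qed simp

lemma max_increment_Lipschitz:
  assumes "0 \<le> c" "\<And>i. i \<le> n \<Longrightarrow> \<bar>b i - b' i\<bar> \<le> c"
  shows "\<bar>max_increment b n - max_increment b' n\<bar> \<le> 2 * c"
proof -
  have "\<bar>running_max b n - running_max b' n\<bar> \<le> c" "\<bar>running_max b (Suc n) - running_max b' (Suc n)\<bar> \<le> c"
    by (rule running_max_Lipschitz[OF assms(1)], rule assms(2), simp)+
  then show ?thesis unfolding max_increment_def by linarith
qed

lemma running_max_measurable:
  assumes "\<And>i. i < n \<Longrightarrow> (\<lambda>x. b x i) \<in> borel_measurable M"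
  shows "(\<lambda>x. running_max (b x) n) \<in> borel_measurable M"
  using assms
proof (induction n)
  case (Suc n)
  then have "(\<lambda>x. running_max (b x) n) \<in> borel_measurable M" "(\<lambda>x. b x n) \<in> borel_measurable M" by auto
  then show ?case by simp
qed simp

lemma max_increment_measurable:
  assumes "\<And>i. i \<le> n \<Longrightarrow> (\<lambda>x. b x i) \<in> borel_measurable M"
  shows "(\<lambda>x. max_increment (b x) n) \<in> borel_measurable M"
  unfolding max_increment_def
  by (intro borel_measurable_diff running_max_measurable) (use assms in auto)

context wiener_space
begin

text \<open>A finite rank operator into the range of \<open>\<iota>\<^sup>*\<close> together with the functionals that represent
  its values, depending measurably on the argument.\<close>

definition admissible_control :: "('k::{real_inner, banach, second_countable_topology} \<Rightarrow>\<^sub>L 'w) \<Rightarrow> ('k \<Rightarrow> 'e \<Rightarrow> real) \<Rightarrow> bool" where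
  "admissible_control A l \<longleftrightarrow>
    (\<forall>v. l v \<in> dual_on E \<and> is_adjoint_image HW \<iota> (l v) (blinfun_apply A v)) \<and>
    (\<lambda>(v, \<omega>). l v \<omega>) \<in> borel_measurable (borel \<Otimes>\<^sub>M \<gamma>) \<and>
    (\<exists>B. finite B \<and> B \<subseteq> adjoint_range E HW \<iota> \<and> range (blinfun_apply A) \<subseteq> span B)"

lemma admissible_control_zero: "admissible_control 0 (\<lambda>_ _. 0)"
  unfolding admissible_control_def is_adjoint_image_def
  using dual_on_zero subspace_0[OF subspaces(2)] by (auto intro!: exI[of _ "{}"])

lemma admissible_control_functional: "admissible_control A l \<Longrightarrow> wiener_functional E HW \<iota> \<gamma> (l v) (blinfun_apply A v)"
  unfolding admissible_control_def by unfold_locales auto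

lemma admissible_control_in: "admissible_control A l \<Longrightarrow> blinfun_apply A v \<in> HW"
  unfolding admissible_control_def is_adjoint_image_def by blast

lemma \<iota>_bound: obtains C where "C \<ge> 0" "\<And>k. k \<in> HW \<Longrightarrow> norm (\<iota> k) \<le> C * norm k"
proof -
  obtain B where B: "\<And>k. k \<in> HW \<Longrightarrow> norm (\<iota> k) \<le> B * norm k"
    using \<iota>_bounded_linear unfolding bounded_linear_on_def by blast
  have "norm (\<iota> k) \<le> \<bar>B\<bar> * norm k" if "k \<in> HW" for k
    using B[OF that] by (rule order_trans) (intro mult_right_mono; simp)
  then show ?thesis using that[of "\<bar>B\<bar>"] by simp
qed

lemma control_shift_measurable:
  assumes A: "admissible_control A l" and v: "v \<in> N \<rightarrow>\<^sub>M borel" and w: "w \<in> N \<rightarrow>\<^sub>M \<gamma>"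
  shows "(\<lambda>x. w x + c *\<^sub>R \<iota> (blinfun_apply A (v x))) \<in> N \<rightarrow>\<^sub>M \<gamma>"
proof (rule measurable_add[OF w _ subspaces(1)])
  have "continuous_on UNIV (\<lambda>a. c *\<^sub>R \<iota> (blinfun_apply A a))"
    using admissible_control_in[OF A]
    by (intro continuous_on_scaleR continuous_on_const
        continuous_on_compose2[OF bounded_linear_on_continuous[OF \<iota>_bounded_linear subspaces(2)]]
        blinfun.continuous_on continuous_on_id) auto
  then have "(\<lambda>a. c *\<^sub>R \<iota> (blinfun_apply A a)) \<in> borel \<rightarrow>\<^sub>M \<gamma>"
    using \<iota>_range[OF admissible_control_in[OF A]] subspaces(1)
    by (intro measurable_into borel_measurable_continuous_onI) (auto intro: subspace_scale)
  then show "(\<lambda>x. c *\<^sub>R \<iota> (blinfun_apply A (v x))) \<in> N \<rightarrow>\<^sub>M \<gamma>" using v by (rule measurable_compose[rotated])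
qed

end

context wiener_functional
begin

lemma shift_pm_measurable: "(\<lambda>w. w + \<iota> h) \<in> \<gamma> \<rightarrow>\<^sub>M \<gamma>" "(\<lambda>w. w - \<iota> h) \<in> \<gamma> \<rightarrow>\<^sub>M \<gamma>"
  using shift_measurable[of "\<lambda>w. w" \<gamma> "\<lambda>_. 1"] shift_measurable[of "\<lambda>w. w" \<gamma> "\<lambda>_. -1"] by simp_all

lemma Cameron_Martin_back:
  assumes g: "g \<in> borel_measurable \<gamma>"
  shows "(\<integral>\<^sup>+w. g (w - \<iota> h) * ennreal (cm_density w) \<partial>\<gamma>) = (\<integral>\<^sup>+w. g w \<partial>\<gamma>)"
  using Cameron_Martin[OF measurable_compose[OF shift_pm_measurable(2) g]] by simp

text \<open>The density of the part of the shifted weighted measure that lies below the weighted measure.\<close>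

definition overlap :: "('e \<Rightarrow> real) \<Rightarrow> 'e \<Rightarrow> real" where
  "overlap \<psi> w = min (\<psi> (w - \<iota> h) * cm_density w) (\<psi> w)"

text \<open>The loss has two sources: the variation of \<open>\<psi>\<close> along the shift, bounded by \<open>\<Lambda>\<close>, and the distance
  of the density from 1.\<close>

lemma overlap_deficit:
  assumes \<psi>[measurable]: "\<psi> \<in> borel_measurable \<gamma>" and b: "\<And>w. 0 \<le> \<psi> w" "\<And>w. \<psi> w \<le> 1"
    and Lip: "\<And>w. w \<in> E \<Longrightarrow> \<bar>\<psi> (w - \<iota> h) - \<psi> w\<bar> \<le> \<Lambda>" "0 \<le> \<Lambda>" and h: "norm h \<le> 1"
  shows "(\<integral>\<^sup>+w. ennreal (\<psi> w) \<partial>\<gamma>) \<le> (\<integral>\<^sup>+w. ennreal (overlap \<psi> w) \<partial>\<gamma>) + ennreal (\<Lambda> + 2 * norm h)"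
proof -
  have [measurable]: "(\<lambda>w. \<psi> (w - \<iota> h)) \<in> borel_measurable \<gamma>" by (rule measurable_compose[OF shift_pm_measurable(2) \<psi>])
  have [measurable]: "overlap \<psi> \<in> borel_measurable \<gamma>" unfolding overlap_def by measurable
  have "(\<integral>\<^sup>+w. ennreal (\<psi> w) \<partial>\<gamma>)
      \<le> (\<integral>\<^sup>+w. ennreal (overlap \<psi> w) + (ennreal \<Lambda> * ennreal (cm_density w) + ennreal \<bar>cm_density w - 1\<bar>) \<partial>\<gamma>)"
  proof (rule nn_integral_mono)
    fix w assume "w \<in> space \<gamma>"
    then have w: "w \<in> E" by (simp add: space_eq)
    have p: "0 \<le> cm_density w" by (rule cm_density_nonneg)
    have "\<psi> w - \<psi> (w - \<iota> h) * cm_density w = \<psi> w * (1 - cm_density w) + (\<psi> w - \<psi> (w - \<iota> h)) * cm_density w"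
      by (simp add: algebra_simps)
    also have "\<psi> w * (1 - cm_density w) \<le> 1 * \<bar>cm_density w - 1\<bar>"
    proof -
      have "\<psi> w * (1 - cm_density w) \<le> \<psi> w * \<bar>cm_density w - 1\<bar>" using b(1)[of w] by (intro mult_left_mono) auto
      also have "\<dots> \<le> 1 * \<bar>cm_density w - 1\<bar>" using b(2)[of w] by (intro mult_right_mono) auto
      finally show ?thesis .
    qed
    also have "(\<psi> w - \<psi> (w - \<iota> h)) * cm_density w \<le> \<Lambda> * cm_density w"
      using Lip(1)[OF w] p by (intro mult_right_mono) auto
    finally have "\<psi> w \<le> overlap \<psi> w + (\<Lambda> * cm_density w + \<bar>cm_density w - 1\<bar>)"
      unfolding overlap_def using p Lip(2) by (auto simp: min_def)
    then have "ennreal (\<psi> w) \<le> ennreal (overlap \<psi> w + (\<Lambda> * cm_density w + \<bar>cm_density w - 1\<bar>))" by (rule ennreal_leI)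
    also have "\<dots> = ennreal (overlap \<psi> w) + (ennreal \<Lambda> * ennreal (cm_density w) + ennreal \<bar>cm_density w - 1\<bar>)"
      using b p Lip(2) by (simp add: overlap_def ennreal_plus ennreal_mult)
    finally show "ennreal (\<psi> w) \<le> ennreal (overlap \<psi> w) + (ennreal \<Lambda> * ennreal (cm_density w) + ennreal \<bar>cm_density w - 1\<bar>)" .
  qed
  also have "\<dots> = (\<integral>\<^sup>+w. ennreal (overlap \<psi> w) \<partial>\<gamma>)
      + (ennreal \<Lambda> * (\<integral>\<^sup>+w. ennreal (cm_density w) \<partial>\<gamma>) + (\<integral>\<^sup>+w. ennreal \<bar>cm_density w - 1\<bar> \<partial>\<gamma>))"
    by (simp add: nn_integral_add nn_integral_cmult)
  also have "\<dots> \<le> (\<integral>\<^sup>+w. ennreal (overlap \<psi> w) \<partial>\<gamma>) + (ennreal \<Lambda> * 1 + ennreal (2 * norm h))"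
    unfolding cm_density_integral by (intro add_mono order_refl cm_density_L1 h)
  also have "\<dots> = (\<integral>\<^sup>+w. ennreal (overlap \<psi> w) \<partial>\<gamma>) + ennreal (\<Lambda> + 2 * norm h)"
    using Lip(2) by (simp add: ennreal_plus)
  finally show ?thesis .
qed

end

text \<open>Instead of a shift \<open>\<omega> \<mapsto> \<omega> + \<iota> h(\<omega>)\<close> with \<open>h\<close> depending on \<open>\<omega>\<close>, whose image measure would be
  hard to compare with \<open>\<gamma>\<close>, one of finitely many constant shifts is chosen at random with
  probabilities \<open>\<psi>\<^sub>j(\<omega>)\<close>. The part of the \<open>j\<close>-th shifted measure that stays below \<open>\<psi>\<^sub>j \<gamma>\<close> defines a
  sub-coupling, and its missing mass is of the order of the shift.\<close>

lemma (in wiener_space) control_coupling: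
  fixes \<Phi> :: "'h::{real_inner, banach, second_countable_topology} \<Rightarrow> 'e \<Rightarrow> 'h"
    and emb :: "'h \<Rightarrow>\<^sub>L 'k::{real_inner, banach, second_countable_topology}"
    and A :: "nat \<Rightarrow> 'k \<Rightarrow>\<^sub>L 'w" and l :: "nat \<Rightarrow> 'k \<Rightarrow> 'e \<Rightarrow> real"
  assumes \<Phi>: "(\<lambda>(x, \<omega>). \<Phi> x \<omega>) \<in> borel \<Otimes>\<^sub>M \<gamma> \<rightarrow>\<^sub>M borel" and Q: "\<And>x. distr \<gamma> borel (\<Phi> x) = Q x"
    and A: "\<And>j. j < n \<Longrightarrow> admissible_control (A j) (l j)"
    and \<psi>: "\<And>j. j < n \<Longrightarrow> (\<lambda>(z, \<omega>). \<psi> j z \<omega>) \<in> borel_measurable ((borel \<Otimes>\<^sub>M borel) \<Otimes>\<^sub>M \<gamma>)"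
    and \<psi>b: "\<And>j z \<omega>. j < n \<Longrightarrow> 0 \<le> \<psi> j z \<omega>" "\<And>j z \<omega>. j < n \<Longrightarrow> \<psi> j z \<omega> \<le> 1"
    and \<psi>1: "\<And>z \<omega>. \<omega> \<in> E \<Longrightarrow> (\<Sum>j<n. \<psi> j z \<omega>) = 1"
  obtains \<kappa> where "couples \<kappa> Q borel"
    "\<And>x y f u w \<Lambda>. f \<in> borel_measurable (borel \<Otimes>\<^sub>M borel) \<Longrightarrow> (\<And>p. f p \<le> 1) \<Longrightarrow> u \<in> borel_measurable borel \<Longrightarrow>
      (\<And>j. j < n \<Longrightarrow> w j \<in> borel_measurable \<gamma>) \<Longrightarrow>
      (\<And>j \<omega>. j < n \<Longrightarrow> \<omega> \<in> E \<Longrightarrow> f (\<Phi> x \<omega>, \<Phi> y (\<omega> + \<iota> (A j (emb (y - x)))))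
        \<le> u (\<Phi> x \<omega>) + u (\<Phi> y (\<omega> + \<iota> (A j (emb (y - x))))) + w j \<omega>) \<Longrightarrow>
      (\<And>j. j < n \<Longrightarrow> norm (A j (emb (y - x))) \<le> 1) \<Longrightarrow> (\<And>j. j < n \<Longrightarrow> 0 \<le> \<Lambda> j) \<Longrightarrow>
      (\<And>j \<omega>. j < n \<Longrightarrow> \<omega> \<in> E \<Longrightarrow> \<bar>\<psi> j (x, y) (\<omega> - \<iota> (A j (emb (y - x)))) - \<psi> j (x, y) \<omega>\<bar> \<le> \<Lambda> j) \<Longrightarrow>
      (\<integral>\<^sup>+p. f p \<partial>\<kappa> (x, y)) \<le> (\<integral>\<^sup>+a. u a \<partial>Q x) + (\<integral>\<^sup>+a. u a \<partial>Q y)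
        + (\<Sum>j<n. \<integral>\<^sup>+\<omega>. ennreal (\<psi> j (x, y) \<omega>) * w j \<omega> \<partial>\<gamma>)
        + (\<Sum>j<n. ennreal (\<Lambda> j + 2 * norm (A j (emb (y - x)))))"
proof -
  define Z where "Z = (borel :: 'h measure) \<Otimes>\<^sub>M (borel :: 'h measure)"
  have spZ: "space Z = UNIV" unfolding Z_def by (simp add: space_pair_measure)
  define v where "v z = emb (snd z - fst z)" for z
  define h where "h j z = \<iota> (A j (v z))" for j z
  define m where "m j z = wiener_functional.overlap \<iota> (l j (v z)) (A j (v z)) (\<psi> j z)" for j z
  have WF: "wiener_functional E HW \<iota> \<gamma> (l j (v z)) (A j (v z))" if "j < n" for j z
    by (rule admissible_control_functional[OF A[OF that]])
  have m_def': "m j z w = min (\<psi> j z (w - h j z) * exp (l j (v z) w - (norm (A j (v z)))\<^sup>2 / 2)) (\<psi> j z w)"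
    if "j < n" for j z w
    unfolding m_def wiener_functional.overlap_def[OF WF[OF that]] wiener_functional.cm_density_def[OF WF[OF that]] h_def ..
  have vm[measurable]: "v \<in> Z \<rightarrow>\<^sub>M borel" unfolding v_def Z_def
    by (rule borel_measurable_continuous_on[OF blinfun.continuous_on[OF continuous_on_const continuous_on_id]]) measurable
  have sm: "(\<lambda>p. snd p - h j (fst p)) \<in> Z \<Otimes>\<^sub>M \<gamma> \<rightarrow>\<^sub>M \<gamma>" if "j < n" for j
    using control_shift_measurable[OF A[OF that], of "\<lambda>p. v (fst p)" "Z \<Otimes>\<^sub>M \<gamma>" snd "-1"] unfolding h_def by simp
  have hE: "h j z \<in> E" if "j < n" for j z unfolding h_def by (rule \<iota>_range[OF admissible_control_in[OF A[OF that]]])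
  have lm: "(\<lambda>p. l j (v (fst p)) (snd p)) \<in> borel_measurable (Z \<Otimes>\<^sub>M \<gamma>)" if "j < n" for j
  proof -
    have "(\<lambda>p. (v (fst p), snd p)) \<in> Z \<Otimes>\<^sub>M \<gamma> \<rightarrow>\<^sub>M borel \<Otimes>\<^sub>M \<gamma>" by measurable
    moreover have "(\<lambda>(v, \<omega>). l j v \<omega>) \<in> borel_measurable (borel \<Otimes>\<^sub>M \<gamma>)" using A[OF that] unfolding admissible_control_def by blast
    ultimately show ?thesis using measurable_compose by fastforce
  qed
  have \<psi>m: "(\<lambda>p. \<psi> j (fst p) (snd p)) \<in> borel_measurable (Z \<Otimes>\<^sub>M \<gamma>)" if "j < n" for j
    using \<psi>[OF that] unfolding Z_def by (simp add: case_prod_beta')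
  have \<psi>sm: "(\<lambda>p. \<psi> j (fst p) (snd p - h j (fst p))) \<in> borel_measurable (Z \<Otimes>\<^sub>M \<gamma>)" if "j < n" for j
    using measurable_compose[OF measurable_Pair[OF measurable_fst sm[OF that]] \<psi>m[OF that]] by simp
  have Am: "(\<lambda>p. norm (A j (v (fst p)))) \<in> borel_measurable (Z \<Otimes>\<^sub>M \<gamma>)" for j
    by (rule measurable_compose[of _ _ borel "\<lambda>a. norm (A j a)"])
      (auto intro!: borel_measurable_continuous_onI continuous_intros blinfun.continuous_on)
  have mm: "(\<lambda>p. m j (fst p) (snd p)) \<in> borel_measurable (Z \<Otimes>\<^sub>M \<gamma>)" if "j < n" for j
    unfolding m_def'[OF that] using lm[OF that] \<psi>m[OF that] \<psi>sm[OF that] Am[of j] by measurable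
  have sect: "g \<circ> Pair z \<in> borel_measurable \<gamma>" if "g \<in> borel_measurable (Z \<Otimes>\<^sub>M \<gamma>)" for g :: "_ \<Rightarrow> real" and z
    using measurable_compose[OF measurable_Pair1'[of z Z \<gamma>] that] by (simp add: comp_def spZ)
  have mmz[measurable]: "m j z \<in> borel_measurable \<gamma>" "\<psi> j z \<in> borel_measurable \<gamma>" if "j < n" for j z
    using sect[OF mm[OF that], of z] sect[OF \<psi>m[OF that], of z] by (simp_all add: comp_def)
  have m0: "0 \<le> m j z w" "m j z w \<le> \<psi> j z w" if "j < n" for j z w
    unfolding m_def'[OF that] using \<psi>b[OF that] by auto
  have ub: "m j z w \<le> \<psi> j z (w - h j z) * wiener_functional.cm_density (l j (v z)) (A j (v z)) w" if "j < n" for j z w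
    unfolding m_def'[OF that] wiener_functional.cm_density_def[OF WF[OF that]] by simp
  \<comment> \<open>In terms of the noise of the second copy: the first copy has the noise before the shift. The weight
    \<open>m\<close> is below \<open>\<psi> j z\<close> for the second noise and, after shifting back, below \<open>\<psi> j z\<close> for the first,
    so that the sum over \<open>j\<close> has marginals below those prescribed.\<close>
  define F where "F j z w = (\<Phi> (fst z) (w - h j z), \<Phi> (snd z) w)" for j z w
  have Fm: "(\<lambda>p. F j (fst p) (snd p)) \<in> Z \<Otimes>\<^sub>M \<gamma> \<rightarrow>\<^sub>M Z" if "j < n" for j
  proof -
    have "(\<lambda>p. (fst (fst p), snd p - h j (fst p))) \<in> Z \<Otimes>\<^sub>M \<gamma> \<rightarrow>\<^sub>M borel \<Otimes>\<^sub>M \<gamma>"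
      by (rule measurable_Pair[OF _ sm[OF that]]) (simp add: Z_def)
    from measurable_compose[OF this \<Phi>]
    have 1: "(\<lambda>p. \<Phi> (fst (fst p)) (snd p - h j (fst p))) \<in> Z \<Otimes>\<^sub>M \<gamma> \<rightarrow>\<^sub>M borel" by simp
    have "(\<lambda>p. (snd (fst p), snd p)) \<in> Z \<Otimes>\<^sub>M \<gamma> \<rightarrow>\<^sub>M borel \<Otimes>\<^sub>M \<gamma>" by (simp add: Z_def)
    from measurable_compose[OF this \<Phi>]
    have 2: "(\<lambda>p. \<Phi> (snd (fst p)) (snd p)) \<in> Z \<Otimes>\<^sub>M \<gamma> \<rightarrow>\<^sub>M borel" by simp
    show ?thesis unfolding F_def Z_def using measurable_Pair[OF 1 2] unfolding Z_def .
  qed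
  have Fmz: "F j z \<in> \<gamma> \<rightarrow>\<^sub>M Z" if "j < n" for j z
    using measurable_compose[OF measurable_Pair1'[of z Z \<gamma>] Fm[OF that]] by (simp add: spZ)
  have \<Phi>m[measurable]: "\<Phi> x \<in> \<gamma> \<rightarrow>\<^sub>M borel" for x
    using measurable_compose[OF measurable_Pair1'[of x borel \<gamma>] \<Phi>] by simp
  \<comment> \<open>\<open>L z\<close> is the sum of the measures \<open>Lj z j\<close>.\<close>
  define Lj where "Lj z j = distr (density \<gamma> (\<lambda>w. ennreal (m j z w))) Z (F j z)" for z j
  define L where "L z = count_space {..<n} \<bind> Lj z" for z
  have Ljint: "(\<integral>\<^sup>+p. f p \<partial>Lj z j) = (\<integral>\<^sup>+w. ennreal (m j z w) * f (F j z w) \<partial>\<gamma>)"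
    if "j < n" "f \<in> borel_measurable Z" for j z f
  proof -
    have fd: "F j z \<in> density \<gamma> (\<lambda>w. ennreal (m j z w)) \<rightarrow>\<^sub>M Z" using Fmz[OF that(1)] by simp
    have "(\<lambda>w. f (F j z w)) \<in> borel_measurable \<gamma>" by (rule measurable_compose[OF Fmz[OF that(1)] that(2)])
    then show ?thesis unfolding Lj_def using that mmz(1)[OF that(1)]
      by (subst nn_integral_distr[OF fd]) (auto simp: nn_integral_density)
  qed
  have tot: "(\<Sum>j<n. \<integral>\<^sup>+w. ennreal (\<psi> j z w) * g w \<partial>\<gamma>) = (\<integral>\<^sup>+w. g w \<partial>\<gamma>)"
    if g: "g \<in> borel_measurable \<gamma>" for z g
  proof -
    have "(\<Sum>j<n. \<integral>\<^sup>+w. ennreal (\<psi> j z w) * g w \<partial>\<gamma>) = (\<integral>\<^sup>+w. (\<Sum>j<n. ennreal (\<psi> j z w) * g w) \<partial>\<gamma>)"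
      using g by (intro nn_integral_sum[symmetric]) auto
    also have "\<dots> = (\<integral>\<^sup>+w. g w \<partial>\<gamma>)"
    proof (rule nn_integral_cong)
      fix w assume "w \<in> space \<gamma>"
      moreover have "(\<Sum>j<n. ennreal (\<psi> j z w)) = ennreal (\<Sum>j<n. \<psi> j z w)" using \<psi>b(1) by (intro sum_ennreal) simp
      ultimately have "(\<Sum>j<n. ennreal (\<psi> j z w)) = 1" using \<psi>1[of w z] by (simp add: space_eq)
      then show "(\<Sum>j<n. ennreal (\<psi> j z w) * g w) = g w" by (simp flip: sum_distrib_right)
    qed
    finally show ?thesis .
  qed
  have Ljsub: "subprob_space (Lj z j)" "sets (Lj z j) = sets Z" if "j < n" for j z
  proof -
    show s: "sets (Lj z j) = sets Z" unfolding Lj_def by simp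
    have "emeasure (Lj z j) (space (Lj z j)) = (\<integral>\<^sup>+w. ennreal (m j z w) \<partial>\<gamma>)"
      using Ljint[OF that, of "\<lambda>_. 1"] by simp
    also have "\<dots> \<le> (\<integral>\<^sup>+w. 1 \<partial>\<gamma>)"
      using m0(2)[OF that] \<psi>b(2)[OF that] by (intro nn_integral_mono) (metis ennreal_1 ennreal_leI order_trans)
    finally show "subprob_space (Lj z j)"
      using sets_eq_imp_space_eq[OF s] by (intro subprob_spaceI) (auto simp: emeasure_space_1 spZ)
  qed
  have ker: "Lj z \<in> count_space {..<n} \<rightarrow>\<^sub>M subprob_algebra Z" for z
    using Ljsub by (auto simp: space_subprob_algebra)
  have Lint: "(\<integral>\<^sup>+p. f p \<partial>L z) = (\<Sum>j<n. \<integral>\<^sup>+w. ennreal (m j z w) * f (F j z w) \<partial>\<gamma>)"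
    if f: "f \<in> borel_measurable Z" for f z
    unfolding L_def nn_integral_bind[OF f ker] by (simp add: nn_integral_count_space_finite Ljint f)
  have n0: "n \<noteq> 0"
  proof
    assume "n = 0"
    then show False using \<psi>1 E_nonempty by fastforce
  qed
  have Lsets: "sets (L z) = sets Z" for z
    unfolding L_def by (rule sets_bind) (use Ljsub n0 in auto)
  have Lspace: "space (L z) = UNIV" for z using sets_eq_imp_space_eq[OF Lsets] spZ by simp
  have Lem: "emeasure (L z) X = (\<Sum>j<n. \<integral>\<^sup>+w. ennreal (m j z w) * indicator X (F j z w) \<partial>\<gamma>)"
    if X: "X \<in> sets Z" for z X
    using Lint[of "indicator X" z] X Lsets by simp
  \<comment> \<open>Cameron--Martin undoes the shift in the first marginal.\<close>
  have bound1: "(\<integral>\<^sup>+w. ennreal (m j z w) * g (w - h j z) \<partial>\<gamma>) \<le> (\<integral>\<^sup>+w. ennreal (\<psi> j z w) * g w \<partial>\<gamma>)"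
    if j: "j < n" and g: "g \<in> borel_measurable \<gamma>" for j z g
  proof -
    interpret W: wiener_functional E HW \<iota> \<gamma> "l j (v z)" "A j (v z)" by (rule WF[OF j])
    have "(\<integral>\<^sup>+w. ennreal (m j z w) * g (w - h j z) \<partial>\<gamma>)
        \<le> (\<integral>\<^sup>+w. (ennreal (\<psi> j z (w - h j z)) * g (w - h j z)) * ennreal (W.cm_density w) \<partial>\<gamma>)"
    proof (rule nn_integral_mono)
      fix w
      have "ennreal (m j z w) \<le> ennreal (\<psi> j z (w - h j z)) * ennreal (W.cm_density w)"
        using ub[OF j, of z w] \<psi>b[OF j] W.cm_density_nonneg[of w] by (simp add: ennreal_leI flip: ennreal_mult)
      then have "ennreal (m j z w) * g (w - h j z) \<le> ennreal (\<psi> j z (w - h j z)) * ennreal (W.cm_density w) * g (w - h j z)"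
        by (rule mult_right_mono) simp
      then show "ennreal (m j z w) * g (w - h j z) \<le> (ennreal (\<psi> j z (w - h j z)) * g (w - h j z)) * ennreal (W.cm_density w)"
        by (simp only: mult_ac)
    qed
    also have "\<dots> = (\<integral>\<^sup>+w. ennreal (\<psi> j z w) * g w \<partial>\<gamma>)"
      unfolding h_def using g j by (intro W.Cameron_Martin_back[of "\<lambda>w. ennreal (\<psi> j z w) * g w"]) measurable
    finally show ?thesis .
  qed
  have bound2: "(\<integral>\<^sup>+w. ennreal (m j z w) * g w \<partial>\<gamma>) \<le> (\<integral>\<^sup>+w. ennreal (\<psi> j z w) * g w \<partial>\<gamma>)"
    if j: "j < n" for j z g
    using m0(2)[OF j] by (intro nn_integral_mono mult_right_mono ennreal_leI) auto
  have Qint: "(\<integral>\<^sup>+a. g a \<partial>Q x) = (\<integral>\<^sup>+w. g (\<Phi> x w) \<partial>\<gamma>)" if "g \<in> borel_measurable borel" for g x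
    using that by (subst Q[symmetric]) (simp add: nn_integral_distr)
  have marg: "emeasure (L z) (X \<times> UNIV) \<le> emeasure (Q (fst z)) X" "emeasure (L z) (UNIV \<times> X) \<le> emeasure (Q (snd z)) X"
    if X: "X \<in> sets borel" for z X
  proof -
    have [measurable]: "X \<in> sets borel" by fact
    have XZ: "X \<times> UNIV \<in> sets Z" "UNIV \<times> X \<in> sets Z" unfolding Z_def using X by auto
    have Qe: "emeasure (Q x) X = (\<integral>\<^sup>+w. indicator X (\<Phi> x w) \<partial>\<gamma>)" for x
    proof -
      have "X \<in> sets (Q x)" using X by (simp flip: Q)
      then show ?thesis using Qint[of "indicator X" x] X by simp
    qed
    have i1: "(\<lambda>w. indicator X (\<Phi> x w) :: ennreal) \<in> borel_measurable \<gamma>" for x by measurable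
    have "emeasure (L z) (X \<times> UNIV) = (\<Sum>j<n. \<integral>\<^sup>+w. ennreal (m j z w) * indicator X (\<Phi> (fst z) (w - h j z)) \<partial>\<gamma>)"
      unfolding Lem[OF XZ(1)] F_def by (simp add: indicator_def)
    also have "\<dots> \<le> (\<Sum>j<n. \<integral>\<^sup>+w. ennreal (\<psi> j z w) * indicator X (\<Phi> (fst z) w) \<partial>\<gamma>)"
      using bound1[OF _ i1[of "fst z"]] by (intro sum_mono) simp
    also have "\<dots> = emeasure (Q (fst z)) X" unfolding Qe by (rule tot[OF i1])
    finally show "emeasure (L z) (X \<times> UNIV) \<le> emeasure (Q (fst z)) X" .
    have "emeasure (L z) (UNIV \<times> X) = (\<Sum>j<n. \<integral>\<^sup>+w. ennreal (m j z w) * indicator X (\<Phi> (snd z) w) \<partial>\<gamma>)"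
      unfolding Lem[OF XZ(2)] F_def by (simp add: indicator_def)
    also have "\<dots> \<le> (\<Sum>j<n. \<integral>\<^sup>+w. ennreal (\<psi> j z w) * indicator X (\<Phi> (snd z) w) \<partial>\<gamma>)"
      using bound2 by (intro sum_mono) simp
    also have "\<dots> = emeasure (Q (snd z)) X" unfolding Qe by (rule tot[OF i1])
    finally show "emeasure (L z) (UNIV \<times> X) \<le> emeasure (Q (snd z)) X" .
  qed
  have Qprob: "prob_space (Q x)" "sets (Q x) = sets borel" for x
    using prob_space_distr[OF \<Phi>m[of x]] by (simp_all flip: Q)
  have Qk: "Q \<in> borel \<rightarrow>\<^sub>M prob_algebra borel"
  proof -
    have "(\<lambda>x. distr \<gamma> borel (\<Phi> x)) \<in> borel \<rightarrow>\<^sub>M prob_algebra borel"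
      by (rule measurable_distr_prob_space2[where M = \<gamma>])
        (use \<Phi> prob_space_axioms in \<open>auto simp: space_prob_algebra\<close>)
    then show ?thesis by (simp add: Q)
  qed
  have Lsub: "subprob_space (L z)" for z
  proof (rule subprob_spaceI)
    have "emeasure (L z) UNIV \<le> emeasure (Q (fst z)) UNIV" using marg(1)[of UNIV z] by simp
    also have "\<dots> \<le> 1" using prob_space.emeasure_space_1[OF Qprob(1)] sets_eq_imp_space_eq[OF Qprob(2)] by simp
    finally show "emeasure (L z) (space (L z)) \<le> 1" using Lspace by simp
  qed (simp add: Lspace)
  have Lk: "L \<in> Z \<rightarrow>\<^sub>M subprob_algebra Z"
  proof (rule measurable_subprob_algebra[OF Lsub Lsets])
    fix X assume X: "X \<in> sets Z"
    have "(\<lambda>z. \<integral>\<^sup>+w. ennreal (m j z w) * indicator X (F j z w) \<partial>\<gamma>) \<in> borel_measurable Z" if "j < n" for j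
    proof -
      have "(\<lambda>p. indicator X (F j (fst p) (snd p)) :: ennreal) \<in> borel_measurable (Z \<Otimes>\<^sub>M \<gamma>)"
        by (rule measurable_compose[OF Fm[OF that]]) (use X in simp)
      then have "(\<lambda>p. ennreal (m j (fst p) (snd p)) * indicator X (F j (fst p) (snd p))) \<in> borel_measurable (Z \<Otimes>\<^sub>M \<gamma>)"
        using mm[OF that] by measurable
      from borel_measurable_nn_integral_fst[OF this] show ?thesis by simp
    qed
    then have "(\<lambda>z. \<Sum>j<n. \<integral>\<^sup>+w. ennreal (m j z w) * indicator X (F j z w) \<partial>\<gamma>) \<in> borel_measurable Z"
      by (intro borel_measurable_sum) simp
    then show "(\<lambda>z. emeasure (L z) X) \<in> borel_measurable Z" by (simp add: Lem[OF X])
  qed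
  have Q12: "(\<lambda>z. Q (fst z)) \<in> Z \<rightarrow>\<^sub>M prob_algebra borel" "(\<lambda>z. Q (snd z)) \<in> Z \<rightarrow>\<^sub>M prob_algebra borel"
    unfolding Z_def by (rule measurable_compose[OF measurable_fst Qk], rule measurable_compose[OF measurable_snd Qk])
  have Lk': "L \<in> Z \<rightarrow>\<^sub>M subprob_algebra (borel \<Otimes>\<^sub>M borel)" using Lk unfolding Z_def .
  obtain \<kappa> where \<kappa>: "\<kappa> \<in> Z \<rightarrow>\<^sub>M prob_algebra (borel \<Otimes>\<^sub>M borel)"
    "\<And>z. z \<in> space Z \<Longrightarrow> distr (\<kappa> z) borel fst = Q (fst z)" "\<And>z. z \<in> space Z \<Longrightarrow> distr (\<kappa> z) borel snd = Q (snd z)"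
    "\<And>z f. z \<in> space Z \<Longrightarrow> f \<in> borel_measurable (borel \<Otimes>\<^sub>M borel) \<Longrightarrow> (\<And>p. f p \<le> 1) \<Longrightarrow>
      (\<integral>\<^sup>+p. f p \<partial>\<kappa> z) \<le> (\<integral>\<^sup>+p. f p \<partial>L z) + (1 - emeasure (L z) (space borel \<times> space borel))"
    by (rule coupling_completion[OF Q12 Lk']) (use marg in auto)
  show ?thesis
  proof (rule that[of \<kappa>])
    show "couples \<kappa> Q borel" unfolding couples_def using \<kappa>(1-3) by (auto simp: Z_def space_pair_measure)
    fix x y f u w \<Lambda>
    assume f: "f \<in> borel_measurable (borel \<Otimes>\<^sub>M borel)" "\<And>p. f p \<le> (1::ennreal)"
      and u[measurable]: "u \<in> borel_measurable borel"
      and w: "\<And>j. j < n \<Longrightarrow> w j \<in> borel_measurable \<gamma>"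
      and fb: "\<And>j \<omega>. j < n \<Longrightarrow> \<omega> \<in> E \<Longrightarrow> f (\<Phi> x \<omega>, \<Phi> y (\<omega> + \<iota> (A j (emb (y - x)))))
        \<le> u (\<Phi> x \<omega>) + u (\<Phi> y (\<omega> + \<iota> (A j (emb (y - x))))) + w j \<omega>"
      and h1: "\<And>j. j < n \<Longrightarrow> norm (A j (emb (y - x))) \<le> 1" and \<Lambda>0: "\<And>j. j < n \<Longrightarrow> 0 \<le> \<Lambda> j"
      and \<Lambda>: "\<And>j \<omega>. j < n \<Longrightarrow> \<omega> \<in> E \<Longrightarrow> \<bar>\<psi> j (x, y) (\<omega> - \<iota> (A j (emb (y - x)))) - \<psi> j (x, y) \<omega>\<bar> \<le> \<Lambda> j"
    define z where "z = (x, y)"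
    have vz: "v z = emb (y - x)" unfolding v_def z_def by simp
    have fZ: "f \<in> borel_measurable Z" using f(1) unfolding Z_def .
    have ux: "(\<lambda>\<omega>. u (\<Phi> x \<omega>)) \<in> borel_measurable \<gamma>" for x by measurable
    have each: "(\<integral>\<^sup>+\<omega>. ennreal (m j z \<omega>) * f (F j z \<omega>) \<partial>\<gamma>)
        \<le> (\<integral>\<^sup>+\<omega>. ennreal (\<psi> j z \<omega>) * u (\<Phi> x \<omega>) \<partial>\<gamma>) + (\<integral>\<^sup>+\<omega>. ennreal (\<psi> j z \<omega>) * u (\<Phi> y \<omega>) \<partial>\<gamma>)
          + (\<integral>\<^sup>+\<omega>. ennreal (\<psi> j z \<omega>) * w j \<omega> \<partial>\<gamma>)" if j: "j < n" for j
    proof -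
      interpret W: wiener_functional E HW \<iota> \<gamma> "l j (v z)" "A j (v z)" by (rule WF[OF j])
      have shm: "(\<lambda>\<omega>. \<omega> - h j z) \<in> \<gamma> \<rightarrow>\<^sub>M \<gamma>" using W.shift_pm_measurable(2) unfolding h_def .
      have [measurable]: "(\<lambda>\<omega>. u (\<Phi> x (\<omega> - h j z))) \<in> borel_measurable \<gamma>" "(\<lambda>\<omega>. w j (\<omega> - h j z)) \<in> borel_measurable \<gamma>"
        by (rule measurable_compose[OF shm ux], rule measurable_compose[OF shm w[OF j]])
      have "(\<integral>\<^sup>+\<omega>. ennreal (m j z \<omega>) * f (F j z \<omega>) \<partial>\<gamma>)
          \<le> (\<integral>\<^sup>+\<omega>. ennreal (m j z \<omega>) * u (\<Phi> x (\<omega> - h j z)) + ennreal (m j z \<omega>) * u (\<Phi> y \<omega>)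
            + ennreal (m j z \<omega>) * w j (\<omega> - h j z) \<partial>\<gamma>)"
      proof (rule nn_integral_mono)
        fix \<omega> assume "\<omega> \<in> space \<gamma>"
        then have "\<omega> - h j z \<in> E" using hE[OF j, of z] subspaces(1) by (simp add: space_eq subspace_diff)
        from fb[OF j this] have "f (F j z \<omega>) \<le> u (\<Phi> x (\<omega> - h j z)) + u (\<Phi> y \<omega>) + w j (\<omega> - h j z)"
          unfolding F_def h_def vz by (simp add: z_def)
        from mult_left_mono[OF this, of "ennreal (m j z \<omega>)"]
        show "ennreal (m j z \<omega>) * f (F j z \<omega>) \<le> ennreal (m j z \<omega>) * u (\<Phi> x (\<omega> - h j z)) + ennreal (m j z \<omega>) * u (\<Phi> y \<omega>)
            + ennreal (m j z \<omega>) * w j (\<omega> - h j z)" by (simp add: distrib_left)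
      qed
      also have "\<dots> = (\<integral>\<^sup>+\<omega>. ennreal (m j z \<omega>) * u (\<Phi> x (\<omega> - h j z)) \<partial>\<gamma>) + (\<integral>\<^sup>+\<omega>. ennreal (m j z \<omega>) * u (\<Phi> y \<omega>) \<partial>\<gamma>)
            + (\<integral>\<^sup>+\<omega>. ennreal (m j z \<omega>) * w j (\<omega> - h j z) \<partial>\<gamma>)"
        using mmz(1)[OF j] by (simp add: nn_integral_add)
      also have "\<dots> \<le> (\<integral>\<^sup>+\<omega>. ennreal (\<psi> j z \<omega>) * u (\<Phi> x \<omega>) \<partial>\<gamma>) + (\<integral>\<^sup>+\<omega>. ennreal (\<psi> j z \<omega>) * u (\<Phi> y \<omega>) \<partial>\<gamma>)
          + (\<integral>\<^sup>+\<omega>. ennreal (\<psi> j z \<omega>) * w j \<omega> \<partial>\<gamma>)"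
        by (intro add_mono bound1[OF j ux] bound1[OF j w[OF j]] bound2[OF j])
      finally show ?thesis .
    qed
    have "(\<integral>\<^sup>+p. f p \<partial>L z) \<le> (\<Sum>j<n. (\<integral>\<^sup>+\<omega>. ennreal (\<psi> j z \<omega>) * u (\<Phi> x \<omega>) \<partial>\<gamma>)
        + (\<integral>\<^sup>+\<omega>. ennreal (\<psi> j z \<omega>) * u (\<Phi> y \<omega>) \<partial>\<gamma>) + (\<integral>\<^sup>+\<omega>. ennreal (\<psi> j z \<omega>) * w j \<omega> \<partial>\<gamma>))"
      unfolding Lint[OF fZ] by (intro sum_mono each) simp
    also have "\<dots> = (\<integral>\<^sup>+a. u a \<partial>Q x) + (\<integral>\<^sup>+a. u a \<partial>Q y) + (\<Sum>j<n. \<integral>\<^sup>+\<omega>. ennreal (\<psi> j z \<omega>) * w j \<omega> \<partial>\<gamma>)"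
      unfolding sum.distrib tot[OF ux] Qint[OF u] ..
    finally have main: "(\<integral>\<^sup>+p. f p \<partial>L z) \<le> (\<integral>\<^sup>+a. u a \<partial>Q x) + (\<integral>\<^sup>+a. u a \<partial>Q y)
        + (\<Sum>j<n. \<integral>\<^sup>+\<omega>. ennreal (\<psi> j z \<omega>) * w j \<omega> \<partial>\<gamma>)" .
    have "1 = (\<Sum>j<n. \<integral>\<^sup>+\<omega>. ennreal (\<psi> j z \<omega>) \<partial>\<gamma>)" using tot[of "\<lambda>_. 1" z] by (simp add: emeasure_space_1)
    also have "\<dots> \<le> (\<Sum>j<n. (\<integral>\<^sup>+\<omega>. ennreal (m j z \<omega>) \<partial>\<gamma>) + ennreal (\<Lambda> j + 2 * norm (A j (v z))))"
    proof (rule sum_mono)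
      fix j assume "j \<in> {..<n}"
      then have j: "j < n" by simp
      interpret W: wiener_functional E HW \<iota> \<gamma> "l j (v z)" "A j (v z)" by (rule WF[OF j])
      show "(\<integral>\<^sup>+\<omega>. ennreal (\<psi> j z \<omega>) \<partial>\<gamma>) \<le> (\<integral>\<^sup>+\<omega>. ennreal (m j z \<omega>) \<partial>\<gamma>) + ennreal (\<Lambda> j + 2 * norm (A j (v z)))"
        unfolding m_def by (rule W.overlap_deficit) (use j \<psi>b h1 \<Lambda> \<Lambda>0 mmz(2) vz in \<open>auto simp: z_def\<close>)
    qed
    also have "\<dots> = emeasure (L z) UNIV + (\<Sum>j<n. ennreal (\<Lambda> j + 2 * norm (A j (v z))))"
      using Lem[of UNIV z] spZ sets.top[of Z] by (simp add: sum.distrib)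
    finally have "1 - emeasure (L z) UNIV \<le> (\<Sum>j<n. ennreal (\<Lambda> j + 2 * norm (A j (v z))))"
      using subprob_space.emeasure_subprob_space_less_top[OF Lsub]
      by (subst ennreal_minus_le_iff) (auto simp: less_top)
    then have "(\<integral>\<^sup>+p. f p \<partial>\<kappa> z) \<le> (\<integral>\<^sup>+p. f p \<partial>L z) + (\<Sum>j<n. ennreal (\<Lambda> j + 2 * norm (A j (v z))))"
      using \<kappa>(4)[of z f, OF _ f] spZ by (simp add: add_left_mono order_trans)
    also have "\<dots> \<le> ((\<integral>\<^sup>+a. u a \<partial>Q x) + (\<integral>\<^sup>+a. u a \<partial>Q y)
        + (\<Sum>j<n. \<integral>\<^sup>+\<omega>. ennreal (\<psi> j z \<omega>) * w j \<omega> \<partial>\<gamma>)) + (\<Sum>j<n. ennreal (\<Lambda> j + 2 * norm (A j (v z))))"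
      by (rule add_right_mono[OF main])
    finally show "(\<integral>\<^sup>+p. f p \<partial>\<kappa> (x, y)) \<le> (\<integral>\<^sup>+a. u a \<partial>Q x) + (\<integral>\<^sup>+a. u a \<partial>Q y)
        + (\<Sum>j<n. \<integral>\<^sup>+\<omega>. ennreal (\<psi> j (x, y) \<omega>) * w j \<omega> \<partial>\<gamma>)
        + (\<Sum>j<n. ennreal (\<Lambda> j + 2 * norm (A j (emb (y - x)))))"
      unfolding vz[symmetric] z_def .
  qed
qed

section \<open>Finitely many controls\<close>

context wiener_space
begin

lemma adjoint_sum:
  assumes "finite B" "\<And>b. b \<in> B \<Longrightarrow> l b \<in> dual_on E" "\<And>b. b \<in> B \<Longrightarrow> is_adjoint_image HW \<iota> (l b) (h b)"
  shows "(\<lambda>x. \<Sum>b\<in>B. c b * l b x) \<in> dual_on E \<and>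
    is_adjoint_image HW \<iota> (\<lambda>x. \<Sum>b\<in>B. c b * l b x) (\<Sum>b\<in>B. c b *\<^sub>R h b)"
  using assms
proof (induction rule: finite_induct)
  case empty
  then show ?case using dual_on_zero subspace_0[OF subspaces(2)] by (simp add: is_adjoint_image_def)
next
  case (insert a B)
  have "l a \<in> dual_on E" "is_adjoint_image HW \<iota> (l a) (h a)"
    "(\<lambda>x. \<Sum>b\<in>B. c b * l b x) \<in> dual_on E"
    "is_adjoint_image HW \<iota> (\<lambda>x. \<Sum>b\<in>B. c b * l b x) (\<Sum>b\<in>B. c b *\<^sub>R h b)"
    using insert by auto
  from dual_on_lincomb[OF this(3,1), of "c a"] is_adjoint_image_lincomb[OF this(4,2) subspaces(2), of "c a"]
  show ?case using insert(1,2) by (simp add: add.commute)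
qed

text \<open>Dense range of \<open>D\<close> on the Cameron--Martin space persists on the dense subspace \<open>\<iota>\<^sup>*(E\<^sup>*)\<close>, from
  which the control directions can therefore be taken.\<close>

lemma admissible_control_exists:
  fixes K :: "'k::{real_inner, banach, second_countable_topology} \<Rightarrow>\<^sub>L 'k" and D :: "'w \<Rightarrow>\<^sub>L 'k"
  assumes K: "compact_operator K" and D: "closure (blinfun_apply D ` HW) = UNIV" and e: "e > 0"
  shows "\<exists>A l. admissible_control A l \<and> norm (K + (D o\<^sub>L A)) \<le> e"
proof -
  have "blinfun_apply D ` HW \<subseteq> closure (blinfun_apply D ` adjoint_range E HW \<iota>)"
  proof -
    have "blinfun_apply D ` closure (adjoint_range E HW \<iota>) \<subseteq> closure (blinfun_apply D ` adjoint_range E HW \<iota>)"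
      by (rule image_closure_subset) (auto intro: closure_subset[THEN subsetD] blinfun.continuous_on continuous_on_id)
    then show ?thesis using adjoint_range_dense by blast
  qed
  then have "closure (blinfun_apply D ` HW) \<subseteq> closure (blinfun_apply D ` adjoint_range E HW \<iota>)"
    by (rule closure_minimal) simp
  then have dense: "closure (blinfun_apply D ` adjoint_range E HW \<iota>) = UNIV" using D by auto
  obtain B h A where B: "finite B" "\<forall>b\<in>B. h b \<in> adjoint_range E HW \<iota>"
    "\<forall>v. blinfun_apply A v = (\<Sum>b\<in>B. inner (K v) (- b) *\<^sub>R h b)" "norm (K + (D o\<^sub>L A)) \<le> e"
    using finite_rank_control_exists[OF K dense e] by blast
  have "\<forall>b\<in>B. \<exists>l. l \<in> dual_on E \<and> is_adjoint_image HW \<iota> l (h b)"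
    using B(2) unfolding adjoint_range_def by blast
  then obtain lb where lb: "\<And>b. b \<in> B \<Longrightarrow> lb b \<in> dual_on E" "\<And>b. b \<in> B \<Longrightarrow> is_adjoint_image HW \<iota> (lb b) (h b)"
    by metis
  define l where "l v w = (\<Sum>b\<in>B. inner (K v) (- b) * lb b w)" for v w
  have "admissible_control A l" unfolding admissible_control_def
  proof (intro conjI allI)
    fix v
    show "l v \<in> dual_on E" "is_adjoint_image HW \<iota> (l v) (blinfun_apply A v)"
      using adjoint_sum[OF B(1) lb, where c = "\<lambda>b. inner (K v) (- b)"] B(3) unfolding l_def by simp_all
  next
    have "(\<lambda>p. inner (K (fst p)) (- b) * lb b (snd p)) \<in> borel_measurable (borel \<Otimes>\<^sub>M \<gamma>)" if "b \<in> B" for b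
    proof -
      have "(\<lambda>v. inner (K v) (- b)) \<in> borel_measurable borel"
        by (intro borel_measurable_continuous_onI continuous_intros blinfun.continuous_on)
      from measurable_compose[OF measurable_fst this]
      have "(\<lambda>p. inner (K (fst p)) (- b)) \<in> borel_measurable (borel \<Otimes>\<^sub>M \<gamma>)" .
      moreover have "(\<lambda>p. lb b (snd p)) \<in> borel_measurable (borel \<Otimes>\<^sub>M \<gamma>)"
        by (rule measurable_compose[OF measurable_snd dual_on_measurable[OF lb(1)[OF that]]])
      ultimately show ?thesis by (rule borel_measurable_times)
    qed
    then show "(\<lambda>(v, \<omega>). l v \<omega>) \<in> borel_measurable (borel \<Otimes>\<^sub>M \<gamma>)"
      unfolding l_def case_prod_beta' by (rule borel_measurable_sum)
    show "\<exists>B. finite B \<and> B \<subseteq> adjoint_range E HW \<iota> \<and> range (blinfun_apply A) \<subseteq> span B"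
    proof (intro exI[of _ "h ` B"] conjI)
      show "range (blinfun_apply A) \<subseteq> span (h ` B)"
      proof (rule image_subsetI)
        fix v
        show "blinfun_apply A v \<in> span (h ` B)"
          unfolding B(3)[rule_format] by (intro span_sum span_scale span_base imageI)
      qed
    qed (use B in auto)
  qed
  then show ?thesis using B(4) by blast
qed

end

text \<open>The data of one time block of fixed length, with the operators that witness \<open>assumption_SC\<close>.\<close>

locale controlled_block = wiener_space E HW \<iota> \<gamma>
  for E :: "'e::banach set" and HW :: "'w::{real_inner, banach} set" and \<iota> and \<gamma> +
  fixes emb :: "'h::{real_inner, banach, second_countable_topology} \<Rightarrow>\<^sub>L
                'k::{real_inner, banach, second_countable_topology}"
    and V :: "'h \<Rightarrow> real" and \<Phi> :: "'h \<Rightarrow> 'e \<Rightarrow> 'h" and D :: "'h \<Rightarrow> 'e \<Rightarrow> 'w \<Rightarrow>\<^sub>L 'k"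
    and S K :: "'h \<times> 'h \<Rightarrow> 'e \<Rightarrow> 'k \<Rightarrow>\<^sub>L 'k" and \<rho> p\<^sub>0 :: real
  assumes embedding: "dense_embedding emb"
    and \<Phi>_measurable: "(\<lambda>(x, \<omega>). \<Phi> x \<omega>) \<in> borel \<Otimes>\<^sub>M \<gamma> \<rightarrow>\<^sub>M borel"
    and V_ge_1: "\<And>x. 1 \<le> V x" and V_continuous: "continuous_on UNIV V"
    and sublevel_compact: "\<And>R. compact (blinfun_apply emb ` sublevel V R)"
    and splitting: "SC_splitting emb E \<gamma> \<Phi> S K \<rho>"
    and continuity: "SC_continuity emb V E HW \<iota> \<gamma> \<Phi> D K"
    and remainder: "SC_remainder emb V E HW \<iota> \<gamma> \<Phi> D (\<lambda>z \<omega>. S z \<omega> + K z \<omega>) p\<^sub>0"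
    and p0: "p\<^sub>0 > 0"
begin

lemma emb_inj: "inj (blinfun_apply emb)" using embedding unfolding dense_embedding_def by blast

lemma emb_measurable: "blinfun_apply emb \<in> borel \<rightarrow>\<^sub>M borel"
  by (intro borel_measurable_continuous_onI blinfun.continuous_on continuous_on_id continuous_on_const)

lemma V_measurable: "V \<in> borel_measurable borel"
  using V_continuous by (rule borel_measurable_continuous_onI)

lemma \<Phi>_section_measurable: "\<Phi> x \<in> \<gamma> \<rightarrow>\<^sub>M borel"
  using measurable_compose[OF measurable_Pair1'[of x borel \<gamma>] \<Phi>_measurable] by simp

text \<open>Compactness of the sublevel sets in the larger space: finitely many controls serve all pairs in a
  sublevel set and all noises in a compact set.\<close>

lemma control_cover:
  assumes G: "compact G" "G \<subseteq> E" and dense: "\<And>x \<omega>. \<omega> \<in> G \<Longrightarrow> closure (blinfun_apply (D x \<omega>) ` HW) = UNIV"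
    and e: "e > 0"
  obtains N W C A l where
    "\<And>j. j < (N::nat) \<Longrightarrow> W j \<in> sets (borel \<Otimes>\<^sub>M borel)"
    "\<And>j. j < N \<Longrightarrow> closed (C j)" "\<And>j. j < N \<Longrightarrow> C j \<noteq> {}" "\<And>j. j < N \<Longrightarrow> C j \<subseteq> G"
    "\<And>j. j < N \<Longrightarrow> admissible_control (A j) (l j)"
    "\<And>j z \<omega>. j < N \<Longrightarrow> z \<in> W j \<Longrightarrow> \<omega> \<in> C j \<Longrightarrow> norm (K z \<omega> + (D (snd z) \<omega> o\<^sub>L A j)) \<le> e"
    "\<And>x y \<omega>. x \<in> sublevel V R \<Longrightarrow> y \<in> sublevel V R \<Longrightarrow> \<omega> \<in> G \<Longrightarrow> \<exists>j<N. (x, y) \<in> W j \<and> \<omega> \<in> C j"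
proof -
  \<comment> \<open>Pairs and noises are parametrised by a compact subset of a metric space, since the topology of
    \<open>sublevel_top\<close> is the one induced by \<open>emb\<close>.\<close>
  define X where "X = blinfun_apply emb ` sublevel V R"
  define Q where "Q = X \<times> X \<times> G"
  define g where "g = inv (blinfun_apply emb)"
  have ge: "g (emb x) = x" for x unfolding g_def using emb_inj by simp
  have cQ: "compact Q" unfolding Q_def X_def by (intro compact_Times sublevel_compact G)
  have gX: "g a \<in> sublevel V R" "emb (g a) = a" if "a \<in> X" for a using that ge unfolding X_def by auto
  have g_cont: "continuous_map (top_of_set X) (sublevel_top emb V R) g"
    unfolding sublevel_top_def
  proof (rule continuous_map_pullback')
    have "continuous_map (top_of_set X) euclidean (\<lambda>a. a)" by simp
    then show "continuous_map (top_of_set X) euclidean (blinfun_apply emb \<circ> g)"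
      by (rule continuous_map_eq) (simp add: gX)
    show "topspace (top_of_set X) \<subseteq> g -` sublevel V R" using gX by auto
  qed
  have Kc: "continuous_map
        (prod_topology (prod_topology (sublevel_top emb V R) (sublevel_top emb V R)) (top_of_set G))
        euclidean (\<lambda>(z, \<omega>). K z \<omega>)"
    and Dc: "continuous_map (prod_topology (sublevel_top emb V R) (top_of_set G)) euclidean (\<lambda>(x, \<omega>). D x \<omega>)"
    using continuity G unfolding SC_continuity_def by auto
  have coords: "continuous_map (top_of_set Q) (sublevel_top emb V R) (\<lambda>p. g (fst p))"
    "continuous_map (top_of_set Q) (sublevel_top emb V R) (\<lambda>p. g (fst (snd p)))"
    "continuous_map (top_of_set Q) (top_of_set G) (\<lambda>p. snd (snd p))"
  proof -
    have c1: "continuous_map (top_of_set Q) (top_of_set X) fst"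
      and c2: "continuous_map (top_of_set Q) (top_of_set X) (\<lambda>p. fst (snd p))"
      and c3: "continuous_map (top_of_set Q) (top_of_set G) (\<lambda>p. snd (snd p))"
      unfolding Q_def by (auto intro!: continuous_intros)
    show "continuous_map (top_of_set Q) (sublevel_top emb V R) (\<lambda>p. g (fst p))"
      using continuous_map_compose[OF c1 g_cont] by (simp only: comp_def)
    show "continuous_map (top_of_set Q) (sublevel_top emb V R) (\<lambda>p. g (fst (snd p)))"
      using continuous_map_compose[OF c2 g_cont] by (simp only: comp_def)
    show "continuous_map (top_of_set Q) (top_of_set G) (\<lambda>p. snd (snd p))" by (rule c3)
  qed
  define KQ where "KQ p = K (g (fst p), g (fst (snd p))) (snd (snd p))" for p
  define DQ where "DQ p = D (g (fst (snd p))) (snd (snd p))" for p :: "'k \<times> 'k \<times> 'e"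
  have KQc: "continuous_on Q KQ"
  proof -
    have "continuous_map (top_of_set Q)
        (prod_topology (prod_topology (sublevel_top emb V R) (sublevel_top emb V R)) (top_of_set G))
        (\<lambda>p. ((g (fst p), g (fst (snd p))), snd (snd p)))"
      by (intro continuous_map_pairedI coords)
    from continuous_map_compose[OF this Kc] show ?thesis unfolding KQ_def by (simp add: comp_def)
  qed
  have DQc: "continuous_on Q DQ"
  proof -
    have "continuous_map (top_of_set Q)
        (prod_topology (sublevel_top emb V R) (top_of_set G)) (\<lambda>p. (g (fst (snd p)), snd (snd p)))"
      by (intro continuous_map_pairedI coords)
    from continuous_map_compose[OF this Dc] show ?thesis unfolding DQ_def by (simp add: comp_def)
  qed
  \<comment> \<open>In the product, distances add up over three coordinates, whence the factor 3.\<close>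
  have local: "\<exists>A l r. admissible_control A l \<and> r > 0 \<and>
      (\<forall>q\<in>Q. dist q p < 3 * r \<longrightarrow> norm (KQ q + (DQ q o\<^sub>L A)) \<le> e)" if p: "p \<in> Q" for p
  proof -
    have pG: "snd (snd p) \<in> G" using p unfolding Q_def by auto
    have "compact_operator (KQ p)" using splitting pG G(2) unfolding SC_splitting_def KQ_def by blast
    moreover have "closure (blinfun_apply (DQ p) ` HW) = UNIV" unfolding DQ_def by (rule dense[OF pG])
    ultimately obtain A l where A: "admissible_control A l" "norm (KQ p + (DQ p o\<^sub>L A)) \<le> e / 2"
      using admissible_control_exists[of "KQ p" "DQ p" "e / 2"] e by auto
    have "continuous_on Q (\<lambda>q. norm (KQ q + (DQ q o\<^sub>L A)))"
      by (intro continuous_on_norm continuous_on_add KQc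
          bounded_bilinear.continuous_on[OF bounded_bilinear_blinfun_compose DQc continuous_on_const])
    then obtain d where d: "d > 0" "\<And>q. q \<in> Q \<Longrightarrow> dist q p < d \<Longrightarrow>
        dist (norm (KQ q + (DQ q o\<^sub>L A))) (norm (KQ p + (DQ p o\<^sub>L A))) < e / 2"
      using p e unfolding continuous_on_iff by (metis half_gt_zero)
    have "norm (KQ q + (DQ q o\<^sub>L A)) \<le> e" if "q \<in> Q" "dist q p < 3 * (d / 3)" for q
    proof -
      have "dist q p < d" using that(2) by simp
      from d(2)[OF that(1) this] A(2) show ?thesis unfolding dist_real_def by linarith
    qed
    then show ?thesis using A(1) d(1) by (intro exI[of _ A] exI[of _ l] exI[of _ "d / 3"]) auto
  qed
  obtain A0 l0 r0 where loc: "\<And>p. p \<in> Q \<Longrightarrow> admissible_control (A0 p) (l0 p)" "\<And>p. p \<in> Q \<Longrightarrow> r0 p > 0"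
    "\<And>p q. p \<in> Q \<Longrightarrow> q \<in> Q \<Longrightarrow> dist q p < 3 * r0 p \<Longrightarrow> norm (KQ q + (DQ q o\<^sub>L A0 p)) \<le> e"
    using local by metis
  have "Q \<subseteq> (\<Union>p\<in>Q. ball p (r0 p))" using loc(2) by force
  then obtain P where P: "P \<subseteq> Q" "finite P" "Q \<subseteq> (\<Union>p\<in>P. ball p (r0 p))"
    using compactE_image[OF cQ, of Q "\<lambda>p. ball p (r0 p)"] by auto
  obtain f where f: "bij_betw f {..<card P} P" using P(2) by (metis bij_betw_from_nat_into_finite)
  have fP: "f j \<in> P" "f j \<in> Q" if "j < card P" for j using f P(1) that unfolding bij_betw_def by auto
  define W where "W j = {z. V (fst z) \<le> R \<and> V (snd z) \<le> R \<and> dist (emb (fst z)) (fst (f j)) < r0 (f j) \<and>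
      dist (emb (snd z)) (fst (snd (f j))) < r0 (f j)}" for j
  define C where "C j = G \<inter> cball (snd (snd (f j))) (r0 (f j))" for j
  show ?thesis
  proof (rule that[of "card P" W C "\<lambda>j. A0 (f j)" "\<lambda>j. l0 (f j)"])
    fix j assume j: "j < card P"
    show "W j \<in> sets (borel \<Otimes>\<^sub>M borel)"
    proof -
      have [measurable]: "V \<in> borel_measurable borel" "blinfun_apply emb \<in> borel \<rightarrow>\<^sub>M borel"
        by (rule V_measurable emb_measurable)+
      have "{z \<in> space (borel \<Otimes>\<^sub>M borel). V (fst z) \<le> R \<and> V (snd z) \<le> R \<and> dist (emb (fst z)) (fst (f j)) < r0 (f j) \<and>
        dist (emb (snd z)) (fst (snd (f j))) < r0 (f j)} \<in> sets (borel \<Otimes>\<^sub>M borel)" by measurable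
      then show ?thesis unfolding W_def by (simp add: space_pair_measure)
    qed
    show "closed (C j)" unfolding C_def using compact_imp_closed[OF G(1)] by (intro closed_Int closed_cball)
    have "snd (snd (f j)) \<in> C j" using fP(2)[OF j] loc(2)[OF fP(2)[OF j]] unfolding C_def Q_def by auto
    then show "C j \<noteq> {}" by blast
    show "C j \<subseteq> G" unfolding C_def by blast
    show "admissible_control (A0 (f j)) (l0 (f j))" by (rule loc(1)[OF fP(2)[OF j]])
  next
    fix j z \<omega> assume j: "j < card P" and z: "z \<in> W j" and \<omega>: "\<omega> \<in> C j"
    define q where "q = (emb (fst z), emb (snd z), \<omega>)"
    have q: "q \<in> Q" using z \<omega> unfolding q_def Q_def X_def W_def C_def sublevel_def by auto
    have "dist q (f j) \<le> dist (fst q) (fst (f j)) + (dist (fst (snd q)) (fst (snd (f j))) + dist (snd (snd q)) (snd (snd (f j))))"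
      unfolding dist_prod_def by (intro order_trans[OF sqrt_sum_squares_le_sum] add_left_mono sqrt_sum_squares_le_sum) auto
    also have "\<dots> < r0 (f j) + (r0 (f j) + r0 (f j))"
      using z \<omega> unfolding q_def W_def C_def by (intro add_strict_mono add_less_le_mono) (auto simp: dist_commute)
    finally have "dist q (f j) < 3 * r0 (f j)" by simp
    from loc(3)[OF fP(2)[OF j] q this] show "norm (K z \<omega> + (D (snd z) \<omega> o\<^sub>L A0 (f j))) \<le> e"
      unfolding KQ_def DQ_def q_def by (simp add: ge)
  next
    fix x y \<omega> assume xy: "x \<in> sublevel V R" "y \<in> sublevel V R" and \<omega>: "\<omega> \<in> G"
    define q where "q = (emb x, emb y, \<omega>)"
    have "q \<in> Q" using xy \<omega> unfolding q_def Q_def X_def by auto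
    then obtain p where p: "p \<in> P" "dist p q < r0 p" using P(3) by auto
    then obtain j where j: "j < card P" "f j = p" using f unfolding bij_betw_def by (metis imageE lessThan_iff)
    have "dist (fst p) (fst q) < r0 p" "dist (fst (snd p)) (fst (snd q)) < r0 p" "dist (snd (snd p)) (snd (snd q)) < r0 p"
      using p(2) dist_fst_le[of p q] dist_snd_le[of p q] dist_fst_le[of "snd p" "snd q"] dist_snd_le[of "snd p" "snd q"]
      by linarith+
    then show "\<exists>j<card P. (x, y) \<in> W j \<and> \<omega> \<in> C j"
      using j xy \<omega> unfolding W_def C_def q_def sublevel_def
      by (intro exI[of _ j]) (auto simp: dist_commute)
  qed
qed

lemma moment_data:
  obtains C r :: "'h \<Rightarrow> 'e \<Rightarrow> real" and M :: real where
    "M \<ge> 0" "\<And>y. r y \<in> borel_measurable \<gamma>" "\<And>y \<omega>. \<omega> \<in> E \<Longrightarrow> 0 < r y \<omega>"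
    "\<And>y \<omega>. \<omega> \<in> E \<Longrightarrow> 1 \<le> C y \<omega>"
    "\<And>y \<omega>. y \<in> sublevel V R \<Longrightarrow> \<omega> \<in> E \<Longrightarrow> quadratic_remainder emb \<iota> \<Phi> D HW y \<omega> (C y \<omega>) (r y \<omega>)"
    "\<And>x y. x \<in> sublevel V R \<Longrightarrow> y \<in> sublevel V R \<Longrightarrow>
      (\<integral>\<^sup>+\<omega>. ennreal (C x \<omega> powr p\<^sub>0 + r x \<omega> powr (- p\<^sub>0) + norm (D x \<omega>) powr p\<^sub>0
        + norm (S (x, y) \<omega> + K (x, y) \<omega>) powr p\<^sub>0) \<partial>\<gamma>) \<le> ennreal M"
proof -
  obtain C r :: "'h \<Rightarrow> 'e \<Rightarrow> real" where Cr:
    "(\<lambda>(x, \<omega>). r x \<omega>) \<in> borel \<Otimes>\<^sub>M \<gamma> \<rightarrow>\<^sub>M borel"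
    "\<forall>x. \<forall>\<omega>\<in>E. C x \<omega> \<ge> 1 \<and> 0 < r x \<omega> \<and> r x \<omega> \<le> 1"
    "\<forall>x\<in>sublevel V R. \<forall>\<omega>\<in>E. quadratic_remainder emb \<iota> \<Phi> D HW x \<omega> (C x \<omega>) (r x \<omega>)"
    "(SUP (x, y) \<in> sublevel V R \<times> sublevel V R.
          \<integral>\<^sup>+\<omega>. ennreal (C x \<omega> powr p\<^sub>0 + r x \<omega> powr (- p\<^sub>0) + norm (D x \<omega>) powr p\<^sub>0
            + norm (S (x, y) \<omega> + K (x, y) \<omega>) powr p\<^sub>0) \<partial>\<gamma>) < \<infinity>"
    using remainder unfolding SC_remainder_def by blast
  define m where "m = (SUP (x, y) \<in> sublevel V R \<times> sublevel V R.
          \<integral>\<^sup>+\<omega>. ennreal (C x \<omega> powr p\<^sub>0 + r x \<omega> powr (- p\<^sub>0) + norm (D x \<omega>) powr p\<^sub>0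
            + norm (S (x, y) \<omega> + K (x, y) \<omega>) powr p\<^sub>0) \<partial>\<gamma>)"
  have m: "m = ennreal (enn2real m)" using Cr(4) unfolding m_def[symmetric] by simp
  show ?thesis
  proof (rule that[of "enn2real m" r C])
    show "r y \<in> borel_measurable \<gamma>" for y
      using measurable_compose[OF measurable_Pair1'[of y borel \<gamma>] Cr(1)] by simp
    fix x y assume xy: "x \<in> sublevel V R" "y \<in> sublevel V R"
    have "(\<integral>\<^sup>+\<omega>. ennreal (C x \<omega> powr p\<^sub>0 + r x \<omega> powr (- p\<^sub>0) + norm (D x \<omega>) powr p\<^sub>0
        + norm (S (x, y) \<omega> + K (x, y) \<omega>) powr p\<^sub>0) \<partial>\<gamma>) \<le> m"
      unfolding m_def by (rule SUP_upper2[of "(x, y)"]) (use xy in auto)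
    then show "(\<integral>\<^sup>+\<omega>. ennreal (C x \<omega> powr p\<^sub>0 + r x \<omega> powr (- p\<^sub>0) + norm (D x \<omega>) powr p\<^sub>0
        + norm (S (x, y) \<omega> + K (x, y) \<omega>) powr p\<^sub>0) \<partial>\<gamma>) \<le> ennreal (enn2real m)" using m by simp
  qed (use Cr in auto)
qed

section \<open>Moments of the displacement\<close>

text \<open>On the exceptional noises only moments are available: the displacement of the controlled pair is at
  most the sum of the uncontrolled displacement and the effect of the control. Where the control leaves
  the range of the quadratic estimate, the integrand is cut off.\<close>

lemma controlled_displacement_moment:
  fixes A :: "'k \<Rightarrow>\<^sub>L 'w" and C r :: "'h \<Rightarrow> 'e \<Rightarrow> real"
  assumes M: "M \<ge> 0"
    and r: "\<And>y. r y \<in> borel_measurable \<gamma>"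
    and C: "\<And>y \<omega>. \<omega> \<in> E \<Longrightarrow> 1 \<le> C y \<omega>"
    and quad: "\<And>y \<omega>. y \<in> sublevel V R \<Longrightarrow> \<omega> \<in> E \<Longrightarrow> quadratic_remainder emb \<iota> \<Phi> D HW y \<omega> (C y \<omega>) (r y \<omega>)"
    and moment: "\<And>x y. x \<in> sublevel V R \<Longrightarrow> y \<in> sublevel V R \<Longrightarrow>
      (\<integral>\<^sup>+\<omega>. ennreal (C x \<omega> powr p\<^sub>0 + r x \<omega> powr (- p\<^sub>0) + norm (D x \<omega>) powr p\<^sub>0
        + norm (S (x, y) \<omega> + K (x, y) \<omega>) powr p\<^sub>0) \<partial>\<gamma>) \<le> ennreal M"
    and q: "0 < q" "q \<le> p\<^sub>0" and L: "1 \<le> L"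
    and xy: "x \<in> sublevel V R" "y \<in> sublevel V R"
    and A: "admissible_control A l" "norm A \<le> L"
    and v: "v = emb (y - x)" "0 < norm v" "norm v \<le> 1"
  shows "(\<integral>\<^sup>+\<omega>. indicator {\<omega>. norm (A v) \<le> r y \<omega>} \<omega>
      * ennreal (norm (emb (\<Phi> y (\<omega> + \<iota> (A v))) - emb (\<Phi> x \<omega>)) powr q) \<partial>\<gamma>)
    \<le> ennreal ((4 * L\<^sup>2) powr q * (2 + 2 * M) * norm v powr q)"
proof -
  define h where "h = blinfun_apply A v"
  interpret W: wiener_functional E HW \<iota> \<gamma> "l v" h
    unfolding h_def by (rule admissible_control_functional[OF A(1)])
  have hL: "norm h \<le> L * norm v"
    unfolding h_def using norm_blinfun[of A v] A(2) by (meson mult_right_mono norm_ge_zero order_trans)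
  define \<Delta> where "\<Delta> \<omega> = norm (emb (\<Phi> y (\<omega> + \<iota> h)) - emb (\<Phi> x \<omega>))" for \<omega>
  define J where "J \<omega> = norm (emb (\<Phi> y \<omega> - \<Phi> x \<omega>))" for \<omega>
  define I where "I \<omega> = (indicator {\<omega>. norm h \<le> r y \<omega>} \<omega> :: real)" for \<omega>
  \<comment> \<open>The two contributions, normalised so that \<open>a\<close> is at most the norm of \<open>S + K\<close> and \<open>b\<close> at most
    \<open>C\<close> or the norm of \<open>D\<close>; both \<open>norm h\<close> and its square are at most \<open>L\<^sup>2 * norm v\<close>.\<close>
  define a where "a \<omega> = J \<omega> / norm v" for \<omega>
  define b where "b \<omega> = I \<omega> * (max 0 (\<Delta> \<omega> - J \<omega>) / (2 * L\<^sup>2 * norm v))" for \<omega>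
  note [measurable] = emb_measurable \<Phi>_section_measurable r
  have [measurable]: "(\<lambda>\<omega>. \<Phi> y (\<omega> + \<iota> h)) \<in> \<gamma> \<rightarrow>\<^sub>M borel"
    by (rule measurable_compose[OF W.shift_pm_measurable(1) \<Phi>_section_measurable])
  have [measurable]: "\<Delta> \<in> borel_measurable \<gamma>" "J \<in> borel_measurable \<gamma>" "I \<in> borel_measurable \<gamma>"
    unfolding \<Delta>_def J_def I_def by measurable
  have [measurable]: "a \<in> borel_measurable \<gamma>" "b \<in> borel_measurable \<gamma>" unfolding a_def b_def by measurable
  have L0: "0 < 2 * L\<^sup>2 * norm v" using L v(2) by simp
  have I01: "0 \<le> I \<omega>" "I \<omega> \<le> 1" for \<omega> unfolding I_def by (auto simp: indicator_def)
  have a0: "0 \<le> a \<omega>" and b0: "0 \<le> b \<omega>" for \<omega>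
    using v(2) I01 L0 unfolding a_def b_def J_def by auto
  have aM: "(\<integral>\<^sup>+\<omega>. ennreal (a \<omega> powr p\<^sub>0) \<partial>\<gamma>) \<le> ennreal M"
  proof (rule order_trans[OF nn_integral_mono moment[OF xy]])
    fix \<omega> assume "\<omega> \<in> space \<gamma>"
    then have \<omega>: "\<omega> \<in> E" by (simp add: space_eq)
    have "J \<omega> = norm ((S (x, y) \<omega> + K (x, y) \<omega>) v)"
      using splitting \<omega> unfolding SC_splitting_def J_def v(1) by simp
    also have "\<dots> \<le> norm (S (x, y) \<omega> + K (x, y) \<omega>) * norm v" by (rule norm_blinfun)
    finally have "a \<omega> \<le> norm (S (x, y) \<omega> + K (x, y) \<omega>)" unfolding a_def using v(2) by (simp add: field_simps)
    then have "a \<omega> powr p\<^sub>0 \<le> norm (S (x, y) \<omega> + K (x, y) \<omega>) powr p\<^sub>0" using a0 p0 by (intro powr_mono2) auto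
    also have "\<dots> \<le> C x \<omega> powr p\<^sub>0 + r x \<omega> powr (- p\<^sub>0) + norm (D x \<omega>) powr p\<^sub>0 + norm (S (x, y) \<omega> + K (x, y) \<omega>) powr p\<^sub>0"
      by simp
    finally show "ennreal (a \<omega> powr p\<^sub>0) \<le> ennreal (C x \<omega> powr p\<^sub>0 + r x \<omega> powr (- p\<^sub>0) + norm (D x \<omega>) powr p\<^sub>0
        + norm (S (x, y) \<omega> + K (x, y) \<omega>) powr p\<^sub>0)" by (rule ennreal_leI)
  qed
  have bM: "(\<integral>\<^sup>+\<omega>. ennreal (b \<omega> powr p\<^sub>0) \<partial>\<gamma>) \<le> ennreal M"
  proof (rule order_trans[OF nn_integral_mono moment[OF xy(2,1)]])
    fix \<omega> assume "\<omega> \<in> space \<gamma>"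
    then have \<omega>: "\<omega> \<in> E" by (simp add: space_eq)
    have "b \<omega> \<le> max (C y \<omega>) (norm (D y \<omega>))"
    proof (cases "norm h \<le> r y \<omega>")
      case True
      have "\<Delta> \<omega> \<le> norm (emb (\<Phi> y (\<omega> + \<iota> h)) - emb (\<Phi> y \<omega>) - D y \<omega> h) + norm (D y \<omega> h) + J \<omega>"
      proof -
        have "emb (\<Phi> y (\<omega> + \<iota> h)) - emb (\<Phi> x \<omega>) = ((emb (\<Phi> y (\<omega> + \<iota> h)) - emb (\<Phi> y \<omega>) - D y \<omega> h) + D y \<omega> h)
            + emb (\<Phi> y \<omega> - \<Phi> x \<omega>)" by (simp add: blinfun.diff_right)
        then show ?thesis unfolding \<Delta>_def J_def
          by (metis (no_types, lifting) add_right_mono norm_triangle_ineq order_trans)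
      qed
      moreover have "norm (emb (\<Phi> y (\<omega> + \<iota> h)) - emb (\<Phi> y \<omega>) - D y \<omega> h) \<le> C y \<omega> * (norm h)\<^sup>2"
        using quad[OF xy(2) \<omega>] W.h_in True unfolding quadratic_remainder_def by blast
      moreover have "norm (D y \<omega> h) \<le> norm (D y \<omega>) * norm h" by (rule norm_blinfun)
      moreover have "norm h \<le> L\<^sup>2 * norm v"
      proof -
        have "L * norm v \<le> L\<^sup>2 * norm v" using L by (intro mult_right_mono) (auto simp: power2_eq_square)
        then show ?thesis using hL by linarith
      qed
      then have "norm (D y \<omega>) * norm h \<le> norm (D y \<omega>) * (L\<^sup>2 * norm v)" by (intro mult_left_mono) auto
      moreover have "(norm h)\<^sup>2 \<le> L\<^sup>2 * norm v"
      proof -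
        have "(norm h)\<^sup>2 \<le> (L * norm v)\<^sup>2" using hL by (intro power_mono) auto
        also have "\<dots> = L\<^sup>2 * (norm v * norm v)" by (simp add: power2_eq_square)
        also have "\<dots> \<le> L\<^sup>2 * (norm v * 1)" using v(3) by (intro mult_left_mono) auto
        finally show ?thesis by simp
      qed
      then have "C y \<omega> * (norm h)\<^sup>2 \<le> C y \<omega> * (L\<^sup>2 * norm v)" using C[OF \<omega>, of y] by (intro mult_left_mono) auto
      ultimately have "\<Delta> \<omega> - J \<omega> \<le> C y \<omega> * (L\<^sup>2 * norm v) + norm (D y \<omega>) * (L\<^sup>2 * norm v)" by linarith
      also have "\<dots> \<le> max (C y \<omega>) (norm (D y \<omega>)) * (L\<^sup>2 * norm v) + max (C y \<omega>) (norm (D y \<omega>)) * (L\<^sup>2 * norm v)"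
        by (intro add_mono mult_right_mono) auto
      finally have "\<Delta> \<omega> - J \<omega> \<le> max (C y \<omega>) (norm (D y \<omega>)) * (2 * L\<^sup>2 * norm v)" by (simp add: mult_ac)
      moreover have "0 \<le> max (C y \<omega>) (norm (D y \<omega>)) * (2 * L\<^sup>2 * norm v)"
        using L0 C[OF \<omega>, of y] by (intro mult_nonneg_nonneg) auto
      ultimately have "max 0 (\<Delta> \<omega> - J \<omega>) \<le> max (C y \<omega>) (norm (D y \<omega>)) * (2 * L\<^sup>2 * norm v)" by simp
      then have "max 0 (\<Delta> \<omega> - J \<omega>) / (2 * L\<^sup>2 * norm v) \<le> max (C y \<omega>) (norm (D y \<omega>))"
        using L0 by (simp only: pos_divide_le_eq)
      moreover have "I \<omega> = 1" using True unfolding I_def by simp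
      ultimately show ?thesis unfolding b_def by simp
    next
      case False
      then have "b \<omega> = 0" unfolding b_def I_def by simp
      then show ?thesis using C[OF \<omega>, of y] by simp
    qed
    then have "b \<omega> powr p\<^sub>0 \<le> max (C y \<omega>) (norm (D y \<omega>)) powr p\<^sub>0" using b0 p0 by (intro powr_mono2) auto
    also have "\<dots> \<le> C y \<omega> powr p\<^sub>0 + norm (D y \<omega>) powr p\<^sub>0" by (simp add: max_def)
    also have "\<dots> \<le> C y \<omega> powr p\<^sub>0 + r y \<omega> powr (- p\<^sub>0) + norm (D y \<omega>) powr p\<^sub>0 + norm (S (y, x) \<omega> + K (y, x) \<omega>) powr p\<^sub>0"
      by simp
    finally show "ennreal (b \<omega> powr p\<^sub>0) \<le> ennreal (C y \<omega> powr p\<^sub>0 + r y \<omega> powr (- p\<^sub>0) + norm (D y \<omega>) powr p\<^sub>0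
        + norm (S (y, x) \<omega> + K (y, x) \<omega>) powr p\<^sub>0)" by (rule ennreal_leI)
  qed
  have powr_le: "t powr q \<le> 1 + t powr p\<^sub>0" if "0 \<le> t" for t :: real
  proof (cases "t \<le> 1")
    case True
    then have "t powr q \<le> 1" using that q by (simp add: powr_le1)
    then show ?thesis by (smt (verit) powr_ge_zero)
  next
    case False
    then have "t powr q \<le> t powr p\<^sub>0" using q by (intro powr_mono) auto
    then show ?thesis by simp
  qed
  define c where "c = (4 * L\<^sup>2) powr q * norm v powr q"
  have c0: "0 \<le> c" unfolding c_def by simp
  have pt: "I \<omega> * \<Delta> \<omega> powr q \<le> c * (2 + a \<omega> powr p\<^sub>0 + b \<omega> powr p\<^sub>0)" for \<omega>
  proof (cases "norm h \<le> r y \<omega>")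
    case True
    then have I1: "I \<omega> = 1" unfolding I_def by simp
    have J: "J \<omega> = norm v * a \<omega>" using v(2) unfolding a_def by simp
    have "L \<noteq> 0" using L by simp
    then have bb: "max 0 (\<Delta> \<omega> - J \<omega>) = 2 * L\<^sup>2 * norm v * b \<omega>" using I1 v(2) unfolding b_def by simp
    have "1 \<le> L\<^sup>2" using L by (rule one_le_power)
    then have "1 \<le> 2 * L\<^sup>2" by simp
    then have "1 * (norm v * a \<omega>) \<le> 2 * L\<^sup>2 * (norm v * a \<omega>)" using a0 by (intro mult_right_mono) auto
    then have "J \<omega> + max 0 (\<Delta> \<omega> - J \<omega>) \<le> 2 * L\<^sup>2 * (norm v * a \<omega>) + 2 * L\<^sup>2 * norm v * b \<omega>"
      unfolding J[symmetric] bb[symmetric] by simp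
    moreover have "\<Delta> \<omega> \<le> J \<omega> + max 0 (\<Delta> \<omega> - J \<omega>)" by simp
    ultimately have "\<Delta> \<omega> \<le> 2 * L\<^sup>2 * (norm v * a \<omega>) + 2 * L\<^sup>2 * norm v * b \<omega>" by linarith
    then have "\<Delta> \<omega> \<le> 2 * L\<^sup>2 * norm v * (a \<omega> + b \<omega>)" by (simp add: algebra_simps)
    also have "\<dots> \<le> 2 * L\<^sup>2 * norm v * (2 * max (a \<omega>) (b \<omega>))" using L0 by (intro mult_left_mono) auto
    also have "\<dots> = 4 * L\<^sup>2 * norm v * max (a \<omega>) (b \<omega>)" by simp
    finally have "\<Delta> \<omega> powr q \<le> (4 * L\<^sup>2 * norm v * max (a \<omega>) (b \<omega>)) powr q"
      using q unfolding \<Delta>_def by (intro powr_mono2) auto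
    also have "\<dots> = c * max (a \<omega>) (b \<omega>) powr q" unfolding c_def using a0[of \<omega>] by (simp add: powr_mult le_max_iff_disj)
    also have "max (a \<omega>) (b \<omega>) powr q \<le> a \<omega> powr q + b \<omega> powr q" by (simp add: max_def)
    also have "\<dots> \<le> 2 + a \<omega> powr p\<^sub>0 + b \<omega> powr p\<^sub>0" using powr_le[OF a0, of \<omega>] powr_le[OF b0, of \<omega>] by linarith
    finally show ?thesis using I1 c0 by (simp add: mult_left_mono)
  next
    case False
    then show ?thesis unfolding I_def using c0 by (simp add: add_nonneg_nonneg)
  qed
  have "(\<integral>\<^sup>+\<omega>. indicator {\<omega>. norm h \<le> r y \<omega>} \<omega> * ennreal (\<Delta> \<omega> powr q) \<partial>\<gamma>)
      \<le> (\<integral>\<^sup>+\<omega>. ennreal c * (2 + ennreal (a \<omega> powr p\<^sub>0) + ennreal (b \<omega> powr p\<^sub>0)) \<partial>\<gamma>)"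
  proof (rule nn_integral_mono)
    fix \<omega>
    have "indicator {\<omega>. norm h \<le> r y \<omega>} \<omega> * ennreal (\<Delta> \<omega> powr q) = ennreal (I \<omega> * \<Delta> \<omega> powr q)"
      unfolding I_def by (simp add: indicator_def)
    also have "\<dots> \<le> ennreal (c * (2 + a \<omega> powr p\<^sub>0 + b \<omega> powr p\<^sub>0))" by (rule ennreal_leI[OF pt])
    also have "\<dots> = ennreal c * (2 + ennreal (a \<omega> powr p\<^sub>0) + ennreal (b \<omega> powr p\<^sub>0))"
      using c0 by (simp add: ennreal_mult ennreal_plus add_nonneg_nonneg)
    finally show "indicator {\<omega>. norm h \<le> r y \<omega>} \<omega> * ennreal (\<Delta> \<omega> powr q)
        \<le> ennreal c * (2 + ennreal (a \<omega> powr p\<^sub>0) + ennreal (b \<omega> powr p\<^sub>0))" .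
  qed
  also have "\<dots> = ennreal c * (2 + (\<integral>\<^sup>+\<omega>. ennreal (a \<omega> powr p\<^sub>0) \<partial>\<gamma>) + (\<integral>\<^sup>+\<omega>. ennreal (b \<omega> powr p\<^sub>0) \<partial>\<gamma>))"
    by (simp add: nn_integral_cmult nn_integral_add emeasure_space_1)
  also have "\<dots> \<le> ennreal c * (2 + ennreal M + ennreal M)" by (intro mult_left_mono add_mono aM bM) auto
  also have "\<dots> = ennreal (c * (2 + 2 * M))"
  proof -
    have 1: "ennreal (2 + M + M) = ennreal (2 + M) + ennreal M" by (rule ennreal_plus) (use M in auto)
    have 2: "ennreal (2 + M) = ennreal 2 + ennreal M" by (rule ennreal_plus) (use M in auto)
    have "ennreal c * (2 + ennreal M + ennreal M) = ennreal c * ennreal (2 + M + M)"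
      by (simp only: 1 2 ennreal_numeral)
    also have "\<dots> = ennreal (c * (2 + M + M))" by (rule ennreal_mult[symmetric]) (use M c0 in auto)
    also have "c * (2 + M + M) = c * (2 + 2 * M)" by simp
    finally show ?thesis .
  qed
  also have "c * (2 + 2 * M) = (4 * L\<^sup>2) powr q * (2 + 2 * M) * norm v powr q" unfolding c_def by simp
  finally show ?thesis unfolding \<Delta>_def h_def .
qed

text \<open>Cauchy--Schwarz turns the moment bound into smallness on sets of small measure, relative to the
  distance and uniformly in the controls of bounded norm.\<close>

lemma controlled_displacement_on_small_set:
  fixes C r :: "'h \<Rightarrow> 'e \<Rightarrow> real"
  assumes M: "M \<ge> 0"
    and r: "\<And>y. r y \<in> borel_measurable \<gamma>"
    and C: "\<And>y \<omega>. \<omega> \<in> E \<Longrightarrow> 1 \<le> C y \<omega>"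
    and quad: "\<And>y \<omega>. y \<in> sublevel V R \<Longrightarrow> \<omega> \<in> E \<Longrightarrow> quadratic_remainder emb \<iota> \<Phi> D HW y \<omega> (C y \<omega>) (r y \<omega>)"
    and moment: "\<And>x y. x \<in> sublevel V R \<Longrightarrow> y \<in> sublevel V R \<Longrightarrow>
      (\<integral>\<^sup>+\<omega>. ennreal (C x \<omega> powr p\<^sub>0 + r x \<omega> powr (- p\<^sub>0) + norm (D x \<omega>) powr p\<^sub>0
        + norm (S (x, y) \<omega> + K (x, y) \<omega>) powr p\<^sub>0) \<partial>\<gamma>) \<le> ennreal M"
    and q: "0 < q" "2 * q \<le> p\<^sub>0" and L: "1 \<le> L" and b: "b > 0"
  obtains \<eta> where "\<eta> > 0"
    "\<And>B x y v A l. B \<in> sets \<gamma> \<Longrightarrow> measure \<gamma> B \<le> \<eta> \<Longrightarrow> x \<in> sublevel V R \<Longrightarrow> y \<in> sublevel V R \<Longrightarrow>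
      admissible_control A l \<Longrightarrow> norm A \<le> L \<Longrightarrow> v = emb (y - x) \<Longrightarrow> 0 < norm v \<Longrightarrow> norm v \<le> 1 \<Longrightarrow>
      (\<integral>\<^sup>+\<omega>. indicator B \<omega> * (indicator {\<omega>. norm (blinfun_apply A v) \<le> r y \<omega>} \<omega>
        * ennreal (norm (emb (\<Phi> y (\<omega> + \<iota> (A v))) - emb (\<Phi> x \<omega>)) powr q)) \<partial>\<gamma>)
      \<le> ennreal (b * norm v powr q)"
proof -
  define Y where "Y = (4 * L\<^sup>2) powr (2 * q) * (2 + 2 * M)"
  have Y: "Y > 0" unfolding Y_def using L M by simp
  show ?thesis
  proof (rule that[of "b\<^sup>2 / Y"])
    show "b\<^sup>2 / Y > 0" using b Y by simp
    fix B x y v and A :: "'k \<Rightarrow>\<^sub>L 'w" and l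
    assume B: "B \<in> sets \<gamma>" "measure \<gamma> B \<le> b\<^sup>2 / Y" and xy: "x \<in> sublevel V R" "y \<in> sublevel V R"
      and A: "admissible_control A l" "norm A \<le> L" and v: "v = emb (y - x)" "0 < norm v" "norm v \<le> 1"
    define h where "h = blinfun_apply A v"
    interpret W: wiener_functional E HW \<iota> \<gamma> "l v" h
      unfolding h_def by (rule admissible_control_functional[OF A(1)])
    define \<Delta> where "\<Delta> \<omega> = norm (emb (\<Phi> y (\<omega> + \<iota> h)) - emb (\<Phi> x \<omega>))" for \<omega>
    define f where "f \<omega> = (indicator B \<omega> :: real)" for \<omega>
    define g where "g \<omega> = indicator {\<omega>. norm h \<le> r y \<omega>} \<omega> * \<Delta> \<omega> powr (2 * q)" for \<omega>
    note [measurable] = emb_measurable \<Phi>_section_measurable r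
    have [measurable]: "(\<lambda>\<omega>. \<Phi> y (\<omega> + \<iota> h)) \<in> \<gamma> \<rightarrow>\<^sub>M borel"
      by (rule measurable_compose[OF W.shift_pm_measurable(1) \<Phi>_section_measurable])
    have gm: "g \<in> borel_measurable \<gamma>" unfolding g_def \<Delta>_def by measurable
    have fm: "f \<in> borel_measurable \<gamma>" unfolding f_def using B(1) by measurable
    have fb: "(\<integral>\<^sup>+\<omega>. ennreal (f \<omega>) \<partial>\<gamma>) \<le> ennreal (b\<^sup>2 / Y)"
    proof -
      have "(\<integral>\<^sup>+\<omega>. ennreal (f \<omega>) \<partial>\<gamma>) = emeasure \<gamma> B"
        unfolding f_def ennreal_indicator using B(1) by simp
      then show ?thesis using B(2) by (simp add: emeasure_eq_measure ennreal_leI)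
    qed
    have gb: "(\<integral>\<^sup>+\<omega>. ennreal (g \<omega>) \<partial>\<gamma>) \<le> ennreal (Y * norm v powr (2 * q))"
    proof -
      have "ennreal (g \<omega>) = indicator {\<omega>. norm h \<le> r y \<omega>} \<omega> * ennreal (\<Delta> \<omega> powr (2 * q))" for \<omega>
        unfolding g_def by (simp add: indicator_def)
      moreover have "0 < 2 * q" using q(1) by simp
      ultimately show ?thesis
        using controlled_displacement_moment[OF M r C quad moment _ q(2) L xy A v] unfolding \<Delta>_def h_def Y_def by simp
    qed
    have "(\<integral>\<^sup>+\<omega>. ennreal (sqrt (f \<omega> * g \<omega>)) \<partial>\<gamma>) \<le> ennreal (sqrt (b\<^sup>2 / Y * (Y * norm v powr (2 * q))))"
      by (rule nn_integral_sqrt_mult_le[OF fm _ gm _ fb _ gb]) (use Y in \<open>auto simp: f_def g_def\<close>)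
    also have "b\<^sup>2 / Y * (Y * norm v powr (2 * q)) = (b * norm v powr q)\<^sup>2"
      using Y v(2) by (simp add: power_mult_distrib power2_eq_square flip: powr_add)
    also have "sqrt \<dots> = b * norm v powr q" using b by simp
    also have "(\<lambda>\<omega>. ennreal (sqrt (f \<omega> * g \<omega>))) = (\<lambda>\<omega>. indicator B \<omega> * (indicator {\<omega>. norm h \<le> r y \<omega>} \<omega> * ennreal (\<Delta> \<omega> powr q)))"
    proof
      fix \<omega>
      have "sqrt (\<Delta> \<omega> powr (2 * q)) = \<Delta> \<omega> powr q"
      proof -
        have "\<Delta> \<omega> powr (2 * q) = (\<Delta> \<omega> powr q)\<^sup>2" by (simp add: power2_eq_square flip: powr_add)
        then show ?thesis by simp
      qed
      then show "ennreal (sqrt (f \<omega> * g \<omega>)) = indicator B \<omega> * (indicator {\<omega>. norm h \<le> r y \<omega>} \<omega> * ennreal (\<Delta> \<omega> powr q))"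
        unfolding f_def g_def by (simp add: indicator_def)
    qed
    finally show "(\<integral>\<^sup>+\<omega>. indicator B \<omega> * (indicator {\<omega>. norm (blinfun_apply A v) \<le> r y \<omega>} \<omega>
        * ennreal (norm (emb (\<Phi> y (\<omega> + \<iota> (A v))) - emb (\<Phi> x \<omega>)) powr q)) \<partial>\<gamma>)
      \<le> ennreal (b * norm v powr q)" unfolding \<Delta>_def h_def .
  qed
qed

end

section \<open>Contraction at small distances\<close>

text \<open>Two applications of Young's inequality. They separate the exponential weights of \<open>D_chi\<close> at the
  endpoints, of which only marginal moments are known, from the displacement \<open>t\<close>; the parameter \<open>k\<close> is
  the typical size of \<open>t\<close>, which makes all terms of this order.\<close>

lemma weighted_product_le:
  fixes a b t k :: real
  assumes "0 \<le> t" "0 < k"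
  shows "exp (a + b) * t \<le> k / 4 * exp (4 * a) + k / 4 * exp (4 * b) + t\<^sup>2 / (2 * k)"
proof -
  have young: "2 * (p * q) \<le> p\<^sup>2 + q\<^sup>2" for p q :: real
    using sum_squares_ge_zero[of "p - q" 0] by (simp add: power2_eq_square algebra_simps)
  have e: "(exp (a + b))\<^sup>2 = exp (2 * a) * exp (2 * b)" by (simp add: power2_eq_square flip: exp_add)
  have "2 * (exp (2 * a) * exp (2 * b)) \<le> exp (4 * a) + exp (4 * b)"
    using young[of "exp (2 * a)" "exp (2 * b)"] by (simp add: power2_eq_square flip: exp_add)
  then have 1: "(exp (a + b))\<^sup>2 \<le> exp (4 * a) / 2 + exp (4 * b) / 2" unfolding e by simp
  have "2 * (exp (a + b) * t) \<le> k * (exp (a + b))\<^sup>2 + t\<^sup>2 / k"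
    using young[of "sqrt k * exp (a + b)" "t / sqrt k"] assms
    by (simp add: power_mult_distrib power_divide)
  also have "\<dots> \<le> k * (exp (4 * a) / 2 + exp (4 * b) / 2) + t\<^sup>2 / k"
    using 1 assms by (intro add_right_mono mult_left_mono) auto
  finally show ?thesis using assms by (simp add: field_simps)
qed

lemma ennreal_affine:
  assumes "0 \<le> a" "0 \<le> b" "0 \<le> c" "0 \<le> d"
  shows "ennreal (a + b + c * d) = ennreal a + ennreal b + ennreal c * ennreal d"
  using assms by (simp add: ennreal_plus ennreal_mult)

lemma ennreal_affine':
  assumes "0 \<le> a" "0 \<le> b" "0 \<le> c" "0 \<le> d" "0 \<le> e"
  shows "ennreal a + ennreal b * (ennreal c * ennreal d + ennreal e) = ennreal (a + b * (c * d + e))"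
  using assms by (simp add: ennreal_plus ennreal_mult)

lemma ennreal_plus4:
  assumes "0 \<le> a" "0 \<le> b" "0 \<le> c" "0 \<le> d"
  shows "ennreal a + ennreal b + ennreal c + ennreal d = ennreal (a + b + c + d)"
  using assms by (simp add: ennreal_plus)

context controlled_block
begin

lemma D_chi_pair_measurable:
  "(\<lambda>p. D_chi emb V chi (fst p) (snd p)) \<in> borel_measurable (borel \<Otimes>\<^sub>M borel)"
proof -
  note [measurable] = V_measurable emb_measurable
  show ?thesis unfolding D_chi_def by measurable
qed

text \<open>The pieces of the choice: \<open>\<epsilon>\<close> bounds the remaining linear expansion; the compact set \<open>G\<close> is fixed
  before the controls, since the uncontrolled displacement does not depend on them; the width of the
  partition of unity is fixed after the controls, so that the set where a control acts outside
  its validity is small relative to their norms; \<open>r\<^sub>1\<close> finally absorbs the Lipschitz constants. The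
  second moments of the displacement to the power \<open>\<alpha>\<close>, to which Cauchy--Schwarz is applied once more,
  are the reason for \<open>4 * \<alpha> \<le> p\<^sub>0\<close>.\<close>

theorem local_contraction:
  assumes Q: "\<And>x. distr \<gamma> borel (\<Phi> x) = Q x"
    and full: "\<Omega> \<in> sets \<gamma>" "measure \<gamma> \<Omega> = 1" "\<And>x \<omega>. \<omega> \<in> \<Omega> \<Longrightarrow> closure (blinfun_apply (D x \<omega>) ` HW) = UNIV"
    and chi: "chi > 0" and \<alpha>: "0 < \<alpha>" "\<alpha> \<le> 1" "4 * \<alpha> \<le> p\<^sub>0"
    and U: "0 \<le> U" "\<And>x. x \<in> sublevel V R \<Longrightarrow> (\<integral>\<^sup>+u. ennreal (exp (4 * \<alpha> * chi * V u)) \<partial>Q x) \<le> ennreal U"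
    and \<epsilon>: "0 < \<epsilon>" "\<rho> \<le> \<epsilon>" "(3 * \<epsilon>) powr \<alpha> * (U / 2 + 3 / 2) \<le> 1 / 4"
  obtains \<kappa> r\<^sub>1 where "couples \<kappa> Q borel" "0 < r\<^sub>1"
    "\<And>r\<^sub>0 x y. 0 < r\<^sub>0 \<Longrightarrow> r\<^sub>0 \<le> r\<^sub>1 \<Longrightarrow> x \<in> sublevel V R \<Longrightarrow> y \<in> sublevel V R \<Longrightarrow> x \<noteq> y \<Longrightarrow>
      D_chi emb V chi x y < r\<^sub>0 \<Longrightarrow>
      (\<integral>\<^sup>+p. ennreal (d\<^sub>0 emb V chi r\<^sub>0 \<alpha> (fst p) (snd p)) \<partial>\<kappa> (x, y)) \<le> ennreal (d\<^sub>0 emb V chi r\<^sub>0 \<alpha> x y / 2)"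
proof -
  obtain C r M where CM: "M \<ge> 0" "\<And>y. r y \<in> borel_measurable \<gamma>" "\<And>y \<omega>. \<omega> \<in> E \<Longrightarrow> 0 < r y \<omega>"
    "\<And>y \<omega>. \<omega> \<in> E \<Longrightarrow> 1 \<le> C y \<omega>"
    "\<And>y \<omega>. y \<in> sublevel V R \<Longrightarrow> \<omega> \<in> E \<Longrightarrow> quadratic_remainder emb \<iota> \<Phi> D HW y \<omega> (C y \<omega>) (r y \<omega>)"
    "\<And>x y. x \<in> sublevel V R \<Longrightarrow> y \<in> sublevel V R \<Longrightarrow>
      (\<integral>\<^sup>+\<omega>. ennreal (C x \<omega> powr p\<^sub>0 + r x \<omega> powr (- p\<^sub>0) + norm (D x \<omega>) powr p\<^sub>0
        + norm (S (x, y) \<omega> + K (x, y) \<omega>) powr p\<^sub>0) \<partial>\<gamma>) \<le> ennreal M"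
    by (rule moment_data[of R]) (rule that; assumption)
  have q: "0 < 2 * \<alpha>" "2 * (2 * \<alpha>) \<le> p\<^sub>0" using \<alpha> by auto
  have small: "\<exists>\<eta>>0. \<forall>B x y v A l. B \<in> sets \<gamma> \<longrightarrow> measure \<gamma> B \<le> \<eta> \<longrightarrow> x \<in> sublevel V R \<longrightarrow> y \<in> sublevel V R \<longrightarrow>
        admissible_control A l \<longrightarrow> norm A \<le> L \<longrightarrow> v = emb (y - x) \<longrightarrow> 0 < norm v \<longrightarrow> norm v \<le> 1 \<longrightarrow>
        (\<integral>\<^sup>+\<omega>. indicator B \<omega> * (indicator {\<omega>. norm (blinfun_apply A v) \<le> r y \<omega>} \<omega>
          * ennreal (norm (emb (\<Phi> y (\<omega> + \<iota> (A v))) - emb (\<Phi> x \<omega>)) powr (2 * \<alpha>))) \<partial>\<gamma>)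
        \<le> ennreal (b * norm v powr (2 * \<alpha>))"
    if Lb: "1 \<le> L" "b > 0" for L b
  proof (rule controlled_displacement_on_small_set[where M = M and r = r and C = C and R = R and q = "2 * \<alpha>" and L = L and b = b])
    fix \<eta> :: real
    assume "\<eta> > 0" and "\<And>B x y v A l. B \<in> sets \<gamma> \<Longrightarrow> measure \<gamma> B \<le> \<eta> \<Longrightarrow> x \<in> sublevel V R \<Longrightarrow> y \<in> sublevel V R \<Longrightarrow>
        admissible_control A l \<Longrightarrow> norm A \<le> L \<Longrightarrow> v = emb (y - x) \<Longrightarrow> 0 < norm v \<Longrightarrow> norm v \<le> 1 \<Longrightarrow>
        (\<integral>\<^sup>+\<omega>. indicator B \<omega> * (indicator {\<omega>. norm (blinfun_apply A v) \<le> r y \<omega>} \<omega>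
          * ennreal (norm (emb (\<Phi> y (\<omega> + \<iota> (A v))) - emb (\<Phi> x \<omega>)) powr (2 * \<alpha>))) \<partial>\<gamma>)
        \<le> ennreal (b * norm v powr (2 * \<alpha>))"
    then show ?thesis by blast
  qed (rule CM q Lb; assumption)+
  define b\<^sub>0 where "b\<^sub>0 = (3 * \<epsilon>) powr (2 * \<alpha>)"
  have b0: "b\<^sub>0 > 0" unfolding b\<^sub>0_def using \<epsilon> by simp
  \<comment> \<open>Outside \<open>G\<close> no control acts, so the smallness needed there involves the zero control only.\<close>
  obtain \<eta>\<^sub>0 where \<eta>0: "\<eta>\<^sub>0 > 0"
    "\<And>B x y v A l. B \<in> sets \<gamma> \<Longrightarrow> measure \<gamma> B \<le> \<eta>\<^sub>0 \<Longrightarrow> x \<in> sublevel V R \<Longrightarrow> y \<in> sublevel V R \<Longrightarrow>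
      admissible_control A l \<Longrightarrow> norm A \<le> 1 \<Longrightarrow> v = emb (y - x) \<Longrightarrow> 0 < norm v \<Longrightarrow> norm v \<le> 1 \<Longrightarrow>
      (\<integral>\<^sup>+\<omega>. indicator B \<omega> * (indicator {\<omega>. norm (blinfun_apply A v) \<le> r y \<omega>} \<omega>
        * ennreal (norm (emb (\<Phi> y (\<omega> + \<iota> (A v))) - emb (\<Phi> x \<omega>)) powr (2 * \<alpha>))) \<partial>\<gamma>)
      \<le> ennreal (b\<^sub>0 * norm v powr (2 * \<alpha>))"
    using small[OF order_refl b0] by blast
  obtain G where G: "compact G" "G \<subseteq> \<Omega>" "measure \<gamma> (\<Omega> - G) < \<eta>\<^sub>0"
    using inner_regular_compact[OF full(1) \<eta>0(1)] by blast
  have \<Omega>E: "\<Omega> \<subseteq> E" using full(1) sets_iff by blast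
  have GE: "G \<subseteq> E" using G(2) \<Omega>E by blast
  have Gs: "G \<in> sets \<gamma>" using compact_imp_closed[OF G(1)] GE by (simp add: sets_iff)
  have EG: "E - G \<in> sets \<gamma>" "measure \<gamma> (E - G) \<le> \<eta>\<^sub>0"
  proof -
    have Es: "E \<in> sets \<gamma>" using sets.top[of \<gamma>] unfolding space_eq .
    show "E - G \<in> sets \<gamma>" using Es Gs by blast
    have "measure \<gamma> (E - G) \<le> measure \<gamma> ((\<Omega> - G) \<union> (E - \<Omega>))"
      using Es Gs full(1) by (intro finite_measure_mono) auto
    also have "\<dots> \<le> measure \<gamma> (\<Omega> - G) + measure \<gamma> (E - \<Omega>)" using Es Gs full(1) by (intro measure_Un_le) auto
    also have "measure \<gamma> (E - \<Omega>) = 0" using prob_compl[OF full(1)] full(2) unfolding space_eq by simp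
    finally show "measure \<gamma> (E - G) \<le> \<eta>\<^sub>0" using G(3) by simp
  qed
  have dense': "closure (blinfun_apply (D x \<omega>) ` HW) = UNIV" if "\<omega> \<in> G" for x \<omega>
    using full(3) G(2) that by blast
  obtain N W Cs A l where cover:
    "\<And>j. j < (N::nat) \<Longrightarrow> W j \<in> sets (borel \<Otimes>\<^sub>M borel)"
    "\<And>j. j < N \<Longrightarrow> closed (Cs j)" "\<And>j. j < N \<Longrightarrow> Cs j \<noteq> {}" "\<And>j. j < N \<Longrightarrow> Cs j \<subseteq> G"
    "\<And>j. j < N \<Longrightarrow> admissible_control (A j) (l j)"
    "\<And>j z \<omega>. j < N \<Longrightarrow> z \<in> W j \<Longrightarrow> \<omega> \<in> Cs j \<Longrightarrow> norm (K z \<omega> + (D (snd z) \<omega> o\<^sub>L A j)) \<le> \<epsilon>"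
    "\<And>x y \<omega>. x \<in> sublevel V R \<Longrightarrow> y \<in> sublevel V R \<Longrightarrow> \<omega> \<in> G \<Longrightarrow> \<exists>j<N. (x, y) \<in> W j \<and> \<omega> \<in> Cs j"
    by (rule control_cover[OF G(1) GE _ \<epsilon>(1), of R]) ((rule dense'; assumption) | (rule that; assumption))+
  define L where "L = 1 + (\<Sum>j<N. norm (A j))"
  have L1: "1 \<le> L" unfolding L_def by (simp add: sum_nonneg)
  have AL: "norm (A j) \<le> L" if "j < N" for j
    unfolding L_def using member_le_sum[of j "{..<N}" "\<lambda>j. norm (A j)"] that by simp
  obtain c r\<^sub>F where cF: "r\<^sub>F > 0"
    "\<And>y \<omega> j v. y \<in> sublevel V R \<Longrightarrow> \<omega> \<in> G \<Longrightarrow> j < N \<Longrightarrow> norm (A j v) \<le> r\<^sub>F \<Longrightarrow>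
      norm (emb (\<Phi> y (\<omega> + \<iota> (A j v))) - emb (\<Phi> y \<omega>) - D y \<omega> (A j v)) \<le> c * (norm (A j v))\<^sup>2"
  proof -
    have "\<exists>B. j < N \<longrightarrow> finite B \<and> B \<subseteq> adjoint_range E HW \<iota> \<and> range (blinfun_apply (A j)) \<subseteq> span B" for j
    proof (cases "j < N")
      case True
      from cover(5)[OF True]
      have "\<exists>B. finite B \<and> B \<subseteq> adjoint_range E HW \<iota> \<and> range (blinfun_apply (A j)) \<subseteq> span B"
        unfolding admissible_control_def by (elim conjE)
      then show ?thesis by blast
    qed simp
    then obtain B where B: "\<And>j. j < N \<Longrightarrow> finite (B j)" "\<And>j. j < N \<Longrightarrow> B j \<subseteq> adjoint_range E HW \<iota>"
      "\<And>j. j < N \<Longrightarrow> range (blinfun_apply (A j)) \<subseteq> span (B j)" by metis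
    define F where "F = span (\<Union>j<N. B j)"
    have F: "subspace F" "\<exists>B. finite B \<and> F = span B" "F \<subseteq> adjoint_range E HW \<iota>"
    proof -
      show "subspace F" unfolding F_def by (rule subspace_span)
      show "\<exists>B. finite B \<and> F = span B" unfolding F_def using B(1) by blast
      show "F \<subseteq> adjoint_range E HW \<iota>" unfolding F_def
        by (rule span_minimal[OF _ subspace_adjoint_range]) (use B(2) in blast)
    qed
    have "\<exists>c r. r > 0 \<and> (\<forall>x\<in>sublevel V R. \<forall>\<omega>\<in>G. quadratic_remainder emb \<iota> \<Phi> D F x \<omega> c r)"
      using remainder F GE G(1) unfolding SC_remainder_def by blast
    then obtain c r where cr: "r > 0" "\<And>y \<omega>. y \<in> sublevel V R \<Longrightarrow> \<omega> \<in> G \<Longrightarrow> quadratic_remainder emb \<iota> \<Phi> D F y \<omega> c r"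
      by blast
    have "A j v \<in> F" if "j < N" for j v
      using B(3)[OF that] span_mono[of "B j" "\<Union>j<N. B j"] that unfolding F_def by blast
    then show ?thesis using that[of r c] cr unfolding quadratic_remainder_def by blast
  qed
  have b1: "b\<^sub>0 / (real N + 1) > 0" using b0 by simp
  obtain \<eta>\<^sub>1 where \<eta>1: "\<eta>\<^sub>1 > 0"
    "\<And>B x y v A l. B \<in> sets \<gamma> \<Longrightarrow> measure \<gamma> B \<le> \<eta>\<^sub>1 \<Longrightarrow> x \<in> sublevel V R \<Longrightarrow> y \<in> sublevel V R \<Longrightarrow>
      admissible_control A l \<Longrightarrow> norm A \<le> L \<Longrightarrow> v = emb (y - x) \<Longrightarrow> 0 < norm v \<Longrightarrow> norm v \<le> 1 \<Longrightarrow>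
      (\<integral>\<^sup>+\<omega>. indicator B \<omega> * (indicator {\<omega>. norm (blinfun_apply A v) \<le> r y \<omega>} \<omega>
        * ennreal (norm (emb (\<Phi> y (\<omega> + \<iota> (A v))) - emb (\<Phi> x \<omega>)) powr (2 * \<alpha>))) \<partial>\<gamma>)
      \<le> ennreal (b\<^sub>0 / (real N + 1) * norm v powr (2 * \<alpha>))"
    using small[OF L1 b1] by blast
  have "\<exists>k>0. j < N \<longrightarrow> (\<forall>k'. 0 < k' \<longrightarrow> k' \<le> k \<longrightarrow> measure \<gamma> {w\<in>E. 0 < infdist w (Cs j) \<and> infdist w (Cs j) < k'} < \<eta>\<^sub>1)" for j
  proof (cases "j < N")
    case True
    obtain k where "k > 0" "\<And>k'. 0 < k' \<Longrightarrow> k' \<le> k \<Longrightarrow> measure \<gamma> {w\<in>E. 0 < infdist w (Cs j) \<and> infdist w (Cs j) < k'} < \<eta>\<^sub>1"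
      by (rule punctured_neighbourhood_small[OF cover(2)[OF True] cover(3)[OF True] \<eta>1(1)]) (rule that; assumption)
    then show ?thesis by (intro exI[of _ k]) simp
  qed (intro exI[of _ 1], simp)
  then have "\<forall>j. \<exists>k. k > 0 \<and> (j < N \<longrightarrow> (\<forall>k'. 0 < k' \<longrightarrow> k' \<le> k \<longrightarrow>
      measure \<gamma> {w\<in>E. 0 < infdist w (Cs j) \<and> infdist w (Cs j) < k'} < \<eta>\<^sub>1))" by simp
  from choice[OF this] obtain kf where "\<forall>j. kf j > 0 \<and> (j < N \<longrightarrow> (\<forall>k'. 0 < k' \<longrightarrow> k' \<le> kf j \<longrightarrow>
      measure \<gamma> {w\<in>E. 0 < infdist w (Cs j) \<and> infdist w (Cs j) < k'} < \<eta>\<^sub>1))" ..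
  then have kf: "\<And>j. kf j > 0"
    "\<And>j k'. j < N \<Longrightarrow> 0 < k' \<Longrightarrow> k' \<le> kf j \<Longrightarrow> measure \<gamma> {w\<in>E. 0 < infdist w (Cs j) \<and> infdist w (Cs j) < k'} < \<eta>\<^sub>1"
    by simp_all
  define kk where "kk = Min (insert 1 (kf ` {..<N}))"
  have kk: "kk > 0" "\<And>j. j < N \<Longrightarrow> kk \<le> kf j" unfolding kk_def using kf(1) by auto
  \<comment> \<open>The index \<open>N\<close> stands for the absence of a control. \<open>B j\<close> contains the noises at which the
    \<open>j\<close>-th choice may be drawn although it is not known to be effective.\<close>
  define B where "B j = (if j < N then {w\<in>E. 0 < infdist w (Cs j) \<and> infdist w (Cs j) < kk} else E - G)" for j
  have infm: "(\<lambda>w. infdist w X) \<in> borel_measurable \<gamma>" for X by (intro continuous_measurable continuous_intros)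
  have Bs: "B j \<in> sets \<gamma>" for j
  proof -
    have "{w\<in>space \<gamma>. 0 < infdist w (Cs j) \<and> infdist w (Cs j) < kk} \<in> sets \<gamma>" using infm[of "Cs j"] by measurable
    then show ?thesis unfolding B_def space_eq using EG(1) by simp
  qed
  define A' where "A' j = (if j < N then A j else 0)" for j
  define l' where "l' j = (if j < N then l j else (\<lambda>_ _. 0))" for j
  have A': "admissible_control (A' j) (l' j)" for j
    unfolding A'_def l'_def by (cases "j < N") (simp_all add: cover(5) admissible_control_zero)
  have A'L: "norm (A' j) \<le> L" for j unfolding A'_def using AL L1 by simp
  \<comment> \<open>Since the cut-off at \<open>N\<close> is constantly 1, the increments of the running maximum sum up to 1, and the
    last one vanishes wherever one of the others equals 1; for pairs in the sublevel set this is so on \<open>G\<close>.\<close>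
  define b where "b z \<omega> j = (if j < N then indicator (W j) z * max 0 (1 - infdist \<omega> (Cs j) / kk) else (1::real))" for z \<omega> j
  define \<psi> where "\<psi> j z \<omega> = max_increment (b z \<omega>) j" for j z \<omega>
  have b01: "0 \<le> b z \<omega> j" "b z \<omega> j \<le> 1" for z \<omega> j
    unfolding b_def using kk(1) infdist_nonneg[of \<omega> "Cs j"] by (auto simp: indicator_def)
  have bm: "(\<lambda>p. b (fst p) (snd p) j) \<in> borel_measurable ((borel \<Otimes>\<^sub>M borel) \<Otimes>\<^sub>M \<gamma>)" for j
  proof (cases "j < N")
    case True
    note [measurable] = cover(1)[OF True] measurable_compose[OF measurable_snd infm[of "Cs j"]]
    show ?thesis unfolding b_def using True by simp
  qed (simp add: b_def)
  have \<psi>m: "(\<lambda>(z, \<omega>). \<psi> j z \<omega>) \<in> borel_measurable ((borel \<Otimes>\<^sub>M borel) \<Otimes>\<^sub>M \<gamma>)" for j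
    unfolding \<psi>_def case_prod_beta' by (rule max_increment_measurable) (rule bm)
  have \<psi>0: "0 \<le> \<psi> j z \<omega>" and \<psi>b: "\<psi> j z \<omega> \<le> b z \<omega> j" for j z \<omega>
    unfolding \<psi>_def using max_increment_nonneg max_increment_le b01 by auto
  have \<psi>1: "\<psi> j z \<omega> \<le> 1" for j z \<omega> using \<psi>b[of j z \<omega>] b01(2)[of z \<omega> j] by linarith
  have \<psi>sum: "(\<Sum>j<Suc N. \<psi> j z \<omega>) = 1" for z \<omega>
    unfolding \<psi>_def max_increment_sum by (rule running_max_eq_1[where i = N]) (use b01 in \<open>auto simp: b_def\<close>)
  have \<psi>Lip: "\<bar>\<psi> j z (\<omega> - a) - \<psi> j z \<omega>\<bar> \<le> 2 * (norm a / kk)" for j z \<omega> a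
    unfolding \<psi>_def
  proof (rule max_increment_Lipschitz)
    show "0 \<le> norm a / kk" using kk(1) by simp
    fix i
    have "\<bar>infdist (\<omega> - a) (Cs i) - infdist \<omega> (Cs i)\<bar> \<le> norm a"
      using infdist_triangle_abs[of "\<omega> - a" "Cs i" \<omega>] by (simp add: dist_norm)
    then have "\<bar>infdist (\<omega> - a) (Cs i) / kk - infdist \<omega> (Cs i) / kk\<bar> \<le> norm a / kk"
      using kk(1) by (simp add: divide_right_mono flip: diff_divide_distrib)
    then have m: "\<bar>max 0 (1 - infdist (\<omega> - a) (Cs i) / kk) - max 0 (1 - infdist \<omega> (Cs i) / kk)\<bar> \<le> norm a / kk"
      by (auto simp: max_def abs_le_iff)
    show "\<bar>b z (\<omega> - a) i - b z \<omega> i\<bar> \<le> norm a / kk"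
      unfolding b_def using m kk(1) by (auto simp: indicator_def)
  qed
  obtain \<kappa> where \<kappa>: "couples \<kappa> Q borel"
    "\<And>x y f u w \<Lambda>. f \<in> borel_measurable (borel \<Otimes>\<^sub>M borel) \<Longrightarrow> (\<And>p. f p \<le> 1) \<Longrightarrow> u \<in> borel_measurable borel \<Longrightarrow>
      (\<And>j. j < Suc N \<Longrightarrow> w j \<in> borel_measurable \<gamma>) \<Longrightarrow>
      (\<And>j \<omega>. j < Suc N \<Longrightarrow> \<omega> \<in> E \<Longrightarrow> f (\<Phi> x \<omega>, \<Phi> y (\<omega> + \<iota> (A' j (emb (y - x)))))
        \<le> u (\<Phi> x \<omega>) + u (\<Phi> y (\<omega> + \<iota> (A' j (emb (y - x))))) + w j \<omega>) \<Longrightarrow>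
      (\<And>j. j < Suc N \<Longrightarrow> norm (A' j (emb (y - x))) \<le> 1) \<Longrightarrow> (\<And>j. j < Suc N \<Longrightarrow> 0 \<le> \<Lambda> j) \<Longrightarrow>
      (\<And>j \<omega>. j < Suc N \<Longrightarrow> \<omega> \<in> E \<Longrightarrow> \<bar>\<psi> j (x, y) (\<omega> - \<iota> (A' j (emb (y - x)))) - \<psi> j (x, y) \<omega>\<bar> \<le> \<Lambda> j) \<Longrightarrow>
      (\<integral>\<^sup>+p. f p \<partial>\<kappa> (x, y)) \<le> (\<integral>\<^sup>+a. u a \<partial>Q x) + (\<integral>\<^sup>+a. u a \<partial>Q y)
        + (\<Sum>j<Suc N. \<integral>\<^sup>+\<omega>. ennreal (\<psi> j (x, y) \<omega>) * w j \<omega> \<partial>\<gamma>)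
        + (\<Sum>j<Suc N. ennreal (\<Lambda> j + 2 * norm (A' j (emb (y - x)))))"
    by (rule control_coupling[OF \<Phi>_measurable Q, where n = "Suc N" and \<psi> = \<psi> and emb = emb and A = A' and l = l'])
      ((rule A' \<psi>m \<psi>0 \<psi>1 \<psi>sum)+, rule that, assumption, blast)
  obtain C\<iota> where C\<iota>: "C\<iota> \<ge> 0" "\<And>k. k \<in> HW \<Longrightarrow> norm (\<iota> k) \<le> C\<iota> * norm k" using \<iota>_bound by blast
  define n where "n = real (Suc N)"
  define Md where "Md = n * M * L powr p\<^sub>0"
  define Cd where "Cd = n * (2 * (C\<iota> * L / kk) + 2 * L)"
  have Md0: "Md \<ge> 0" unfolding Md_def n_def using CM(1) by simp
  have Cd0: "Cd \<ge> 0" unfolding Cd_def n_def using C\<iota>(1) L1 kk(1) by simp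
  \<comment> \<open>In this order: the distance is at most 1; controls stay in the range of the uniform quadratic
    estimate; its remainder is at most \<open>\<epsilon>\<close> times the distance; controls have norm at most 1; the
    probability that a control leaves the range \<open>r\<close> and the missing mass of the coupling each cost
    at most an eighth.\<close>
  define r\<^sub>1 where "r\<^sub>1 = Min {1, r\<^sub>F / L, \<epsilon> / (\<bar>c\<bar> * L\<^sup>2 + 1), 1 / L,
      (1 / (8 * (Md + 1))) powr (1 / p\<^sub>0), 1 / (8 * (Cd + 1))}"
  have cL: "\<bar>c\<bar> * L\<^sup>2 + 1 > 0" by (rule add_nonneg_pos) auto
  have r1: "r\<^sub>1 > 0"
  proof -
    have "r\<^sub>F / L > 0" "\<epsilon> / (\<bar>c\<bar> * L\<^sup>2 + 1) > 0" "1 / L > 0" "(1 / (8 * (Md + 1))) powr (1 / p\<^sub>0) > 0"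
      "1 / (8 * (Cd + 1)) > 0" using cF(1) L1 \<epsilon>(1) cL Md0 Cd0 by auto
    then show ?thesis unfolding r\<^sub>1_def by (subst Min_gr_iff) auto
  qed
  have r1le: "r\<^sub>1 \<le> 1" "r\<^sub>1 \<le> r\<^sub>F / L" "r\<^sub>1 \<le> \<epsilon> / (\<bar>c\<bar> * L\<^sup>2 + 1)" "r\<^sub>1 \<le> 1 / L"
    "r\<^sub>1 \<le> (1 / (8 * (Md + 1))) powr (1 / p\<^sub>0)" "r\<^sub>1 \<le> 1 / (8 * (Cd + 1))"
    unfolding r\<^sub>1_def by (rule Min_le; simp only: finite.emptyI finite.insertI insert_iff simp_thms)+
  show ?thesis
  proof (rule that[OF \<kappa>(1) r1])
    fix r\<^sub>0 x y assume r0: "0 < r\<^sub>0" "r\<^sub>0 \<le> r\<^sub>1" and xy: "x \<in> sublevel V R" "y \<in> sublevel V R" and ne: "x \<noteq> y"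
      and near: "D_chi emb V chi x y < r\<^sub>0"
    define v where "v = emb (y - x)"
    define \<delta> where "\<delta> = norm v"
    have \<delta>0: "\<delta> > 0"
    proof -
      have "emb x \<noteq> emb y" using ne injD[OF emb_inj, of x y] by blast
      then show ?thesis unfolding \<delta>_def v_def by (simp add: blinfun.diff_right)
    qed
    have \<delta>D: "\<delta> \<le> D_chi emb V chi x y"
    proof -
      have "0 \<le> chi * (V x + V y)" using chi V_ge_1[of x] V_ge_1[of y] by simp
      then have "1 * \<delta> \<le> exp (chi * (V x + V y)) * \<delta>" using \<delta>0 by (intro mult_right_mono) auto
      moreover have "norm (emb (x - y)) = \<delta>" unfolding \<delta>_def v_def by (simp add: blinfun.diff_right norm_minus_commute)
      ultimately show ?thesis unfolding D_chi_def by simp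
    qed
    have \<delta>r: "\<delta> \<le> r\<^sub>1" "\<delta> \<le> r\<^sub>0" using \<delta>D near r0(2) by linarith+
    have \<delta>1: "\<delta> \<le> 1" using \<delta>r r1le(1) by linarith
    have hL: "norm (A' j v) \<le> L * \<delta>" for j
      unfolding \<delta>_def using norm_blinfun[of "A' j" v] A'L[of j] by (meson mult_right_mono norm_ge_zero order_trans)
    have Lpos: "L > 0" using L1 by simp
    have hF: "norm (A' j v) \<le> r\<^sub>F" "norm (A' j v) \<le> 1" for j
    proof -
      have "\<delta> \<le> r\<^sub>F / L" "\<delta> \<le> 1 / L" using \<delta>r r1le by linarith+
      then have "L * \<delta> \<le> r\<^sub>F" "L * \<delta> \<le> 1" using Lpos by (simp_all add: pos_le_divide_eq mult.commute)
      then show "norm (A' j v) \<le> r\<^sub>F" "norm (A' j v) \<le> 1" using hL[of j] by linarith+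
    qed
    define \<Delta> where "\<Delta> j \<omega> = norm (emb (\<Phi> y (\<omega> + \<iota> (A' j v))) - emb (\<Phi> x \<omega>))" for j \<omega>
    have good: "\<Delta> j \<omega> \<le> 3 * \<epsilon> * \<delta>" if j: "j < Suc N" and \<omega>: "\<omega> \<in> E" and pos: "\<psi> j (x, y) \<omega> > 0" and nB: "\<omega> \<notin> B j" for j \<omega>
    proof (cases "j < N")
      case True
      have bpos: "b (x, y) \<omega> j > 0" using pos \<psi>b[of j "(x, y)" \<omega>] by linarith
      then have W: "(x, y) \<in> W j" using True unfolding b_def by (cases "(x, y) \<in> W j") simp_all
      then have "1 - infdist \<omega> (Cs j) / kk > 0" using bpos True unfolding b_def by (simp add: less_max_iff_disj)
      then have "infdist \<omega> (Cs j) < kk" using kk(1) by (simp add: field_simps)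
      then have "infdist \<omega> (Cs j) = 0" using nB True \<omega> infdist_nonneg[of \<omega> "Cs j"] unfolding B_def by auto
      then have \<omega>C: "\<omega> \<in> Cs j" using in_closed_iff_infdist_zero[OF cover(2)[OF True] cover(3)[OF True]] by blast
      then have \<omega>G: "\<omega> \<in> G" using cover(4)[OF True] by blast
      have A: "A' j = A j" unfolding A'_def using True by simp
      define h where "h = A j v"
      have h1: "norm h \<le> L * \<delta>" "norm h \<le> r\<^sub>F" using hL[of j] hF(1)[of j] unfolding A h_def by auto
      have rem: "norm (emb (\<Phi> y (\<omega> + \<iota> h)) - emb (\<Phi> y \<omega>) - D y \<omega> h) \<le> c * (norm h)\<^sup>2"
        using cF(2)[OF xy(2) \<omega>G True, of v] h1(2) unfolding h_def by blast
      have sp: "emb (\<Phi> y \<omega> - \<Phi> x \<omega>) = (S (x, y) \<omega> + K (x, y) \<omega>) v" "norm (S (x, y) \<omega>) \<le> \<rho>"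
        using splitting \<omega> unfolding SC_splitting_def v_def by blast+
      have "emb (\<Phi> y (\<omega> + \<iota> h)) - emb (\<Phi> x \<omega>) = (emb (\<Phi> y (\<omega> + \<iota> h)) - emb (\<Phi> y \<omega>) - D y \<omega> h)
          + (S (x, y) \<omega> v + (K (x, y) \<omega> + (D y \<omega> o\<^sub>L A j)) v)"
      proof -
        have "emb (\<Phi> y \<omega>) - emb (\<Phi> x \<omega>) = S (x, y) \<omega> v + K (x, y) \<omega> v"
          using sp(1) by (simp add: blinfun.diff_right blinfun.add_left)
        then show ?thesis unfolding h_def by (simp add: blinfun.add_left algebra_simps)
      qed
      then have "\<Delta> j \<omega> \<le> norm (emb (\<Phi> y (\<omega> + \<iota> h)) - emb (\<Phi> y \<omega>) - D y \<omega> h)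
          + (norm (S (x, y) \<omega> v) + norm ((K (x, y) \<omega> + (D y \<omega> o\<^sub>L A j)) v))"
        unfolding \<Delta>_def A h_def[symmetric]
        by (metis (no_types, lifting) add_left_mono norm_triangle_ineq order_trans)
      also have "norm (S (x, y) \<omega> v) \<le> \<epsilon> * \<delta>"
      proof -
        have "norm (S (x, y) \<omega>) \<le> \<epsilon>" using sp(2) \<epsilon>(2) by linarith
        then show ?thesis unfolding \<delta>_def using norm_blinfun[of "S (x, y) \<omega>" v]
          by (meson mult_right_mono norm_ge_zero order_trans)
      qed
      also have "norm ((K (x, y) \<omega> + (D y \<omega> o\<^sub>L A j)) v) \<le> \<epsilon> * \<delta>"
        unfolding \<delta>_def using norm_blinfun[of "K (x, y) \<omega> + (D y \<omega> o\<^sub>L A j)" v] cover(6)[OF True W \<omega>C]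
        by (simp only: snd_conv) (meson mult_right_mono norm_ge_zero order_trans)
      also have "norm (emb (\<Phi> y (\<omega> + \<iota> h)) - emb (\<Phi> y \<omega>) - D y \<omega> h) \<le> \<epsilon> * \<delta>"
      proof -
        have "c * (norm h)\<^sup>2 \<le> \<bar>c\<bar> * (L * \<delta>)\<^sup>2"
          using h1(1) by (intro mult_mono power_mono) auto
        also have "\<dots> = (\<bar>c\<bar> * L\<^sup>2 * \<delta>) * \<delta>" by (simp add: power2_eq_square)
        also have "\<bar>c\<bar> * L\<^sup>2 * \<delta> \<le> (\<bar>c\<bar> * L\<^sup>2 + 1) * \<delta>" using \<delta>0 by (intro mult_right_mono) auto
        also have "\<dots> \<le> \<epsilon>"
        proof -
          have "\<delta> \<le> \<epsilon> / (\<bar>c\<bar> * L\<^sup>2 + 1)" using \<delta>r(1) r1le(3) by linarith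
          then show ?thesis using cL by (simp add: pos_le_divide_eq mult.commute)
        qed
        finally have "c * (norm h)\<^sup>2 \<le> \<epsilon> * \<delta>" using \<delta>0 by (simp add: mult_right_mono)
        then show ?thesis using rem by linarith
      qed
      finally show ?thesis by (simp add: algebra_simps)
    next
      case False
      then have jN: "j = N" using j by simp
      then have "\<omega> \<in> G" using nB \<omega> unfolding B_def by simp
      then obtain i where i: "i < N" "(x, y) \<in> W i" "\<omega> \<in> Cs i" using cover(7)[OF xy] by blast
      then have "b (x, y) \<omega> i = 1" unfolding b_def by simp
      then have "\<psi> j (x, y) \<omega> = 0" unfolding \<psi>_def jN using i(1) b01(2) by (intro max_increment_eq_0) auto
      then show ?thesis using pos by simp
    qed
    \<comment> \<open>The displacement after an effective control to the power \<open>\<alpha>\<close>, and the factor that turns powers of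
      \<open>D_chi\<close> into \<open>d\<^sub>0\<close>.\<close>
    define k where "k = (3 * \<epsilon> * \<delta>) powr \<alpha>"
    define s where "s = r\<^sub>0 powr (- \<alpha>)"
    have k0: "k > 0" unfolding k_def using \<epsilon>(1) \<delta>0 by simp
    have s0: "s > 0" unfolding s_def using r0 by simp
    have ksq: "(3 * \<epsilon> * \<delta>) powr (2 * \<alpha>) = k\<^sup>2" unfolding k_def by (simp add: power2_eq_square flip: powr_add)
    have b0k: "b\<^sub>0 * \<delta> powr (2 * \<alpha>) = k\<^sup>2"
      unfolding ksq[symmetric] b\<^sub>0_def using \<epsilon>(1) \<delta>0 by (simp add: powr_mult)
    define u where "u a = ennreal (s * (k / 4) * exp (4 * \<alpha> * chi * V a))" for a
    define w where "w j \<omega> = indicator {\<omega>. r y \<omega> < norm (A' j v)} \<omega>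
        + ennreal (s / (2 * k)) * (indicator {\<omega>. norm (A' j v) \<le> r y \<omega>} \<omega> * ennreal (\<Delta> j \<omega> powr (2 * \<alpha>)))" for j \<omega>
    define f where "f p = ennreal (d\<^sub>0 emb V chi r\<^sub>0 \<alpha> (fst p) (snd p))" for p
    define \<Lambda> where "\<Lambda> j = 2 * (C\<iota> * norm (A' j v) / kk)" for j
    note [measurable] = V_measurable emb_measurable \<Phi>_section_measurable CM(2) D_chi_pair_measurable
    have \<Delta>m[measurable]: "\<Delta> j \<in> borel_measurable \<gamma>" for j
    proof -
      interpret W: wiener_functional E HW \<iota> \<gamma> "l' j v" "A' j v" by (rule admissible_control_functional[OF A'])
      have [measurable]: "(\<lambda>\<omega>. \<Phi> y (\<omega> + \<iota> (A' j v))) \<in> \<gamma> \<rightarrow>\<^sub>M borel"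
        by (rule measurable_compose[OF W.shift_pm_measurable(1) \<Phi>_section_measurable])
      show ?thesis unfolding \<Delta>_def by measurable
    qed
    have um: "u \<in> borel_measurable borel" unfolding u_def by measurable
    have wm: "w j \<in> borel_measurable \<gamma>" for j unfolding w_def by measurable
    have fm: "f \<in> borel_measurable (borel \<Otimes>\<^sub>M borel)" unfolding f_def d\<^sub>0_def by measurable
    have f1: "f p \<le> 1" for p unfolding f_def d\<^sub>0_def by (simp add: ennreal_le_1)
    have fb: "f (\<Phi> x \<omega>, \<Phi> y (\<omega> + \<iota> (A' j v))) \<le> u (\<Phi> x \<omega>) + u (\<Phi> y (\<omega> + \<iota> (A' j v))) + w j \<omega>" for j \<omega>
    proof (cases "norm (A' j v) \<le> r y \<omega>")
      case False
      then have "1 \<le> w j \<omega>" unfolding w_def by simp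
      then show ?thesis using f1[of "(\<Phi> x \<omega>, \<Phi> y (\<omega> + \<iota> (A' j v)))"] by (meson add_increasing order_trans zero_le)
    next
      case True
      define X where "X = \<Phi> x \<omega>"
      define Y where "Y = \<Phi> y (\<omega> + \<iota> (A' j v))"
      have \<Delta>XY: "norm (emb (X - Y)) = \<Delta> j \<omega>" unfolding \<Delta>_def X_def Y_def by (simp add: blinfun.diff_right norm_minus_commute)
      have "d\<^sub>0 emb V chi r\<^sub>0 \<alpha> X Y \<le> (D_chi emb V chi X Y / r\<^sub>0) powr \<alpha>" unfolding d\<^sub>0_def by simp
      also have "\<dots> = s * (exp (\<alpha> * chi * V X + \<alpha> * chi * V Y) * \<Delta> j \<omega> powr \<alpha>)"
        unfolding D_chi_def \<Delta>XY s_def using r0 \<Delta>_def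
        by (simp add: powr_divide powr_mult exp_powr_real powr_minus_divide algebra_simps)
      also have "\<dots> \<le> s * (k / 4 * exp (4 * (\<alpha> * chi * V X)) + k / 4 * exp (4 * (\<alpha> * chi * V Y)) + (\<Delta> j \<omega> powr \<alpha>)\<^sup>2 / (2 * k))"
        using s0 k0 by (intro mult_left_mono weighted_product_le) auto
      also have "(\<Delta> j \<omega> powr \<alpha>)\<^sup>2 = \<Delta> j \<omega> powr (2 * \<alpha>)" by (simp add: power2_eq_square flip: powr_add)
      finally have "f (X, Y) \<le> ennreal (s * (k / 4) * exp (4 * \<alpha> * chi * V X) + s * (k / 4) * exp (4 * \<alpha> * chi * V Y)
          + s / (2 * k) * \<Delta> j \<omega> powr (2 * \<alpha>))"
        unfolding f_def by (intro ennreal_leI) (simp add: algebra_simps)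
      also have "\<dots> = u X + u Y + ennreal (s / (2 * k)) * ennreal (\<Delta> j \<omega> powr (2 * \<alpha>))"
        unfolding u_def by (rule ennreal_affine) (use s0 k0 in auto)
      also have "ennreal (s / (2 * k)) * ennreal (\<Delta> j \<omega> powr (2 * \<alpha>)) \<le> w j \<omega>" unfolding w_def using True by simp
      finally show ?thesis unfolding X_def Y_def by (simp add: add_left_mono)
    qed
    have \<Lambda>: "0 \<le> \<Lambda> j" "\<bar>\<psi> j (x, y) (\<omega> - \<iota> (A' j v)) - \<psi> j (x, y) \<omega>\<bar> \<le> \<Lambda> j" for j \<omega>
    proof -
      show "0 \<le> \<Lambda> j" unfolding \<Lambda>_def using C\<iota>(1) kk(1) by simp
      have "norm (\<iota> (A' j v)) / kk \<le> C\<iota> * norm (A' j v) / kk"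
        using C\<iota>(2)[OF admissible_control_in[OF A']] kk(1) by (intro divide_right_mono) auto
      then show "\<bar>\<psi> j (x, y) (\<omega> - \<iota> (A' j v)) - \<psi> j (x, y) \<omega>\<bar> \<le> \<Lambda> j"
        using \<psi>Lip[of j "(x, y)" \<omega> "\<iota> (A' j v)"] unfolding \<Lambda>_def by linarith
    qed
    have main: "(\<integral>\<^sup>+p. f p \<partial>\<kappa> (x, y)) \<le> (\<integral>\<^sup>+a. u a \<partial>Q x) + (\<integral>\<^sup>+a. u a \<partial>Q y)
        + (\<Sum>j<Suc N. \<integral>\<^sup>+\<omega>. ennreal (\<psi> j (x, y) \<omega>) * w j \<omega> \<partial>\<gamma>)
        + (\<Sum>j<Suc N. ennreal (\<Lambda> j + 2 * norm (A' j v)))"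
      unfolding v_def
      by (rule \<kappa>(2)) (rule fm f1 um wm fb[unfolded v_def] hF(2)[unfolded v_def] \<Lambda>(1) \<Lambda>(2)[unfolded v_def])+
    have uQ: "(\<integral>\<^sup>+a. u a \<partial>Q z) \<le> ennreal (s * (k / 4) * U)" if z: "z \<in> sublevel V R" for z
    proof -
      have sQ: "sets (Q z) = sets borel" by (simp flip: Q)
      have ue: "(\<lambda>a. ennreal (exp (4 * \<alpha> * chi * V a))) \<in> borel_measurable (Q z)"
        unfolding measurable_cong_sets[OF sQ refl] by measurable
      have "(\<integral>\<^sup>+a. u a \<partial>Q z) = ennreal (s * (k / 4)) * (\<integral>\<^sup>+a. ennreal (exp (4 * \<alpha> * chi * V a)) \<partial>Q z)"
      proof -
        have "u a = ennreal (s * (k / 4)) * ennreal (exp (4 * \<alpha> * chi * V a))" for a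
          unfolding u_def by (rule ennreal_mult) (use s0 k0 in auto)
        then show ?thesis using ue by (simp only: nn_integral_cmult)
      qed
      also have "\<dots> \<le> ennreal (s * (k / 4)) * ennreal U" by (intro mult_left_mono U(2) z) simp
      also have "\<dots> = ennreal (s * (k / 4) * U)" by (rule ennreal_mult[symmetric]) (use s0 k0 U(1) in auto)
      finally show ?thesis .
    qed
    define t where "t j = enn2real (\<integral>\<^sup>+\<omega>. ennreal (\<psi> j (x, y) \<omega>) \<partial>\<gamma>)" for j
    have \<psi>z[measurable]: "\<psi> j (x, y) \<in> borel_measurable \<gamma>" for j
      using measurable_compose[OF measurable_Pair1'[of "(x, y)" "borel \<Otimes>\<^sub>M borel" \<gamma>] \<psi>m[of j]] by (simp add: space_pair_measure)
    have t: "(\<integral>\<^sup>+\<omega>. ennreal (\<psi> j (x, y) \<omega>) \<partial>\<gamma>) = ennreal (t j)" "0 \<le> t j" for j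
    proof -
      have "(\<integral>\<^sup>+\<omega>. ennreal (\<psi> j (x, y) \<omega>) \<partial>\<gamma>) \<le> (\<integral>\<^sup>+\<omega>. 1 \<partial>\<gamma>)"
        using \<psi>1 by (intro nn_integral_mono) (simp add: ennreal_le_1)
      also have "\<dots> < top" by (simp add: emeasure_space_1)
      finally show "(\<integral>\<^sup>+\<omega>. ennreal (\<psi> j (x, y) \<omega>) \<partial>\<gamma>) = ennreal (t j)" unfolding t_def by simp
      show "0 \<le> t j" unfolding t_def by simp
    qed
    have tsum: "(\<Sum>j<Suc N. t j) = 1"
    proof -
      have "ennreal (\<Sum>j<Suc N. t j) = (\<Sum>j<Suc N. \<integral>\<^sup>+\<omega>. ennreal (\<psi> j (x, y) \<omega>) \<partial>\<gamma>)"
        unfolding t(1) by (rule sum_ennreal[symmetric]) (simp add: t)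
      also have "\<dots> = (\<integral>\<^sup>+\<omega>. (\<Sum>j<Suc N. ennreal (\<psi> j (x, y) \<omega>)) \<partial>\<gamma>)" by (rule nn_integral_sum[symmetric]) simp
      also have "\<dots> = (\<integral>\<^sup>+\<omega>. 1 \<partial>\<gamma>)"
      proof (rule nn_integral_cong)
        fix \<omega>
        have "(\<Sum>j<Suc N. ennreal (\<psi> j (x, y) \<omega>)) = ennreal (\<Sum>j<Suc N. \<psi> j (x, y) \<omega>)" using \<psi>0 by (intro sum_ennreal) simp
        then show "(\<Sum>j<Suc N. ennreal (\<psi> j (x, y) \<omega>)) = 1" unfolding \<psi>sum by simp
      qed
      also have "\<dots> = ennreal 1" by (simp add: emeasure_space_1)
      finally show ?thesis by (subst (asm) ennreal_inj) (auto simp: t sum_nonneg)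
    qed
    \<comment> \<open>The share of the \<open>j\<close>-th choice in the contribution of the exceptional noises.\<close>
    define \<beta> where "\<beta> j = (if j < N then b\<^sub>0 / (real N + 1) else b\<^sub>0)" for j
    have \<beta>0: "0 \<le> \<beta> j" for j unfolding \<beta>_def using b0 by simp
    have \<beta>sum: "(\<Sum>j<Suc N. \<beta> j) \<le> 2 * b\<^sub>0"
    proof -
      have "(\<Sum>j<Suc N. \<beta> j) = real N * (b\<^sub>0 / (real N + 1)) + b\<^sub>0" unfolding \<beta>_def by simp
      also have "real N * (b\<^sub>0 / (real N + 1)) \<le> b\<^sub>0" using b0 by (simp add: field_simps)
      finally show ?thesis by simp
    qed
    have bad: "(\<integral>\<^sup>+\<omega>. indicator (B j) \<omega> * (indicator {\<omega>. norm (A' j v) \<le> r y \<omega>} \<omega> * ennreal (\<Delta> j \<omega> powr (2 * \<alpha>))) \<partial>\<gamma>)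
        \<le> ennreal (\<beta> j * \<delta> powr (2 * \<alpha>))" if j: "j < Suc N" for j
    proof (cases "j < N")
      case True
      then have "measure \<gamma> (B j) \<le> \<eta>\<^sub>1" unfolding B_def using kf(2)[OF True kk(1) kk(2)[OF True]] by simp
      from \<eta>1(2)[OF Bs this xy A' A'L v_def] \<delta>0 \<delta>1 show ?thesis
        unfolding \<beta>_def \<Delta>_def \<delta>_def using True by simp
    next
      case False
      then have "measure \<gamma> (B j) \<le> \<eta>\<^sub>0" "norm (A' j) \<le> 1" unfolding B_def A'_def using EG(2) by auto
      from \<eta>0(2)[OF Bs this(1) xy A' this(2) v_def] \<delta>0 \<delta>1 show ?thesis
        unfolding \<beta>_def \<Delta>_def \<delta>_def using False by simp
    qed
    have far: "(\<integral>\<^sup>+\<omega>. indicator {\<omega>. r y \<omega> < norm (A' j v)} \<omega> \<partial>\<gamma>) \<le> ennreal ((L * \<delta>) powr p\<^sub>0 * M)" for j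
    proof -
      have "(\<integral>\<^sup>+\<omega>. indicator {\<omega>. r y \<omega> < norm (A' j v)} \<omega> \<partial>\<gamma>)
          \<le> (\<integral>\<^sup>+\<omega>. ennreal ((L * \<delta>) powr p\<^sub>0) * ennreal (r y \<omega> powr (- p\<^sub>0)) \<partial>\<gamma>)"
      proof (rule nn_integral_mono)
        fix \<omega> assume "\<omega> \<in> space \<gamma>"
        then have rp: "0 < r y \<omega>" using CM(3) by (simp add: space_eq)
        show "indicator {\<omega>. r y \<omega> < norm (A' j v)} \<omega> \<le> ennreal ((L * \<delta>) powr p\<^sub>0) * ennreal (r y \<omega> powr (- p\<^sub>0))"
        proof (cases "r y \<omega> < norm (A' j v)")
          case True
          then have "r y \<omega> \<le> L * \<delta>" using hL[of j] by linarith
          then have "r y \<omega> powr p\<^sub>0 \<le> (L * \<delta>) powr p\<^sub>0" using rp p0 by (intro powr_mono2) auto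
          then have "1 \<le> (L * \<delta>) powr p\<^sub>0 * r y \<omega> powr (- p\<^sub>0)" using rp by (simp add: powr_minus divide_inverse[symmetric])
          then have "ennreal 1 \<le> ennreal ((L * \<delta>) powr p\<^sub>0 * r y \<omega> powr (- p\<^sub>0))" by (rule ennreal_leI)
          then show ?thesis using True by (simp add: ennreal_mult)
        qed simp
      qed
      also have "\<dots> = ennreal ((L * \<delta>) powr p\<^sub>0) * (\<integral>\<^sup>+\<omega>. ennreal (r y \<omega> powr (- p\<^sub>0)) \<partial>\<gamma>)"
        by (rule nn_integral_cmult) measurable
      also have "(\<integral>\<^sup>+\<omega>. ennreal (r y \<omega> powr (- p\<^sub>0)) \<partial>\<gamma>) \<le> ennreal M"
        by (rule order_trans[OF nn_integral_mono CM(6)[OF xy(2) xy(2)]]) (auto intro!: ennreal_leI)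
      finally show ?thesis by (simp add: ennreal_mult CM(1) mult_left_mono)
    qed
    have each: "(\<integral>\<^sup>+\<omega>. ennreal (\<psi> j (x, y) \<omega>) * w j \<omega> \<partial>\<gamma>)
        \<le> ennreal ((L * \<delta>) powr p\<^sub>0 * M + s / (2 * k) * (t j * k\<^sup>2 + \<beta> j * \<delta> powr (2 * \<alpha>)))" if j: "j < Suc N" for j
    proof -
      define I where "I \<omega> = indicator {\<omega>. norm (A' j v) \<le> r y \<omega>} \<omega> * ennreal (\<Delta> j \<omega> powr (2 * \<alpha>))" for \<omega>
      have Im[measurable]: "I \<in> borel_measurable \<gamma>" unfolding I_def by measurable
      note [measurable] = Bs[of j]
      have "(\<integral>\<^sup>+\<omega>. ennreal (\<psi> j (x, y) \<omega>) * w j \<omega> \<partial>\<gamma>)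
          \<le> (\<integral>\<^sup>+\<omega>. indicator {\<omega>. r y \<omega> < norm (A' j v)} \<omega> + ennreal (s / (2 * k)) *
              (ennreal (\<psi> j (x, y) \<omega>) * ennreal (k\<^sup>2) + indicator (B j) \<omega> * I \<omega>) \<partial>\<gamma>)"
      proof (rule nn_integral_mono)
        fix \<omega> assume "\<omega> \<in> space \<gamma>"
        then have \<omega>: "\<omega> \<in> E" by (simp add: space_eq)
        have p1: "ennreal (\<psi> j (x, y) \<omega>) \<le> 1" using \<psi>1 by (simp add: ennreal_le_1)
        have 1: "ennreal (\<psi> j (x, y) \<omega>) * a \<le> a" for a using mult_right_mono[OF p1, of a] by simp
        have 2: "ennreal (\<psi> j (x, y) \<omega>) * I \<omega> \<le> ennreal (\<psi> j (x, y) \<omega>) * ennreal (k\<^sup>2) + indicator (B j) \<omega> * I \<omega>"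
        proof (cases "\<omega> \<in> B j")
          case True
          then show ?thesis using 1[of "I \<omega>"] by (simp add: add_increasing)
        next
          case False
          show ?thesis
          proof (cases "\<psi> j (x, y) \<omega> > 0")
            case True
            have "\<Delta> j \<omega> powr (2 * \<alpha>) \<le> k\<^sup>2"
              unfolding ksq[symmetric] using good[OF j \<omega> True False] \<alpha>(1) by (intro powr_mono2) (auto simp: \<Delta>_def)
            then have "I \<omega> \<le> ennreal (k\<^sup>2)" unfolding I_def by (auto simp: indicator_def intro: ennreal_leI)
            then show ?thesis using False by (simp add: mult_left_mono)
          next
            case False
            then have "\<psi> j (x, y) \<omega> = 0" using \<psi>0[of j "(x, y)" \<omega>] by simp
            then show ?thesis by simp
          qed
        qed
        have "ennreal (\<psi> j (x, y) \<omega>) * w j \<omega> = ennreal (\<psi> j (x, y) \<omega>) * indicator {\<omega>. r y \<omega> < norm (A' j v)} \<omega>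
            + ennreal (s / (2 * k)) * (ennreal (\<psi> j (x, y) \<omega>) * I \<omega>)"
          unfolding w_def I_def by (simp add: distrib_left mult.left_commute)
        also have "\<dots> \<le> indicator {\<omega>. r y \<omega> < norm (A' j v)} \<omega> + ennreal (s / (2 * k)) *
              (ennreal (\<psi> j (x, y) \<omega>) * ennreal (k\<^sup>2) + indicator (B j) \<omega> * I \<omega>)"
          by (intro add_mono 1 mult_left_mono 2) simp
        finally show "ennreal (\<psi> j (x, y) \<omega>) * w j \<omega> \<le> indicator {\<omega>. r y \<omega> < norm (A' j v)} \<omega> + ennreal (s / (2 * k)) *
              (ennreal (\<psi> j (x, y) \<omega>) * ennreal (k\<^sup>2) + indicator (B j) \<omega> * I \<omega>)" .
      qed
      also have "\<dots> = (\<integral>\<^sup>+\<omega>. indicator {\<omega>. r y \<omega> < norm (A' j v)} \<omega> \<partial>\<gamma>) + ennreal (s / (2 * k)) *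
          ((\<integral>\<^sup>+\<omega>. ennreal (\<psi> j (x, y) \<omega>) \<partial>\<gamma>) * ennreal (k\<^sup>2) + (\<integral>\<^sup>+\<omega>. indicator (B j) \<omega> * I \<omega> \<partial>\<gamma>))"
        by (simp add: nn_integral_add nn_integral_cmult nn_integral_multc)
      also have "\<dots> \<le> ennreal ((L * \<delta>) powr p\<^sub>0 * M) + ennreal (s / (2 * k)) *
          (ennreal (t j) * ennreal (k\<^sup>2) + ennreal (\<beta> j * \<delta> powr (2 * \<alpha>)))"
        unfolding t(1) using bad[OF j] unfolding I_def by (intro add_mono far mult_left_mono) auto
      also have "\<dots> = ennreal ((L * \<delta>) powr p\<^sub>0 * M + s / (2 * k) * (t j * k\<^sup>2 + \<beta> j * \<delta> powr (2 * \<alpha>)))"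
        by (rule ennreal_affine') (use CM(1) s0 k0 t(2)[of j] \<beta>0[of j] in auto)
      finally show ?thesis .
    qed
    define \<tau> where "\<tau> = \<delta> / r\<^sub>0"
    have \<tau>: "0 < \<tau>" "\<tau> \<le> 1" "\<delta> = r\<^sub>0 * \<tau>" unfolding \<tau>_def using \<delta>0 r0 \<delta>r by auto
    have sumw: "(\<Sum>j<Suc N. \<integral>\<^sup>+\<omega>. ennreal (\<psi> j (x, y) \<omega>) * w j \<omega> \<partial>\<gamma>)
        \<le> ennreal (Md * \<delta> powr p\<^sub>0 + s * k * (3 / 2))"
    proof -
      have "(\<Sum>j<Suc N. \<integral>\<^sup>+\<omega>. ennreal (\<psi> j (x, y) \<omega>) * w j \<omega> \<partial>\<gamma>)
          \<le> (\<Sum>j<Suc N. ennreal ((L * \<delta>) powr p\<^sub>0 * M + s / (2 * k) * (t j * k\<^sup>2 + \<beta> j * \<delta> powr (2 * \<alpha>))))"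
        by (intro sum_mono each) simp
      also have "\<dots> = ennreal (\<Sum>j<Suc N. (L * \<delta>) powr p\<^sub>0 * M + s / (2 * k) * (t j * k\<^sup>2 + \<beta> j * \<delta> powr (2 * \<alpha>)))"
        using CM(1) s0 k0 t(2) \<beta>0 by (intro sum_ennreal) (auto intro!: add_nonneg_nonneg mult_nonneg_nonneg)
      also have "(\<Sum>j<Suc N. (L * \<delta>) powr p\<^sub>0 * M + s / (2 * k) * (t j * k\<^sup>2 + \<beta> j * \<delta> powr (2 * \<alpha>)))
          = n * ((L * \<delta>) powr p\<^sub>0 * M) + s / (2 * k) * ((\<Sum>j<Suc N. t j) * k\<^sup>2 + (\<Sum>j<Suc N. \<beta> j) * \<delta> powr (2 * \<alpha>))"
        unfolding n_def sum.distrib sum_distrib_left[symmetric] sum_distrib_right[symmetric] by simp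
      also have "\<dots> \<le> n * ((L * \<delta>) powr p\<^sub>0 * M) + s / (2 * k) * (1 * k\<^sup>2 + 2 * b\<^sub>0 * \<delta> powr (2 * \<alpha>))"
        unfolding tsum using \<beta>sum s0 k0 by (intro add_left_mono mult_left_mono mult_right_mono) auto
      also have "\<dots> = Md * \<delta> powr p\<^sub>0 + s / (2 * k) * (3 * k\<^sup>2)"
        unfolding Md_def using b0k Lpos \<delta>0 by (simp add: powr_mult)
      also have "s / (2 * k) * (3 * k\<^sup>2) = s * k * (3 / 2)" using k0 by (simp add: power2_eq_square)
      finally show ?thesis by (simp add: ennreal_leI)
    qed
    have sum\<Lambda>: "(\<Sum>j<Suc N. ennreal (\<Lambda> j + 2 * norm (A' j v))) \<le> ennreal (Cd * \<delta>)"
    proof -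
      have "\<Lambda> j + 2 * norm (A' j v) \<le> (2 * (C\<iota> * L / kk) + 2 * L) * \<delta>" for j
      proof -
        have "C\<iota> * norm (A' j v) / kk \<le> C\<iota> * (L * \<delta>) / kk"
          using hL[of j] C\<iota>(1) kk(1) by (intro divide_right_mono mult_left_mono) auto
        moreover have "(2 * (C\<iota> * L / kk) + 2 * L) * \<delta> = 2 * (C\<iota> * (L * \<delta>) / kk) + 2 * (L * \<delta>)"
          by (simp add: algebra_simps)
        ultimately show ?thesis unfolding \<Lambda>_def using hL[of j] by linarith
      qed
      then have "(\<Sum>j<Suc N. ennreal (\<Lambda> j + 2 * norm (A' j v))) \<le> (\<Sum>j<Suc N. ennreal ((2 * (C\<iota> * L / kk) + 2 * L) * \<delta>))"
        by (intro sum_mono ennreal_leI)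
      also have "\<dots> = ennreal (\<Sum>j<Suc N. (2 * (C\<iota> * L / kk) + 2 * L) * \<delta>)"
        using C\<iota>(1) kk(1) Lpos \<delta>0 by (intro sum_ennreal) auto
      also have "(\<Sum>j<Suc N. (2 * (C\<iota> * L / kk) + 2 * L) * \<delta>) = Cd * \<delta>" unfolding Cd_def n_def by simp
      finally show ?thesis .
    qed
    have sk: "s * k = (3 * \<epsilon>) powr \<alpha> * \<tau> powr \<alpha>"
      unfolding s_def k_def \<tau>_def using r0 \<epsilon>(1) \<delta>0 by (simp add: powr_mult powr_divide powr_minus_divide)
    \<comment> \<open>The weights and the displacement together use up a quarter, the remaining errors two eighths.\<close>
    have "(\<integral>\<^sup>+p. f p \<partial>\<kappa> (x, y)) \<le> ennreal (s * (k / 4) * U) + ennreal (s * (k / 4) * U)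
        + ennreal (Md * \<delta> powr p\<^sub>0 + s * k * (3 / 2)) + ennreal (Cd * \<delta>)"
      by (rule order_trans[OF main]) (intro add_mono uQ xy sumw sum\<Lambda>)
    also have "\<dots> = ennreal (s * (k / 4) * U + s * (k / 4) * U + (Md * \<delta> powr p\<^sub>0 + s * k * (3 / 2)) + Cd * \<delta>)"
      by (rule ennreal_plus4) (use s0 k0 U(1) Md0 Cd0 \<delta>0 in auto)
    also have "s * (k / 4) * U + s * (k / 4) * U + (Md * \<delta> powr p\<^sub>0 + s * k * (3 / 2)) + Cd * \<delta>
        = s * k * (U / 2 + 3 / 2) + Md * \<delta> powr p\<^sub>0 + Cd * \<delta>" by (simp add: field_simps)
    also have "\<dots> \<le> 1 / 4 * \<tau> powr \<alpha> + 1 / 8 * \<tau> powr \<alpha> + 1 / 8 * \<tau> powr \<alpha>"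
    proof (intro add_mono)
      have "s * k * (U / 2 + 3 / 2) = ((3 * \<epsilon>) powr \<alpha> * (U / 2 + 3 / 2)) * \<tau> powr \<alpha>" unfolding sk by simp
      also have "\<dots> \<le> 1 / 4 * \<tau> powr \<alpha>" by (intro mult_right_mono \<epsilon>(3)) simp
      finally show "s * k * (U / 2 + 3 / 2) \<le> 1 / 4 * \<tau> powr \<alpha>" .
      have "r\<^sub>0 powr p\<^sub>0 \<le> ((1 / (8 * (Md + 1))) powr (1 / p\<^sub>0)) powr p\<^sub>0"
        using r0 r1le(5) p0 by (intro powr_mono2) auto
      also have "\<dots> = 1 / (8 * (Md + 1))" using p0 Md0 by (simp add: powr_powr)
      finally have "Md * r\<^sub>0 powr p\<^sub>0 \<le> Md * (1 / (8 * (Md + 1)))" using Md0 by (intro mult_left_mono) auto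
      also have "\<dots> \<le> 1 / 8" using Md0 by (simp add: field_simps)
      finally have m: "Md * r\<^sub>0 powr p\<^sub>0 \<le> 1 / 8" .
      have "Md * \<delta> powr p\<^sub>0 = Md * r\<^sub>0 powr p\<^sub>0 * \<tau> powr p\<^sub>0" unfolding \<tau>(3) using r0 \<tau>(1) by (simp add: powr_mult)
      also have "\<dots> \<le> 1 / 8 * \<tau> powr \<alpha>"
        using m \<tau> \<alpha> by (intro mult_mono powr_mono') auto
      finally show "Md * \<delta> powr p\<^sub>0 \<le> 1 / 8 * \<tau> powr \<alpha>" .
      have "Cd * r\<^sub>0 \<le> Cd * (1 / (8 * (Cd + 1)))" using r0 r1le(6) Cd0 by (intro mult_left_mono) auto
      also have "\<dots> \<le> 1 / 8" using Cd0 by (simp add: field_simps)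
      finally have m: "Cd * r\<^sub>0 \<le> 1 / 8" .
      have "\<tau> powr 1 \<le> \<tau> powr \<alpha>" using \<tau> \<alpha> by (intro powr_mono') auto
      then have "\<tau> \<le> \<tau> powr \<alpha>" using \<tau>(1) by simp
      then have "Cd * r\<^sub>0 * \<tau> \<le> 1 / 8 * \<tau> powr \<alpha>" using m \<tau>(1) by (intro mult_mono) auto
      then show "Cd * \<delta> \<le> 1 / 8 * \<tau> powr \<alpha>" unfolding \<tau>(3) by (simp add: mult.assoc)
    qed
    also have "\<dots> = \<tau> powr \<alpha> / 2" by simp
    also have "\<dots> \<le> d\<^sub>0 emb V chi r\<^sub>0 \<alpha> x y / 2"
    proof -
      have "\<tau> powr \<alpha> \<le> (D_chi emb V chi x y / r\<^sub>0) powr \<alpha>"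
        using \<tau>(1) \<delta>D r0 \<alpha>(1) unfolding \<tau>_def by (intro powr_mono2 divide_right_mono) auto
      moreover have "\<tau> powr \<alpha> \<le> 1" using \<tau> \<alpha>(1) by (simp add: powr_le1)
      ultimately show ?thesis unfolding d\<^sub>0_def by simp
    qed
    finally show "(\<integral>\<^sup>+p. ennreal (d\<^sub>0 emb V chi r\<^sub>0 \<alpha> (fst p) (snd p)) \<partial>\<kappa> (x, y)) \<le> ennreal (d\<^sub>0 emb V chi r\<^sub>0 \<alpha> x y / 2)"
      unfolding f_def by (simp add: ennreal_leI)
  qed
qed

end

section \<open>Contraction over one time block\<close>

lemma (in prob_space) couples_synchronous:
  fixes \<Phi> :: "'h::second_countable_topology \<Rightarrow> 'a \<Rightarrow> 'h"
  assumes \<Phi>: "(\<lambda>(x, \<omega>). \<Phi> x \<omega>) \<in> borel \<Otimes>\<^sub>M M \<rightarrow>\<^sub>M borel" and Q: "\<And>x. distr M borel (\<Phi> x) = Q x"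
  shows "couples (\<lambda>z. distr M (borel \<Otimes>\<^sub>M borel) (\<lambda>\<omega>. (\<Phi> (fst z) \<omega>, \<Phi> (snd z) \<omega>))) Q borel"
  unfolding couples_def
proof (intro conjI ballI)
  have s: "\<Phi> x \<in> M \<rightarrow>\<^sub>M borel" for x using measurable_compose[OF measurable_Pair1'[of x borel M] \<Phi>] by simp
  have 1: "(\<lambda>p. \<Phi> (fst (fst p)) (snd p)) \<in> (borel \<Otimes>\<^sub>M borel) \<Otimes>\<^sub>M M \<rightarrow>\<^sub>M borel"
    using measurable_compose[of "\<lambda>p. (fst (fst p), snd p)" "(borel \<Otimes>\<^sub>M borel) \<Otimes>\<^sub>M M" "borel \<Otimes>\<^sub>M M", OF _ \<Phi>] by simp
  have 2: "(\<lambda>p. \<Phi> (snd (fst p)) (snd p)) \<in> (borel \<Otimes>\<^sub>M borel) \<Otimes>\<^sub>M M \<rightarrow>\<^sub>M borel"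
    using measurable_compose[of "\<lambda>p. (snd (fst p), snd p)" "(borel \<Otimes>\<^sub>M borel) \<Otimes>\<^sub>M M" "borel \<Otimes>\<^sub>M M", OF _ \<Phi>] by simp
  show "(\<lambda>z. distr M (borel \<Otimes>\<^sub>M borel) (\<lambda>\<omega>. (\<Phi> (fst z) \<omega>, \<Phi> (snd z) \<omega>)))
      \<in> borel \<Otimes>\<^sub>M borel \<rightarrow>\<^sub>M prob_algebra (borel \<Otimes>\<^sub>M borel)"
    by (rule measurable_distr_prob_space2[where M = M])
      (use measurable_Pair[OF 1 2] prob_space_axioms in \<open>auto simp: space_prob_algebra case_prod_beta'\<close>)
  fix x y
  have p: "(\<lambda>\<omega>. (\<Phi> x \<omega>, \<Phi> y \<omega>)) \<in> M \<rightarrow>\<^sub>M borel \<Otimes>\<^sub>M borel" using s by measurable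
  show "distr (distr M (borel \<Otimes>\<^sub>M borel) (\<lambda>\<omega>. (\<Phi> (fst (x, y)) \<omega>, \<Phi> (snd (x, y)) \<omega>))) borel fst = Q x"
    using distr_distr[OF measurable_fst p] Q[of x] by (simp add: comp_def)
  show "distr (distr M (borel \<Otimes>\<^sub>M borel) (\<lambda>\<omega>. (\<Phi> (fst (x, y)) \<omega>, \<Phi> (snd (x, y)) \<omega>))) borel snd = Q y"
    using distr_distr[OF measurable_snd p] Q[of y] by (simp add: comp_def)
qed

text \<open>Jensen's inequality up to the factor 2, from \<open>a\<^sup>s \<le> 1 + a\<close>.\<close>

lemma (in prob_space) nn_integral_powr_le:
  assumes f: "f \<in> borel_measurable M" "\<And>x. 0 \<le> f x" and k: "0 < k" "(\<integral>\<^sup>+x. ennreal (f x) \<partial>M) \<le> ennreal k"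
    and s: "0 < s" "s \<le> 1"
  shows "(\<integral>\<^sup>+x. ennreal (f x powr s) \<partial>M) \<le> ennreal (2 * k powr s)"
proof -
  have le: "f x powr s \<le> k powr s + k powr s / k * f x" for x
  proof -
    have "(f x / k) powr s \<le> 1 + f x / k"
    proof (cases "f x / k \<le> 1")
      case True
      then have "(f x / k) powr s \<le> 1" using f(2) k(1) s by (intro powr_le1) auto
      moreover have "0 \<le> f x / k" using f(2) k(1) by simp
      ultimately show ?thesis by linarith
    next
      case False
      then have "(f x / k) powr s \<le> (f x / k) powr 1" using s by (intro powr_mono) auto
      also have "\<dots> = f x / k" using k(1) f(2)[of x] by simp
      finally show ?thesis by simp
    qed
    then have "k powr s * (f x / k) powr s \<le> k powr s * (1 + f x / k)" by (intro mult_left_mono) auto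
    moreover have "k powr s * (f x / k) powr s = f x powr s"
      using k(1) f(2)[of x] by (simp add: powr_divide)
    ultimately show ?thesis by (simp add: distrib_left)
  qed
  have "(\<integral>\<^sup>+x. ennreal (f x powr s) \<partial>M) \<le> (\<integral>\<^sup>+x. ennreal (k powr s) + ennreal (k powr s / k) * ennreal (f x) \<partial>M)"
  proof (rule nn_integral_mono)
    fix x
    have "ennreal (f x powr s) \<le> ennreal (k powr s + k powr s / k * f x)" by (rule ennreal_leI[OF le])
    also have "\<dots> = ennreal (k powr s) + ennreal (k powr s / k * f x)" by (rule ennreal_plus) (use k f(2) in auto)
    also have "ennreal (k powr s / k * f x) = ennreal (k powr s / k) * ennreal (f x)"
      by (rule ennreal_mult) (use k f(2) in auto)
    finally show "ennreal (f x powr s) \<le> ennreal (k powr s) + ennreal (k powr s / k) * ennreal (f x)" .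
  qed
  also have "\<dots> = ennreal (k powr s) + ennreal (k powr s / k) * (\<integral>\<^sup>+x. ennreal (f x) \<partial>M)"
    using f(1) by (simp add: nn_integral_add nn_integral_cmult emeasure_space_1)
  also have "\<dots> \<le> ennreal (k powr s) + ennreal (k powr s / k) * ennreal k" by (intro add_left_mono mult_left_mono k) simp
  also have "ennreal (k powr s / k) * ennreal k = ennreal (k powr s / k * k)" by (rule ennreal_mult[symmetric]) (use k in auto)
  also have "ennreal (k powr s) + ennreal (k powr s / k * k) = ennreal (2 * k powr s)"
    using k(1) by (simp flip: ennreal_plus)
  finally show ?thesis .
qed

lemma d0_bounds: "0 \<le> d\<^sub>0 emb V chi r \<alpha> x y" "d\<^sub>0 emb V chi r \<alpha> x y \<le> 1" unfolding d\<^sub>0_def by auto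

lemma d0_less_1_iff:
  assumes "0 < \<alpha>" "0 < r"
  shows "d\<^sub>0 emb V chi r \<alpha> x y < 1 \<longleftrightarrow> D_chi emb V chi x y < r"
proof -
  have D0: "0 \<le> D_chi emb V chi x y" unfolding D_chi_def by simp
  have "(D_chi emb V chi x y / r) powr \<alpha> < 1 \<longleftrightarrow> D_chi emb V chi x y / r < 1"
  proof
    assume "(D_chi emb V chi x y / r) powr \<alpha> < 1"
    then show "D_chi emb V chi x y / r < 1" using ge_one_powr_ge_zero[of "D_chi emb V chi x y / r" \<alpha>] assms by force
  next
    assume "D_chi emb V chi x y / r < 1"
    then have "(D_chi emb V chi x y / r) powr \<alpha> < 1 powr \<alpha>" using D0 assms by (intro powr_less_mono2) auto
    then show "(D_chi emb V chi x y / r) powr \<alpha> < 1" by simp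
  qed
  then show ?thesis unfolding d\<^sub>0_def using assms(2) by (simp add: min_less_iff_disj)
qed

context controlled_block
begin

text \<open>Where the Lyapunov function is large the synchronous coupling contracts by the assumed
  squeezing estimate, whose exponent \<open>\<alpha>\<^sub>s\<close> is lowered to \<open>\<alpha>\<close> by Jensen's inequality. Elsewhere the
  control coupling does.\<close>

theorem one_step_contraction:
  assumes Q: "\<And>x. distr \<gamma> borel (\<Phi> x) = Q x"
    and full: "\<Omega> \<in> sets \<gamma>" "measure \<gamma> \<Omega> = 1" "\<And>x \<omega>. \<omega> \<in> \<Omega> \<Longrightarrow> closure (blinfun_apply (D x \<omega>) ` HW) = UNIV"
    and chi: "chi > 0" and \<alpha>: "0 < \<alpha>" "\<alpha> \<le> 1" "4 * \<alpha> \<le> p\<^sub>0"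
    and U: "0 \<le> U" "\<And>x. x \<in> sublevel V R \<Longrightarrow> (\<integral>\<^sup>+u. ennreal (exp (4 * \<alpha> * chi * V u)) \<partial>Q x) \<le> ennreal U"
    and \<epsilon>: "0 < \<epsilon>" "\<rho> \<le> \<epsilon>" "(3 * \<epsilon>) powr \<alpha> * (U / 2 + 3 / 2) \<le> 1 / 4"
    and \<alpha>s: "\<alpha> \<le> \<alpha>\<^sub>s" and b: "b \<ge> 1" and c: "c > 0"
    and squeeze: "\<And>x y. x \<noteq> y \<Longrightarrow> (\<integral>\<^sup>+\<omega>. ennreal (D_chi emb V chi (\<Phi> x \<omega>) (\<Phi> y \<omega>) powr \<alpha>\<^sub>s) \<partial>\<gamma>)
      \<le> ennreal (b * exp (- c * (V x + V y)) * D_chi emb V chi x y powr \<alpha>\<^sub>s)"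
    and R: "b * exp (- c * R) \<le> (1 / 4) powr (\<alpha>\<^sub>s / \<alpha>)"
  obtains \<kappa> r\<^sub>0 where "couples \<kappa> Q borel" "0 < r\<^sub>0"
    "\<And>x y. d\<^sub>0 emb V chi r\<^sub>0 \<alpha> x y < 1 \<Longrightarrow>
      (\<integral>\<^sup>+(u, v). ennreal (d\<^sub>0 emb V chi r\<^sub>0 \<alpha> u v) \<partial>\<kappa> (x, y)) \<le> ennreal (d\<^sub>0 emb V chi r\<^sub>0 \<alpha> x y / 2)"
proof -
  obtain \<kappa>\<^sub>c r\<^sub>0 where k: "couples \<kappa>\<^sub>c Q borel" "0 < r\<^sub>0"
    "\<And>r x y. 0 < r \<Longrightarrow> r \<le> r\<^sub>0 \<Longrightarrow> x \<in> sublevel V R \<Longrightarrow> y \<in> sublevel V R \<Longrightarrow> x \<noteq> y \<Longrightarrow>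
      D_chi emb V chi x y < r \<Longrightarrow>
      (\<integral>\<^sup>+p. ennreal (d\<^sub>0 emb V chi r \<alpha> (fst p) (snd p)) \<partial>\<kappa>\<^sub>c (x, y)) \<le> ennreal (d\<^sub>0 emb V chi r \<alpha> x y / 2)"
    using local_contraction[OF Q full chi \<alpha> U \<epsilon>] by blast
  define sync where "sync z = distr \<gamma> (borel \<Otimes>\<^sub>M borel) (\<lambda>\<omega>. (\<Phi> (fst z) \<omega>, \<Phi> (snd z) \<omega>))" for z
  have cs: "couples sync Q borel" unfolding sync_def by (rule couples_synchronous[OF \<Phi>_measurable Q])
  define A where "A z \<longleftrightarrow> fst z \<noteq> snd z \<and> V (fst z) + V (snd z) \<le> R" for z :: "'h \<times> 'h"
  have Am: "{z \<in> space (borel \<Otimes>\<^sub>M borel). A z} \<in> sets (borel \<Otimes>\<^sub>M borel)"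
  proof -
    note [measurable] = V_measurable
    show ?thesis unfolding A_def by measurable
  qed
  define \<kappa> where "\<kappa> z = (if A z then \<kappa>\<^sub>c z else sync z)" for z
  have D0: "0 \<le> D_chi emb V chi x y" for x y unfolding D_chi_def by simp
  note [measurable] = V_measurable emb_measurable \<Phi>_section_measurable D_chi_pair_measurable
  show ?thesis
  proof (rule that[of \<kappa> r\<^sub>0])
    show "couples \<kappa> Q borel" unfolding \<kappa>_def by (rule couples_if[OF k(1) cs Am])
    show "0 < r\<^sub>0" by (rule k(2))
    fix x y assume "d\<^sub>0 emb V chi r\<^sub>0 \<alpha> x y < 1"
    then have near: "D_chi emb V chi x y < r\<^sub>0" using d0_less_1_iff \<alpha>(1) k(2) by blast
    have sync_int: "(\<integral>\<^sup>+(u, v). ennreal (d\<^sub>0 emb V chi r\<^sub>0 \<alpha> u v) \<partial>sync (x, y))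
        = (\<integral>\<^sup>+\<omega>. ennreal (d\<^sub>0 emb V chi r\<^sub>0 \<alpha> (\<Phi> x \<omega>) (\<Phi> y \<omega>)) \<partial>\<gamma>)"
    proof -
      have "(\<lambda>p. ennreal (d\<^sub>0 emb V chi r\<^sub>0 \<alpha> (fst p) (snd p))) \<in> borel_measurable (borel \<Otimes>\<^sub>M borel)"
        unfolding d\<^sub>0_def by measurable
      moreover have "(\<lambda>\<omega>. (\<Phi> x \<omega>, \<Phi> y \<omega>)) \<in> \<gamma> \<rightarrow>\<^sub>M borel \<Otimes>\<^sub>M borel" by measurable
      ultimately show ?thesis unfolding sync_def case_prod_beta' by (simp add: nn_integral_distr)
    qed
    show "(\<integral>\<^sup>+(u, v). ennreal (d\<^sub>0 emb V chi r\<^sub>0 \<alpha> u v) \<partial>\<kappa> (x, y)) \<le> ennreal (d\<^sub>0 emb V chi r\<^sub>0 \<alpha> x y / 2)"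
    proof (cases "x = y")
      case True
      have "d\<^sub>0 emb V chi r\<^sub>0 \<alpha> u u = 0" for u
        unfolding d\<^sub>0_def D_chi_def by (simp add: blinfun.zero_right)
      then show ?thesis using sync_int True unfolding \<kappa>_def A_def by simp
    next
      case ne: False
      show ?thesis
      proof (cases "V x + V y \<le> R")
        case True
        have "x \<in> sublevel V R" "y \<in> sublevel V R"
          using True V_ge_1[of x] V_ge_1[of y] unfolding sublevel_def by auto
        from k(3)[OF k(2) order_refl this ne near] show ?thesis
          using True ne unfolding \<kappa>_def A_def by (simp add: case_prod_beta')
      next
        case False
        define s where "s = \<alpha> / \<alpha>\<^sub>s"
        have \<alpha>s0: "\<alpha>\<^sub>s > 0" using \<alpha> \<alpha>s by simp
        have s: "0 < s" "s \<le> 1" "\<alpha>\<^sub>s * s = \<alpha>" unfolding s_def using \<alpha> \<alpha>s \<alpha>s0 by auto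
        have Dp: "D_chi emb V chi x y > 0"
        proof -
          have "emb x \<noteq> emb y" using ne injD[OF emb_inj, of x y] by blast
          then show ?thesis unfolding D_chi_def by (simp add: blinfun.diff_right)
        qed
        define kk where "kk = b * exp (- c * (V x + V y)) * D_chi emb V chi x y powr \<alpha>\<^sub>s"
        have kk: "kk > 0" unfolding kk_def using b Dp by simp
        have small: "b * exp (- c * (V x + V y)) \<le> (1 / 4) powr (\<alpha>\<^sub>s / \<alpha>)"
        proof -
          have "c * R \<le> c * (V x + V y)" using False c by (intro mult_left_mono) auto
          then have "exp (- c * (V x + V y)) \<le> exp (- c * R)" by simp
          then have "b * exp (- c * (V x + V y)) \<le> b * exp (- c * R)" using b by (intro mult_left_mono) auto
          then show ?thesis using R by linarith
        qed
        have "kk powr s = (b * exp (- c * (V x + V y))) powr s * D_chi emb V chi x y powr \<alpha>"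
          unfolding kk_def using b Dp s(3) by (simp add: powr_mult powr_powr)
        also have "(b * exp (- c * (V x + V y))) powr s \<le> ((1 / 4) powr (\<alpha>\<^sub>s / \<alpha>)) powr s"
          using small b s by (intro powr_mono2) auto
        also have "((1 / 4) powr (\<alpha>\<^sub>s / \<alpha>)) powr s = 1 / (4::real)"
          unfolding powr_powr s_def using \<alpha>(1) \<alpha>s0 by simp
        finally have kks: "kk powr s \<le> 1 / 4 * D_chi emb V chi x y powr \<alpha>" by (simp add: mult_right_mono)
        have "(\<integral>\<^sup>+(u, v). ennreal (d\<^sub>0 emb V chi r\<^sub>0 \<alpha> u v) \<partial>sync (x, y))
            \<le> (\<integral>\<^sup>+\<omega>. ennreal (1 / r\<^sub>0 powr \<alpha>) * ennreal ((D_chi emb V chi (\<Phi> x \<omega>) (\<Phi> y \<omega>) powr \<alpha>\<^sub>s) powr s) \<partial>\<gamma>)"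
          unfolding sync_int
        proof (rule nn_integral_mono)
          fix \<omega>
          have "d\<^sub>0 emb V chi r\<^sub>0 \<alpha> (\<Phi> x \<omega>) (\<Phi> y \<omega>) \<le> (D_chi emb V chi (\<Phi> x \<omega>) (\<Phi> y \<omega>) / r\<^sub>0) powr \<alpha>"
            unfolding d\<^sub>0_def by simp
          also have "\<dots> = 1 / r\<^sub>0 powr \<alpha> * (D_chi emb V chi (\<Phi> x \<omega>) (\<Phi> y \<omega>) powr \<alpha>\<^sub>s) powr s"
            using D0 k(2) by (simp add: powr_divide powr_powr s(3))
          finally have "ennreal (d\<^sub>0 emb V chi r\<^sub>0 \<alpha> (\<Phi> x \<omega>) (\<Phi> y \<omega>))
              \<le> ennreal (1 / r\<^sub>0 powr \<alpha> * (D_chi emb V chi (\<Phi> x \<omega>) (\<Phi> y \<omega>) powr \<alpha>\<^sub>s) powr s)" by (rule ennreal_leI)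
          also have "\<dots> = ennreal (1 / r\<^sub>0 powr \<alpha>) * ennreal ((D_chi emb V chi (\<Phi> x \<omega>) (\<Phi> y \<omega>) powr \<alpha>\<^sub>s) powr s)"
            by (rule ennreal_mult) auto
          finally show "ennreal (d\<^sub>0 emb V chi r\<^sub>0 \<alpha> (\<Phi> x \<omega>) (\<Phi> y \<omega>))
              \<le> ennreal (1 / r\<^sub>0 powr \<alpha>) * ennreal ((D_chi emb V chi (\<Phi> x \<omega>) (\<Phi> y \<omega>) powr \<alpha>\<^sub>s) powr s)" .
        qed
        also have "\<dots> = ennreal (1 / r\<^sub>0 powr \<alpha>) * (\<integral>\<^sup>+\<omega>. ennreal ((D_chi emb V chi (\<Phi> x \<omega>) (\<Phi> y \<omega>) powr \<alpha>\<^sub>s) powr s) \<partial>\<gamma>)"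
        proof (rule nn_integral_cmult)
          show "(\<lambda>\<omega>. ennreal ((D_chi emb V chi (\<Phi> x \<omega>) (\<Phi> y \<omega>) powr \<alpha>\<^sub>s) powr s)) \<in> borel_measurable \<gamma>"
            unfolding D_chi_def by measurable
        qed
        also have "\<dots> \<le> ennreal (1 / r\<^sub>0 powr \<alpha>) * ennreal (2 * kk powr s)"
        proof (intro mult_left_mono nn_integral_powr_le)
          show "(\<lambda>\<omega>. D_chi emb V chi (\<Phi> x \<omega>) (\<Phi> y \<omega>) powr \<alpha>\<^sub>s) \<in> borel_measurable \<gamma>"
            unfolding D_chi_def by measurable
          show "(\<integral>\<^sup>+\<omega>. ennreal (D_chi emb V chi (\<Phi> x \<omega>) (\<Phi> y \<omega>) powr \<alpha>\<^sub>s) \<partial>\<gamma>) \<le> ennreal kk"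
            unfolding kk_def by (rule squeeze[OF ne])
        qed (use kk s in auto)
        also have "\<dots> = ennreal (1 / r\<^sub>0 powr \<alpha> * (2 * kk powr s))" by (rule ennreal_mult[symmetric]) auto
        also have "\<dots> \<le> ennreal (d\<^sub>0 emb V chi r\<^sub>0 \<alpha> x y / 2)"
        proof (rule ennreal_leI)
          have "1 / r\<^sub>0 powr \<alpha> * (2 * kk powr s) \<le> 1 / r\<^sub>0 powr \<alpha> * (2 * (1 / 4 * D_chi emb V chi x y powr \<alpha>))"
            using kks by (intro mult_left_mono) auto
          also have "\<dots> = (D_chi emb V chi x y / r\<^sub>0) powr \<alpha> / 2" using Dp k(2) by (simp add: powr_divide)
          also have "(D_chi emb V chi x y / r\<^sub>0) powr \<alpha> \<le> 1" using Dp near k(2) \<alpha>(1) by (intro powr_le1) auto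
          then have "(D_chi emb V chi x y / r\<^sub>0) powr \<alpha> / 2 \<le> d\<^sub>0 emb V chi r\<^sub>0 \<alpha> x y / 2" unfolding d\<^sub>0_def by simp
          finally show "1 / r\<^sub>0 powr \<alpha> * (2 * kk powr s) \<le> d\<^sub>0 emb V chi r\<^sub>0 \<alpha> x y / 2" .
        qed
        finally show ?thesis using False unfolding \<kappa>_def A_def by simp
      qed
    qed
  qed
qed

end

text \<open>Near \<open>a\<close> the weight is bounded by continuity of \<open>V\<close>, and the norm of the larger space is bounded by
  that of the smaller one.\<close>

lemma d0_small_on_ball:
  fixes emb :: "'h::real_normed_vector \<Rightarrow>\<^sub>L 'k::real_normed_vector"
  assumes V: "continuous_on UNIV V" and chi: "chi > 0" and r: "r > 0" and \<alpha>: "\<alpha> > 0"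
  obtains \<epsilon> where "\<epsilon> > 0" "\<And>x y. x \<in> ball a \<epsilon> \<Longrightarrow> y \<in> ball a \<epsilon> \<Longrightarrow> d\<^sub>0 emb V chi r \<alpha> x y \<le> 1 / 2"
proof -
  obtain \<delta> where \<delta>: "\<delta> > 0" "\<And>x. dist x a < \<delta> \<Longrightarrow> dist (V x) (V a) < 1"
    using V unfolding continuous_on_iff by (metis UNIV_I zero_less_one)
  define B where "B = exp (chi * (2 * (V a + 1)))"
  define t where "t = r * (1 / 2) powr (1 / \<alpha>)"
  have B: "B > 0" unfolding B_def by simp
  have t: "t > 0" unfolding t_def using r by simp
  define \<epsilon> where "\<epsilon> = min \<delta> (t / (2 * B * (norm emb + 1)))"
  have n: "norm emb + 1 > 0" by (rule add_nonneg_pos) auto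
  have e: "\<epsilon> > 0" unfolding \<epsilon>_def using \<delta>(1) t B n by simp
  show ?thesis
  proof (rule that[OF e])
    fix x y assume xy: "x \<in> ball a \<epsilon>" "y \<in> ball a \<epsilon>"
    have "V x \<le> V a + 1" "V y \<le> V a + 1"
      using xy \<delta>(2)[of x] \<delta>(2)[of y] unfolding \<epsilon>_def by (auto simp: dist_commute dist_real_def)
    then have 1: "exp (chi * (V x + V y)) \<le> B" unfolding B_def using chi by simp
    have "dist x y \<le> 2 * \<epsilon>" using xy dist_triangle2[of x y a] by (auto simp: dist_commute)
    then have "norm (x - y) \<le> 2 * \<epsilon>" by (simp add: dist_norm)
    have "norm (emb (x - y)) \<le> norm emb * norm (x - y)" by (rule norm_blinfun)
    also have "\<dots> \<le> (norm emb + 1) * (2 * \<epsilon>)" using \<open>norm (x - y) \<le> 2 * \<epsilon>\<close> by (intro mult_mono) auto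
    finally have "D_chi emb V chi x y \<le> B * ((norm emb + 1) * (2 * \<epsilon>))"
      unfolding D_chi_def using 1 B by (intro mult_mono) auto
    also have "\<dots> = \<epsilon> * (2 * B * (norm emb + 1))" by (simp add: mult_ac)
    also have "\<dots> \<le> t"
    proof -
      have "\<epsilon> \<le> t / (2 * B * (norm emb + 1))" unfolding \<epsilon>_def by simp
      then show ?thesis using B n by (simp add: pos_le_divide_eq)
    qed
    finally have "D_chi emb V chi x y / r \<le> (1 / 2) powr (1 / \<alpha>)" unfolding t_def using r by (simp add: pos_divide_le_eq mult.commute)
    moreover have "0 \<le> D_chi emb V chi x y / r" unfolding D_chi_def using r by simp
    ultimately have "(D_chi emb V chi x y / r) powr \<alpha> \<le> ((1 / 2) powr (1 / \<alpha>)) powr \<alpha>" using \<alpha> by (intro powr_mono2) auto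
    also have "\<dots> = 1 / 2" using \<alpha> by (simp add: powr_powr)
    finally show "d\<^sub>0 emb V chi r \<alpha> x y \<le> 1 / 2" unfolding d\<^sub>0_def by simp
  qed
qed

lemma exp_half_le:
  fixes C t :: real
  shows "C * exp (t / 2) \<le> exp t / 8 + 2 * C\<^sup>2"
proof -
  have "0 \<le> (exp (t / 2) / 4 - C)\<^sup>2" by simp
  then have "C * exp (t / 2) / 2 \<le> (exp (t / 2))\<^sup>2 / 16 + C\<^sup>2" by (simp add: power2_eq_square algebra_simps)
  moreover have "(exp (t / 2))\<^sup>2 = exp t" by (simp add: power2_eq_square flip: exp_add)
  ultimately show ?thesis by simp
qed

section \<open>Contraction of the transport distance\<close>

theorem theorem3p6:
  fixes emb :: "'h::{real_inner, banach, second_countable_topology} \<Rightarrow>\<^sub>L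
                'k::{real_inner, banach, second_countable_topology}"
    and P :: "real \<Rightarrow> 'h \<Rightarrow> 'h measure"
    and V :: "'h \<Rightarrow> real"
    and E :: "real \<Rightarrow> 'e::banach set"
    and HW :: "real \<Rightarrow> 'w::{real_inner, banach} set"
    and \<iota> :: "real \<Rightarrow> 'w \<Rightarrow> 'e"
    and \<gamma> :: "real \<Rightarrow> 'e measure"
    and \<Phi> :: "real \<Rightarrow> 'h \<Rightarrow> 'e \<Rightarrow> 'h"
    and D :: "real \<Rightarrow> 'h \<Rightarrow> 'e \<Rightarrow> 'w \<Rightarrow>\<^sub>L 'k"
    and lam0 \<alpha>_star chi :: real
  assumes "dense_embedding emb"
    and "feller_markov_semigroup P"
    and "\<And>T. T > 0 \<Longrightarrow> abstract_wiener_space (E T) (HW T) (\<iota> T) (\<gamma> T)"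
    and "\<And>T. T > 0 \<Longrightarrow> endpoint_representation (P T) (\<gamma> T) (\<Phi> T)"
    and "assumption_L emb P V lam0"
    and "assumption_SC emb V E HW \<iota> \<gamma> \<Phi> D"
    and "assumption_M HW \<gamma> D"
    and "assumption_S emb V \<gamma> \<Phi> \<alpha>_star chi"
    and "assumption_A P V"
  shows "\<exists>\<alpha> \<tau> r\<^sub>0 \<beta> lam \<rho> :: real.
    0 < \<alpha> \<and> \<alpha> \<le> \<alpha>_star \<and> \<tau> > 0 \<and> r\<^sub>0 > 0 \<and> \<beta> > 0 \<and> 0 < lam \<and> lam \<le> lam0 \<and> 0 < \<rho> \<and> \<rho> < 1 \<and>
    (\<forall>\<mu>\<^sub>1 \<mu>\<^sub>2 :: 'h measure. \<forall>n :: nat.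
      prob_space \<mu>\<^sub>1 \<longrightarrow> sets \<mu>\<^sub>1 = sets borel \<longrightarrow> (\<integral>\<^sup>+x. ennreal (exp (lam * V x)) \<partial>\<mu>\<^sub>1) < \<infinity> \<longrightarrow>
      prob_space \<mu>\<^sub>2 \<longrightarrow> sets \<mu>\<^sub>2 = sets borel \<longrightarrow> (\<integral>\<^sup>+x. ennreal (exp (lam * V x)) \<partial>\<mu>\<^sub>2) < \<infinity> \<longrightarrow>
      wasserstein (dist_d emb V chi r\<^sub>0 \<alpha> \<beta> lam) (\<mu>\<^sub>1 \<bind> P (real n * \<tau>)) (\<mu>\<^sub>2 \<bind> P (real n * \<tau>))
        \<le> ennreal (\<rho> ^ n) * wasserstein (dist_d emb V chi r\<^sub>0 \<alpha> \<beta> lam) \<mu>\<^sub>1 \<mu>\<^sub>2)"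
proof -
  note embedding = assms(1) and feller = assms(2) and wiener = assms(3) and endpoint = assms(4)
  have P: "P t \<in> borel \<rightarrow>\<^sub>M prob_algebra borel" if "t \<ge> 0" for t
    using feller that unfolding feller_markov_semigroup_def by blast
  have P0: "P 0 x = return borel x" for x using feller unfolding feller_markov_semigroup_def by blast
  have CK: "P (s + t) x = P s x \<bind> P t" if "s \<ge> 0" "t \<ge> 0" for s t x
    using feller that unfolding feller_markov_semigroup_def by blast
  from assms(5) have lam0: "lam0 > 0" and V1: "\<And>x. V x \<ge> 1" and Vc: "continuous_on UNIV V"
    and Vcomp: "\<And>R. compact (blinfun_apply emb ` sublevel V R)"
    and "\<exists>(C::real) \<theta>. (\<forall>t\<ge>0. \<theta> t \<ge> 0) \<and> \<theta> \<in> o[at_top](\<lambda>t. 1 / t) \<and>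
      (\<forall>\<sigma> t x. 0 < \<sigma> \<longrightarrow> \<sigma> \<le> lam0 \<longrightarrow> 0 \<le> t \<longrightarrow>
        (\<integral>\<^sup>+y. ennreal (exp (\<sigma> * V y)) \<partial>P t x) \<le> ennreal (C * exp (\<sigma> * \<theta> t * V x)))"
    unfolding assumption_L_def by auto
  then obtain C0 :: real and \<theta> where \<theta>: "\<And>t. t \<ge> 0 \<Longrightarrow> \<theta> t \<ge> 0" "\<theta> \<in> o[at_top](\<lambda>t. 1 / t)"
    and C0: "\<And>\<sigma> t x. 0 < \<sigma> \<Longrightarrow> \<sigma> \<le> lam0 \<Longrightarrow> 0 \<le> t \<Longrightarrow>
        (\<integral>\<^sup>+y. ennreal (exp (\<sigma> * V y)) \<partial>P t x) \<le> ennreal (C0 * exp (\<sigma> * \<theta> t * V x))"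
    by blast
  define C where "C = max C0 1"
  have C1: "C \<ge> 1" unfolding C_def by simp
  have moment: "(\<integral>\<^sup>+y. ennreal (exp (\<sigma> * V y)) \<partial>P t x) \<le> ennreal (C * exp (\<sigma> * \<theta> t * V x))"
    if "0 < \<sigma>" "\<sigma> \<le> lam0" "0 \<le> t" for \<sigma> t x
  proof -
    have "C0 * exp (\<sigma> * \<theta> t * V x) \<le> C * exp (\<sigma> * \<theta> t * V x)" unfolding C_def by (intro mult_right_mono) auto
    then show ?thesis using C0[OF that, of x] ennreal_leI order_trans by blast
  qed
  from assms(6) obtain \<rho> p\<^sub>0 where \<rho>: "(\<rho> \<longlongrightarrow> 0) at_top" and p0: "p\<^sub>0 > 0"
    and SC: "\<forall>\<^sub>F T in at_top. \<exists>S K.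
        SC_splitting emb (E T) (\<gamma> T) (\<Phi> T) S K (\<rho> T) \<and>
        SC_continuity emb V (E T) (HW T) (\<iota> T) (\<gamma> T) (\<Phi> T) (D T) K \<and>
        SC_remainder emb V (E T) (HW T) (\<iota> T) (\<gamma> T) (\<Phi> T) (D T) (\<lambda>z \<omega>. S z \<omega> + K z \<omega>) p\<^sub>0"
    unfolding assumption_SC_def by blast
  from assms(7) have M: "\<forall>\<^sub>F T in at_top. \<exists>\<Omega>\<in>sets (\<gamma> T). measure (\<gamma> T) \<Omega> = 1 \<and>
      (\<forall>x. \<forall>\<omega>\<in>\<Omega>. closure (blinfun_apply (D T x \<omega>) ` HW T) = UNIV)"
    unfolding assumption_M_def .
  from assms(8) have as: "0 < \<alpha>_star" "\<alpha>_star \<le> 1" and chi: "chi > 0"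
    and "\<exists>c C. c > 0 \<and> C > 0 \<and> (\<forall>\<^sub>F T in at_top. \<exists>C\<^sub>T\<ge>1. ln C\<^sub>T \<le> C * (1 + T) \<and>
        (\<forall>x y. x \<noteq> y \<longrightarrow>
          (\<integral>\<^sup>+\<omega>. ennreal (D_chi emb V chi (\<Phi> T x \<omega>) (\<Phi> T y \<omega>) powr \<alpha>_star) \<partial>\<gamma> T)
            \<le> ennreal (C\<^sub>T * exp (- c * (V x + V y)) * D_chi emb V chi x y powr \<alpha>_star)))"
    unfolding assumption_S_def by auto
  then obtain c Cs where c: "c > 0" and Cs: "Cs > 0"
    and S: "\<forall>\<^sub>F T in at_top. \<exists>C\<^sub>T\<ge>1. ln C\<^sub>T \<le> Cs * (1 + T) \<and>
        (\<forall>x y. x \<noteq> y \<longrightarrow>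
          (\<integral>\<^sup>+\<omega>. ennreal (D_chi emb V chi (\<Phi> T x \<omega>) (\<Phi> T y \<omega>) powr \<alpha>_star) \<partial>\<gamma> T)
            \<le> ennreal (C\<^sub>T * exp (- c * (V x + V y)) * D_chi emb V chi x y powr \<alpha>_star))"
    by blast
  from assms(9) obtain x_star where A: "\<And>R \<epsilon>. \<epsilon> > 0 \<Longrightarrow> \<exists>t\<^sub>0\<ge>0. \<forall>t\<ge>t\<^sub>0.
      (INF x\<in>sublevel V R. emeasure (P t x) (ball x_star \<epsilon>)) > 0"
    unfolding assumption_A_def by blast
  \<comment> \<open>Fourth powers of the displacement and of the weight in \<open>D_chi\<close>, to the power \<open>\<alpha>\<close>, must be
    controlled by \<open>assumption_SC\<close> and \<open>assumption_L\<close>.\<close>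
  define \<alpha> where "\<alpha> = min \<alpha>_star (min (p\<^sub>0 / 4) (lam0 / (4 * chi)))"
  have \<alpha>: "0 < \<alpha>" "\<alpha> \<le> \<alpha>_star" "\<alpha> \<le> 1" "4 * \<alpha> \<le> p\<^sub>0" "4 * \<alpha> * chi \<le> lam0"
  proof -
    show "0 < \<alpha>" unfolding \<alpha>_def using as p0 lam0 chi by simp
    show "\<alpha> \<le> \<alpha>_star" unfolding \<alpha>_def by simp
    then show "\<alpha> \<le> 1" using as by simp
    have "\<alpha> \<le> p\<^sub>0 / 4" "\<alpha> \<le> lam0 / (4 * chi)" unfolding \<alpha>_def by auto
    then show "4 * \<alpha> \<le> p\<^sub>0" "4 * \<alpha> * chi \<le> lam0" using chi by (simp_all add: pos_le_divide_eq mult_ac)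
  qed
  \<comment> \<open>A bound for the moments of the weights at time \<open>T\<close> as soon as \<open>\<theta> T * R T \<le> 1\<close>; the size \<open>\<epsilon>\<close> of the
    contracting part follows from it before \<open>T\<close> is fixed.\<close>
  define U where "U = C * exp lam0"
  have U: "U > 0" unfolding U_def using C1 by simp
  define \<epsilon> where "\<epsilon> = (1 / (4 * (U / 2 + 3 / 2))) powr (1 / \<alpha>) / 3"
  have \<epsilon>: "\<epsilon> > 0" "(3 * \<epsilon>) powr \<alpha> * (U / 2 + 3 / 2) \<le> 1 / 4"
  proof -
    have Up: "U / 2 + 3 / 2 > 0" using U by simp
    show "\<epsilon> > 0" unfolding \<epsilon>_def using Up by simp
    have "(3 * \<epsilon>) powr \<alpha> = 1 / (4 * (U / 2 + 3 / 2))" unfolding \<epsilon>_def using Up \<alpha>(1) by (simp add: powr_powr)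
    then show "(3 * \<epsilon>) powr \<alpha> * (U / 2 + 3 / 2) \<le> 1 / 4" using Up by simp
  qed
  \<comment> \<open>The level above which the squeezing estimate at time \<open>T\<close> contracts grows linearly in \<open>T\<close>, so that
    \<open>\<theta>(T) = o(1/T)\<close> keeps the exponential moments below this level bounded.\<close>
  define R where "R T = (Cs * (1 + T) + \<alpha>_star / \<alpha> * ln 4) / c" for T
  have ev_\<theta>R: "\<forall>\<^sub>F T in at_top. \<theta> T * R T \<le> 1"
  proof -
    define a where "a = (2 * Cs + \<alpha>_star / \<alpha> * ln 4) / c"
    have a: "a > 0" unfolding a_def using Cs c as \<alpha>(1) by (intro divide_pos_pos add_pos_nonneg) auto
    have "\<forall>\<^sub>F T in at_top. norm (\<theta> T) \<le> 1 / a * norm (1 / T)"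
      using landau_o.smallD[OF \<theta>(2), of "1 / a"] a by simp
    moreover have "\<forall>\<^sub>F T in at_top. T \<ge> (1::real)" by (rule eventually_ge_at_top)
    ultimately show ?thesis
    proof eventually_elim
      case (elim T)
      have "R T \<le> a * T"
      proof -
        have "0 \<le> \<alpha>_star / \<alpha> * ln 4" using as \<alpha>(1) by simp
        then have "\<alpha>_star / \<alpha> * ln 4 * 1 \<le> \<alpha>_star / \<alpha> * ln 4 * T" using elim(2) by (intro mult_left_mono) auto
        moreover have "Cs * (1 + T) \<le> Cs * (2 * T)" using elim(2) Cs by (intro mult_left_mono) auto
        ultimately have "Cs * (1 + T) + \<alpha>_star / \<alpha> * ln 4 \<le> (2 * Cs + \<alpha>_star / \<alpha> * ln 4) * T"
          by (simp add: algebra_simps)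
        then have "R T \<le> (2 * Cs + \<alpha>_star / \<alpha> * ln 4) * T / c" unfolding R_def using c by (intro divide_right_mono) auto
        then show ?thesis unfolding a_def by simp
      qed
      moreover have "0 \<le> \<theta> T" using \<theta>(1) elim(2) by simp
      ultimately have "\<theta> T * R T \<le> \<theta> T * (a * T)" by (intro mult_left_mono)
      also have "\<theta> T \<le> 1 / a * (1 / T)" using elim by simp
      then have "\<theta> T * (a * T) \<le> 1 / a * (1 / T) * (a * T)" using a elim(2) by (intro mult_right_mono) auto
      also have "\<dots> = 1" using a elim(2) by simp
      finally show ?case .
    qed
  qed
  have "\<forall>\<^sub>F T in at_top. \<theta> T \<le> 1 / 2"
  proof -
    have "\<forall>\<^sub>F T in at_top. norm (\<theta> T) \<le> 1 / 2 * norm (1 / T)"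
      using landau_o.smallD[OF \<theta>(2), of "1 / 2"] by simp
    moreover have "\<forall>\<^sub>F T in at_top. T \<ge> (1::real)" by (rule eventually_ge_at_top)
    ultimately show ?thesis
    proof eventually_elim
      case (elim T)
      have "norm (1 / T) \<le> 1" using elim(2) by simp
      then have "norm (\<theta> T) \<le> 1 / 2" using elim(1) by linarith
      then show ?case by simp
    qed
  qed
  then obtain T1 where T1: "\<And>t. t \<ge> T1 \<Longrightarrow> \<theta> t \<le> 1 / 2" unfolding eventually_at_top_linorder by blast
  have "\<forall>\<^sub>F T in at_top. \<rho> T < \<epsilon>" using order_tendstoD(2)[OF \<rho> \<epsilon>(1)] .
  then have "\<forall>\<^sub>F T in at_top. T \<ge> max 1 T1 \<and> \<rho> T < \<epsilon> \<and> \<theta> T * R T \<le> 1 \<and>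
      (\<exists>S K.
        SC_splitting emb (E T) (\<gamma> T) (\<Phi> T) S K (\<rho> T) \<and>
        SC_continuity emb V (E T) (HW T) (\<iota> T) (\<gamma> T) (\<Phi> T) (D T) K \<and>
        SC_remainder emb V (E T) (HW T) (\<iota> T) (\<gamma> T) (\<Phi> T) (D T) (\<lambda>z \<omega>. S z \<omega> + K z \<omega>) p\<^sub>0) \<and>
      (\<exists>\<Omega>\<in>sets (\<gamma> T). measure (\<gamma> T) \<Omega> = 1 \<and>
        (\<forall>x. \<forall>\<omega>\<in>\<Omega>. closure (blinfun_apply (D T x \<omega>) ` HW T) = UNIV)) \<and>
      (\<exists>C\<^sub>T\<ge>1. ln C\<^sub>T \<le> Cs * (1 + T) \<and>
        (\<forall>x y. x \<noteq> y \<longrightarrow>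
          (\<integral>\<^sup>+\<omega>. ennreal (D_chi emb V chi (\<Phi> T x \<omega>) (\<Phi> T y \<omega>) powr \<alpha>_star) \<partial>\<gamma> T)
            \<le> ennreal (C\<^sub>T * exp (- c * (V x + V y)) * D_chi emb V chi x y powr \<alpha>_star)))"
    using ev_\<theta>R SC M S by (intro eventually_conj eventually_ge_at_top)
  from eventually_happens'[OF trivial_limit_at_top_linorder this]
  obtain T where T: "T \<ge> max 1 T1" "\<rho> T < \<epsilon>" "\<theta> T * R T \<le> 1"
    and SCT: "\<exists>S K. SC_splitting emb (E T) (\<gamma> T) (\<Phi> T) S K (\<rho> T) \<and>
        SC_continuity emb V (E T) (HW T) (\<iota> T) (\<gamma> T) (\<Phi> T) (D T) K \<and>
        SC_remainder emb V (E T) (HW T) (\<iota> T) (\<gamma> T) (\<Phi> T) (D T) (\<lambda>z \<omega>. S z \<omega> + K z \<omega>) p\<^sub>0"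
    and MT: "\<exists>\<Omega>\<in>sets (\<gamma> T). measure (\<gamma> T) \<Omega> = 1 \<and>
        (\<forall>x. \<forall>\<omega>\<in>\<Omega>. closure (blinfun_apply (D T x \<omega>) ` HW T) = UNIV)"
    and ST: "\<exists>C\<^sub>T\<ge>1. ln C\<^sub>T \<le> Cs * (1 + T) \<and>
        (\<forall>x y. x \<noteq> y \<longrightarrow>
          (\<integral>\<^sup>+\<omega>. ennreal (D_chi emb V chi (\<Phi> T x \<omega>) (\<Phi> T y \<omega>) powr \<alpha>_star) \<partial>\<gamma> T)
            \<le> ennreal (C\<^sub>T * exp (- c * (V x + V y)) * D_chi emb V chi x y powr \<alpha>_star))"
    by (elim exE) (elim conjE, rule that, assumption+)
  have Tpos: "T > 0" using T(1) by simp
  obtain Sz Kz where SK: "SC_splitting emb (E T) (\<gamma> T) (\<Phi> T) Sz Kz (\<rho> T)"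
    "SC_continuity emb V (E T) (HW T) (\<iota> T) (\<gamma> T) (\<Phi> T) (D T) Kz"
    "SC_remainder emb V (E T) (HW T) (\<iota> T) (\<gamma> T) (\<Phi> T) (D T) (\<lambda>z \<omega>. Sz z \<omega> + Kz z \<omega>) p\<^sub>0"
    using SCT by blast
  obtain \<Omega> where \<Omega>: "\<Omega> \<in> sets (\<gamma> T)" "measure (\<gamma> T) \<Omega> = 1"
    "\<And>x \<omega>. \<omega> \<in> \<Omega> \<Longrightarrow> closure (blinfun_apply (D T x \<omega>) ` HW T) = UNIV" using MT by blast
  obtain b where b: "b \<ge> 1" "ln b \<le> Cs * (1 + T)"
    "\<And>x y. x \<noteq> y \<Longrightarrow> (\<integral>\<^sup>+\<omega>. ennreal (D_chi emb V chi (\<Phi> T x \<omega>) (\<Phi> T y \<omega>) powr \<alpha>_star) \<partial>\<gamma> T)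
            \<le> ennreal (b * exp (- c * (V x + V y)) * D_chi emb V chi x y powr \<alpha>_star)"
    using ST by blast
  have ep: "(\<lambda>(x, \<omega>). \<Phi> T x \<omega>) \<in> borel \<Otimes>\<^sub>M \<gamma> T \<rightarrow>\<^sub>M borel" "\<And>x. distr (\<gamma> T) borel (\<Phi> T x) = P T x"
    using endpoint[OF Tpos] unfolding endpoint_representation_def by auto
  interpret B: controlled_block "E T" "HW T" "\<iota> T" "\<gamma> T" emb V "\<Phi> T" "D T" Sz Kz "\<rho> T" p\<^sub>0
    by unfold_locales (use wiener[OF Tpos] embedding ep V1 Vc Vcomp SK p0 in auto)
  have UT: "(\<integral>\<^sup>+u. ennreal (exp (4 * \<alpha> * chi * V u)) \<partial>P T x) \<le> ennreal U" if x: "x \<in> sublevel V (R T)" for x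
  proof -
    have pos: "0 < 4 * \<alpha> * chi" using \<alpha>(1) chi by simp
    have "\<theta> T * V x \<le> \<theta> T * R T" using x \<theta>(1)[of T] Tpos unfolding sublevel_def by (intro mult_left_mono) auto
    then have "\<theta> T * V x \<le> 1" using T(3) by linarith
    then have "4 * \<alpha> * chi * (\<theta> T * V x) \<le> 4 * \<alpha> * chi * 1" using pos by (intro mult_left_mono) auto
    then have "4 * \<alpha> * chi * \<theta> T * V x \<le> lam0" using \<alpha>(5) by (simp add: mult.assoc)
    then have "C * exp (4 * \<alpha> * chi * \<theta> T * V x) \<le> U" unfolding U_def using C1 by (intro mult_left_mono) auto
    then show ?thesis using order_trans[OF moment[OF pos \<alpha>(5) less_imp_le[OF Tpos], of x] ennreal_leI] by blast
  qed
  have RT: "b * exp (- c * R T) \<le> (1 / 4) powr (\<alpha>_star / \<alpha>)"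
  proof -
    have "c * R T = Cs * (1 + T) + \<alpha>_star / \<alpha> * ln 4" unfolding R_def using c by simp
    then have "ln b + - c * R T \<le> - (\<alpha>_star / \<alpha> * ln 4)" using b(2) by simp
    then have le: "exp (ln b + - c * R T) \<le> exp (- (\<alpha>_star / \<alpha> * ln 4))" by (rule exp_le_cancel_iff[THEN iffD2])
    have e1: "exp (ln b + - c * R T) = b * exp (- c * R T)" using b(1) by (simp only: exp_add exp_ln)
    have e2: "exp (- (\<alpha>_star / \<alpha> * ln 4)) = (1 / 4) powr (\<alpha>_star / \<alpha>)" by (simp add: powr_def ln_div)
    show ?thesis using le unfolding e1 e2 .
  qed
  obtain \<kappa> r\<^sub>0 where \<kappa>: "couples \<kappa> (P T) borel" and r0: "0 < r\<^sub>0"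
    and near: "\<And>x y. d\<^sub>0 emb V chi r\<^sub>0 \<alpha> x y < 1 \<Longrightarrow>
      (\<integral>\<^sup>+(u, v). ennreal (d\<^sub>0 emb V chi r\<^sub>0 \<alpha> u v) \<partial>\<kappa> (x, y)) \<le> ennreal (d\<^sub>0 emb V chi r\<^sub>0 \<alpha> x y / 2)"
  proof (rule B.one_step_contraction[OF ep(2) \<Omega> chi \<alpha>(1,3,4) less_imp_le[OF U] UT \<epsilon>(1)
          less_imp_le[OF T(2)] \<epsilon>(2) \<alpha>(2) b(1) c b(3) RT])
    fix \<kappa> r\<^sub>0 assume 1: "couples \<kappa> (P T) borel" "0 < r\<^sub>0"
      "\<And>x y. d\<^sub>0 emb V chi r\<^sub>0 \<alpha> x y < 1 \<Longrightarrow>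
        (\<integral>\<^sup>+(u, v). ennreal (d\<^sub>0 emb V chi r\<^sub>0 \<alpha> u v) \<partial>\<kappa> (x, y)) \<le> ennreal (d\<^sub>0 emb V chi r\<^sub>0 \<alpha> x y / 2)"
    show thesis by (rule that[OF 1])
  qed
  define K where "K = 2 * C\<^sup>2"
  have K: "K \<ge> 0" unfolding K_def by simp
  obtain \<delta> where \<delta>: "\<delta> > 0" "\<And>x y. x \<in> ball x_star \<delta> \<Longrightarrow> y \<in> ball x_star \<delta> \<Longrightarrow> d\<^sub>0 emb V chi r\<^sub>0 \<alpha> x y \<le> 1 / 2"
    using d0_small_on_ball[OF Vc chi r0 \<alpha>(1), of x_star emb] by blast
  \<comment> \<open>The level of \<open>V\<close> that corresponds to \<open>W x + W y \<le> 8 * K + 8\<close> in the weak Harris argument.\<close>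
  define R1 where "R1 = ln (8 * K + 8) / lam0"
  obtain t\<^sub>0 where t0: "\<And>t. t \<ge> t\<^sub>0 \<Longrightarrow> (INF x\<in>sublevel V R1. emeasure (P t x) (ball x_star \<delta>)) > 0"
    using A[OF \<delta>(1), of R1] by blast
  obtain m :: nat where m: "t\<^sub>0 < real m * T" using reals_Archimedean3[OF Tpos] by blast
  \<comment> \<open>A multiple of the block length, because the contraction of \<open>d\<^sub>0\<close> is inherited by iteration, that is
    late enough for \<open>assumption_A\<close>.\<close>
  define \<tau> where "\<tau> = real (Suc m) * T"
  have \<tau>: "\<tau> \<ge> T" "\<tau> > 0" "\<tau> \<ge> t\<^sub>0"
  proof -
    have "\<tau> = real m * T + T" unfolding \<tau>_def by (simp add: algebra_simps)
    moreover have "0 \<le> real m * T" using Tpos by simp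
    ultimately show "\<tau> \<ge> T" "\<tau> > 0" "\<tau> \<ge> t\<^sub>0" using m Tpos by linarith+
  qed
  have d0m: "(\<lambda>(x, y). d\<^sub>0 emb V chi r\<^sub>0 \<alpha> x y) \<in> borel_measurable (borel \<Otimes>\<^sub>M borel)"
  proof -
    note [measurable] = B.D_chi_pair_measurable
    show ?thesis unfolding d\<^sub>0_def case_prod_beta' by measurable
  qed
  have "\<exists>\<kappa>\<^sub>m. couples \<kappa>\<^sub>m (P \<tau>) borel \<and> (\<forall>x\<in>space borel. \<forall>y\<in>space borel. d\<^sub>0 emb V chi r\<^sub>0 \<alpha> x y < 1 \<longrightarrow>
      (\<integral>\<^sup>+(u, v). ennreal (d\<^sub>0 emb V chi r\<^sub>0 \<alpha> u v) \<partial>\<kappa>\<^sub>m (x, y)) \<le> ennreal (d\<^sub>0 emb V chi r\<^sub>0 \<alpha> x y / 2))"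
    unfolding \<tau>_def by (rule iterated_coupling[OF less_imp_le[OF Tpos] P CK \<kappa> d0m d0_bounds near])
  then obtain \<kappa>\<^sub>m where \<kappa>m: "couples \<kappa>\<^sub>m (P \<tau>) borel"
    and near_m: "\<forall>x\<in>space borel. \<forall>y\<in>space borel. d\<^sub>0 emb V chi r\<^sub>0 \<alpha> x y < 1 \<longrightarrow>
      (\<integral>\<^sup>+(u, v). ennreal (d\<^sub>0 emb V chi r\<^sub>0 \<alpha> u v) \<partial>\<kappa>\<^sub>m (x, y)) \<le> ennreal (d\<^sub>0 emb V chi r\<^sub>0 \<alpha> x y / 2)"
    by (elim exE conjE) (rule that, assumption+)
  define ind where "ind z = P \<tau> (fst z) \<Otimes>\<^sub>M P \<tau> (snd z)" for z
  have P\<tau>: "P \<tau> \<in> borel \<rightarrow>\<^sub>M prob_algebra borel" using P \<tau>(2) by simp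
  have cind: "couples ind (P \<tau>) borel" unfolding ind_def by (rule couples_independent[OF P\<tau>])
  define \<kappa>' where "\<kappa>' z = (if d\<^sub>0 emb V chi r\<^sub>0 \<alpha> (fst z) (snd z) < 1 then \<kappa>\<^sub>m z else ind z)" for z
  have c\<kappa>': "couples \<kappa>' (P \<tau>) borel"
  proof -
    have "(\<lambda>z. d\<^sub>0 emb V chi r\<^sub>0 \<alpha> (fst z) (snd z)) \<in> borel_measurable (borel \<Otimes>\<^sub>M borel)"
      using d0m by (simp add: case_prod_beta')
    then have "{z \<in> space (borel \<Otimes>\<^sub>M borel). d\<^sub>0 emb V chi r\<^sub>0 \<alpha> (fst z) (snd z) < 1} \<in> sets (borel \<Otimes>\<^sub>M borel)"
      by measurable
    then show ?thesis unfolding \<kappa>'_def by (rule couples_if[OF \<kappa>m cind])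
  qed
  define W where "W x = exp (lam0 * V x)" for x
  have Wm: "W \<in> borel_measurable borel"
  proof -
    note [measurable] = B.V_measurable
    show ?thesis unfolding W_def by measurable
  qed
  have Lyapunov: "(\<integral>\<^sup>+u. ennreal (W u) \<partial>P \<tau> x) \<le> ennreal (W x / 8 + K)" for x
  proof -
    have "\<theta> \<tau> \<le> 1 / 2" using T1 \<tau>(1) T(1) by simp
    then have "\<theta> \<tau> * (lam0 * V x) \<le> 1 / 2 * (lam0 * V x)" using lam0 V1[of x] by (intro mult_right_mono) auto
    then have "C * exp (lam0 * \<theta> \<tau> * V x) \<le> C * exp (lam0 * V x / 2)" using C1 by (simp add: mult_ac)
    also have "\<dots> \<le> W x / 8 + K" unfolding W_def K_def by (rule exp_half_le)
    finally show ?thesis unfolding W_def using order_trans[OF moment[OF lam0 order_refl less_imp_le[OF \<tau>(2)], of x] ennreal_leI] by blast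
  qed
  define I where "I = (INF x\<in>sublevel V R1. emeasure (P \<tau> x) (ball x_star \<delta>))"
  define p where "p = enn2real (min I 1)"
  have p: "0 < p" "p \<le> 1" "ennreal p \<le> I"
  proof -
    have "min I 1 > 0" using t0[OF \<tau>(3)] unfolding I_def by simp
    moreover have "min I 1 < top" by (simp add: min_less_iff_disj)
    ultimately have e: "ennreal p = min I 1" "0 < p" unfolding p_def by (simp_all add: enn2real_positive_iff)
    show "0 < p" by (rule e(2))
    show "ennreal p \<le> I" using e(1) by simp
    have "ennreal p \<le> 1" using e(1) by simp
    then show "p \<le> 1" by (simp add: ennreal_le_1)
  qed
  have Pp: "prob_space (P \<tau> x)" "sets (P \<tau> x) = sets borel" for x
    using measurable_space[OF P\<tau>, of x] by (auto simp: space_prob_algebra)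
  have small: "(\<integral>\<^sup>+(u, v). ennreal (d\<^sub>0 emb V chi r\<^sub>0 \<alpha> u v) \<partial>\<kappa>' (x, y)) \<le> ennreal (1 - p * p / 2)"
    if d1: "d\<^sub>0 emb V chi r\<^sub>0 \<alpha> x y = 1" and W: "W x + W y \<le> 8 * K + 8" for x y
  proof -
    have sub: "z \<in> sublevel V R1" if "W z \<le> 8 * K + 8" for z
    proof -
      have "ln (W z) \<le> ln (8 * K + 8)" using that K unfolding W_def by (subst ln_le_cancel_iff) auto
      then have "lam0 * V z \<le> ln (8 * K + 8)" unfolding W_def by simp
      then show ?thesis unfolding sublevel_def R1_def using lam0 by (simp add: pos_le_divide_eq mult.commute)
    qed
    have W0: "W x \<ge> 0" "W y \<ge> 0" unfolding W_def by auto
    have xy: "x \<in> sublevel V R1" "y \<in> sublevel V R1" using W W0 by (intro sub; linarith)+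
    have ball: "ennreal p \<le> emeasure (P \<tau> z) (ball x_star \<delta>)" if "z \<in> sublevel V R1" for z
      using p(3) INF_lower[OF that] unfolding I_def by (rule order_trans)
    have "(\<integral>\<^sup>+(u, v). ennreal (d\<^sub>0 emb V chi r\<^sub>0 \<alpha> u v) \<partial>(P \<tau> x \<Otimes>\<^sub>M P \<tau> y)) \<le> ennreal (1 - p * p / 2)"
      by (rule independent_coupling_small[OF Pp(1) Pp(1) _ _ ball[OF xy(1)] ball[OF xy(2)]])
        (use p Pp(2) d0_bounds \<delta>(2) in auto)
    then show ?thesis using d1 unfolding \<kappa>'_def ind_def by simp
  qed
  have e: "0 < p * p / 2" "p * p / 2 \<le> 1"
  proof -
    show "0 < p * p / 2" using p by simp
    have "p * p \<le> 1 * 1" using p by (intro mult_mono) auto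
    then show "p * p / 2 \<le> 1" by simp
  qed
  obtain \<beta> q where \<beta>: "\<beta> > 0" and q: "0 < q" "q < 1"
    and contr: "\<And>x y. x \<in> space borel \<Longrightarrow> y \<in> space borel \<Longrightarrow>
      (\<integral>\<^sup>+(u, v). ennreal (sqrt (d\<^sub>0 emb V chi r\<^sub>0 \<alpha> u v * (1 + \<beta> * W u + \<beta> * W v))) \<partial>\<kappa>' (x, y))
        \<le> ennreal q * ennreal (sqrt (d\<^sub>0 emb V chi r\<^sub>0 \<alpha> x y * (1 + \<beta> * W x + \<beta> * W y)))"
  proof (rule weak_Harris_contraction[OF c\<kappa>' Wm _ d0m d0_bounds K Lyapunov _ e small])
    show "0 \<le> W x" for x unfolding W_def by simp
    show "(\<integral>\<^sup>+(u, v). ennreal (d\<^sub>0 emb V chi r\<^sub>0 \<alpha> u v) \<partial>\<kappa>' (x, y)) \<le> ennreal (d\<^sub>0 emb V chi r\<^sub>0 \<alpha> x y / 2)"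
      if "d\<^sub>0 emb V chi r\<^sub>0 \<alpha> x y < 1" for x y
      using near_m that unfolding \<kappa>'_def by simp
    fix \<beta> q assume 1: "\<beta> > 0" "0 < q" "q < 1" "\<And>x y. x \<in> space borel \<Longrightarrow> y \<in> space borel \<Longrightarrow>
      (\<integral>\<^sup>+(u, v). ennreal (sqrt (d\<^sub>0 emb V chi r\<^sub>0 \<alpha> u v * (1 + \<beta> * W u + \<beta> * W v))) \<partial>\<kappa>' (x, y))
        \<le> ennreal q * ennreal (sqrt (d\<^sub>0 emb V chi r\<^sub>0 \<alpha> x y * (1 + \<beta> * W x + \<beta> * W y)))"
    show thesis by (rule that[OF 1])
  qed
  let ?d = "dist_d emb V chi r\<^sub>0 \<alpha> \<beta> lam0"
  have dd: "?d x y = sqrt (d\<^sub>0 emb V chi r\<^sub>0 \<alpha> x y * (1 + \<beta> * W x + \<beta> * W y))" for x y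
    unfolding dist_d_def W_def ..
  have ddm: "(\<lambda>(x, y). ?d x y) \<in> borel_measurable (borel \<Otimes>\<^sub>M borel)"
  proof -
    have [measurable]: "(\<lambda>p. d\<^sub>0 emb V chi r\<^sub>0 \<alpha> (fst p) (snd p)) \<in> borel_measurable (borel \<Otimes>\<^sub>M borel)"
      using d0m by (simp add: case_prod_beta')
    note [measurable] = Wm
    show ?thesis unfolding dd case_prod_beta' by measurable
  qed
  have step: "wasserstein ?d (\<mu>\<^sub>1 \<bind> P \<tau>) (\<mu>\<^sub>2 \<bind> P \<tau>) \<le> ennreal q * wasserstein ?d \<mu>\<^sub>1 \<mu>\<^sub>2"
    if "prob_space \<mu>\<^sub>1" "sets \<mu>\<^sub>1 = sets borel" "prob_space \<mu>\<^sub>2" "sets \<mu>\<^sub>2 = sets borel" for \<mu>\<^sub>1 \<mu>\<^sub>2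
    by (rule wasserstein_bind_le[OF c\<kappa>' P\<tau> ddm _ q(1) that]) (use contr in \<open>simp add: dd\<close>)
  have prob: "prob_space (\<mu> \<bind> P t)" "sets (\<mu> \<bind> P t) = sets borel"
    if "prob_space \<mu>" "sets \<mu> = sets borel" "t \<ge> 0" for \<mu> t
    using prob_space_bind'[of \<mu> borel "P t" borel] sets_bind'[of \<mu> borel "P t" borel] P that
    by (auto simp: space_prob_algebra)
  have Psuc: "\<mu> \<bind> P (real (Suc n) * \<tau>) = (\<mu> \<bind> P (real n * \<tau>)) \<bind> P \<tau>" if "sets \<mu> = sets borel" for \<mu> n
  proof -
    have n0: "0 \<le> real n * \<tau>" using \<tau>(2) by simp
    have "P (real (Suc n) * \<tau>) = (\<lambda>x. P (real n * \<tau>) x \<bind> P \<tau>)"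
      using CK[OF n0 less_imp_le[OF \<tau>(2)]] by (auto simp: algebra_simps)
    moreover have "P (real n * \<tau>) \<in> \<mu> \<rightarrow>\<^sub>M subprob_algebra borel"
      using measurable_prob_algebraD[OF P[OF n0]] measurable_cong_sets[OF that refl] by blast
    ultimately show ?thesis using bind_assoc[OF _ measurable_prob_algebraD[OF P\<tau>]] by metis
  qed
  have iter: "wasserstein ?d (\<mu>\<^sub>1 \<bind> P (real n * \<tau>)) (\<mu>\<^sub>2 \<bind> P (real n * \<tau>)) \<le> ennreal (q ^ n) * wasserstein ?d \<mu>\<^sub>1 \<mu>\<^sub>2"
    if \<mu>: "prob_space \<mu>\<^sub>1" "sets \<mu>\<^sub>1 = sets borel" "prob_space \<mu>\<^sub>2" "sets \<mu>\<^sub>2 = sets borel" for \<mu>\<^sub>1 \<mu>\<^sub>2 n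
  proof (induction n)
    case 0
    have "P 0 = return borel" using P0 by blast
    then show ?case using \<mu> by (simp add: bind_return'')
  next
    case (Suc n)
    have n0: "0 \<le> real n * \<tau>" using \<tau>(2) by simp
    have "wasserstein ?d (\<mu>\<^sub>1 \<bind> P (real (Suc n) * \<tau>)) (\<mu>\<^sub>2 \<bind> P (real (Suc n) * \<tau>))
        \<le> ennreal q * wasserstein ?d (\<mu>\<^sub>1 \<bind> P (real n * \<tau>)) (\<mu>\<^sub>2 \<bind> P (real n * \<tau>))"
      unfolding Psuc[OF \<mu>(2)] Psuc[OF \<mu>(4)] by (rule step) (use prob \<mu> n0 in auto)
    also have "\<dots> \<le> ennreal q * (ennreal (q ^ n) * wasserstein ?d \<mu>\<^sub>1 \<mu>\<^sub>2)" by (intro mult_left_mono Suc) simp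
    also have "\<dots> = ennreal (q ^ Suc n) * wasserstein ?d \<mu>\<^sub>1 \<mu>\<^sub>2"
      using q(1) by (simp add: ennreal_mult mult.assoc)
    finally show ?case .
  qed
  show ?thesis
    by (intro exI[of _ \<alpha>] exI[of _ \<tau>] exI[of _ r\<^sub>0] exI[of _ \<beta>] exI[of _ lam0] exI[of _ q] conjI allI impI
        \<alpha>(1,2) \<tau>(2) r0 \<beta> lam0 order_refl q iter)
qed

end
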